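(* For any cartesian 2-category $\mathbf{A}$ and cartesian double category $\mathbb{E}$, the virtual double category $\mathbf{vCartLax}_{\ell,u}(\mathrm{VerDbl}(\mathbf{A}),\mathbb{E})$ is representable as a double category.
   Context: Double categories are pseudo: strict in the direction of arrows, weak in the direction of proarrows. A double category $\mathbb{D}$ has underlying categories $\mathbb{D}_0$ (objects and arrows) and $\mathbb{D}_1$ (proarrows, written $m: x \nrightarrow y$, and cells). A cell $\alpha: m \to n$ from $m: x \nrightarrow y$ to $n: w \nrightarrow z$ over $(f,g)$ has source arrow $f: x\to w$ and target arrow $g: y \to z$; it is globular if $f,g$ are identities. Composition in $\mathbb{D}_0,\mathbb{D}_1$ is written $\cdot$ in diagrammatic order; external composition of proarrows and cells is written $\odot$ in diagrammatic order, with external identities $\mathrm{id}_x,\mathrm{id}_f$; $1_x, 1_m$ are identities in $\mathbb{D}_0,\mathbb{D}_1$. Coherence isomorphisms for $\odot$ are suppressed in formulas. Cartesian: a double category $\mathbb{D}$ is cartesian if $\mathbb{D}\to\mathbb{D}\times\mathbb{D}$ (diagonal) and $\mathbb{D}\to\mathbb{1}$ have right adjoints in the 2-category of double categories, pseudo double functors and natural transformations; explicitly, $\mathbb{D}_0,\mathbb{D}_1$ have finite products, preserved by source and target, and external composition and external identity preserve finite products up to the canonical comparison isomorphisms. The terminal object of $\mathbb{D}_1$ is $I_1$. A cartesian 2-category is a 2-category with finite (strict) 2-products. $\mathrm{VerDbl}(\mathbf{A})$ is the strict double category with the objects of $\mathbf{A}$, arrows the morphisms of $\mathbf{A}$, only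 identity proarrows, and cells $\mathrm{id}_x\to\mathrm{id}_y$ over $(f,g)$ the 2-cells $f\Rightarrow g$ of $\mathbf{A}$; it is cartesian when $\mathbf{A}$ is. Lax double functor $F:\mathbb{D}\to\mathbb{E}$: functors $F_0,F_1$ compatible with source and target, with globular laxators $F_{m,n}:Fm\odot Fn\to F(m\odot n)$ and unitors $F_x:\mathrm{id}_{Fx}\to F\mathrm{id}_x$, natural ($(F\alpha\odot F\beta)\cdot F_{m',n'}=F_{m,n}\cdot F(\alpha\odot\beta)$, $\mathrm{id}_{Ff}\cdot F_y=F_x\cdot F\mathrm{id}_f$), associative and unital. $F_{x,m}:F\mathrm{id}_x\odot Fm\to Fm$ and $F_{m,y}:Fm\odot F\mathrm{id}_y\to Fm$ denote laxators at identity proarrows. $F$ is unitary if its unitors are identities; between cartesian double categories it is cartesian if $F_0$ and $F_1$ preserve finite products. Lax natural transformation $\alpha:F\Rightarrow G$ of lax functors $\mathbb{D}\to\mathbb{E}$: arrows $\alpha_x:Fx\to Gx$; cells $\alpha_m:Fm\to Gm$ over $(\alpha_x,\alpha_y)$ for $m:x\nrightarrow y$; for each arrow $f:x\to y$ a cell $\alpha_f:\mathrm{id}_{Fx}\to G\mathrm{id}_y$ over $(\alpha_x\cdot Gf,\ Ff\cdot\alpha_y)$; such that (1) for each cell $\gamma:m\to n$ over $(f,g)$, $m:x\nrightarrow y$, $n:w\nrightarrow z$: $(\alpha_f\odot(F\gamma\cdot\alpha_n))\cdot G_{w,n}=((\alpha_m\cdot G\gamma)\odot\alpha_g)\cdot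 G_{n,z}$; (2) $F_{m,n}\cdot\alpha_{m\odot n}=(\alpha_m\odot\alpha_n)\cdot G_{m,n}$ and $F_x\cdot\alpha_{\mathrm{id}_x}=\mathrm{id}_{\alpha_x}\cdot G_x$; (3) for $x\xrightarrow{f}y\xrightarrow{g}z$, $\alpha_{f\cdot g}=((\alpha_f\cdot G\mathrm{id}_g)\odot(\mathrm{id}_{Ff}\cdot\alpha_g))\cdot G_{z,z}$ and $\alpha_{1_x}=\mathrm{id}_{\alpha_x}\cdot G_x$. The composite of lax $\alpha:F\Rightarrow G$, $\beta:G\Rightarrow H$ has $(\alpha\beta)_x=\alpha_x\cdot\beta_x$, $(\alpha\beta)_m=\alpha_m\cdot\beta_m$, $(\alpha\beta)_f=((\mathrm{id}_{\alpha_x}\cdot\beta_f)\odot(\alpha_f\cdot\beta_{\mathrm{id}_y}))\cdot H_{y,y}$. A transformation is cartesian if for each projection $\pi:x_1\times x_2\to x_i$ it is strictly natural: $\alpha_{x_1\times x_2}\cdot G\pi=F\pi\cdot\alpha_{x_i}$, and $\alpha_\pi=\mathrm{id}_{F\pi\cdot\alpha_{x_i}}\cdot G_{x_i}$. Module: let $\mathbb{I}$ be the strict double category freely generated by one proarrow $i:0\nrightarrow 1$. A module $M:F\nrightarrow G$ between lax functors $F,G:\mathbb{D}\to\mathbb{E}$ is a lax functor $M:\mathbb{D}\times\mathbb{I}\to\mathbb{E}$ with $M(-,0)=F$, $M(-,1)=G$. Write $Mm=M(m,i):Fx\nrightarrow Gy$, $M\alpha=M(\alpha,1_i)$, and $M^\ell_{m,n}:Fm\odot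 Mn\to M(m\odot n)$, $M^r_{m,n}:Mm\odot Gn\to M(m\odot n)$ for the resulting laxators (left and right actions). For cartesian $F,G$, the module is cartesian if for all proarrows $m:x\nrightarrow y$, $m':x'\nrightarrow y'$ the canonical cell $\langle M\pi_{m,m'},M\pi'_{m,m'}\rangle:M(m\times m')\to Mm\times Mm'$ is an isomorphism in $\mathbb{E}_1$, and so is the unique cell $M(I_1)\to I_1$. Multimodulation $\mu:(M_1,\dots,M_k)\to N$ over $(\alpha,\beta)$, for modules $F_0\overset{M_1}{\nrightarrow}F_1\cdots\overset{M_k}{\nrightarrow}F_k$, $N:G\nrightarrow H$ and transformations $\alpha:F_0\Rightarrow G$, $\beta:F_k\Rightarrow H$: for each $x_0\overset{m_1}{\nrightarrow}\cdots\overset{m_k}{\nrightarrow}x_k$ a cell $\mu_{m_1,\dots,m_k}:M_1m_1\odot\cdots\odot M_km_k\to N(m_1\odot\cdots\odot m_k)$ over $(\alpha_{x_0},\beta_{x_k})$ (for $k=0$: cells $\mu_x:\mathrm{id}_{F_0x}\to N\mathrm{id}_x$) such that: left equivariance ($k\ge1$) $(\alpha_{m_0}\odot\mu_{m_1,\dots,m_k})\cdot N^\ell_{m_0,m_1\odot\cdots\odot m_k}=((M_1)^\ell_{m_0,m_1}\odot1\odot\cdots\odot1)\cdot\mu_{m_0\odot m_1,m_2,\dots,m_k}$; right equivariance, dually with $\beta$, $N^r$, $(M_k)^r$; inner equivariance ($1\le i<k$) $(1\odot(M_i)^r_{m_i,m'}\odot1)\cdot\mu_{\dots,m_i\odot m',m_{i+1},\dots}=(1\odot(M_{i+1})^\ell_{m',m_{i+1}}\odot1)\cdot\mu_{\dots,m_i,m'\odot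 m_{i+1},\dots}$; nullary equivariance ($k=0$, $m:x\nrightarrow y$) $(\mu_x\odot\beta_m)\cdot N^r_{\mathrm{id}_x,m}=(\alpha_m\odot\mu_y)\cdot N^\ell_{m,\mathrm{id}_y}$; naturality: for cells $\gamma_j:m_j\to n_j$ over $(f_{j-1},f_j)$, $f_j:x_j\to y_j$, $n=n_1\odot\cdots\odot n_k$, $(\alpha_{f_0}\odot((M_1\gamma_1\odot\cdots\odot M_k\gamma_k)\cdot\mu_{n_1,\dots,n_k}))\cdot N^\ell_{\mathrm{id}_{y_0},n}=((\mu_{m_1,\dots,m_k}\cdot N(\gamma_1\odot\cdots\odot\gamma_k))\odot\beta_{f_k})\cdot N^r_{n,\mathrm{id}_{y_k}}$. Multimodulations compose by composing component cells in the same shape. $\mathbf{vCartLax}_{\ell,u}(\mathbb{D},\mathbb{E})$ is the virtual double category of cartesian unitary lax functors (objects), cartesian lax natural transformations (arrows), cartesian modules (proarrows) and multimodulations (multicells). A virtual double category is representable as a double category if it arises from a pseudo double category, i.e. every composable sequence of proarrows (including empty ones) has a composite: an opcartesian multicell out of it, through which multicells out of any longer sequence containing it factor uniquely. *)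

theory Defs
  imports "HOL-Library.FuncSet"
begin

section \<open>Categories and finite products\<close>

text \<open>All composition is written in diagrammatic order. Operations are total functions that are
  meaningful only on the stated carriers.\<close>

record ('o, 'a) cat =
  Ob :: "'o set"
  Arr :: "'a set"
  Dom :: "'a \<Rightarrow> 'o"
  Cod :: "'a \<Rightarrow> 'o"
  ide :: "'o \<Rightarrow> 'a"
  cmp :: "'a \<Rightarrow> 'a \<Rightarrow> 'a" (infixl "\<cdot>\<index>" 70)

definition Hom :: "('o, 'a, 'z) cat_scheme \<Rightarrow> 'o \<Rightarrow> 'o \<Rightarrow> 'a set" where
  "Hom C x y = {f \<in> Arr C. Dom C f = x \<and> Cod C f = y}"

locale category =
  fixes C :: "('o, 'a, 'z) cat_scheme" (structure)
  assumes Dom_in: "f \<in> Arr C \<Longrightarrow> Dom C f \<in> Ob C"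
    and Cod_in: "f \<in> Arr C \<Longrightarrow> Cod C f \<in> Ob C"
    and ide_in: "x \<in> Ob C \<Longrightarrow> ide C x \<in> Hom C x x"
    and cmp_in: "f \<in> Arr C \<Longrightarrow> g \<in> Arr C \<Longrightarrow> Cod C f = Dom C g \<Longrightarrow> f \<cdot> g \<in> Hom C (Dom C f) (Cod C g)"
    and ide_cmp: "f \<in> Arr C \<Longrightarrow> ide C (Dom C f) \<cdot> f = f"
    and cmp_ide: "f \<in> Arr C \<Longrightarrow> f \<cdot> ide C (Cod C f) = f"
    and cmp_assoc: "f \<in> Arr C \<Longrightarrow> g \<in> Arr C \<Longrightarrow> h \<in> Arr C \<Longrightarrow> Cod C f = Dom C g \<Longrightarrow> Cod C g = Dom C h
      \<Longrightarrow> (f \<cdot> g) \<cdot> h = f \<cdot> (g \<cdot> h)"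

definition inverses :: "('o, 'a, 'z) cat_scheme \<Rightarrow> 'a \<Rightarrow> 'a \<Rightarrow> bool" where
  "inverses C f g \<longleftrightarrow> f \<in> Arr C \<and> g \<in> Hom C (Cod C f) (Dom C f) \<and>
     f \<cdot>\<^bsub>C\<^esub> g = ide C (Dom C f) \<and> g \<cdot>\<^bsub>C\<^esub> f = ide C (Cod C f)"

definition is_iso :: "('o, 'a, 'z) cat_scheme \<Rightarrow> 'a \<Rightarrow> bool" where
  "is_iso C f \<longleftrightarrow> (\<exists>g. inverses C f g)"

definition inverse_arr :: "('o, 'a, 'z) cat_scheme \<Rightarrow> 'a \<Rightarrow> 'a" where
  "inverse_arr C f = (THE g. inverses C f g)"

definition is_functor ::
  "('o, 'a, 'z) cat_scheme \<Rightarrow> ('o2, 'a2, 'z2) cat_scheme \<Rightarrow> ('o \<Rightarrow> 'o2) \<Rightarrow> ('a \<Rightarrow> 'a2) \<Rightarrow> bool" where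
  "is_functor C C' Fo Fa \<longleftrightarrow>
     (\<forall>x\<in>Ob C. Fo x \<in> Ob C') \<and>
     (\<forall>f\<in>Arr C. Fa f \<in> Hom C' (Fo (Dom C f)) (Fo (Cod C f))) \<and>
     (\<forall>x\<in>Ob C. Fa (ide C x) = ide C' (Fo x)) \<and>
     (\<forall>f\<in>Arr C. \<forall>g\<in>Arr C. Cod C f = Dom C g \<longrightarrow> Fa (f \<cdot>\<^bsub>C\<^esub> g) = Fa f \<cdot>\<^bsub>C'\<^esub> Fa g)"

definition is_product :: "('o, 'a, 'z) cat_scheme \<Rightarrow> 'a \<Rightarrow> 'a \<Rightarrow> bool" where
  "is_product C p q \<longleftrightarrow> p \<in> Arr C \<and> q \<in> Arr C \<and> Dom C p = Dom C q \<and>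
     (\<forall>f\<in>Arr C. \<forall>g\<in>Arr C. Dom C f = Dom C g \<and> Cod C f = Cod C p \<and> Cod C g = Cod C q \<longrightarrow>
        (\<exists>!h. h \<in> Hom C (Dom C f) (Dom C p) \<and> h \<cdot>\<^bsub>C\<^esub> p = f \<and> h \<cdot>\<^bsub>C\<^esub> q = g))"

definition is_terminal :: "('o, 'a, 'z) cat_scheme \<Rightarrow> 'o \<Rightarrow> bool" where
  "is_terminal C t \<longleftrightarrow> t \<in> Ob C \<and> (\<forall>x\<in>Ob C. \<exists>!h. h \<in> Hom C x t)"

definition preserves_finite_products ::
  "('o, 'a, 'z) cat_scheme \<Rightarrow> ('o2, 'a2, 'z2) cat_scheme \<Rightarrow> ('o \<Rightarrow> 'o2) \<Rightarrow> ('a \<Rightarrow> 'a2) \<Rightarrow> bool" where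
  "preserves_finite_products C C' Fo Fa \<longleftrightarrow>
     (\<forall>p q. is_product C p q \<longrightarrow> is_product C' (Fa p) (Fa q)) \<and>
     (\<forall>t. is_terminal C t \<longrightarrow> is_terminal C' (Fo t))"

text \<open>A choice of a terminal object and of binary product cones.\<close>

record ('o, 'a) products =
  term_ob :: 'o
  prod_ob :: "'o \<Rightarrow> 'o \<Rightarrow> 'o"
  proj1 :: "'o \<Rightarrow> 'o \<Rightarrow> 'a"
  proj2 :: "'o \<Rightarrow> 'o \<Rightarrow> 'a"

definition finite_products :: "('o, 'a, 'z) cat_scheme \<Rightarrow> ('o, 'a) products \<Rightarrow> bool" where
  "finite_products C P \<longleftrightarrow> is_terminal C (term_ob P) \<and>
     (\<forall>x\<in>Ob C. \<forall>y\<in>Ob C.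
        proj1 P x y \<in> Hom C (prod_ob P x y) x \<and> proj2 P x y \<in> Hom C (prod_ob P x y) y \<and>
        is_product C (proj1 P x y) (proj2 P x y))"

definition pairing ::
  "('o, 'a, 'z) cat_scheme \<Rightarrow> ('o, 'a) products \<Rightarrow> 'a \<Rightarrow> 'a \<Rightarrow> 'a" where
  "pairing C P f g = (THE h. h \<in> Hom C (Dom C f) (prod_ob P (Cod C f) (Cod C g)) \<and>
     h \<cdot>\<^bsub>C\<^esub> proj1 P (Cod C f) (Cod C g) = f \<and> h \<cdot>\<^bsub>C\<^esub> proj2 P (Cod C f) (Cod C g) = g)"

definition to_term :: "('o, 'a, 'z) cat_scheme \<Rightarrow> ('o, 'a) products \<Rightarrow> 'o \<Rightarrow> 'a" where
  "to_term C P x = (THE h. h \<in> Hom C x (term_ob P))"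


section \<open>Pseudo double categories\<close>

text \<open>\<open>psrc\<close>, \<open>ptgt\<close>, \<open>csrc\<close>, \<open>ctgt\<close> are the object and arrow parts of source and target;
  \<open>idp x\<close> and \<open>idc f\<close> are the external identities on an object and on an arrow;
  \<open>m \<odot> n\<close> and \<open>\<alpha> \<star> \<beta>\<close> are external composition of proarrows and of cells.\<close>

record ('o, 'a, 'p, 'c) dbl =
  D0 :: "('o, 'a) cat"
  D1 :: "('p, 'c) cat"
  psrc :: "'p \<Rightarrow> 'o"
  ptgt :: "'p \<Rightarrow> 'o"
  csrc :: "'c \<Rightarrow> 'a"
  ctgt :: "'c \<Rightarrow> 'a"
  idp :: "'o \<Rightarrow> 'p"
  idc :: "'a \<Rightarrow> 'c"
  odot :: "'p \<Rightarrow> 'p \<Rightarrow> 'p" (infixl "\<odot>\<index>" 75)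
  star :: "'c \<Rightarrow> 'c \<Rightarrow> 'c" (infixl "\<star>\<index>" 75)
  assoc :: "'p \<Rightarrow> 'p \<Rightarrow> 'p \<Rightarrow> 'c"
  lun :: "'p \<Rightarrow> 'c"
  run :: "'p \<Rightarrow> 'c"

abbreviation Objs :: "('o, 'a, 'p, 'c, 'z) dbl_scheme \<Rightarrow> 'o set" where "Objs D \<equiv> Ob (D0 D)"
abbreviation Arrs :: "('o, 'a, 'p, 'c, 'z) dbl_scheme \<Rightarrow> 'a set" where "Arrs D \<equiv> Arr (D0 D)"
abbreviation Pros :: "('o, 'a, 'p, 'c, 'z) dbl_scheme \<Rightarrow> 'p set" where "Pros D \<equiv> Ob (D1 D)"
abbreviation Cells :: "('o, 'a, 'p, 'c, 'z) dbl_scheme \<Rightarrow> 'c set" where "Cells D \<equiv> Arr (D1 D)"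

abbreviation idcell :: "('o, 'a, 'p, 'c, 'z) dbl_scheme \<Rightarrow> 'p \<Rightarrow> 'c" where
  "idcell D m \<equiv> ide (D1 D) m"

abbreviation ccomp :: "('o, 'a, 'p, 'c, 'z) dbl_scheme \<Rightarrow> 'c \<Rightarrow> 'c \<Rightarrow> 'c" (infixl "\<bullet>\<index>" 70) where
  "ccomp D \<equiv> cmp (D1 D)"

definition cell :: "('o, 'a, 'p, 'c, 'z) dbl_scheme \<Rightarrow> 'p \<Rightarrow> 'p \<Rightarrow> 'a \<Rightarrow> 'a \<Rightarrow> 'c set" where
  "cell D m n f g = {c \<in> Hom (D1 D) m n. csrc D c = f \<and> ctgt D c = g}"

definition globular :: "('o, 'a, 'p, 'c, 'z) dbl_scheme \<Rightarrow> 'p \<Rightarrow> 'p \<Rightarrow> 'c set" where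
  "globular D m n = cell D m n (ide (D0 D) (psrc D m)) (ide (D0 D) (ptgt D m))"

locale double_category =
  fixes D :: "('o, 'a, 'p, 'c, 'z) dbl_scheme" (structure)
  assumes D0_category: "category (D0 D)"
    and D1_category: "category (D1 D)"
    and src_functor: "is_functor (D1 D) (D0 D) (psrc D) (csrc D)"
    and tgt_functor: "is_functor (D1 D) (D0 D) (ptgt D) (ctgt D)"
    and id_functor: "is_functor (D0 D) (D1 D) (idp D) (idc D)"
    and id_src_tgt: "x \<in> Objs D \<Longrightarrow> psrc D (idp D x) = x \<and> ptgt D (idp D x) = x"
    and idc_src_tgt: "f \<in> Arrs D \<Longrightarrow> csrc D (idc D f) = f \<and> ctgt D (idc D f) = f"
    and odot_in: "m \<in> Pros D \<Longrightarrow> n \<in> Pros D \<Longrightarrow> ptgt D m = psrc D n \<Longrightarrow>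
      m \<odot> n \<in> Pros D \<and> psrc D (m \<odot> n) = psrc D m \<and> ptgt D (m \<odot> n) = ptgt D n"
    and star_in: "c \<in> Cells D \<Longrightarrow> d \<in> Cells D \<Longrightarrow> ctgt D c = csrc D d \<Longrightarrow>
      c \<star> d \<in> cell D (Dom (D1 D) c \<odot> Dom (D1 D) d) (Cod (D1 D) c \<odot> Cod (D1 D) d) (csrc D c) (ctgt D d)"
    and star_id: "m \<in> Pros D \<Longrightarrow> n \<in> Pros D \<Longrightarrow> ptgt D m = psrc D n \<Longrightarrow>
      idcell D m \<star> idcell D n = idcell D (m \<odot> n)"
    and interchange: "c \<in> Cells D \<Longrightarrow> c' \<in> Cells D \<Longrightarrow> d \<in> Cells D \<Longrightarrow> d' \<in> Cells D \<Longrightarrow>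
      Cod (D1 D) c = Dom (D1 D) c' \<Longrightarrow> Cod (D1 D) d = Dom (D1 D) d' \<Longrightarrow>
      ctgt D c = csrc D d \<Longrightarrow> ctgt D c' = csrc D d' \<Longrightarrow>
      (c \<bullet> c') \<star> (d \<bullet> d') = (c \<star> d) \<bullet> (c' \<star> d')"
    and assoc_in: "m \<in> Pros D \<Longrightarrow> n \<in> Pros D \<Longrightarrow> p \<in> Pros D \<Longrightarrow> ptgt D m = psrc D n \<Longrightarrow> ptgt D n = psrc D p \<Longrightarrow>
      assoc D m n p \<in> globular D ((m \<odot> n) \<odot> p) (m \<odot> (n \<odot> p)) \<and> is_iso (D1 D) (assoc D m n p)"
    and lun_in: "m \<in> Pros D \<Longrightarrow>
      lun D m \<in> globular D (idp D (psrc D m) \<odot> m) m \<and> is_iso (D1 D) (lun D m)"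
    and run_in: "m \<in> Pros D \<Longrightarrow>
      run D m \<in> globular D (m \<odot> idp D (ptgt D m)) m \<and> is_iso (D1 D) (run D m)"
    and assoc_natural: "c \<in> Cells D \<Longrightarrow> d \<in> Cells D \<Longrightarrow> e \<in> Cells D \<Longrightarrow> ctgt D c = csrc D d \<Longrightarrow> ctgt D d = csrc D e \<Longrightarrow>
      ((c \<star> d) \<star> e) \<bullet> assoc D (Cod (D1 D) c) (Cod (D1 D) d) (Cod (D1 D) e) =
      assoc D (Dom (D1 D) c) (Dom (D1 D) d) (Dom (D1 D) e) \<bullet> (c \<star> (d \<star> e))"
    and lun_natural: "c \<in> Cells D \<Longrightarrow>
      (idc D (csrc D c) \<star> c) \<bullet> lun D (Cod (D1 D) c) = lun D (Dom (D1 D) c) \<bullet> c"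
    and run_natural: "c \<in> Cells D \<Longrightarrow>
      (c \<star> idc D (ctgt D c)) \<bullet> run D (Cod (D1 D) c) = run D (Dom (D1 D) c) \<bullet> c"
    and pentagon: "m \<in> Pros D \<Longrightarrow> n \<in> Pros D \<Longrightarrow> p \<in> Pros D \<Longrightarrow> q \<in> Pros D \<Longrightarrow>
      ptgt D m = psrc D n \<Longrightarrow> ptgt D n = psrc D p \<Longrightarrow> ptgt D p = psrc D q \<Longrightarrow>
      assoc D (m \<odot> n) p q \<bullet> assoc D m n (p \<odot> q) =
      (assoc D m n p \<star> idcell D q) \<bullet> assoc D m (n \<odot> p) q \<bullet> (idcell D m \<star> assoc D n p q)"
    and triangle: "m \<in> Pros D \<Longrightarrow> n \<in> Pros D \<Longrightarrow> ptgt D m = psrc D n \<Longrightarrow>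
      assoc D m (idp D (ptgt D m)) n \<bullet> (idcell D m \<star> lun D n) = run D m \<star> idcell D n"


subsection \<open>Cartesian double categories\<close>

text \<open>The right adjoints to the diagonal and to the map to the terminal double category are
  pseudo double functors, hence commute strictly with source and target: the chosen
  products of \<open>D1\<close> lie over the chosen products of \<open>D0\<close>.\<close>

record ('o, 'a, 'p, 'c) cdbl = "('o, 'a, 'p, 'c) dbl" +
  P0 :: "('o, 'a) products"
  P1 :: "('p, 'c) products"

locale cartesian_double_category = double_category D
  for D :: "('o, 'a, 'p, 'c, 'z) cdbl_scheme" (structure) +
  assumes D0_products: "finite_products (D0 D) (P0 D)"
    and D1_products: "finite_products (D1 D) (P1 D)"
    and term_src_tgt: "psrc D (term_ob (P1 D)) = term_ob (P0 D)" "ptgt D (term_ob (P1 D)) = term_ob (P0 D)"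
    and prod_src_tgt: "m \<in> Pros D \<Longrightarrow> n \<in> Pros D \<Longrightarrow>
      psrc D (prod_ob (P1 D) m n) = prod_ob (P0 D) (psrc D m) (psrc D n) \<and>
      ptgt D (prod_ob (P1 D) m n) = prod_ob (P0 D) (ptgt D m) (ptgt D n)"
    and proj_src: "m \<in> Pros D \<Longrightarrow> n \<in> Pros D \<Longrightarrow>
      csrc D (proj1 (P1 D) m n) = proj1 (P0 D) (psrc D m) (psrc D n) \<and>
      csrc D (proj2 (P1 D) m n) = proj2 (P0 D) (psrc D m) (psrc D n)"
    and proj_tgt: "m \<in> Pros D \<Longrightarrow> n \<in> Pros D \<Longrightarrow>
      ctgt D (proj1 (P1 D) m n) = proj1 (P0 D) (ptgt D m) (ptgt D n) \<and>
      ctgt D (proj2 (P1 D) m n) = proj2 (P0 D) (ptgt D m) (ptgt D n)"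
    and odot_prod: "m \<in> Pros D \<Longrightarrow> n \<in> Pros D \<Longrightarrow> m' \<in> Pros D \<Longrightarrow> n' \<in> Pros D \<Longrightarrow>
      ptgt D m = psrc D n \<Longrightarrow> ptgt D m' = psrc D n' \<Longrightarrow>
      is_iso (D1 D) (pairing (D1 D) (P1 D)
        (proj1 (P1 D) m m' \<star> proj1 (P1 D) n n') (proj2 (P1 D) m m' \<star> proj2 (P1 D) n n'))"
    and idp_prod: "x \<in> Objs D \<Longrightarrow> x' \<in> Objs D \<Longrightarrow>
      is_iso (D1 D) (pairing (D1 D) (P1 D) (idc D (proj1 (P0 D) x x')) (idc D (proj2 (P0 D) x x')))"
    and odot_term: "is_iso (D1 D) (to_term (D1 D) (P1 D) (term_ob (P1 D) \<odot> term_ob (P1 D)))"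
    and idp_term: "is_iso (D1 D) (to_term (D1 D) (P1 D) (idp D (term_ob (P0 D))))"


subsection \<open>Products of double categories and the walking proarrow\<close>

definition prod_cat :: "('o, 'a, 'z) cat_scheme \<Rightarrow> ('o2, 'a2, 'z2) cat_scheme \<Rightarrow> ('o \<times> 'o2, 'a \<times> 'a2) cat" where
  "prod_cat C C' = \<lparr> Ob = Ob C \<times> Ob C', Arr = Arr C \<times> Arr C',
     Dom = map_prod (Dom C) (Dom C'), Cod = map_prod (Cod C) (Cod C'), ide = map_prod (ide C) (ide C'),
     cmp = (\<lambda>(f, f') (g, g'). (f \<cdot>\<^bsub>C\<^esub> g, f' \<cdot>\<^bsub>C'\<^esub> g')) \<rparr>"

definition prod_dbl ::
  "('o, 'a, 'p, 'c, 'z) dbl_scheme \<Rightarrow> ('o2, 'a2, 'p2, 'c2, 'z2) dbl_scheme \<Rightarrow>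
   ('o \<times> 'o2, 'a \<times> 'a2, 'p \<times> 'p2, 'c \<times> 'c2) dbl" where
  "prod_dbl D E = \<lparr> D0 = prod_cat (D0 D) (D0 E), D1 = prod_cat (D1 D) (D1 E),
     psrc = map_prod (psrc D) (psrc E), ptgt = map_prod (ptgt D) (ptgt E),
     csrc = map_prod (csrc D) (csrc E), ctgt = map_prod (ctgt D) (ctgt E),
     idp = map_prod (idp D) (idp E), idc = map_prod (idc D) (idc E),
     odot = (\<lambda>(m, m') (n, n'). (m \<odot>\<^bsub>D\<^esub> n, m' \<odot>\<^bsub>E\<^esub> n')),
     star = (\<lambda>(c, c') (d, d'). (c \<star>\<^bsub>D\<^esub> d, c' \<star>\<^bsub>E\<^esub> d')),
     assoc = (\<lambda>(m, m') (n, n') (p, p'). (assoc D m n p, assoc E m' n' p')),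
     lun = map_prod (lun D) (lun E), run = map_prod (run D) (run E) \<rparr>"

text \<open>The double category freely generated by one proarrow: its only arrows and cells are
  identities, which are represented by the objects and proarrows themselves.\<close>

datatype wobj = Zero | One
datatype wpro = Idw wobj | Gen

definition discrete :: "('o, 'o) cat" where
  "discrete = \<lparr> Ob = UNIV, Arr = UNIV, Dom = id, Cod = id, ide = id, cmp = (\<lambda>x y. x) \<rparr>"

fun wsrc :: "wpro \<Rightarrow> wobj" where "wsrc (Idw x) = x" | "wsrc Gen = Zero"
fun wtgt :: "wpro \<Rightarrow> wobj" where "wtgt (Idw x) = x" | "wtgt Gen = One"
fun wodot :: "wpro \<Rightarrow> wpro \<Rightarrow> wpro" where "wodot (Idw x) q = q" | "wodot Gen q = Gen"

definition walking :: "(wobj, wobj, wpro, wpro) dbl" where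
  "walking = \<lparr> D0 = discrete, D1 = discrete, psrc = wsrc, ptgt = wtgt, csrc = wsrc, ctgt = wtgt,
     idp = Idw, idc = Idw, odot = wodot, star = wodot,
     assoc = (\<lambda>m n p. wodot m (wodot n p)), lun = id, run = id \<rparr>"


subsection \<open>Iterated external composites and coherence\<close>

fun chain :: "'p set \<Rightarrow> ('p \<Rightarrow> 'o) \<Rightarrow> ('p \<Rightarrow> 'o) \<Rightarrow> 'o \<Rightarrow> 'p list \<Rightarrow> 'o \<Rightarrow> bool" where
  "chain S s t x [] y \<longleftrightarrow> x = y"
| "chain S s t x (m # ms) y \<longleftrightarrow> m \<in> S \<and> s m = x \<and> chain S s t (t m) ms y"

definition chain_end :: "('p \<Rightarrow> 'o) \<Rightarrow> 'o \<Rightarrow> 'p list \<Rightarrow> 'o" where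
  "chain_end t x ms = (if ms = [] then x else t (last ms))"

definition ppath :: "('o, 'a, 'p, 'c, 'z) dbl_scheme \<Rightarrow> 'o \<Rightarrow> 'p list \<Rightarrow> 'o \<Rightarrow> bool" where
  "ppath D x ms y \<longleftrightarrow> x \<in> Objs D \<and> chain (Pros D) (psrc D) (ptgt D) x ms y"

definition cpath :: "('o, 'a, 'p, 'c, 'z) dbl_scheme \<Rightarrow> 'a \<Rightarrow> 'c list \<Rightarrow> 'a \<Rightarrow> bool" where
  "cpath D f cs g \<longleftrightarrow> f \<in> Arrs D \<and> chain (Cells D) (csrc D) (ctgt D) f cs g"

text \<open>Iterated composites \<open>m1 \<odot> (m2 \<odot> (\<dots> \<odot> mk))\<close> are bracketed to the right; the first
  argument is the starting object (arrow) of the path, used only when the path is empty.\<close>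

fun odots :: "('o, 'a, 'p, 'c, 'z) dbl_scheme \<Rightarrow> 'o \<Rightarrow> 'p list \<Rightarrow> 'p" where
  "odots D x [] = idp D x"
| "odots D x [m] = m"
| "odots D x (m # n # ms) = m \<odot>\<^bsub>D\<^esub> odots D (ptgt D m) (n # ms)"

fun stars :: "('o, 'a, 'p, 'c, 'z) dbl_scheme \<Rightarrow> 'a \<Rightarrow> 'c list \<Rightarrow> 'c" where
  "stars D f [] = idc D f"
| "stars D f [c] = c"
| "stars D f (c # d # cs) = c \<star>\<^bsub>D\<^esub> stars D (ctgt D c) (d # cs)"

text \<open>Canonical isomorphism \<open>odots x ms \<odot> odots y ns \<rightarrow> odots x (ms @ ns)\<close>.\<close>

fun coh :: "('o, 'a, 'p, 'c, 'z) dbl_scheme \<Rightarrow> 'o \<Rightarrow> 'p list \<Rightarrow> 'p list \<Rightarrow> 'c" where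
  "coh D x [] ns = lun D (odots D x ns)"
| "coh D x [m] [] = run D m"
| "coh D x [m] (n # ns) = idcell D (m \<odot>\<^bsub>D\<^esub> odots D (ptgt D m) (n # ns))"
| "coh D x (m # m' # ms) ns =
     assoc D m (odots D (ptgt D m) (m' # ms)) (odots D (chain_end (ptgt D) x (m # m' # ms)) ns) \<bullet>\<^bsub>D\<^esub>
     (idcell D m \<star>\<^bsub>D\<^esub> coh D (ptgt D m) (m' # ms) ns)"

text \<open>For a path cut into blocks: the composites of the blocks, and the canonical isomorphism
  from the composite of these composites to the composite of the whole path.\<close>

fun blocks :: "('o, 'a, 'p, 'c, 'z) dbl_scheme \<Rightarrow> 'o \<Rightarrow> 'p list list \<Rightarrow> 'p list" where
  "blocks D x [] = []"
| "blocks D x (b # bs) = odots D x b # blocks D (chain_end (ptgt D) x b) bs"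

fun cohs :: "('o, 'a, 'p, 'c, 'z) dbl_scheme \<Rightarrow> 'o \<Rightarrow> 'p list list \<Rightarrow> 'c" where
  "cohs D x [] = idcell D (idp D x)"
| "cohs D x [b] = idcell D (odots D x b)"
| "cohs D x (b # b' # bs) =
     (idcell D (odots D x b) \<star>\<^bsub>D\<^esub> cohs D (chain_end (ptgt D) x b) (b' # bs)) \<bullet>\<^bsub>D\<^esub>
     coh D x b (concat (b' # bs))"

text \<open>The coherence isomorphism between two bracketings of the same path
  (\<open>concat bs = concat bs'\<close>).\<close>

definition rebracket :: "('o, 'a, 'p, 'c, 'z) dbl_scheme \<Rightarrow> 'o \<Rightarrow> 'p list list \<Rightarrow> 'p list list \<Rightarrow> 'c" where
  "rebracket D x bs bs' = cohs D x bs \<bullet>\<^bsub>D\<^esub> inverse_arr (D1 D) (cohs D x bs')"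

abbreviation singles :: "'p list \<Rightarrow> 'p list list" where
  "singles ms \<equiv> map (\<lambda>m. [m]) ms"


section \<open>Cartesian 2-categories\<close>

text \<open>\<open>A1\<close> carries the 2-cells under vertical composition, its objects being the morphisms;
  \<open>hcmp\<close> is horizontal composition.\<close>

record ('o, 'f, 't) two_cat =
  A0 :: "('o, 'f) cat"
  A1 :: "('f, 't) cat"
  hcmp :: "'t \<Rightarrow> 't \<Rightarrow> 't" (infixl "\<ast>\<index>" 75)

definition dom0 :: "('o, 'f, 't, 'z) two_cat_scheme \<Rightarrow> 't \<Rightarrow> 'o" where
  "dom0 A s = Dom (A0 A) (Dom (A1 A) s)"

definition cod0 :: "('o, 'f, 't, 'z) two_cat_scheme \<Rightarrow> 't \<Rightarrow> 'o" where
  "cod0 A s = Cod (A0 A) (Dom (A1 A) s)"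

locale two_category =
  fixes A :: "('o, 'f, 't, 'z) two_cat_scheme" (structure)
  assumes A0_category: "category (A0 A)"
    and A1_category: "category (A1 A)"
    and A1_objects: "Ob (A1 A) = Arr (A0 A)"
    and parallel: "s \<in> Arr (A1 A) \<Longrightarrow>
      Dom (A0 A) (Cod (A1 A) s) = dom0 A s \<and> Cod (A0 A) (Cod (A1 A) s) = cod0 A s"
    and hcmp_in: "s \<in> Arr (A1 A) \<Longrightarrow> t \<in> Arr (A1 A) \<Longrightarrow> cod0 A s = dom0 A t \<Longrightarrow>
      s \<ast> t \<in> Hom (A1 A) (Dom (A1 A) s \<cdot>\<^bsub>A0 A\<^esub> Dom (A1 A) t) (Cod (A1 A) s \<cdot>\<^bsub>A0 A\<^esub> Cod (A1 A) t)"
    and hcmp_assoc: "s \<in> Arr (A1 A) \<Longrightarrow> t \<in> Arr (A1 A) \<Longrightarrow> u \<in> Arr (A1 A) \<Longrightarrow>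
      cod0 A s = dom0 A t \<Longrightarrow> cod0 A t = dom0 A u \<Longrightarrow> (s \<ast> t) \<ast> u = s \<ast> (t \<ast> u)"
    and ide_hcmp: "s \<in> Arr (A1 A) \<Longrightarrow> ide (A1 A) (ide (A0 A) (dom0 A s)) \<ast> s = s"
    and hcmp_ide: "s \<in> Arr (A1 A) \<Longrightarrow> s \<ast> ide (A1 A) (ide (A0 A) (cod0 A s)) = s"
    and hcmp_id: "f \<in> Arr (A0 A) \<Longrightarrow> g \<in> Arr (A0 A) \<Longrightarrow> Cod (A0 A) f = Dom (A0 A) g \<Longrightarrow>
      ide (A1 A) f \<ast> ide (A1 A) g = ide (A1 A) (f \<cdot>\<^bsub>A0 A\<^esub> g)"
    and middle_four: "s \<in> Arr (A1 A) \<Longrightarrow> s' \<in> Arr (A1 A) \<Longrightarrow> t \<in> Arr (A1 A) \<Longrightarrow> t' \<in> Arr (A1 A) \<Longrightarrow>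
      Cod (A1 A) s = Dom (A1 A) s' \<Longrightarrow> Cod (A1 A) t = Dom (A1 A) t' \<Longrightarrow> cod0 A s = dom0 A t \<Longrightarrow>
      (s \<cdot>\<^bsub>A1 A\<^esub> s') \<ast> (t \<cdot>\<^bsub>A1 A\<^esub> t') = (s \<ast> t) \<cdot>\<^bsub>A1 A\<^esub> (s' \<ast> t')"

record ('o, 'f, 't) ctwo_cat = "('o, 'f, 't) two_cat" +
  P2 :: "('o, 'f) products"

locale cartesian_two_category = two_category A
  for A :: "('o, 'f, 't, 'z) ctwo_cat_scheme" (structure) +
  assumes A0_products: "finite_products (A0 A) (P2 A)"
    and terminal_2cells: "z \<in> Ob (A0 A) \<Longrightarrow>
      \<exists>!s. s \<in> Arr (A1 A) \<and> dom0 A s = z \<and> cod0 A s = term_ob (P2 A)"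
    and product_2cells: "x \<in> Ob (A0 A) \<Longrightarrow> y \<in> Ob (A0 A) \<Longrightarrow>
      s \<in> Arr (A1 A) \<Longrightarrow> t \<in> Arr (A1 A) \<Longrightarrow> dom0 A s = dom0 A t \<Longrightarrow> cod0 A s = x \<Longrightarrow> cod0 A t = y \<Longrightarrow>
      \<exists>!u. u \<in> Arr (A1 A) \<and> dom0 A u = dom0 A s \<and> cod0 A u = prod_ob (P2 A) x y \<and>
        u \<ast> ide (A1 A) (proj1 (P2 A) x y) = s \<and> u \<ast> ide (A1 A) (proj2 (P2 A) x y) = t"

text \<open>The only proarrows are the identities, so the proarrow \<open>idp x\<close> is represented by \<open>x\<close>.
  Composition in \<open>D1\<close> is horizontal composition of 2-cells, external composition is vertical.\<close>

definition VerDbl :: "('o, 'f, 't, 'z) ctwo_cat_scheme \<Rightarrow> ('o, 'f, 'o, 't) cdbl" where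
  "VerDbl A = \<lparr> D0 = A0 A,
     D1 = \<lparr> Ob = Ob (A0 A), Arr = Arr (A1 A), Dom = dom0 A, Cod = cod0 A,
            ide = (\<lambda>x. ide (A1 A) (ide (A0 A) x)), cmp = hcmp A \<rparr>,
     psrc = id, ptgt = id, csrc = Dom (A1 A), ctgt = Cod (A1 A), idp = id, idc = ide (A1 A),
     odot = (\<lambda>x y. x), star = cmp (A1 A),
     assoc = (\<lambda>x y z. ide (A1 A) (ide (A0 A) x)),
     lun = (\<lambda>x. ide (A1 A) (ide (A0 A) x)), run = (\<lambda>x. ide (A1 A) (ide (A0 A) x)),
     P0 = P2 A,
     P1 = \<lparr> term_ob = term_ob (P2 A), prod_ob = prod_ob (P2 A),
            proj1 = (\<lambda>x y. ide (A1 A) (proj1 (P2 A) x y)), proj2 = (\<lambda>x y. ide (A1 A) (proj2 (P2 A) x y)) \<rparr> \<rparr>"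


section \<open>Lax double functors\<close>

text \<open>All components are extensional (\<open>undefined\<close> outside their carriers), so that equality of
  records is equality of lax functors; likewise for the structures below.\<close>

record ('o, 'a, 'p, 'c, 'o2, 'a2, 'p2, 'c2) lax_fun =
  onOb :: "'o \<Rightarrow> 'o2"
  onArr :: "'a \<Rightarrow> 'a2"
  onPro :: "'p \<Rightarrow> 'p2"
  onCell :: "'c \<Rightarrow> 'c2"
  laxator :: "'p \<times> 'p \<Rightarrow> 'c2"
  unitor :: "'o \<Rightarrow> 'c2"

definition composable :: "('o, 'a, 'p, 'c, 'z) dbl_scheme \<Rightarrow> ('p \<times> 'p) set" where
  "composable D = {(m, n). m \<in> Pros D \<and> n \<in> Pros D \<and> ptgt D m = psrc D n}"

locale lax_functor =
  fixes D :: "('o, 'a, 'p, 'c, 'z) dbl_scheme"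
    and E :: "('o2, 'a2, 'p2, 'c2, 'z2) dbl_scheme"
    and F :: "('o, 'a, 'p, 'c, 'o2, 'a2, 'p2, 'c2) lax_fun"
  assumes functor0: "is_functor (D0 D) (D0 E) (onOb F) (onArr F)"
    and functor1: "is_functor (D1 D) (D1 E) (onPro F) (onCell F)"
    and fun_src_tgt: "m \<in> Pros D \<Longrightarrow>
      psrc E (onPro F m) = onOb F (psrc D m) \<and> ptgt E (onPro F m) = onOb F (ptgt D m)"
    and fun_csrc_ctgt: "c \<in> Cells D \<Longrightarrow>
      csrc E (onCell F c) = onArr F (csrc D c) \<and> ctgt E (onCell F c) = onArr F (ctgt D c)"
    and laxator_in: "(m, n) \<in> composable D \<Longrightarrow>
      laxator F (m, n) \<in> globular E (onPro F m \<odot>\<^bsub>E\<^esub> onPro F n) (onPro F (m \<odot>\<^bsub>D\<^esub> n))"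
    and unitor_in: "x \<in> Objs D \<Longrightarrow>
      unitor F x \<in> globular E (idp E (onOb F x)) (onPro F (idp D x))"
    and laxator_natural: "c \<in> Cells D \<Longrightarrow> d \<in> Cells D \<Longrightarrow> ctgt D c = csrc D d \<Longrightarrow>
      (onCell F c \<star>\<^bsub>E\<^esub> onCell F d) \<bullet>\<^bsub>E\<^esub> laxator F (Cod (D1 D) c, Cod (D1 D) d) =
      laxator F (Dom (D1 D) c, Dom (D1 D) d) \<bullet>\<^bsub>E\<^esub> onCell F (c \<star>\<^bsub>D\<^esub> d)"
    and unitor_natural: "f \<in> Arrs D \<Longrightarrow>
      idc E (onArr F f) \<bullet>\<^bsub>E\<^esub> unitor F (Cod (D0 D) f) = unitor F (Dom (D0 D) f) \<bullet>\<^bsub>E\<^esub> onCell F (idc D f)"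
    and laxator_assoc: "(m, n) \<in> composable D \<Longrightarrow> (n, p) \<in> composable D \<Longrightarrow>
      (laxator F (m, n) \<star>\<^bsub>E\<^esub> idcell E (onPro F p)) \<bullet>\<^bsub>E\<^esub> laxator F (m \<odot>\<^bsub>D\<^esub> n, p) \<bullet>\<^bsub>E\<^esub> onCell F (assoc D m n p) =
      assoc E (onPro F m) (onPro F n) (onPro F p) \<bullet>\<^bsub>E\<^esub>
        (idcell E (onPro F m) \<star>\<^bsub>E\<^esub> laxator F (n, p)) \<bullet>\<^bsub>E\<^esub> laxator F (m, n \<odot>\<^bsub>D\<^esub> p)"
    and left_unital: "m \<in> Pros D \<Longrightarrow>
      (unitor F (psrc D m) \<star>\<^bsub>E\<^esub> idcell E (onPro F m)) \<bullet>\<^bsub>E\<^esub>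
        laxator F (idp D (psrc D m), m) \<bullet>\<^bsub>E\<^esub> onCell F (lun D m) = lun E (onPro F m)"
    and right_unital: "m \<in> Pros D \<Longrightarrow>
      (idcell E (onPro F m) \<star>\<^bsub>E\<^esub> unitor F (ptgt D m)) \<bullet>\<^bsub>E\<^esub>
        laxator F (m, idp D (ptgt D m)) \<bullet>\<^bsub>E\<^esub> onCell F (run D m) = run E (onPro F m)"
    and fun_ext: "onOb F \<in> extensional (Objs D)" "onArr F \<in> extensional (Arrs D)"
      "onPro F \<in> extensional (Pros D)" "onCell F \<in> extensional (Cells D)"
      "laxator F \<in> extensional (composable D)" "unitor F \<in> extensional (Objs D)"

definition unitary ::
  "('o, 'a, 'p, 'c, 'z) dbl_scheme \<Rightarrow> ('o2, 'a2, 'p2, 'c2, 'z2) dbl_scheme \<Rightarrow>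
   ('o, 'a, 'p, 'c, 'o2, 'a2, 'p2, 'c2) lax_fun \<Rightarrow> bool" where
  "unitary D E F \<longleftrightarrow> (\<forall>x\<in>Objs D.
     onPro F (idp D x) = idp E (onOb F x) \<and> unitor F x = idcell E (idp E (onOb F x)))"

definition cartesian_functor ::
  "('o, 'a, 'p, 'c, 'z) dbl_scheme \<Rightarrow> ('o2, 'a2, 'p2, 'c2, 'z2) dbl_scheme \<Rightarrow>
   ('o, 'a, 'p, 'c, 'o2, 'a2, 'p2, 'c2) lax_fun \<Rightarrow> bool" where
  "cartesian_functor D E F \<longleftrightarrow>
     preserves_finite_products (D0 D) (D0 E) (onOb F) (onArr F) \<and>
     preserves_finite_products (D1 D) (D1 E) (onPro F) (onCell F)"

text \<open>The laxators \<open>F id\<^sub>x \<odot> F m \<rightarrow> F m\<close> and \<open>F m \<odot> F id\<^sub>y \<rightarrow> F m\<close> at identity proarrows.\<close>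

definition laxator_idl ::
  "('o, 'a, 'p, 'c, 'z) dbl_scheme \<Rightarrow> ('o2, 'a2, 'p2, 'c2, 'z2) dbl_scheme \<Rightarrow>
   ('o, 'a, 'p, 'c, 'o2, 'a2, 'p2, 'c2) lax_fun \<Rightarrow> 'p \<Rightarrow> 'c2" where
  "laxator_idl D E F m = laxator F (idp D (psrc D m), m) \<bullet>\<^bsub>E\<^esub> onCell F (lun D m)"

definition laxator_idr ::
  "('o, 'a, 'p, 'c, 'z) dbl_scheme \<Rightarrow> ('o2, 'a2, 'p2, 'c2, 'z2) dbl_scheme \<Rightarrow>
   ('o, 'a, 'p, 'c, 'o2, 'a2, 'p2, 'c2) lax_fun \<Rightarrow> 'p \<Rightarrow> 'c2" where
  "laxator_idr D E F m = laxator F (m, idp D (ptgt D m)) \<bullet>\<^bsub>E\<^esub> onCell F (run D m)"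

text \<open>The inverse unit isomorphisms \<open>m \<rightarrow> id \<odot> m\<close> and \<open>m \<rightarrow> m \<odot> id\<close>.\<close>

abbreviation lun_inv :: "('o, 'a, 'p, 'c, 'z) dbl_scheme \<Rightarrow> 'p \<Rightarrow> 'c" where
  "lun_inv D m \<equiv> inverse_arr (D1 D) (lun D m)"

abbreviation run_inv :: "('o, 'a, 'p, 'c, 'z) dbl_scheme \<Rightarrow> 'p \<Rightarrow> 'c" where
  "run_inv D m \<equiv> inverse_arr (D1 D) (run D m)"


section \<open>Lax natural transformations\<close>

record ('o, 'a, 'p, 'c, 'o2, 'a2, 'p2, 'c2) lax_trans =
  tdom :: "('o, 'a, 'p, 'c, 'o2, 'a2, 'p2, 'c2) lax_fun"
  tcod :: "('o, 'a, 'p, 'c, 'o2, 'a2, 'p2, 'c2) lax_fun"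
  atOb :: "'o \<Rightarrow> 'a2"
  atPro :: "'p \<Rightarrow> 'c2"
  atArr :: "'a \<Rightarrow> 'c2"

locale lax_transformation =
  F: lax_functor D E F + G: lax_functor D E G
  for D :: "('o, 'a, 'p, 'c, 'z) dbl_scheme"
    and E :: "('o2, 'a2, 'p2, 'c2, 'z2) dbl_scheme"
    and F G :: "('o, 'a, 'p, 'c, 'o2, 'a2, 'p2, 'c2) lax_fun"
    and \<alpha> :: "('o, 'a, 'p, 'c, 'o2, 'a2, 'p2, 'c2) lax_trans" +
  assumes tdom_tcod: "tdom \<alpha> = F" "tcod \<alpha> = G"
    and atOb_in: "x \<in> Objs D \<Longrightarrow> atOb \<alpha> x \<in> Hom (D0 E) (onOb F x) (onOb G x)"
    and atPro_in: "m \<in> Pros D \<Longrightarrow>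
      atPro \<alpha> m \<in> cell E (onPro F m) (onPro G m) (atOb \<alpha> (psrc D m)) (atOb \<alpha> (ptgt D m))"
    and atArr_in: "f \<in> Hom (D0 D) x y \<Longrightarrow>
      atArr \<alpha> f \<in> cell E (idp E (onOb F x)) (onPro G (idp D y))
        (atOb \<alpha> x \<cdot>\<^bsub>D0 E\<^esub> onArr G f) (onArr F f \<cdot>\<^bsub>D0 E\<^esub> atOb \<alpha> y)"
    and cell_naturality: "\<gamma> \<in> cell D m n f g \<Longrightarrow>
      lun_inv E (onPro F m) \<bullet>\<^bsub>E\<^esub>
        (atArr \<alpha> f \<star>\<^bsub>E\<^esub> (onCell F \<gamma> \<bullet>\<^bsub>E\<^esub> atPro \<alpha> n)) \<bullet>\<^bsub>E\<^esub> laxator_idl D E G n =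
      run_inv E (onPro F m) \<bullet>\<^bsub>E\<^esub>
        ((atPro \<alpha> m \<bullet>\<^bsub>E\<^esub> onCell G \<gamma>) \<star>\<^bsub>E\<^esub> atArr \<alpha> g) \<bullet>\<^bsub>E\<^esub> laxator_idr D E G n"
    and atPro_odot: "(m, n) \<in> composable D \<Longrightarrow>
      laxator F (m, n) \<bullet>\<^bsub>E\<^esub> atPro \<alpha> (m \<odot>\<^bsub>D\<^esub> n) = (atPro \<alpha> m \<star>\<^bsub>E\<^esub> atPro \<alpha> n) \<bullet>\<^bsub>E\<^esub> laxator G (m, n)"
    and atPro_idp: "x \<in> Objs D \<Longrightarrow>
      unitor F x \<bullet>\<^bsub>E\<^esub> atPro \<alpha> (idp D x) = idc E (atOb \<alpha> x) \<bullet>\<^bsub>E\<^esub> unitor G x"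
    and atArr_comp: "f \<in> Hom (D0 D) x y \<Longrightarrow> g \<in> Hom (D0 D) y z \<Longrightarrow>
      atArr \<alpha> (f \<cdot>\<^bsub>D0 D\<^esub> g) =
      lun_inv E (idp E (onOb F x)) \<bullet>\<^bsub>E\<^esub>
        ((atArr \<alpha> f \<bullet>\<^bsub>E\<^esub> onCell G (idc D g)) \<star>\<^bsub>E\<^esub> (idc E (onArr F f) \<bullet>\<^bsub>E\<^esub> atArr \<alpha> g)) \<bullet>\<^bsub>E\<^esub>
        laxator_idl D E G (idp D z)"
    and atArr_ide: "x \<in> Objs D \<Longrightarrow> atArr \<alpha> (ide (D0 D) x) = idc E (atOb \<alpha> x) \<bullet>\<^bsub>E\<^esub> unitor G x"
    and trans_ext: "atOb \<alpha> \<in> extensional (Objs D)" "atPro \<alpha> \<in> extensional (Pros D)"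
      "atArr \<alpha> \<in> extensional (Arrs D)"

definition strictly_natural_at ::
  "('o, 'a, 'p, 'c, 'z) dbl_scheme \<Rightarrow> ('o2, 'a2, 'p2, 'c2, 'z2) dbl_scheme \<Rightarrow>
   ('o, 'a, 'p, 'c, 'o2, 'a2, 'p2, 'c2) lax_trans \<Rightarrow> 'a \<Rightarrow> bool" where
  "strictly_natural_at D E \<alpha> f \<longleftrightarrow>
     (let x = Dom (D0 D) f; y = Cod (D0 D) f; F = tdom \<alpha>; G = tcod \<alpha> in
       atOb \<alpha> x \<cdot>\<^bsub>D0 E\<^esub> onArr G f = onArr F f \<cdot>\<^bsub>D0 E\<^esub> atOb \<alpha> y \<and>
       atArr \<alpha> f = idc E (onArr F f \<cdot>\<^bsub>D0 E\<^esub> atOb \<alpha> y) \<bullet>\<^bsub>E\<^esub> unitor G y)"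

definition cartesian_transformation ::
  "('o, 'a, 'p, 'c, 'z) cdbl_scheme \<Rightarrow> ('o2, 'a2, 'p2, 'c2, 'z2) dbl_scheme \<Rightarrow>
   ('o, 'a, 'p, 'c, 'o2, 'a2, 'p2, 'c2) lax_trans \<Rightarrow> bool" where
  "cartesian_transformation D E \<alpha> \<longleftrightarrow> (\<forall>x\<in>Objs D. \<forall>x'\<in>Objs D.
     strictly_natural_at D E \<alpha> (proj1 (P0 D) x x') \<and> strictly_natural_at D E \<alpha> (proj2 (P0 D) x x'))"

definition id_trans ::
  "('o, 'a, 'p, 'c, 'z) dbl_scheme \<Rightarrow> ('o2, 'a2, 'p2, 'c2, 'z2) dbl_scheme \<Rightarrow>
   ('o, 'a, 'p, 'c, 'o2, 'a2, 'p2, 'c2) lax_fun \<Rightarrow> ('o, 'a, 'p, 'c, 'o2, 'a2, 'p2, 'c2) lax_trans" where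
  "id_trans D E F = \<lparr> tdom = F, tcod = F,
     atOb = (\<lambda>x\<in>Objs D. ide (D0 E) (onOb F x)),
     atPro = (\<lambda>m\<in>Pros D. idcell E (onPro F m)),
     atArr = (\<lambda>f\<in>Arrs D. idc E (onArr F f) \<bullet>\<^bsub>E\<^esub> unitor F (Cod (D0 D) f)) \<rparr>"

definition comp_trans ::
  "('o, 'a, 'p, 'c, 'z) dbl_scheme \<Rightarrow> ('o2, 'a2, 'p2, 'c2, 'z2) dbl_scheme \<Rightarrow>
   ('o, 'a, 'p, 'c, 'o2, 'a2, 'p2, 'c2) lax_trans \<Rightarrow> ('o, 'a, 'p, 'c, 'o2, 'a2, 'p2, 'c2) lax_trans \<Rightarrow>
   ('o, 'a, 'p, 'c, 'o2, 'a2, 'p2, 'c2) lax_trans" where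
  "comp_trans D E \<alpha> \<beta> = \<lparr> tdom = tdom \<alpha>, tcod = tcod \<beta>,
     atOb = (\<lambda>x\<in>Objs D. atOb \<alpha> x \<cdot>\<^bsub>D0 E\<^esub> atOb \<beta> x),
     atPro = (\<lambda>m\<in>Pros D. atPro \<alpha> m \<bullet>\<^bsub>E\<^esub> atPro \<beta> m),
     atArr = (\<lambda>f\<in>Arrs D. let x = Dom (D0 D) f; y = Cod (D0 D) f in
       lun_inv E (idp E (onOb (tdom \<alpha>) x)) \<bullet>\<^bsub>E\<^esub>
         ((idc E (atOb \<alpha> x) \<bullet>\<^bsub>E\<^esub> atArr \<beta> f) \<star>\<^bsub>E\<^esub> (atArr \<alpha> f \<bullet>\<^bsub>E\<^esub> atPro \<beta> (idp D y))) \<bullet>\<^bsub>E\<^esub>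
         laxator_idl D E (tcod \<beta>) (idp D y)) \<rparr>"


section \<open>Modules\<close>

type_synonym ('o, 'a, 'p, 'c, 'o2, 'a2, 'p2, 'c2) bimod =
  "('o \<times> wobj, 'a \<times> wobj, 'p \<times> wpro, 'c \<times> wpro, 'o2, 'a2, 'p2, 'c2) lax_fun"

text \<open>A module is a lax functor \<open>M\<close> out of \<open>prod_dbl D walking\<close>. Its source and target are the
  restrictions \<open>M(-,0)\<close> and \<open>M(-,1)\<close>.\<close>

definition mod_at ::
  "('o, 'a, 'p, 'c, 'z) dbl_scheme \<Rightarrow> wobj \<Rightarrow> ('o, 'a, 'p, 'c, 'o2, 'a2, 'p2, 'c2) bimod \<Rightarrow>
   ('o, 'a, 'p, 'c, 'o2, 'a2, 'p2, 'c2) lax_fun" where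
  "mod_at D w M = \<lparr>
     onOb = (\<lambda>x\<in>Objs D. onOb M (x, w)), onArr = (\<lambda>f\<in>Arrs D. onArr M (f, w)),
     onPro = (\<lambda>m\<in>Pros D. onPro M (m, Idw w)), onCell = (\<lambda>c\<in>Cells D. onCell M (c, Idw w)),
     laxator = (\<lambda>(m, n)\<in>composable D. laxator M ((m, Idw w), (n, Idw w))),
     unitor = (\<lambda>x\<in>Objs D. unitor M (x, w)) \<rparr>"

abbreviation msrc :: "('o, 'a, 'p, 'c, 'z) dbl_scheme \<Rightarrow> ('o, 'a, 'p, 'c, 'o2, 'a2, 'p2, 'c2) bimod \<Rightarrow>
    ('o, 'a, 'p, 'c, 'o2, 'a2, 'p2, 'c2) lax_fun" where
  "msrc D \<equiv> mod_at D Zero"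

abbreviation mtgt :: "('o, 'a, 'p, 'c, 'z) dbl_scheme \<Rightarrow> ('o, 'a, 'p, 'c, 'o2, 'a2, 'p2, 'c2) bimod \<Rightarrow>
    ('o, 'a, 'p, 'c, 'o2, 'a2, 'p2, 'c2) lax_fun" where
  "mtgt D \<equiv> mod_at D One"

abbreviation mpro :: "('o, 'a, 'p, 'c, 'o2, 'a2, 'p2, 'c2) bimod \<Rightarrow> 'p \<Rightarrow> 'p2" where
  "mpro M m \<equiv> onPro M (m, Gen)"

abbreviation mcell :: "('o, 'a, 'p, 'c, 'o2, 'a2, 'p2, 'c2) bimod \<Rightarrow> 'c \<Rightarrow> 'c2" where
  "mcell M c \<equiv> onCell M (c, Gen)"

abbreviation lact :: "('o, 'a, 'p, 'c, 'o2, 'a2, 'p2, 'c2) bimod \<Rightarrow> 'p \<Rightarrow> 'p \<Rightarrow> 'c2" where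
  "lact M m n \<equiv> laxator M ((m, Idw Zero), (n, Gen))"

abbreviation ract :: "('o, 'a, 'p, 'c, 'o2, 'a2, 'p2, 'c2) bimod \<Rightarrow> 'p \<Rightarrow> 'p \<Rightarrow> 'c2" where
  "ract M m n \<equiv> laxator M ((m, Gen), (n, Idw One))"

definition is_module ::
  "('o, 'a, 'p, 'c, 'z) dbl_scheme \<Rightarrow> ('o2, 'a2, 'p2, 'c2, 'z2) dbl_scheme \<Rightarrow>
   ('o, 'a, 'p, 'c, 'o2, 'a2, 'p2, 'c2) bimod \<Rightarrow> bool" where
  "is_module D E M \<longleftrightarrow> lax_functor (prod_dbl D walking) E M"

definition cartesian_module ::
  "('o, 'a, 'p, 'c, 'z) cdbl_scheme \<Rightarrow> ('o2, 'a2, 'p2, 'c2, 'z2) cdbl_scheme \<Rightarrow>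
   ('o, 'a, 'p, 'c, 'o2, 'a2, 'p2, 'c2) bimod \<Rightarrow> bool" where
  "cartesian_module D E M \<longleftrightarrow>
     cartesian_functor D E (msrc D M) \<and> cartesian_functor D E (mtgt D M) \<and>
     (\<forall>m\<in>Pros D. \<forall>m'\<in>Pros D. is_iso (D1 E)
        (pairing (D1 E) (P1 E) (mcell M (proj1 (P1 D) m m')) (mcell M (proj2 (P1 D) m m')))) \<and>
     is_iso (D1 E) (to_term (D1 E) (P1 E) (mpro M (term_ob (P1 D))))"


section \<open>Multimodulations\<close>

text \<open>The component at the path \<open>ms\<close> of proarrows starting at \<open>x\<close> is \<open>mmc \<mu> (x, ms)\<close>.\<close>

record ('o, 'a, 'p, 'c, 'o2, 'a2, 'p2, 'c2) multimod =
  mmin :: "('o, 'a, 'p, 'c, 'o2, 'a2, 'p2, 'c2) bimod list"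
  mmout :: "('o, 'a, 'p, 'c, 'o2, 'a2, 'p2, 'c2) bimod"
  mml :: "('o, 'a, 'p, 'c, 'o2, 'a2, 'p2, 'c2) lax_trans"
  mmr :: "('o, 'a, 'p, 'c, 'o2, 'a2, 'p2, 'c2) lax_trans"
  mmc :: "'o \<times> 'p list \<Rightarrow> 'c2"

definition paths_of_length :: "('o, 'a, 'p, 'c, 'z) dbl_scheme \<Rightarrow> nat \<Rightarrow> ('o \<times> 'p list) set" where
  "paths_of_length D k = {(x, ms). (\<exists>y. ppath D x ms y) \<and> length ms = k}"

abbreviation mpros :: "('o, 'a, 'p, 'c, 'o2, 'a2, 'p2, 'c2) bimod list \<Rightarrow> 'p list \<Rightarrow> 'p2 list" where
  "mpros Ms ms \<equiv> map2 mpro Ms ms"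

definition left_equivariant ::
  "('o, 'a, 'p, 'c, 'z) dbl_scheme \<Rightarrow> ('o2, 'a2, 'p2, 'c2, 'z2) dbl_scheme \<Rightarrow>
   ('o, 'a, 'p, 'c, 'o2, 'a2, 'p2, 'c2) multimod \<Rightarrow> bool" where
  "left_equivariant D E \<mu> \<longleftrightarrow>
     (\<forall>M Ms w m0 m ms y. mmin \<mu> = M # Ms \<and> ppath D w (m0 # m # ms) y \<and> length ms = length Ms \<longrightarrow>
       (let N = mmout \<mu>; F = tdom (mml \<mu>); x = psrc D m in
         (atPro (mml \<mu>) m0 \<star>\<^bsub>E\<^esub> mmc \<mu> (x, m # ms)) \<bullet>\<^bsub>E\<^esub> lact N m0 (odots D x (m # ms)) \<bullet>\<^bsub>E\<^esub>
           mcell N (rebracket D w [[m0], m # ms] ([m0, m] # singles ms)) =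
         rebracket E (onOb F w) [[onPro F m0], mpros (M # Ms) (m # ms)]
             ([onPro F m0, mpro M m] # singles (mpros Ms ms)) \<bullet>\<^bsub>E\<^esub>
           stars E (ide (D0 E) (onOb F w)) (lact M m0 m # map (idcell E) (mpros Ms ms)) \<bullet>\<^bsub>E\<^esub>
           mmc \<mu> (w, (m0 \<odot>\<^bsub>D\<^esub> m) # ms)))"

definition right_equivariant ::
  "('o, 'a, 'p, 'c, 'z) dbl_scheme \<Rightarrow> ('o2, 'a2, 'p2, 'c2, 'z2) dbl_scheme \<Rightarrow>
   ('o, 'a, 'p, 'c, 'o2, 'a2, 'p2, 'c2) multimod \<Rightarrow> bool" where
  "right_equivariant D E \<mu> \<longleftrightarrow>
     (\<forall>M Ms x ms m m' y. mmin \<mu> = Ms @ [M] \<and> ppath D x (ms @ [m, m']) y \<and> length ms = length Ms \<longrightarrow>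
       (let N = mmout \<mu>; F = tdom (mml \<mu>); F' = tdom (mmr \<mu>) in
         (mmc \<mu> (x, ms @ [m]) \<star>\<^bsub>E\<^esub> atPro (mmr \<mu>) m') \<bullet>\<^bsub>E\<^esub> ract N (odots D x (ms @ [m])) m' \<bullet>\<^bsub>E\<^esub>
           mcell N (rebracket D x [ms @ [m], [m']] (singles ms @ [[m, m']])) =
         rebracket E (onOb F x) [mpros (Ms @ [M]) (ms @ [m]), [onPro F' m']]
             (singles (mpros Ms ms) @ [[mpro M m, onPro F' m']]) \<bullet>\<^bsub>E\<^esub>
           stars E (ide (D0 E) (onOb F x)) (map (idcell E) (mpros Ms ms) @ [ract M m m']) \<bullet>\<^bsub>E\<^esub>
           mmc \<mu> (x, ms @ [m \<odot>\<^bsub>D\<^esub> m'])))"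

definition inner_equivariant ::
  "('o, 'a, 'p, 'c, 'z) dbl_scheme \<Rightarrow> ('o2, 'a2, 'p2, 'c2, 'z2) dbl_scheme \<Rightarrow>
   ('o, 'a, 'p, 'c, 'o2, 'a2, 'p2, 'c2) multimod \<Rightarrow> bool" where
  "inner_equivariant D E \<mu> \<longleftrightarrow>
     (\<forall>Ms M M' Ms' x ms m p m' ms' y.
       mmin \<mu> = Ms @ [M, M'] @ Ms' \<and> ppath D x (ms @ [m, p, m'] @ ms') y \<and>
       length ms = length Ms \<and> length ms' = length Ms' \<longrightarrow>
       (let N = mmout \<mu>; F = tdom (mml \<mu>); Fp = onPro (mtgt D M) p; as = mpros Ms ms; bs = mpros Ms' ms' in
         stars E (ide (D0 E) (onOb F x))
             (map (idcell E) as @ [ract M m p, idcell E (mpro M' m')] @ map (idcell E) bs) \<bullet>\<^bsub>E\<^esub>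
           mmc \<mu> (x, ms @ [m \<odot>\<^bsub>D\<^esub> p, m'] @ ms') \<bullet>\<^bsub>E\<^esub>
           mcell N (rebracket D x (singles ms @ [[m, p], [m']] @ singles ms')
                                  (singles ms @ [[m], [p, m']] @ singles ms')) =
         rebracket E (onOb F x) (singles as @ [[mpro M m, Fp], [mpro M' m']] @ singles bs)
                                (singles as @ [[mpro M m], [Fp, mpro M' m']] @ singles bs) \<bullet>\<^bsub>E\<^esub>
           stars E (ide (D0 E) (onOb F x))
             (map (idcell E) as @ [idcell E (mpro M m), lact M' p m'] @ map (idcell E) bs) \<bullet>\<^bsub>E\<^esub>
           mmc \<mu> (x, ms @ [m, p \<odot>\<^bsub>D\<^esub> m'] @ ms')))"

definition nullary_equivariant ::
  "('o, 'a, 'p, 'c, 'z) dbl_scheme \<Rightarrow> ('o2, 'a2, 'p2, 'c2, 'z2) dbl_scheme \<Rightarrow>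
   ('o, 'a, 'p, 'c, 'o2, 'a2, 'p2, 'c2) multimod \<Rightarrow> bool" where
  "nullary_equivariant D E \<mu> \<longleftrightarrow>
     (mmin \<mu> = [] \<longrightarrow> (\<forall>m\<in>Pros D.
       (let N = mmout \<mu>; F = tdom (mml \<mu>); x = psrc D m; y = ptgt D m in
         lun_inv E (onPro F m) \<bullet>\<^bsub>E\<^esub> (mmc \<mu> (x, []) \<star>\<^bsub>E\<^esub> atPro (mmr \<mu>) m) \<bullet>\<^bsub>E\<^esub>
           ract N (idp D x) m \<bullet>\<^bsub>E\<^esub> mcell N (lun D m) =
         run_inv E (onPro F m) \<bullet>\<^bsub>E\<^esub> (atPro (mml \<mu>) m \<star>\<^bsub>E\<^esub> mmc \<mu> (y, [])) \<bullet>\<^bsub>E\<^esub>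
           lact N m (idp D y) \<bullet>\<^bsub>E\<^esub> mcell N (run D m))))"

definition multi_natural ::
  "('o, 'a, 'p, 'c, 'z) dbl_scheme \<Rightarrow> ('o2, 'a2, 'p2, 'c2, 'z2) dbl_scheme \<Rightarrow>
   ('o, 'a, 'p, 'c, 'o2, 'a2, 'p2, 'c2) multimod \<Rightarrow> bool" where
  "multi_natural D E \<mu> \<longleftrightarrow>
     (\<forall>f g \<gamma>s. cpath D f \<gamma>s g \<and> length \<gamma>s = length (mmin \<mu>) \<longrightarrow>
       (let N = mmout \<mu>; F = tdom (mml \<mu>); x = Dom (D0 D) f; y = Cod (D0 D) f; y' = Cod (D0 D) g;
            ms = map (Dom (D1 D)) \<gamma>s; ns = map (Cod (D1 D)) \<gamma>s; n = odots D y ns;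
            Mms = odots E (onOb F x) (mpros (mmin \<mu>) ms) in
         lun_inv E Mms \<bullet>\<^bsub>E\<^esub>
           (atArr (mml \<mu>) f \<star>\<^bsub>E\<^esub> (stars E (onArr F f) (map2 mcell (mmin \<mu>) \<gamma>s) \<bullet>\<^bsub>E\<^esub> mmc \<mu> (y, ns))) \<bullet>\<^bsub>E\<^esub>
           lact N (idp D y) n \<bullet>\<^bsub>E\<^esub> mcell N (lun D n) =
         run_inv E Mms \<bullet>\<^bsub>E\<^esub>
           ((mmc \<mu> (x, ms) \<bullet>\<^bsub>E\<^esub> mcell N (stars D f \<gamma>s)) \<star>\<^bsub>E\<^esub> atArr (mmr \<mu>) g) \<bullet>\<^bsub>E\<^esub>
           ract N n (idp D y') \<bullet>\<^bsub>E\<^esub> mcell N (run D n)))"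

definition multimodulation ::
  "('o, 'a, 'p, 'c, 'z) dbl_scheme \<Rightarrow> ('o2, 'a2, 'p2, 'c2, 'z2) dbl_scheme \<Rightarrow>
   ('o, 'a, 'p, 'c, 'o2, 'a2, 'p2, 'c2) multimod \<Rightarrow> bool" where
  "multimodulation D E \<mu> \<longleftrightarrow>
     (let \<alpha> = mml \<mu>; \<beta> = mmr \<mu>; N = mmout \<mu>; k = length (mmin \<mu>) in
       lax_transformation D E (tdom \<alpha>) (msrc D N) \<alpha> \<and>
       lax_transformation D E (tdom \<beta>) (mtgt D N) \<beta> \<and>
       chain {M. is_module D E M} (msrc D) (mtgt D) (tdom \<alpha>) (mmin \<mu>) (tdom \<beta>) \<and>
       is_module D E N \<and>
       (\<forall>x ms y. ppath D x ms y \<and> length ms = k \<longrightarrow>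
          mmc \<mu> (x, ms) \<in> cell E (odots E (onOb (tdom \<alpha>) x) (mpros (mmin \<mu>) ms)) (mpro N (odots D x ms))
            (atOb \<alpha> x) (atOb \<beta> y)) \<and>
       mmc \<mu> \<in> extensional (paths_of_length D k)) \<and>
     left_equivariant D E \<mu> \<and> right_equivariant D E \<mu> \<and> inner_equivariant D E \<mu> \<and>
     nullary_equivariant D E \<mu> \<and> multi_natural D E \<mu>"

definition id_multimod ::
  "('o, 'a, 'p, 'c, 'z) dbl_scheme \<Rightarrow> ('o2, 'a2, 'p2, 'c2, 'z2) dbl_scheme \<Rightarrow>
   ('o, 'a, 'p, 'c, 'o2, 'a2, 'p2, 'c2) bimod \<Rightarrow> ('o, 'a, 'p, 'c, 'o2, 'a2, 'p2, 'c2) multimod" where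
  "id_multimod D E M = \<lparr> mmin = [M], mmout = M,
     mml = id_trans D E (msrc D M), mmr = id_trans D E (mtgt D M),
     mmc = (\<lambda>(x, ms)\<in>paths_of_length D 1. idcell E (mpro M (hd ms))) \<rparr>"

fun split_by :: "nat list \<Rightarrow> 'p list \<Rightarrow> 'p list list" where
  "split_by [] ms = []"
| "split_by (k # ks) ms = take k ms # split_by ks (drop k ms)"

fun mm_cells ::
  "('o, 'a, 'p, 'c, 'z) dbl_scheme \<Rightarrow> 'o \<Rightarrow> ('o, 'a, 'p, 'c, 'o2, 'a2, 'p2, 'c2) multimod list \<Rightarrow>
   'p list list \<Rightarrow> 'c2 list" where
  "mm_cells D x (\<mu> # \<mu>s) (b # bs) = mmc \<mu> (x, b) # mm_cells D (chain_end (ptgt D) x b) \<mu>s bs"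
| "mm_cells D x _ _ = []"

text \<open>The composite of \<open>\<mu>1, \<dots>, \<mu>n\<close> with an \<open>n\<close>-ary \<open>\<nu>\<close>. The transformation \<open>\<alpha>\<close> is the left
  boundary of \<open>\<mu>1\<close>; it is only additional data for \<open>n = 0\<close>, where a nullary \<open>\<nu>\<close> is composed
  with \<open>\<alpha>\<close> alone.\<close>

definition comp_multimod ::
  "('o, 'a, 'p, 'c, 'z) dbl_scheme \<Rightarrow> ('o2, 'a2, 'p2, 'c2, 'z2) dbl_scheme \<Rightarrow>
   ('o, 'a, 'p, 'c, 'o2, 'a2, 'p2, 'c2) lax_trans \<Rightarrow> ('o, 'a, 'p, 'c, 'o2, 'a2, 'p2, 'c2) multimod list \<Rightarrow>
   ('o, 'a, 'p, 'c, 'o2, 'a2, 'p2, 'c2) multimod \<Rightarrow> ('o, 'a, 'p, 'c, 'o2, 'a2, 'p2, 'c2) multimod" where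
  "comp_multimod D E \<alpha> \<mu>s \<nu> = \<lparr> mmin = concat (map mmin \<mu>s), mmout = mmout \<nu>,
     mml = comp_trans D E \<alpha> (mml \<nu>), mmr = comp_trans D E (chain_end mmr \<alpha> \<mu>s) (mmr \<nu>),
     mmc = (\<lambda>(x, ms)\<in>paths_of_length D (length (concat (map mmin \<mu>s))).
       let mss = split_by (map (\<lambda>\<mu>. length (mmin \<mu>)) \<mu>s) ms;
           Mss = map2 (\<lambda>\<mu> b. mpros (mmin \<mu>) b) \<mu>s mss in
       inverse_arr (D1 E) (cohs E (onOb (tdom \<alpha>) x) Mss) \<bullet>\<^bsub>E\<^esub>
         stars E (atOb \<alpha> x) (mm_cells D x \<mu>s mss) \<bullet>\<^bsub>E\<^esub>
         mmc \<nu> (x, blocks D x mss) \<bullet>\<^bsub>E\<^esub>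
         mcell (mmout \<nu>) (cohs D x mss)) \<rparr>"


section \<open>Virtual double categories\<close>

text \<open>\<open>vcmp V f \<mu>s \<nu>\<close> is the composite of the adjacent multicells \<open>\<mu>s\<close>, whose leftmost boundary is
  the arrow \<open>f\<close>, with \<open>\<nu>\<close>; for empty \<open>\<mu>s\<close> it is the composite of \<open>f\<close> with the nullary \<open>\<nu>\<close>.\<close>

record ('o, 'a, 'p, 'c) vdc =
  V0 :: "('o, 'a) cat"
  vpro :: "'p set"
  vsrc :: "'p \<Rightarrow> 'o"
  vtgt :: "'p \<Rightarrow> 'o"
  vcell :: "'c set"
  vin :: "'c \<Rightarrow> 'p list"
  vout :: "'c \<Rightarrow> 'p"
  vleft :: "'c \<Rightarrow> 'a"
  vright :: "'c \<Rightarrow> 'a"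
  vid :: "'p \<Rightarrow> 'c"
  vcmp :: "'a \<Rightarrow> 'c list \<Rightarrow> 'c \<Rightarrow> 'c"

definition vpath :: "('o, 'a, 'p, 'c, 'z) vdc_scheme \<Rightarrow> 'o \<Rightarrow> 'p list \<Rightarrow> 'o \<Rightarrow> bool" where
  "vpath V x ps y \<longleftrightarrow> x \<in> Ob (V0 V) \<and> chain (vpro V) (vsrc V) (vtgt V) x ps y"

definition vcpath :: "('o, 'a, 'p, 'c, 'z) vdc_scheme \<Rightarrow> 'a \<Rightarrow> 'c list \<Rightarrow> 'a \<Rightarrow> bool" where
  "vcpath V f cs g \<longleftrightarrow> f \<in> Arr (V0 V) \<and> chain (vcell V) (vleft V) (vright V) f cs g"

definition vhom :: "('o, 'a, 'p, 'c, 'z) vdc_scheme \<Rightarrow> 'p list \<Rightarrow> 'p \<Rightarrow> 'a \<Rightarrow> 'a \<Rightarrow> 'c set" where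
  "vhom V ps q f g = {c \<in> vcell V. vin V c = ps \<and> vout V c = q \<and> vleft V c = f \<and> vright V c = g}"

definition vcomposable :: "('o, 'a, 'p, 'c, 'z) vdc_scheme \<Rightarrow> 'a \<Rightarrow> 'c list \<Rightarrow> 'a \<Rightarrow> 'c \<Rightarrow> bool" where
  "vcomposable V f \<mu>s g \<nu> \<longleftrightarrow> \<nu> \<in> vcell V \<and> vcpath V f \<mu>s g \<and> map (vout V) \<mu>s = vin V \<nu> \<and>
     Cod (V0 V) f = Dom (V0 V) (vleft V \<nu>)"

text \<open>Composition of consecutive groups of multicells \<open>\<kappa>ss\<close> with the multicells \<open>\<mu>s\<close>.\<close>

fun vcmps :: "('o, 'a, 'p, 'c, 'z) vdc_scheme \<Rightarrow> 'a \<Rightarrow> 'c list list \<Rightarrow> 'c list \<Rightarrow> 'c list" where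
  "vcmps V f (\<kappa>s # \<kappa>ss) (\<mu> # \<mu>s) = vcmp V f \<kappa>s \<mu> # vcmps V (chain_end (vright V) f \<kappa>s) \<kappa>ss \<mu>s"
| "vcmps V f _ _ = []"

locale virtual_double_category =
  fixes V :: "('o, 'a, 'p, 'c, 'z) vdc_scheme"
  assumes V0_category: "category (V0 V)"
    and vsrc_vtgt: "p \<in> vpro V \<Longrightarrow> vsrc V p \<in> Ob (V0 V) \<and> vtgt V p \<in> Ob (V0 V)"
    and vcell_frame: "\<mu> \<in> vcell V \<Longrightarrow> vout V \<mu> \<in> vpro V \<and>
      (\<exists>x y. vpath V x (vin V \<mu>) y \<and> vleft V \<mu> \<in> Hom (V0 V) x (vsrc V (vout V \<mu>)) \<and>
        vright V \<mu> \<in> Hom (V0 V) y (vtgt V (vout V \<mu>)))"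
    and vid_in: "p \<in> vpro V \<Longrightarrow>
      vid V p \<in> vhom V [p] p (ide (V0 V) (vsrc V p)) (ide (V0 V) (vtgt V p))"
    and vcmp_in: "vcomposable V f \<mu>s g \<nu> \<Longrightarrow>
      vcmp V f \<mu>s \<nu> \<in> vhom V (concat (map (vin V) \<mu>s)) (vout V \<nu>)
        (f \<cdot>\<^bsub>V0 V\<^esub> vleft V \<nu>) (g \<cdot>\<^bsub>V0 V\<^esub> vright V \<nu>)"
    and vcmp_vid: "\<mu> \<in> vcell V \<Longrightarrow> vcmp V (vleft V \<mu>) [\<mu>] (vid V (vout V \<mu>)) = \<mu>"
    and vid_vcmp: "\<mu> \<in> vcell V \<Longrightarrow>
      vcmp V (ide (V0 V) (Dom (V0 V) (vleft V \<mu>))) (map (vid V) (vin V \<mu>)) \<mu> = \<mu>"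
    and vcmp_assoc: "vcomposable V g \<mu>s g' \<nu> \<Longrightarrow> vcpath V f (concat \<kappa>ss) f' \<Longrightarrow>
      map (map (vout V)) \<kappa>ss = map (vin V) \<mu>s \<Longrightarrow> Cod (V0 V) f = Dom (V0 V) g \<Longrightarrow>
      vcmp V (f \<cdot>\<^bsub>V0 V\<^esub> g) (vcmps V f \<kappa>ss \<mu>s) \<nu> = vcmp V f (concat \<kappa>ss) (vcmp V g \<mu>s \<nu>)"

text \<open>When \<open>vin V c\<close> is empty the source of a multicell \<open>\<mu>\<close> may be empty as well, so its starting
  object \<open>z\<close> has to be prescribed separately.\<close>

definition opcartesian :: "('o, 'a, 'p, 'c, 'z) vdc_scheme \<Rightarrow> 'c \<Rightarrow> bool" where
  "opcartesian V c \<longleftrightarrow> c \<in> vcell V \<and>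
     (\<forall>z qs rs \<mu>. vpath V z qs (Dom (V0 V) (vleft V c)) \<and>
          \<mu> \<in> vcell V \<and> vin V \<mu> = qs @ vin V c @ rs \<and> Dom (V0 V) (vleft V \<mu>) = z \<longrightarrow>
        (\<exists>!\<nu>. \<nu> \<in> vhom V (qs @ [vout V c] @ rs) (vout V \<mu>) (vleft V \<mu>) (vright V \<mu>) \<and>
           vcmp V (ide (V0 V) z) (map (vid V) qs @ [c] @ map (vid V) rs) \<nu> = \<mu>))"

definition is_composite :: "('o, 'a, 'p, 'c, 'z) vdc_scheme \<Rightarrow> 'o \<Rightarrow> 'p list \<Rightarrow> 'o \<Rightarrow> 'c \<Rightarrow> bool" where
  "is_composite V x ps y c \<longleftrightarrow> vin V c = ps \<and> vleft V c = ide (V0 V) x \<and> vright V c = ide (V0 V) y \<and>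
     opcartesian V c"

definition representable :: "('o, 'a, 'p, 'c, 'z) vdc_scheme \<Rightarrow> bool" where
  "representable V \<longleftrightarrow> virtual_double_category V \<and>
     (\<forall>x ps y. vpath V x ps y \<longrightarrow> (\<exists>c. is_composite V x ps y c))"


section \<open>Cartesian unitary lax functors\<close>

definition cart_objects ::
  "('o, 'a, 'p, 'c, 'z) cdbl_scheme \<Rightarrow> ('o2, 'a2, 'p2, 'c2, 'z2) cdbl_scheme \<Rightarrow>
   ('o, 'a, 'p, 'c, 'o2, 'a2, 'p2, 'c2) lax_fun set" where
  "cart_objects D E = {F. lax_functor D E F \<and> unitary D E F \<and> cartesian_functor D E F}"

definition cart_arrows ::
  "('o, 'a, 'p, 'c, 'z) cdbl_scheme \<Rightarrow> ('o2, 'a2, 'p2, 'c2, 'z2) cdbl_scheme \<Rightarrow>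
   ('o, 'a, 'p, 'c, 'o2, 'a2, 'p2, 'c2) lax_trans set" where
  "cart_arrows D E = {\<alpha>. tdom \<alpha> \<in> cart_objects D E \<and> tcod \<alpha> \<in> cart_objects D E \<and>
     lax_transformation D E (tdom \<alpha>) (tcod \<alpha>) \<alpha> \<and> cartesian_transformation D E \<alpha>}"

definition cart_proarrows ::
  "('o, 'a, 'p, 'c, 'z) cdbl_scheme \<Rightarrow> ('o2, 'a2, 'p2, 'c2, 'z2) cdbl_scheme \<Rightarrow>
   ('o, 'a, 'p, 'c, 'o2, 'a2, 'p2, 'c2) bimod set" where
  "cart_proarrows D E = {M. is_module D E M \<and> msrc D M \<in> cart_objects D E \<and> mtgt D M \<in> cart_objects D E \<and>
     cartesian_module D E M}"

definition cart_multicells ::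
  "('o, 'a, 'p, 'c, 'z) cdbl_scheme \<Rightarrow> ('o2, 'a2, 'p2, 'c2, 'z2) cdbl_scheme \<Rightarrow>
   ('o, 'a, 'p, 'c, 'o2, 'a2, 'p2, 'c2) multimod set" where
  "cart_multicells D E = {\<mu>. multimodulation D E \<mu> \<and> set (mmin \<mu>) \<subseteq> cart_proarrows D E \<and>
     mmout \<mu> \<in> cart_proarrows D E \<and> mml \<mu> \<in> cart_arrows D E \<and> mmr \<mu> \<in> cart_arrows D E}"

definition vCartLax ::
  "('o, 'a, 'p, 'c, 'z) cdbl_scheme \<Rightarrow> ('o2, 'a2, 'p2, 'c2, 'z2) cdbl_scheme \<Rightarrow>
   (('o, 'a, 'p, 'c, 'o2, 'a2, 'p2, 'c2) lax_fun, ('o, 'a, 'p, 'c, 'o2, 'a2, 'p2, 'c2) lax_trans,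
    ('o, 'a, 'p, 'c, 'o2, 'a2, 'p2, 'c2) bimod, ('o, 'a, 'p, 'c, 'o2, 'a2, 'p2, 'c2) multimod) vdc" where
  "vCartLax D E = \<lparr>
     V0 = \<lparr> Ob = cart_objects D E, Arr = cart_arrows D E, Dom = tdom, Cod = tcod,
            ide = id_trans D E, cmp = comp_trans D E \<rparr>,
     vpro = cart_proarrows D E, vsrc = msrc D, vtgt = mtgt D,
     vcell = cart_multicells D E, vin = mmin, vout = mmout, vleft = mml, vright = mmr,
     vid = id_multimod D E, vcmp = comp_multimod D E \<rparr>"

end

theory Submission
  imports Defs
begin

text \<open>The strictification of \<open>E\<close> has paths of proarrows as proarrows and cells between composites of
  paths as cells; it is a strict double category. Read there, a unitary lax functor out of
  \<open>VerDbl A\<close> is a functor for both compositions of 2-cells, a module is a family of proarrows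
  \<open>M x\<close> with cells \<open>M s\<close> on which the actions are composition, \<open>M (s \<star> t) = F s \<star> M t = M s \<star> G t\<close>,
  and a multimodulation is a family of cells indexed by objects that is natural for identity 2-cells
  only: general 2-cells slide to the left boundary. The coherence cells in the composition of
  multimodulations disappear, and the axioms of a virtual double category reduce to interchange.
  A path of modules has the composite \<open>x \<mapsto> M1 x \<odot> \<dots> \<odot> Mk x\<close>, since a path is isomorphic in the
  strictification to the one-element path of its composite; the composite is cartesian because
  external composition preserves products.\<close>

section \<open>Typing rules in a double category\<close>

text \<open>Over a general base, a composite of modules is a quotient that identifies the two inner
  actions, and such quotients need not exist in an arbitrary \<open>E\<close>. The obstacle
  disappears here: every proarrow of \<open>VerDbl A\<close> is an identity and the functors are
  unitary, so the unit laws force the laxators of a functor and both actions of a module to be unit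
  isomorphisms of \<open>E\<close>. Nothing has to be identified, and plain external composition in
  \<open>E\<close> already serves. What remains is bookkeeping, because the definitions mix unitors,
  rebracketings and inverse coherence cells. Strictification disposes of it at the price of a single
  cocycle identity, \<open>coh_assoc\<close>; no general coherence theorem is invoked. The empty
  path at x is kept distinct from the one-element path on \<open>idp x\<close>. Values of functors
  and of transformations are placed over empty paths, where they compose strictly, and the
  comparison \<open>ucoh\<close> of the two paths gives back the unit isomorphisms that occur in the
  equivariance axioms.\<close>

lemma (in category) cmp_closed [simp]:
  assumes "f \<in> Arr C" "g \<in> Arr C" "Cod C f = Dom C g"
  shows "f \<cdot> g \<in> Arr C" "Dom C (f \<cdot> g) = Dom C f" "Cod C (f \<cdot> g) = Cod C g"
  using cmp_in[OF assms] by (auto simp: Hom_def)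

lemma (in category) ide_closed [simp]:
  assumes "x \<in> Ob C" shows "ide C x \<in> Arr C" "Dom C (ide C x) = x" "Cod C (ide C x) = x"
  using ide_in[OF assms] by (auto simp: Hom_def)

declare (in category) Dom_in [simp] Cod_in [simp] cmp_assoc [simp]

lemma (in category) ide_cmp' [simp]: "f \<in> Arr C \<Longrightarrow> Dom C f = x \<Longrightarrow> ide C x \<cdot> f = f"
  using ide_cmp by blast

lemma (in category) cmp_ide' [simp]: "f \<in> Arr C \<Longrightarrow> Cod C f = x \<Longrightarrow> f \<cdot> ide C x = f"
  using cmp_ide by blast

section \<open>Inverses and cancellation in a category\<close>

lemma (in category) inverses_unique:
  assumes "inverses C f g" "inverses C f h" shows "g = h"
proof -
  have "g = g \<cdot> (f \<cdot> h)" using assms by (simp add: inverses_def Hom_def)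
  also have "\<dots> = (g \<cdot> f) \<cdot> h" using assms by (subst cmp_assoc) (simp_all add: inverses_def Hom_def)
  also have "\<dots> = h" using assms by (simp add: inverses_def Hom_def)
  finally show ?thesis .
qed

lemma (in category) inverse_arr_eqI: "inverses C f g \<Longrightarrow> inverse_arr C f = g"
  unfolding inverse_arr_def using inverses_unique by blast

lemma (in category) inverses_is_iso: "inverses C f g \<Longrightarrow> is_iso C f"
  unfolding is_iso_def by (rule exI)

lemma (in category) inverse_arr:
  assumes "is_iso C f"
  shows "inverse_arr C f \<in> Arr C" "Dom C (inverse_arr C f) = Cod C f" "Cod C (inverse_arr C f) = Dom C f"
    "f \<cdot> inverse_arr C f = ide C (Dom C f)" "inverse_arr C f \<cdot> f = ide C (Cod C f)"
    "f \<in> Arr C"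
proof -
  obtain g where g: "inverses C f g" using assms unfolding is_iso_def ..
  from g inverse_arr_eqI[OF g] show "inverse_arr C f \<in> Arr C" "Dom C (inverse_arr C f) = Cod C f" "Cod C (inverse_arr C f) = Dom C f"
    "f \<cdot> inverse_arr C f = ide C (Dom C f)" "inverse_arr C f \<cdot> f = ide C (Cod C f)"  "f \<in> Arr C"
    by (auto simp: inverses_def Hom_def)
qed

lemma (in category) iso_ide [simp]: "x \<in> Ob C \<Longrightarrow> is_iso C (ide C x)"
  unfolding is_iso_def inverses_def by (rule exI[of _ "ide C x"]) (simp add: Hom_def)

lemma (in category) inverse_ide [simp]: "x \<in> Ob C \<Longrightarrow> inverse_arr C (ide C x) = ide C x"
  by (rule inverse_arr_eqI) (simp add: inverses_def Hom_def)

lemma (in category) inverses_cmp: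
  assumes "inverses C f f'" "inverses C g g'" "Cod C f = Dom C g"
  shows "inverses C (f \<cdot> g) (g' \<cdot> f')"
proof -
  note A = assms[unfolded inverses_def Hom_def]
  have 1: "f \<cdot> g \<cdot> (g' \<cdot> f') = ide C (Dom C f)"
    using A cmp_assoc[of g g' f', symmetric] by simp
  have 2: "g' \<cdot> f' \<cdot> (f \<cdot> g) = ide C (Cod C g)"
    using A cmp_assoc[of f' f g, symmetric] by simp
  show ?thesis unfolding inverses_def Hom_def using A 1 2 by simp
qed

lemma (in category) inverses_inverse_arr: "is_iso C f \<Longrightarrow> inverses C f (inverse_arr C f)"
  using inverse_arr by (simp add: inverses_def Hom_def)

lemma (in category) iso_cmp:
  assumes "is_iso C f" "is_iso C g" "Cod C f = Dom C g"
  shows "is_iso C (f \<cdot> g)"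
  by (rule inverses_is_iso[OF inverses_cmp[OF assms(1,2)[THEN inverses_inverse_arr] assms(3)]])

lemma (in category) iso_cancel_left:
  assumes "is_iso C f" "g \<in> Arr C" "h \<in> Arr C" "Dom C g = Cod C f" "Dom C h = Cod C f" "f \<cdot> g = f \<cdot> h"
  shows "g = h"
proof -
  note I = inverse_arr[OF assms(1)]
  have "(inverse_arr C f \<cdot> f) \<cdot> g = (inverse_arr C f \<cdot> f) \<cdot> h"
    using I assms by (subst (1 2) cmp_assoc) simp_all
  then show ?thesis using I assms by simp
qed

lemma (in category) iso_cancel_right:
  assumes "is_iso C f" "g \<in> Arr C" "h \<in> Arr C" "Cod C g = Dom C f" "Cod C h = Dom C f" "g \<cdot> f = h \<cdot> f"
  shows "g = h"
proof -
  note I = inverse_arr[OF assms(1)]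
  have "g \<cdot> (f \<cdot> inverse_arr C f) = h \<cdot> (f \<cdot> inverse_arr C f)"
    using I assms by (subst (1 2) cmp_assoc[symmetric]) simp_all
  then show ?thesis using I assms by simp
qed

lemma (in category) cmp_inverse_cancel:
  assumes "is_iso C f" "g \<in> Arr C" "Dom C g = Dom C f"
  shows "f \<cdot> (inverse_arr C f \<cdot> g) = g"
  using inverse_arr[OF assms(1)] assms by (subst cmp_assoc[symmetric]) simp_all

lemma (in category) inverse_cmp_cancel:
  assumes "is_iso C f" "g \<in> Arr C" "Dom C g = Cod C f"
  shows "inverse_arr C f \<cdot> (f \<cdot> g) = g"
  using inverse_arr[OF assms(1)] assms by (subst cmp_assoc[symmetric]) simp_all

context double_category
begin

sublocale D0: category "D0 D" by (rule D0_category)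
sublocale D1: category "D1 D" by (rule D1_category)

section \<open>Frames of proarrows and cells, read off from functoriality of source, target and
  external identity\<close>

lemma psrc_in [simp]: "m \<in> Pros D \<Longrightarrow> psrc D m \<in> Objs D"
  and ptgt_in [simp]: "m \<in> Pros D \<Longrightarrow> ptgt D m \<in> Objs D"
  and idp_in [simp]: "x \<in> Objs D \<Longrightarrow> idp D x \<in> Pros D"
  using src_functor tgt_functor id_functor by (auto simp: is_functor_def)

lemma csrc_in [simp]: "c \<in> Cells D \<Longrightarrow> csrc D c \<in> Arrs D"
    "c \<in> Cells D \<Longrightarrow> Dom (D0 D) (csrc D c) = psrc D (Dom (D1 D) c)"
    "c \<in> Cells D \<Longrightarrow> Cod (D0 D) (csrc D c) = psrc D (Cod (D1 D) c)"
  and csrc_idcell [simp]: "m \<in> Pros D \<Longrightarrow> csrc D (idcell D m) = ide (D0 D) (psrc D m)"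
  and csrc_comp [simp]: "c \<in> Cells D \<Longrightarrow> d \<in> Cells D \<Longrightarrow> Cod (D1 D) c = Dom (D1 D) d \<Longrightarrow>
    csrc D (c \<bullet> d) = csrc D c \<cdot>\<^bsub>D0 D\<^esub> csrc D d"
  using src_functor by (auto simp: is_functor_def Hom_def)

lemma ctgt_in [simp]: "c \<in> Cells D \<Longrightarrow> ctgt D c \<in> Arrs D"
    "c \<in> Cells D \<Longrightarrow> Dom (D0 D) (ctgt D c) = ptgt D (Dom (D1 D) c)"
    "c \<in> Cells D \<Longrightarrow> Cod (D0 D) (ctgt D c) = ptgt D (Cod (D1 D) c)"
  and ctgt_idcell [simp]: "m \<in> Pros D \<Longrightarrow> ctgt D (idcell D m) = ide (D0 D) (ptgt D m)"
  and ctgt_comp [simp]: "c \<in> Cells D \<Longrightarrow> d \<in> Cells D \<Longrightarrow> Cod (D1 D) c = Dom (D1 D) d \<Longrightarrow>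
    ctgt D (c \<bullet> d) = ctgt D c \<cdot>\<^bsub>D0 D\<^esub> ctgt D d"
  using tgt_functor by (auto simp: is_functor_def Hom_def)

lemma idc_in [simp]: "f \<in> Arrs D \<Longrightarrow> idc D f \<in> Cells D"
    "f \<in> Arrs D \<Longrightarrow> Dom (D1 D) (idc D f) = idp D (Dom (D0 D) f)"
    "f \<in> Arrs D \<Longrightarrow> Cod (D1 D) (idc D f) = idp D (Cod (D0 D) f)"
  and idc_ide: "x \<in> Objs D \<Longrightarrow> idc D (ide (D0 D) x) = idcell D (idp D x)"
  and idc_comp: "f \<in> Arrs D \<Longrightarrow> g \<in> Arrs D \<Longrightarrow> Cod (D0 D) f = Dom (D0 D) g \<Longrightarrow>
    idc D (f \<cdot>\<^bsub>D0 D\<^esub> g) = idc D f \<bullet> idc D g"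
  using id_functor by (auto simp: is_functor_def Hom_def)

lemma idp_src_tgt [simp]: "x \<in> Objs D \<Longrightarrow> psrc D (idp D x) = x" "x \<in> Objs D \<Longrightarrow> ptgt D (idp D x) = x"
  "f \<in> Arrs D \<Longrightarrow> csrc D (idc D f) = f" "f \<in> Arrs D \<Longrightarrow> ctgt D (idc D f) = f"
  using id_src_tgt idc_src_tgt by auto

lemma odot_closed [simp]:
  assumes "m \<in> Pros D" "n \<in> Pros D" "ptgt D m = psrc D n"
  shows "m \<odot> n \<in> Pros D" "psrc D (m \<odot> n) = psrc D m" "ptgt D (m \<odot> n) = ptgt D n"
  using odot_in[OF assms] by auto

lemma star_closed [simp]:
  assumes "c \<in> Cells D" "d \<in> Cells D" "ctgt D c = csrc D d"
  shows "c \<star> d \<in> Cells D" "Dom (D1 D) (c \<star> d) = Dom (D1 D) c \<odot> Dom (D1 D) d"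
    "Cod (D1 D) (c \<star> d) = Cod (D1 D) c \<odot> Cod (D1 D) d"
    "csrc D (c \<star> d) = csrc D c" "ctgt D (c \<star> d) = ctgt D d"
  using star_in[OF assms] by (auto simp: cell_def Hom_def)

lemma composable_frames:
  assumes "c \<in> Cells D" "d \<in> Cells D" "ctgt D c = csrc D d"
  shows "ptgt D (Dom (D1 D) c) = psrc D (Dom (D1 D) d)" "ptgt D (Cod (D1 D) c) = psrc D (Cod (D1 D) d)"
  using assms by (metis csrc_in(2) ctgt_in(2), metis csrc_in(3) ctgt_in(3))

lemma assoc_closed [simp]:
  assumes "m \<in> Pros D" "n \<in> Pros D" "p \<in> Pros D" "ptgt D m = psrc D n" "ptgt D n = psrc D p"
  shows "assoc D m n p \<in> Cells D" "Dom (D1 D) (assoc D m n p) = m \<odot> n \<odot> p"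
    "Cod (D1 D) (assoc D m n p) = m \<odot> (n \<odot> p)" "csrc D (assoc D m n p) = ide (D0 D) (psrc D m)"
    "ctgt D (assoc D m n p) = ide (D0 D) (ptgt D p)" "is_iso (D1 D) (assoc D m n p)"
  using assoc_in[OF assms] assms by (auto simp: globular_def cell_def Hom_def)

lemma lun_closed [simp]:
  assumes "m \<in> Pros D"
  shows "lun D m \<in> Cells D" "Dom (D1 D) (lun D m) = idp D (psrc D m) \<odot> m"
    "Cod (D1 D) (lun D m) = m" "csrc D (lun D m) = ide (D0 D) (psrc D m)"
    "ctgt D (lun D m) = ide (D0 D) (ptgt D m)" "is_iso (D1 D) (lun D m)"
  using lun_in[OF assms] assms by (auto simp: globular_def cell_def Hom_def)

lemma run_closed [simp]:
  assumes "m \<in> Pros D"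
  shows "run D m \<in> Cells D" "Dom (D1 D) (run D m) = m \<odot> idp D (ptgt D m)"
    "Cod (D1 D) (run D m) = m" "csrc D (run D m) = ide (D0 D) (psrc D m)"
    "ctgt D (run D m) = ide (D0 D) (ptgt D m)" "is_iso (D1 D) (run D m)"
  using run_in[OF assms] assms by (auto simp: globular_def cell_def Hom_def)

lemma inverse_cell [simp]:
  assumes "is_iso (D1 D) c"
  shows "inverse_arr (D1 D) c \<in> Cells D" "Dom (D1 D) (inverse_arr (D1 D) c) = Cod (D1 D) c"
    "Cod (D1 D) (inverse_arr (D1 D) c) = Dom (D1 D) c"
  using D1.inverse_arr[OF assms] by auto

text \<open>Source is functorial, so the source arrow of the inverse composes with an identity arrow
  to an identity and is therefore that identity.\<close>

lemma inverse_globular [simp]: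
  assumes "is_iso (D1 D) c" "csrc D c = ide (D0 D) (psrc D (Dom (D1 D) c))"
  shows "csrc D (inverse_arr (D1 D) c) = csrc D c"
proof -
  note I = D1.inverse_arr[OF assms(1)]
  have c: "c \<in> Cells D" by (rule I)
  have "psrc D (Cod (D1 D) c) = psrc D (Dom (D1 D) c)"
    by (metis (no_types, lifting) D0.ide_closed(3) D1.Dom_in assms(2) c csrc_in(3) psrc_in)
  moreover have "csrc D c \<cdot>\<^bsub>D0 D\<^esub> csrc D (inverse_arr (D1 D) c) = csrc D (c \<bullet> inverse_arr (D1 D) c)"
    by (rule csrc_comp[symmetric]) (use I in auto)
  ultimately show ?thesis using I(1,2,3,4) c assms(2) by simp
qed

lemma inverse_globular' [simp]:
  assumes "is_iso (D1 D) c" "ctgt D c = ide (D0 D) (ptgt D (Dom (D1 D) c))"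
  shows "ctgt D (inverse_arr (D1 D) c) = ctgt D c"
proof -
  note I = D1.inverse_arr[OF assms(1)]
  have c: "c \<in> Cells D" by (rule I)
  have "ptgt D (Cod (D1 D) c) = ptgt D (Dom (D1 D) c)"
    by (metis (no_types, lifting) D0.ide_closed(3) D1.Dom_in assms(2) c ctgt_in(3) ptgt_in)
  moreover have "ctgt D c \<cdot>\<^bsub>D0 D\<^esub> ctgt D (inverse_arr (D1 D) c) = ctgt D (c \<bullet> inverse_arr (D1 D) c)"
    by (rule ctgt_comp[symmetric]) (use I in auto)
  ultimately show ?thesis using I(1,2,3,4) c assms(2) by simp
qed

lemma inverses_star:
  assumes "inverses (D1 D) c c'" "inverses (D1 D) d d'" "ctgt D c = csrc D d" "ctgt D c' = csrc D d'"
  shows "inverses (D1 D) (c \<star> d) (c' \<star> d')"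
proof -
  note A = assms[unfolded inverses_def Hom_def]
  show ?thesis unfolding inverses_def Hom_def
    using A composable_frames[of c d]
    by (simp add: interchange[symmetric] star_id)
qed

text \<open>The arrow shared by \<open>c\<close> and \<open>d\<close> is an identity, so both
  inverses have the same identity as their inner boundary and can be composed externally. This
  covers all canonical isomorphisms; \<open>iso_star\<close> later treats an arbitrary shared
  arrow.\<close>

lemma iso_star_globular:
  assumes "is_iso (D1 D) c" "is_iso (D1 D) d" "ctgt D c = csrc D d"
    "ctgt D c = ide (D0 D) (ptgt D (Dom (D1 D) c))"
  shows "is_iso (D1 D) (c \<star> d)"
    "inverse_arr (D1 D) (c \<star> d) = inverse_arr (D1 D) c \<star> inverse_arr (D1 D) d"
proof -
  have c: "c \<in> Cells D" "d \<in> Cells D" using assms D1.inverse_arr by blast+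
  have "csrc D d = ide (D0 D) (psrc D (Dom (D1 D) d))"
    using composable_frames[OF c assms(3)] assms by simp
  then have "inverses (D1 D) (c \<star> d) (inverse_arr (D1 D) c \<star> inverse_arr (D1 D) d)"
    using assms D1.inverses_inverse_arr by (intro inverses_star) auto
  then show "is_iso (D1 D) (c \<star> d)"
    "inverse_arr (D1 D) (c \<star> d) = inverse_arr (D1 D) c \<star> inverse_arr (D1 D) d"
    by (rule D1.inverses_is_iso, rule D1.inverse_arr_eqI)
qed

end

section \<open>Coherence for iterated composites\<close>

context double_category
begin

section \<open>Whiskering and the unit laws\<close>

lemma whisker_right:
  assumes "c \<in> Cells D" "d \<in> Cells D" "Cod (D1 D) c = Dom (D1 D) d" "n \<in> Pros D"
    "ctgt D c = ide (D0 D) (psrc D n)" "ctgt D d = ide (D0 D) (psrc D n)"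
  shows "(c \<bullet> d) \<star> idcell D n = (c \<star> idcell D n) \<bullet> (d \<star> idcell D n)"
  using assms interchange[of c d "idcell D n" "idcell D n"] by simp

lemma whisker_left:
  assumes "c \<in> Cells D" "d \<in> Cells D" "Cod (D1 D) c = Dom (D1 D) d" "n \<in> Pros D"
    "csrc D c = ide (D0 D) (ptgt D n)" "csrc D d = ide (D0 D) (ptgt D n)"
  shows "idcell D n \<star> (c \<bullet> d) = (idcell D n \<star> c) \<bullet> (idcell D n \<star> d)"
  using assms interchange[of "idcell D n" "idcell D n" c d] by simp

text \<open>Naturality of \<open>lun\<close> exhibits a cell as the conjugate of its whiskering by
  an identity proarrow. Equations may thus be proved after whiskering, which brings in the extra
  unit that the pentagon needs.\<close>

lemma whisker_left_faithful:
  assumes "c \<in> Cells D" "d \<in> Cells D" "Dom (D1 D) c = Dom (D1 D) d" "Cod (D1 D) c = Cod (D1 D) d"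
    "csrc D c = ide (D0 D) x" "csrc D d = ide (D0 D) x" "x \<in> Objs D"
    "idcell D (idp D x) \<star> c = idcell D (idp D x) \<star> d"
  shows "c = d"
proof (rule D1.iso_cancel_left)
  have "psrc D (Dom (D1 D) d) = x" using csrc_in(2)[of d] assms by simp
  then show "lun D (Dom (D1 D) d) \<bullet> c = lun D (Dom (D1 D) d) \<bullet> d"
    using lun_natural[of c] lun_natural[of d] assms by (simp add: idc_ide)
qed (use assms in simp_all)

lemma whisker_right_faithful:
  assumes "c \<in> Cells D" "d \<in> Cells D" "Dom (D1 D) c = Dom (D1 D) d" "Cod (D1 D) c = Cod (D1 D) d"
    "ctgt D c = ide (D0 D) x" "ctgt D d = ide (D0 D) x" "x \<in> Objs D"
    "c \<star> idcell D (idp D x) = d \<star> idcell D (idp D x)"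
  shows "c = d"
proof (rule D1.iso_cancel_left)
  have "ptgt D (Dom (D1 D) d) = x" using ctgt_in(2)[of d] assms by simp
  then show "run D (Dom (D1 D) d) \<bullet> c = run D (Dom (D1 D) d) \<bullet> d"
    using run_natural[of c] run_natural[of d] assms by (simp add: idc_ide)
qed (use assms in simp_all)

text \<open>The three unit laws of Kelly, which the pentagon and the triangle imply.\<close>

lemma lun_odot:
  assumes mn: "m \<in> Pros D" "n \<in> Pros D" "ptgt D m = psrc D n"
  shows "assoc D (idp D (psrc D m)) m n \<bullet> lun D (m \<odot> n) = lun D m \<star> idcell D n"
proof -
  define I where "I = idp D (psrc D m)"
  have I: "I \<in> Pros D" "psrc D I = psrc D m" "ptgt D I = psrc D m" "idp D (psrc D m) = I"
    using mn by (simp_all add: I_def)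
  \<comment> \<open>The first two factors of the three-fold side of the pentagon for
    \<open>I\<close>, \<open>I\<close>, \<open>m\<close>, \<open>n\<close>. Prefixed to the desired
    equation, whiskered by \<open>I\<close>, they complete that side, after which two triangles and
    naturality of the associator finish the comparison.\<close>
  define X where "X = (assoc D I I m \<star> idcell D n) \<bullet> assoc D I (I \<odot> m) n"
  have X: "is_iso (D1 D) X" unfolding X_def
    by (rule D1.iso_cmp, rule iso_star_globular) (use mn I in simp_all)
  have Xt: "X \<in> Cells D" "Dom (D1 D) X = I \<odot> I \<odot> m \<odot> n" "Cod (D1 D) X = I \<odot> (I \<odot> m \<odot> n)"
    using mn I by (simp_all add: X_def)
  have "X \<bullet> (idcell D I \<star> (assoc D I m n \<bullet> lun D (m \<odot> n))) =
      X \<bullet> (idcell D I \<star> assoc D I m n) \<bullet> (idcell D I \<star> lun D (m \<odot> n))"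
    using mn I Xt by (subst whisker_left) simp_all
  also have "X \<bullet> (idcell D I \<star> assoc D I m n) = assoc D (I \<odot> I) m n \<bullet> assoc D I I (m \<odot> n)"
    using mn I pentagon[of I I m n] by (simp add: X_def)
  also have "\<dots> \<bullet> (idcell D I \<star> lun D (m \<odot> n)) = assoc D (I \<odot> I) m n \<bullet> (run D I \<star> idcell D (m \<odot> n))"
    using triangle[of I "m \<odot> n"] mn I by simp
  also have "\<dots> = ((run D I \<star> idcell D m) \<star> idcell D n) \<bullet> assoc D I m n"
    using assoc_natural[of "run D I" "idcell D m" "idcell D n"] mn I
    by (simp add: star_id)
  also have "run D I \<star> idcell D m = assoc D I I m \<bullet> (idcell D I \<star> lun D m)"
    using triangle[of I m] mn I by simp
  also have "(\<dots> \<star> idcell D n) \<bullet> assoc D I m n =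
      (assoc D I I m \<star> idcell D n) \<bullet> (((idcell D I \<star> lun D m) \<star> idcell D n) \<bullet> assoc D I m n)"
    using mn I by (subst whisker_right) simp_all
  also have "((idcell D I \<star> lun D m) \<star> idcell D n) \<bullet> assoc D I m n =
      assoc D I (I \<odot> m) n \<bullet> (idcell D I \<star> (lun D m \<star> idcell D n))"
    using assoc_natural[of "idcell D I" "lun D m" "idcell D n"] mn I by simp
  also have "(assoc D I I m \<star> idcell D n) \<bullet> \<dots> = X \<bullet> (idcell D I \<star> (lun D m \<star> idcell D n))"
    using mn I by (simp add: X_def)
  finally have "idcell D I \<star> (assoc D I m n \<bullet> lun D (m \<odot> n)) = idcell D I \<star> (lun D m \<star> idcell D n)"
    by (rule D1.iso_cancel_left[OF X, rotated -1]) (use mn I Xt in simp_all)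
  then show ?thesis unfolding I_def
    by (rule whisker_left_faithful[rotated -1]) (use mn in simp_all)
qed

text \<open>Mirror image of the preceding law: the equation is whiskered by the unit on the right
  and followed by an associator, so that the pentagon for \<open>m\<close>, \<open>n\<close>,
  \<open>I\<close>, \<open>I\<close> and two triangles apply.\<close>

lemma run_odot:
  assumes mn: "m \<in> Pros D" "n \<in> Pros D" "ptgt D m = psrc D n"
  shows "assoc D m n (idp D (ptgt D n)) \<bullet> (idcell D m \<star> run D n) = run D (m \<odot> n)"
proof -
  define I where "I = idp D (ptgt D n)"
  have I: "I \<in> Pros D" "psrc D I = ptgt D n" "ptgt D I = ptgt D n" "idp D (ptgt D n) = I"
    using mn by (simp_all add: I_def)
  have "((assoc D m n I \<bullet> (idcell D m \<star> run D n)) \<star> idcell D I) \<bullet> assoc D m n I =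
      (assoc D m n I \<star> idcell D I) \<bullet> (((idcell D m \<star> run D n) \<star> idcell D I) \<bullet> assoc D m n I)"
    using mn I by (subst whisker_right) simp_all
  also have "((idcell D m \<star> run D n) \<star> idcell D I) \<bullet> assoc D m n I =
      assoc D m (n \<odot> I) I \<bullet> (idcell D m \<star> (run D n \<star> idcell D I))"
    using assoc_natural[of "idcell D m" "run D n" "idcell D I"] mn I by simp
  also have "run D n \<star> idcell D I = assoc D n I I \<bullet> (idcell D n \<star> lun D I)"
    using triangle[of n I] mn I by simp
  also have "idcell D m \<star> (assoc D n I I \<bullet> (idcell D n \<star> lun D I)) =
      (idcell D m \<star> assoc D n I I) \<bullet> (idcell D m \<star> (idcell D n \<star> lun D I))"
    using mn I by (subst whisker_left) simp_all
  also have "(assoc D m n I \<star> idcell D I) \<bullet> (assoc D m (n \<odot> I) I \<bullet> \<dots>) =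
     ((assoc D m n I \<star> idcell D I) \<bullet> assoc D m (n \<odot> I) I \<bullet> (idcell D m \<star> assoc D n I I)) \<bullet>
       (idcell D m \<star> (idcell D n \<star> lun D I))"
    using mn I by simp
  also have "\<dots> = assoc D (m \<odot> n) I I \<bullet> (assoc D m n (I \<odot> I) \<bullet> (idcell D m \<star> (idcell D n \<star> lun D I)))"
    using mn I by (subst pentagon[symmetric]) simp_all
  also have "assoc D m n (I \<odot> I) \<bullet> (idcell D m \<star> (idcell D n \<star> lun D I)) =
      (idcell D (m \<odot> n) \<star> lun D I) \<bullet> assoc D m n I"
    using assoc_natural[of "idcell D m" "idcell D n" "lun D I"] mn I by (simp add: star_id)
  also have "assoc D (m \<odot> n) I I \<bullet> \<dots> = (run D (m \<odot> n) \<star> idcell D I) \<bullet> assoc D m n I"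
    using triangle[of "m \<odot> n" I] mn I by (simp flip: D1.cmp_assoc)
  finally have "(assoc D m n I \<bullet> (idcell D m \<star> run D n)) \<star> idcell D I = run D (m \<odot> n) \<star> idcell D I"
    by (rule D1.iso_cancel_right[rotated -1]) (use mn I in simp_all)
  then show ?thesis unfolding I_def
    by (rule whisker_right_faithful[rotated -1]) (use mn I in simp_all)
qed

text \<open>Naturality of \<open>lun\<close> at the cell \<open>lun I\<close> itself identifies
  \<open>lun (I \<odot> I)\<close> with the whiskering of \<open>lun I\<close> by \<open>I\<close>
  on the left. Then \<open>lun_odot\<close> and the triangle compute the right whiskerings of
  \<open>lun I\<close> and \<open>run I\<close> to the same cell.\<close>

lemma lun_idp:
  assumes x: "x \<in> Objs D"
  shows "lun D (idp D x) = run D (idp D x)"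
proof -
  define I where "I = idp D x"
  have I: "I \<in> Pros D" "psrc D I = x" "ptgt D I = x" "idp D x = I"
    using x by (simp_all add: I_def)
  have "(idcell D I \<star> lun D I) \<bullet> lun D I = lun D (I \<odot> I) \<bullet> lun D I"
    using lun_natural[of "lun D I"] I x by (simp add: idc_ide)
  then have l: "idcell D I \<star> lun D I = lun D (I \<odot> I)"
    by (rule D1.iso_cancel_right[rotated -1]) (use I in simp_all)
  have "lun D I \<star> idcell D I = assoc D I I I \<bullet> lun D (I \<odot> I)"
    using lun_odot[of I I] I by simp
  also have "\<dots> = run D I \<star> idcell D I"
    using triangle[of I I] I l by simp
  finally have "lun D I = run D I"
    unfolding I_def by (rule whisker_right_faithful[rotated -1]) (use x in simp_all)
  then show ?thesis by (simp add: I_def)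
qed

section \<open>Paths of proarrows and the canonical isomorphisms between their composites\<close>

lemma ppath_simps [simp]:
  "ppath D x [] y \<longleftrightarrow> x \<in> Objs D \<and> x = y"
  "ppath D x (m # ms) y \<longleftrightarrow> m \<in> Pros D \<and> psrc D m = x \<and> ppath D (ptgt D m) ms y"
  by (auto simp: ppath_def)

lemma ppath_ends: "ppath D x ms y \<Longrightarrow> x \<in> Objs D \<and> y \<in> Objs D \<and> chain_end (ptgt D) x ms = y"
  by (induction ms arbitrary: x) (auto simp: chain_end_def)

lemma ppath_append: "ppath D x (ms @ ns) z \<longleftrightarrow> (\<exists>y. ppath D x ms y \<and> ppath D y ns z)"
  by (induction ms arbitrary: x) (auto dest: ppath_ends)

lemma odots_Cons: "ms \<noteq> [] \<Longrightarrow> odots D x (m # ms) = m \<odot> odots D (ptgt D m) ms"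
  by (cases ms) auto

lemma odots_closed:
  "ppath D x ms y \<Longrightarrow> odots D x ms \<in> Pros D \<and> psrc D (odots D x ms) = x \<and> ptgt D (odots D x ms) = y"
proof (induction ms arbitrary: x)
  case (Cons m ms)
  then show ?case by (cases ms) (auto simp: odots_Cons)
qed auto

lemma coh_Cons:
  assumes "ppath D x (m # ms) y" "ppath D y ns z" "ms \<noteq> []"
  shows "coh D x (m # ms) ns =
     assoc D m (odots D (ptgt D m) ms) (odots D y ns) \<bullet> (idcell D m \<star> coh D (ptgt D m) ms ns)"
  using assms ppath_ends[OF assms(1)] by (cases ms) auto

lemma coh_closed:
  assumes "ppath D x ms y" "ppath D y ns z"
  shows "coh D x ms ns \<in> Cells D \<and> Dom (D1 D) (coh D x ms ns) = odots D x ms \<odot> odots D y ns \<and>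
    Cod (D1 D) (coh D x ms ns) = odots D x (ms @ ns) \<and>
    csrc D (coh D x ms ns) = ide (D0 D) x \<and> ctgt D (coh D x ms ns) = ide (D0 D) z \<and>
    is_iso (D1 D) (coh D x ms ns)"
  using assms
proof (induction ms arbitrary: x)
  case Nil
  then show ?case using odots_closed[OF Nil(2)] by auto
next
  case (Cons m ms)
  note ns = odots_closed[OF Cons(3)] ppath_ends[OF Cons(3)]
  show ?case
  proof (cases "ms = []")
    case True
    then show ?thesis using Cons(2,3) ns by (cases ns) (auto simp: odots_Cons)
  next
    case False
    have ms: "ppath D (ptgt D m) ms y" "m \<in> Pros D" "psrc D m = x" using Cons(2) by auto
    note IH = Cons.IH[OF ms(1) Cons(3)]
    note oms = odots_closed[OF ms(1)]
    have "is_iso (D1 D) (idcell D m \<star> coh D (ptgt D m) ms ns)"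
      by (rule iso_star_globular) (use IH ms in simp_all)
    moreover have oz: "ptgt D (odots D (ptgt D m) (ms @ ns)) = z" "odots D (ptgt D m) (ms @ ns) \<in> Pros D"
      using odots_closed[of "ptgt D m" "ms @ ns" z] ms Cons(3) by (auto simp: ppath_append)
    ultimately show ?thesis
      using IH ms oms ns Cons(2,3) False D0.ide_cmp'[of "ide (D0 D) z"]
      by (auto simp: coh_Cons[OF Cons(2,3) False] odots_Cons intro!: D1.iso_cmp)
  qed
qed

text \<open>The recursion of \<open>coh\<close> reaches an empty second path only through its base
  cases. \<open>lun_idp\<close> turns the base case of two empty paths into a right unit, and
  \<open>run_odot\<close> carries the right unit through the recursive clause.\<close>

lemma coh_Nil_right:
  assumes "ppath D x ms y" shows "coh D x ms [] = run D (odots D x ms)"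
  using assms
proof (induction ms arbitrary: x)
  case Nil
  then show ?case using lun_idp by auto
next
  case (Cons m ms)
  show ?case
  proof (cases "ms = []")
    case False
    have ms: "ppath D (ptgt D m) ms y" "m \<in> Pros D" "psrc D m = x" using Cons(2) by auto
    have y: "ppath D y [] y" using ppath_ends[OF ms(1)] by simp
    show ?thesis using Cons.IH[OF ms(1)] ms odots_closed[OF ms(1)] run_odot[of m "odots D (ptgt D m) ms"]
      by (simp add: coh_Cons[OF Cons(2) y False] odots_Cons[OF False])
  qed simp
qed

text \<open>Composites are bracketed to the right, so putting one proarrow in front of a non-empty
  path needs no rebracketing. This is the source of every vanishing coherence cell below.\<close>

lemma coh_singleton:
  assumes "ns \<noteq> []" shows "coh D x [m] ns = idcell D (odots D x (m # ns))"
  using assms by (cases ns) auto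

text \<open>The cocycle identity of \<open>coh\<close>, from which strict associativity of the
  strictification follows. Induction on the first path: the empty path is \<open>lun_odot\<close>
  with naturality of \<open>lun\<close>; a single proarrow followed by an empty path is the
  triangle; the recursive case is the pentagon with naturality of the associator.\<close>

lemma coh_assoc:
  assumes "ppath D x as y" "ppath D y bs z" "ppath D z cs w"
  shows "(coh D x as bs \<star> idcell D (odots D z cs)) \<bullet> coh D x (as @ bs) cs =
    assoc D (odots D x as) (odots D y bs) (odots D z cs) \<bullet>
      (idcell D (odots D x as) \<star> coh D y bs cs) \<bullet> coh D x as (bs @ cs)"
  using assms
proof (induction as arbitrary: x)
  case Nil
  then have x: "x = y" "y \<in> Objs D" by auto
  note o = odots_closed[OF Nil(2)] odots_closed[OF Nil(3)] ppath_ends[OF Nil(2)] ppath_ends[OF Nil(3)]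
  have bc: "ppath D y (bs @ cs) w" using Nil by (auto simp: ppath_append)
  note c = coh_closed[OF Nil(2,3)]
  have "assoc D (idp D y) (odots D y bs) (odots D z cs) \<bullet> (idcell D (idp D y) \<star> coh D y bs cs) \<bullet> lun D (odots D y (bs @ cs))
     = assoc D (idp D y) (odots D y bs) (odots D z cs) \<bullet> (lun D (odots D y bs \<odot> odots D z cs) \<bullet> coh D y bs cs)"
    using lun_natural[of "coh D y bs cs"] c o odots_closed[OF bc] by (simp add: idc_ide)
  also have "\<dots> = (lun D (odots D y bs) \<star> idcell D (odots D z cs)) \<bullet> coh D y bs cs"
    using lun_odot[of "odots D y bs" "odots D z cs"] c o by (simp flip: D1.cmp_assoc)
  finally show ?case using x by simp
next
  case (Cons m as)
  have m: "ppath D (ptgt D m) as y" "m \<in> Pros D" "psrc D m = x" using Cons(2) by auto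
  note o = odots_closed[OF Cons(3)] odots_closed[OF Cons(4)] odots_closed[OF m(1)]
    ppath_ends[OF Cons(3)] ppath_ends[OF Cons(4)]
  note cbc = coh_closed[OF Cons(3,4)]
  have bc: "ppath D y (bs @ cs) w" using Cons by (auto simp: ppath_append)
  show ?case
  proof (cases "as = []")
    case True
    then have y: "ptgt D m = y" using Cons(2) by simp
    show ?thesis
    proof (cases "bs = []")
      case True
      then have z: "z = y" using Cons(3) by auto
      show ?thesis using triangle[of m "odots D z cs"] m o y z cbc \<open>as = []\<close> True coh_closed[OF Cons(2) Cons(4)[unfolded z]]
        by (simp add: flip: D1.cmp_assoc)
    next
      case False
      have "coh D x (m # bs) cs = assoc D m (odots D y bs) (odots D z cs) \<bullet> (idcell D m \<star> coh D y bs cs)"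
        using coh_Cons[of x m bs z cs w] Cons(2,3,4) False m y by simp
      then show ?thesis using True False m o y cbc odots_closed[OF bc]
        by (simp add: coh_singleton odots_Cons star_id)
    qed
  next
    case False
    \<comment> \<open>Capital letters are composites of paths; \<open>h1\<close> to
      \<open>h4\<close> are the four coherence cells of the tail \<open>as\<close>. The induction
      hypothesis is whiskered by \<open>m\<close>, and the pentagon for \<open>m\<close>,
      \<open>A\<close>, \<open>B\<close>, \<open>C\<close> collects the associators that
      \<open>coh_Cons\<close> introduces.\<close>
    define A B C where "A = odots D (ptgt D m) as" and "B = odots D y bs" and "C = odots D z cs"
    define AB BC where "AB = odots D (ptgt D m) (as @ bs)" and "BC = odots D y (bs @ cs)"
    define h1 h2 h3 h4 where "h1 = coh D (ptgt D m) as bs" and "h2 = coh D (ptgt D m) (as @ bs) cs"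
      and "h3 = coh D y bs cs" and "h4 = coh D (ptgt D m) as (bs @ cs)"
    have ab: "ppath D (ptgt D m) (as @ bs) z" using m(1) Cons(3) by (auto simp: ppath_append)
    have mab: "ppath D x (m # (as @ bs)) z" using ab m by simp
    note T = coh_closed[OF m(1) Cons(3), folded A_def B_def AB_def h1_def]
      coh_closed[OF ab Cons(4), folded AB_def C_def h2_def]
      cbc[folded B_def C_def BC_def h3_def]
      coh_closed[OF m(1) bc, folded A_def BC_def h4_def]
      o[folded A_def B_def C_def] odots_closed[OF ab, folded AB_def] odots_closed[OF bc, folded BC_def] m(2,3)
    have IH: "(h1 \<star> idcell D C) \<bullet> h2 = assoc D A B C \<bullet> (idcell D A \<star> h3) \<bullet> h4"
      using Cons.IH[OF m(1) Cons(3,4)] by (simp add: A_def B_def C_def h1_def h2_def h3_def h4_def)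
    have e: "coh D x (m # as) bs = assoc D m A B \<bullet> (idcell D m \<star> h1)"
      "coh D x (m # as @ bs) cs = assoc D m AB C \<bullet> (idcell D m \<star> h2)"
      "coh D x (m # as) (bs @ cs) = assoc D m A BC \<bullet> (idcell D m \<star> h4)"
      "odots D x (m # as) = m \<odot> A"
      using coh_Cons[OF Cons(2) Cons(3) False] coh_Cons[OF Cons(2) bc False] coh_Cons[OF mab Cons(4)] False
      by (simp_all add: A_def B_def C_def AB_def BC_def h1_def h2_def h4_def odots_Cons)
    have "(coh D x (m # as) bs \<star> idcell D C) \<bullet> coh D x (m # as @ bs) cs =
        (assoc D m A B \<star> idcell D C) \<bullet> (((idcell D m \<star> h1) \<star> idcell D C) \<bullet> assoc D m AB C) \<bullet> (idcell D m \<star> h2)"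
      unfolding e by (subst whisker_right) (use T in simp_all)
    also have "((idcell D m \<star> h1) \<star> idcell D C) \<bullet> assoc D m AB C =
        assoc D m (A \<odot> B) C \<bullet> (idcell D m \<star> (h1 \<star> idcell D C))"
      using assoc_natural[of "idcell D m" h1 "idcell D C"] T by simp
    also have "(assoc D m A B \<star> idcell D C) \<bullet> \<dots> \<bullet> (idcell D m \<star> h2) =
        (assoc D m A B \<star> idcell D C) \<bullet> assoc D m (A \<odot> B) C \<bullet> (idcell D m \<star> ((h1 \<star> idcell D C) \<bullet> h2))"
      by (subst whisker_left) (use T in simp_all)
    also have "idcell D m \<star> ((h1 \<star> idcell D C) \<bullet> h2) =
        (idcell D m \<star> assoc D A B C) \<bullet> (idcell D m \<star> ((idcell D A \<star> h3) \<bullet> h4))"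
      unfolding IH using T by (subst whisker_left[symmetric]) simp_all
    also have "\<dots> = (idcell D m \<star> assoc D A B C) \<bullet> (idcell D m \<star> (idcell D A \<star> h3)) \<bullet> (idcell D m \<star> h4)"
      using T by (subst whisker_left) simp_all
    also have "(assoc D m A B \<star> idcell D C) \<bullet> assoc D m (A \<odot> B) C \<bullet> \<dots> =
        ((assoc D m A B \<star> idcell D C) \<bullet> assoc D m (A \<odot> B) C \<bullet> (idcell D m \<star> assoc D A B C)) \<bullet>
        ((idcell D m \<star> (idcell D A \<star> h3)) \<bullet> (idcell D m \<star> h4))"
      using T by simp
    also have "\<dots> = assoc D (m \<odot> A) B C \<bullet> (assoc D m A (B \<odot> C) \<bullet> (idcell D m \<star> (idcell D A \<star> h3))) \<bullet> (idcell D m \<star> h4)"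
      using T by (subst pentagon[symmetric]) simp_all
    also have "assoc D m A (B \<odot> C) \<bullet> (idcell D m \<star> (idcell D A \<star> h3)) = (idcell D (m \<odot> A) \<star> h3) \<bullet> assoc D m A BC"
      using assoc_natural[of "idcell D m" "idcell D A" h3] T by (simp add: star_id)
    finally show ?thesis using T
      by (simp add: e flip: A_def B_def C_def AB_def BC_def h1_def h2_def h3_def h4_def)
  qed
qed

end

section \<open>Strictification\<close>

text \<open>Strictness is stated as equations between composites, usable directly for rewriting. The
  locale has two instances: \<open>VerDbl A\<close>, and the strictification of
  \<open>E\<close>.\<close>

locale strict_double_category = double_category S
  for S :: "('o, 'a, 'p, 'c, 'z) dbl_scheme" (structure) +
  assumes odot_assoc: "m \<in> Pros S \<Longrightarrow> n \<in> Pros S \<Longrightarrow> p \<in> Pros S \<Longrightarrow> ptgt S m = psrc S n \<Longrightarrow> ptgt S n = psrc S p \<Longrightarrow>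
      (m \<odot> n) \<odot> p = m \<odot> (n \<odot> p)"
    and idp_odot: "m \<in> Pros S \<Longrightarrow> idp S (psrc S m) \<odot> m = m"
    and odot_idp: "m \<in> Pros S \<Longrightarrow> m \<odot> idp S (ptgt S m) = m"
    and star_assoc: "c \<in> Cells S \<Longrightarrow> d \<in> Cells S \<Longrightarrow> e \<in> Cells S \<Longrightarrow> ctgt S c = csrc S d \<Longrightarrow> ctgt S d = csrc S e \<Longrightarrow>
      (c \<star> d) \<star> e = c \<star> (d \<star> e)"
    and idc_star: "c \<in> Cells S \<Longrightarrow> idc S (csrc S c) \<star> c = c"
    and star_idc: "c \<in> Cells S \<Longrightarrow> c \<star> idc S (ctgt S c) = c"

abbreviation path_tgt :: "('o, 'a, 'p, 'c, 'z) dbl_scheme \<Rightarrow> 'o \<times> 'p list \<Rightarrow> 'o" where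
  "path_tgt D p \<equiv> chain_end (ptgt D) (fst p) (snd p)"

abbreviation path_odot :: "('o, 'a, 'p, 'c, 'z) dbl_scheme \<Rightarrow> 'o \<times> 'p list \<Rightarrow> 'p" where
  "path_odot D p \<equiv> odots D (fst p) (snd p)"

abbreviation path_coh :: "('o, 'a, 'p, 'c, 'z) dbl_scheme \<Rightarrow> 'o \<times> 'p list \<Rightarrow> 'o \<times> 'p list \<Rightarrow> 'c" where
  "path_coh D p q \<equiv> coh D (fst p) (snd p) (snd q)"

definition paths :: "('o, 'a, 'p, 'c, 'z) dbl_scheme \<Rightarrow> ('o \<times> 'p list) set" where
  "paths D = {p. ppath D (fst p) (snd p) (path_tgt D p)}"

text \<open>A proarrow is a path together with its starting object, so that the empty path at each
  object is a proarrow. A cell is a triple of domain path, codomain path and underlying cell; the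
  paths are recorded because different paths may have the same composite. External composition
  concatenates paths and conjugates the composite in \<open>D\<close> by \<open>coh\<close>.\<close>

definition strictify :: "('o, 'a, 'p, 'c, 'z) dbl_scheme \<Rightarrow>
    ('o, 'a, 'o \<times> 'p list, ('o \<times> 'p list) \<times> ('o \<times> 'p list) \<times> 'c) dbl" where
  "strictify D = \<lparr> D0 = \<lparr> Ob = Objs D, Arr = Arrs D, Dom = Dom (D0 D), Cod = Cod (D0 D),
        ide = ide (D0 D), cmp = cmp (D0 D) \<rparr>,
     D1 = \<lparr> Ob = paths D, Arr = {(p, q, c). p \<in> paths D \<and> q \<in> paths D \<and> c \<in> Hom (D1 D) (path_odot D p) (path_odot D q)},
            Dom = fst, Cod = fst \<circ> snd, ide = (\<lambda>p. (p, p, idcell D (path_odot D p))),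
            cmp = (\<lambda>c d. (fst c, fst (snd d), snd (snd c) \<bullet>\<^bsub>D\<^esub> snd (snd d))) \<rparr>,
     psrc = fst, ptgt = path_tgt D, csrc = (\<lambda>c. csrc D (snd (snd c))), ctgt = (\<lambda>c. ctgt D (snd (snd c))),
     idp = (\<lambda>x. (x, [])), idc = (\<lambda>f. ((Dom (D0 D) f, []), (Cod (D0 D) f, []), idc D f)),
     odot = (\<lambda>p q. (fst p, snd p @ snd q)),
     star = (\<lambda>c d. ((fst (fst c), snd (fst c) @ snd (fst d)),
       (fst (fst (snd c)), snd (fst (snd c)) @ snd (fst (snd d))),
       inverse_arr (D1 D) (path_coh D (fst c) (fst d)) \<bullet>\<^bsub>D\<^esub> (snd (snd c) \<star>\<^bsub>D\<^esub> snd (snd d)) \<bullet>\<^bsub>D\<^esub>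
         path_coh D (fst (snd c)) (fst (snd d)))),
     assoc = (\<lambda>p q r. let s = (fst p, snd p @ snd q @ snd r) in (s, s, idcell D (path_odot D s))),
     lun = (\<lambda>p. (p, p, idcell D (path_odot D p))), run = (\<lambda>p. (p, p, idcell D (path_odot D p))) \<rparr>"

context double_category
begin

lemma strictify_simps:
  "Objs (strictify D) = Objs D" "Arrs (strictify D) = Arrs D" "Dom (D0 (strictify D)) = Dom (D0 D)"
  "Cod (D0 (strictify D)) = Cod (D0 D)" "ide (D0 (strictify D)) = ide (D0 D)" "cmp (D0 (strictify D)) = cmp (D0 D)"
  "Pros (strictify D) = paths D"
  "Dom (D1 (strictify D)) = fst" "Cod (D1 (strictify D)) = fst \<circ> snd"
  "idcell (strictify D) = (\<lambda>p. (p, p, idcell D (path_odot D p)))"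
  "ccomp (strictify D) = (\<lambda>c d. (fst c, fst (snd d), snd (snd c) \<bullet> snd (snd d)))"
  "psrc (strictify D) = fst" "ptgt (strictify D) = path_tgt D"
  "csrc (strictify D) = (\<lambda>c. csrc D (snd (snd c)))" "ctgt (strictify D) = (\<lambda>c. ctgt D (snd (snd c)))"
  "idp (strictify D) = (\<lambda>x. (x, []))"
  "idc (strictify D) = (\<lambda>f. ((Dom (D0 D) f, []), (Cod (D0 D) f, []), idc D f))"
  "odot (strictify D) = (\<lambda>p q. (fst p, snd p @ snd q))"
  "star (strictify D) = (\<lambda>c d. ((fst (fst c), snd (fst c) @ snd (fst d)),
       (fst (fst (snd c)), snd (fst (snd c)) @ snd (fst (snd d))),
       inverse_arr (D1 D) (path_coh D (fst c) (fst d)) \<bullet> (snd (snd c) \<star> snd (snd d)) \<bullet>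
         path_coh D (fst (snd c)) (fst (snd d))))"
  "assoc (strictify D) = (\<lambda>p q r. let s = (fst p, snd p @ snd q @ snd r) in (s, s, idcell D (path_odot D s)))"
  "lun (strictify D) = (\<lambda>p. (p, p, idcell D (path_odot D p)))"
  "run (strictify D) = (\<lambda>p. (p, p, idcell D (path_odot D p)))"
  by (simp_all add: strictify_def)

lemma strictify_cells: "c \<in> Cells (strictify D) \<longleftrightarrow>
    fst c \<in> paths D \<and> fst (snd c) \<in> paths D \<and> snd (snd c) \<in> Cells D \<and>
    Dom (D1 D) (snd (snd c)) = path_odot D (fst c) \<and> Cod (D1 D) (snd (snd c)) = path_odot D (fst (snd c))"
  by (auto simp: strictify_def Hom_def)

lemma paths_ppath: "ppath D x ms y \<Longrightarrow> (x, ms) \<in> paths D \<and> path_tgt D (x, ms) = y"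
  using ppath_ends[of x ms y] by (simp add: paths_def)

lemma paths_Nil [simp]: "(x, []) \<in> paths D \<longleftrightarrow> x \<in> Objs D"
  by (auto simp: paths_def chain_end_def)

lemma path_tgt_Nil [simp]: "chain_end (ptgt D) x [] = x"
  by (simp add: chain_end_def)

lemma path_odot_closed [simp]:
  assumes "p \<in> paths D"
  shows "path_odot D p \<in> Pros D" "psrc D (path_odot D p) = fst p" "ptgt D (path_odot D p) = path_tgt D p"
    "fst p \<in> Objs D" "path_tgt D p \<in> Objs D"
proof -
  have "ppath D (fst p) (snd p) (path_tgt D p)" using assms by (simp add: paths_def)
  from odots_closed[OF this] ppath_ends[OF this]
  show "path_odot D p \<in> Pros D" "psrc D (path_odot D p) = fst p" "ptgt D (path_odot D p) = path_tgt D p"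
    "fst p \<in> Objs D" "path_tgt D p \<in> Objs D" by simp_all
qed

lemma paths_append [simp]:
  assumes "p \<in> paths D" "q \<in> paths D" "path_tgt D p = fst q"
  shows "(fst p, snd p @ snd q) \<in> paths D" "chain_end (ptgt D) (fst p) (snd p @ snd q) = path_tgt D q"
proof -
  have "ppath D (fst p) (snd p @ snd q) (path_tgt D q)"
    using assms by (auto simp: ppath_append paths_def)
  from paths_ppath[OF this]
  show "(fst p, snd p @ snd q) \<in> paths D" "chain_end (ptgt D) (fst p) (snd p @ snd q) = path_tgt D q"
    by simp_all
qed

lemma path_coh_closed [simp]:
  assumes "p \<in> paths D" "q \<in> paths D" "path_tgt D p = fst q"
  shows "path_coh D p q \<in> Cells D" "Dom (D1 D) (path_coh D p q) = path_odot D p \<odot> path_odot D q"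
    "Cod (D1 D) (path_coh D p q) = odots D (fst p) (snd p @ snd q)"
    "csrc D (path_coh D p q) = ide (D0 D) (fst p)" "ctgt D (path_coh D p q) = ide (D0 D) (path_tgt D q)"
    "is_iso (D1 D) (path_coh D p q)"
  using coh_closed[of "fst p" "snd p" "path_tgt D p" "snd q" "path_tgt D q"] assms
  by (simp_all add: paths_def)

lemma path_coh_assoc:
  assumes "p \<in> paths D" "q \<in> paths D" "r \<in> paths D" "path_tgt D p = fst q" "path_tgt D q = fst r"
  shows "(path_coh D p q \<star> idcell D (path_odot D r)) \<bullet> coh D (fst p) (snd p @ snd q) (snd r) =
    assoc D (path_odot D p) (path_odot D q) (path_odot D r) \<bullet>
      (idcell D (path_odot D p) \<star> path_coh D q r) \<bullet> coh D (fst p) (snd p) (snd q @ snd r)"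
  using coh_assoc[of "fst p" "snd p" "path_tgt D p" "snd q" "path_tgt D q" "snd r" "path_tgt D r"] assms
  by (simp add: paths_def)

text \<open>Both bracketings are conjugates of iterated composites in \<open>D\<close>. The cocycle
  identity at the domain paths and at the codomain paths, joined by naturality of the associator,
  makes them agree after an isomorphism has been prefixed, and that isomorphism cancels.\<close>

lemma strictify_star_assoc:
  assumes p: "p \<in> paths D" "p' \<in> paths D" and q: "q \<in> paths D" "q' \<in> paths D" and r: "r \<in> paths D" "r' \<in> paths D"
    and t: "path_tgt D p = fst q" "path_tgt D q = fst r" "path_tgt D p' = fst q'" "path_tgt D q' = fst r'"
    and c: "c \<in> Cells D" "Dom (D1 D) c = path_odot D p" "Cod (D1 D) c = path_odot D p'"
    and d: "d \<in> Cells D" "Dom (D1 D) d = path_odot D q" "Cod (D1 D) d = path_odot D q'" "ctgt D c = csrc D d"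
    and e: "e \<in> Cells D" "Dom (D1 D) e = path_odot D r" "Cod (D1 D) e = path_odot D r'" "ctgt D d = csrc D e"
  defines "i \<equiv> inverse_arr (D1 D)"
  shows "i (coh D (fst p) (snd p @ snd q) (snd r)) \<bullet>
      ((i (path_coh D p q) \<bullet> (c \<star> d) \<bullet> path_coh D p' q') \<star> e) \<bullet> coh D (fst p') (snd p' @ snd q') (snd r') =
    i (coh D (fst p) (snd p) (snd q @ snd r)) \<bullet>
      (c \<star> (i (path_coh D q r) \<bullet> (d \<star> e) \<bullet> path_coh D q' r')) \<bullet> coh D (fst p') (snd p') (snd q' @ snd r')"
proof -
  define P P' Q Q' R R' where "P = path_odot D p" "P' = path_odot D p'" "Q = path_odot D q"
    "Q' = path_odot D q'" "R = path_odot D r" "R' = path_odot D r'"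
  note P_defs = this
  define a a' b b' where "a = path_coh D p q" "a' = path_coh D p' q'" "b = path_coh D q r" "b' = path_coh D q' r'"
  note a_defs = this
  define k k' l l' where "k = coh D (fst p) (snd p @ snd q) (snd r)" "k' = coh D (fst p') (snd p' @ snd q') (snd r')"
    "l = coh D (fst p) (snd p) (snd q @ snd r)" "l' = coh D (fst p') (snd p') (snd q' @ snd r')"
  note k_defs = this
  define PQ PQ' QR QR' X X' where "PQ = odots D (fst p) (snd p @ snd q)" "PQ' = odots D (fst p') (snd p' @ snd q')"
    "QR = odots D (fst q) (snd q @ snd r)" "QR' = odots D (fst q') (snd q' @ snd r')"
    "X = odots D (fst p) (snd p @ snd q @ snd r)" "X' = odots D (fst p') (snd p' @ snd q' @ snd r')"
  note X_defs = this
  have pr: "P \<in> Pros D" "P' \<in> Pros D" "Q \<in> Pros D" "Q' \<in> Pros D" "R \<in> Pros D" "R' \<in> Pros D"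
    "PQ \<in> Pros D" "PQ' \<in> Pros D" "QR \<in> Pros D" "QR' \<in> Pros D"
    "psrc D P = fst p" "psrc D P' = fst p'" "psrc D Q = fst q" "psrc D Q' = fst q'" "psrc D R = fst r" "psrc D R' = fst r'"
    "ptgt D P = fst q" "ptgt D P' = fst q'" "ptgt D Q = fst r" "ptgt D Q' = fst r'"
    "ptgt D R = path_tgt D r" "ptgt D R' = path_tgt D r'"
    "psrc D PQ = fst p" "psrc D PQ' = fst p'" "ptgt D PQ = fst r" "ptgt D PQ' = fst r'"
    "psrc D QR = fst q" "psrc D QR' = fst q'" "ptgt D QR = path_tgt D r" "ptgt D QR' = path_tgt D r'"
    using p q r t path_odot_closed[OF paths_append(1)[of p q]] path_odot_closed[OF paths_append(1)[of p' q']]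
      path_odot_closed[OF paths_append(1)[of q r]] path_odot_closed[OF paths_append(1)[of q' r']]
    by (simp_all add: P_defs X_defs)
  have ob: "fst p \<in> Objs D" "fst q \<in> Objs D" "fst r \<in> Objs D" "path_tgt D r \<in> Objs D"
    "fst p' \<in> Objs D" "fst q' \<in> Objs D" "fst r' \<in> Objs D" "path_tgt D r' \<in> Objs D"
    using p q r by simp_all
  have at: "a \<in> Cells D" "a' \<in> Cells D" "b \<in> Cells D" "b' \<in> Cells D"
    "is_iso (D1 D) a" "is_iso (D1 D) a'" "is_iso (D1 D) b" "is_iso (D1 D) b'"
    "Dom (D1 D) a = P \<odot> Q" "Dom (D1 D) a' = P' \<odot> Q'" "Dom (D1 D) b = Q \<odot> R" "Dom (D1 D) b' = Q' \<odot> R'"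
    "Cod (D1 D) a = PQ" "Cod (D1 D) a' = PQ'" "Cod (D1 D) b = QR" "Cod (D1 D) b' = QR'"
    "csrc D a = ide (D0 D) (fst p)" "csrc D a' = ide (D0 D) (fst p')" "csrc D b = ide (D0 D) (fst q)" "csrc D b' = ide (D0 D) (fst q')"
    "ctgt D a = ide (D0 D) (fst r)" "ctgt D a' = ide (D0 D) (fst r')"
    "ctgt D b = ide (D0 D) (path_tgt D r)" "ctgt D b' = ide (D0 D) (path_tgt D r')"
    using p q r t by (simp_all add: P_defs X_defs a_defs)
  have kt: "k \<in> Cells D" "k' \<in> Cells D" "l \<in> Cells D" "l' \<in> Cells D"
    "is_iso (D1 D) k" "is_iso (D1 D) k'" "is_iso (D1 D) l" "is_iso (D1 D) l'"
    "Dom (D1 D) k = PQ \<odot> R" "Dom (D1 D) k' = PQ' \<odot> R'" "Dom (D1 D) l = P \<odot> QR" "Dom (D1 D) l' = P' \<odot> QR'"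
    "Cod (D1 D) k = X" "Cod (D1 D) k' = X'" "Cod (D1 D) l = X" "Cod (D1 D) l' = X'"
    "csrc D k = ide (D0 D) (fst p)" "csrc D k' = ide (D0 D) (fst p')" "csrc D l = ide (D0 D) (fst p)" "csrc D l' = ide (D0 D) (fst p')"
    "ctgt D k = ide (D0 D) (path_tgt D r)" "ctgt D k' = ide (D0 D) (path_tgt D r')"
    "ctgt D l = ide (D0 D) (path_tgt D r)" "ctgt D l' = ide (D0 D) (path_tgt D r')"
    using p q r t path_coh_closed[of "(fst p, snd p @ snd q)" r] path_coh_closed[of "(fst p', snd p' @ snd q')" r']
     path_coh_closed[of p "(fst q, snd q @ snd r)"] path_coh_closed[of p' "(fst q', snd q' @ snd r')"]
    by (simp_all add: P_defs X_defs k_defs)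
  note c' = c[folded P_defs] and d' = d[folded P_defs] and e' = e[folded P_defs]
  note T = pr at kt c' d' e' ob
  have A: "(a \<star> idcell D R) \<bullet> k = assoc D P Q R \<bullet> (idcell D P \<star> b) \<bullet> l"
    "(a' \<star> idcell D R') \<bullet> k' = assoc D P' Q' R' \<bullet> (idcell D P' \<star> b') \<bullet> l'"
    using path_coh_assoc[of p q r] path_coh_assoc[of p' q' r'] p q r t
    by (simp_all add: P_defs k_defs a_defs)
  define Y Z where "Y = i a \<bullet> (c \<star> d) \<bullet> a'" and "Z = i b \<bullet> (d \<star> e) \<bullet> b'"
  define L M where "L = i k \<bullet> (Y \<star> e) \<bullet> k'" and "M = i l \<bullet> (c \<star> Z) \<bullet> l'"
  have it: "i a \<in> Cells D" "Dom (D1 D) (i a) = PQ" "Cod (D1 D) (i a) = P \<odot> Q" "csrc D (i a) = ide (D0 D) (fst p)" "ctgt D (i a) = ide (D0 D) (fst r)"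
    "i b \<in> Cells D" "Dom (D1 D) (i b) = QR" "Cod (D1 D) (i b) = Q \<odot> R" "csrc D (i b) = ide (D0 D) (fst q)" "ctgt D (i b) = ide (D0 D) (path_tgt D r)"
    "i k \<in> Cells D" "Dom (D1 D) (i k) = X" "Cod (D1 D) (i k) = PQ \<odot> R"
    "i l \<in> Cells D" "Dom (D1 D) (i l) = X" "Cod (D1 D) (i l) = P \<odot> QR"
    by (simp_all add: T i_def)
  have ce: "csrc D d \<in> Arrs D" "csrc D e \<in> Arrs D"  "Dom (D0 D) (csrc D d) = fst q" "Dom (D0 D) (csrc D e) = fst r"
     "Cod (D0 D) (csrc D d) = fst q'" "Cod (D0 D) (csrc D e) = fst r'"
    by (simp_all add: T)
  have Yt: "Y \<in> Cells D" "Dom (D1 D) Y = PQ" "Cod (D1 D) Y = PQ'" "csrc D Y = csrc D c" "ctgt D Y = csrc D e"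
    by (simp_all add: T it ce Y_def)
  have Zt: "Z \<in> Cells D" "Dom (D1 D) Z = QR" "Cod (D1 D) Z = QR'" "csrc D Z = csrc D d" "ctgt D Z = ctgt D e"
    by (simp_all add: T it ce Z_def)
  have s: "a \<bullet> Y = (c \<star> d) \<bullet> a'"
    unfolding i_def Y_def by (simp add: T it D1.cmp_inverse_cancel)
  have s': "b \<bullet> Z = (d \<star> e) \<bullet> b'"
    unfolding i_def Z_def by (simp add: T it D1.cmp_inverse_cancel)
  have kL: "k \<bullet> L = (Y \<star> e) \<bullet> k'"
    unfolding L_def i_def by (simp add: T Yt D1.cmp_inverse_cancel)
  have lM: "l \<bullet> M = (c \<star> Z) \<bullet> l'"
    unfolding M_def i_def by (simp add: T Zt D1.cmp_inverse_cancel)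
  have Lt: "L \<in> Cells D" "Dom (D1 D) L = X" "M \<in> Cells D" "Dom (D1 D) M = X"
    unfolding L_def M_def by (simp_all add: T Yt Zt it)
  have "((a \<star> idcell D R) \<bullet> k) \<bullet> L = ((a \<star> idcell D R) \<bullet> (Y \<star> e)) \<bullet> k'"
    by (simp add: T Yt Lt kL)
  also have "(a \<star> idcell D R) \<bullet> (Y \<star> e) = (a \<bullet> Y) \<star> (idcell D R \<bullet> e)"
    by (rule interchange[symmetric]) (simp_all add: T Yt)
  also have "\<dots> = ((c \<star> d) \<bullet> a') \<star> (e \<bullet> idcell D R')"
    by (simp add: T s)
  also have "\<dots> = ((c \<star> d) \<star> e) \<bullet> (a' \<star> idcell D R')"
    by (rule interchange) (simp_all add: T)
  also have "\<dots> \<bullet> k' = ((c \<star> d) \<star> e) \<bullet> ((a' \<star> idcell D R') \<bullet> k')"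
    by (simp add: T)
  also have "\<dots> = (((c \<star> d) \<star> e) \<bullet> assoc D P' Q' R') \<bullet> ((idcell D P' \<star> b') \<bullet> l')"
    unfolding A by (simp add: T)
  also have "((c \<star> d) \<star> e) \<bullet> assoc D P' Q' R' = assoc D P Q R \<bullet> (c \<star> (d \<star> e))"
    using assoc_natural[of c d e] by (simp add: T)
  also have "\<dots> \<bullet> ((idcell D P' \<star> b') \<bullet> l') = assoc D P Q R \<bullet> (((c \<star> (d \<star> e)) \<bullet> (idcell D P' \<star> b')) \<bullet> l')"
    by (simp add: T)
  also have "(c \<star> (d \<star> e)) \<bullet> (idcell D P' \<star> b') = (c \<bullet> idcell D P') \<star> ((d \<star> e) \<bullet> b')"
    by (rule interchange[symmetric]) (simp_all add: T)
  also have "\<dots> = (idcell D P \<bullet> c) \<star> (b \<bullet> Z)"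
    by (simp add: T s')
  also have "\<dots> = (idcell D P \<star> b) \<bullet> (c \<star> Z)"
    by (rule interchange) (simp_all add: T Zt)
  also have "assoc D P Q R \<bullet> (\<dots> \<bullet> l') = (assoc D P Q R \<bullet> (idcell D P \<star> b) \<bullet> l) \<bullet> M"
    by (simp add: T Zt Lt lM)
  also have "\<dots> = ((a \<star> idcell D R) \<bullet> k) \<bullet> M" by (simp add: A)
  finally have "((a \<star> idcell D R) \<bullet> k) \<bullet> L = ((a \<star> idcell D R) \<bullet> k) \<bullet> M" .
  then have "L = M"
  proof (rule D1.iso_cancel_left[rotated -1])
    show "is_iso (D1 D) ((a \<star> idcell D R) \<bullet> k)"
      by (rule D1.iso_cmp, rule iso_star_globular) (simp_all add: T)
  qed (simp_all add: T Lt)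
  then show ?thesis unfolding L_def M_def Y_def Z_def a_defs k_defs .
qed

lemma path_coh_Nil: "p \<in> paths D \<Longrightarrow> coh D (fst p) (snd p) [] = run D (path_odot D p)"
  by (rule coh_Nil_right) (simp add: paths_def)

text \<open>Composing with the external identity on an empty path conjugates by \<open>lun\<close>
  or \<open>run\<close>, which naturality of the unit isomorphisms undoes; associativity is
  \<open>strictify_star_assoc\<close>. The chosen coherence cells are identities, so the pentagon
  and the triangle become equations between identities.\<close>

lemma strictify_strict: "strict_double_category (strictify D)"
proof -
  note [simp] = strictify_simps
  let ?S = "strictify D"
  have fr: "path_tgt D (fst c) = fst (fst d)" "path_tgt D (fst (snd c)) = fst (fst (snd d))"
    if "c \<in> Cells ?S" "d \<in> Cells ?S" "ctgt ?S c = csrc ?S d" for c d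
    using composable_frames[of "snd (snd c)" "snd (snd d)"] that by (simp_all add: strictify_cells)
  have cs: "Dom (D0 D) (csrc D (snd (snd c))) = fst (fst c)" "Cod (D0 D) (csrc D (snd (snd c))) = fst (fst (snd c))"
     "Dom (D0 D) (ctgt D (snd (snd c))) = path_tgt D (fst c)" "Cod (D0 D) (ctgt D (snd (snd c))) = path_tgt D (fst (snd c))"
    if "c \<in> Cells ?S" for c
    using that by (simp_all add: strictify_cells)
  have st: "star ?S c d \<in> cell ?S (odot ?S (fst c) (fst d)) (odot ?S (fst (snd c)) (fst (snd d))) (csrc ?S c) (ctgt ?S d)"
    if h: "c \<in> Cells ?S" "d \<in> Cells ?S" "ctgt ?S c = csrc ?S d" for c d
    using h fr[OF h] cs[OF h(1)] cs[OF h(2)]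
    by (simp add: cell_def Hom_def strictify_cells)
  have idl: "star ?S (idc ?S (csrc ?S c)) c = c" if h: "c \<in> Cells ?S" for c
  proof -
    have "inverse_arr (D1 D) (lun D (path_odot D (fst c))) \<bullet> (idc D (csrc D (snd (snd c))) \<star> snd (snd c)) \<bullet>
        lun D (path_odot D (fst (snd c))) = snd (snd c)"
      using h lun_natural[of "snd (snd c)"] by (simp add: strictify_cells D1.inverse_cmp_cancel)
    then show ?thesis using h cs[OF h] by (simp add: prod_eq_iff)
  qed
  have idr: "star ?S c (idc ?S (ctgt ?S c)) = c" if h: "c \<in> Cells ?S" for c
  proof -
    have "inverse_arr (D1 D) (run D (path_odot D (fst c))) \<bullet> (snd (snd c) \<star> idc D (ctgt D (snd (snd c)))) \<bullet>
        run D (path_odot D (fst (snd c))) = snd (snd c)"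
      using h run_natural[of "snd (snd c)"] by (simp add: strictify_cells D1.inverse_cmp_cancel)
    moreover have "coh D (fst (fst c)) (snd (fst c)) [] = run D (path_odot D (fst c))"
      "coh D (fst (fst (snd c))) (snd (fst (snd c))) [] = run D (path_odot D (fst (snd c)))"
      using h by (simp_all add: strictify_cells path_coh_Nil)
    ultimately show ?thesis using h cs[OF h] by (simp add: prod_eq_iff)
  qed
  have sta: "star ?S (star ?S c d) e = star ?S c (star ?S d e)"
    if h: "c \<in> Cells ?S" "d \<in> Cells ?S" "e \<in> Cells ?S" "ctgt ?S c = csrc ?S d" "ctgt ?S d = csrc ?S e" for c d e
    using strictify_star_assoc[of "fst c" "fst (snd c)" "fst d" "fst (snd d)" "fst e" "fst (snd e)"
        "snd (snd c)" "snd (snd d)" "snd (snd e)"] h fr[OF h(1,2,4)] fr[OF h(2,3,5)]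
    by (simp add: strictify_cells)
  have idst: "star ?S (idcell ?S p) (idcell ?S q) = idcell ?S (odot ?S p q)"
    if h: "p \<in> Pros ?S" "q \<in> Pros ?S" "ptgt ?S p = psrc ?S q" for p q
  proof -
    have "inverse_arr (D1 D) (path_coh D p q) \<bullet> (idcell D (path_odot D p) \<star> idcell D (path_odot D q)) \<bullet> path_coh D p q =
      idcell D (odots D (fst p) (snd p @ snd q))"
      using h by (simp add: star_id D1.inverse_arr(5))
    then show ?thesis by simp
  qed
  have int: "star ?S (ccomp ?S c c') (ccomp ?S d d') = ccomp ?S (star ?S c d) (star ?S c' d')"
    if h: "c \<in> Cells ?S" "c' \<in> Cells ?S" "d \<in> Cells ?S" "d' \<in> Cells ?S" "Cod (D1 ?S) c = Dom (D1 ?S) c'"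
      "Cod (D1 ?S) d = Dom (D1 ?S) d'" "ctgt ?S c = csrc ?S d" "ctgt ?S c' = csrc ?S d'" for c c' d d'
  proof -
    note f = fr[OF h(1,3,7)] fr[OF h(2,4,8)]
    have "inverse_arr (D1 D) (path_coh D (fst c) (fst d)) \<bullet> ((snd (snd c) \<bullet> snd (snd c')) \<star> (snd (snd d) \<bullet> snd (snd d'))) \<bullet>
         path_coh D (fst (snd c')) (fst (snd d')) =
      (inverse_arr (D1 D) (path_coh D (fst c) (fst d)) \<bullet> (snd (snd c) \<star> snd (snd d)) \<bullet> path_coh D (fst (snd c)) (fst (snd d))) \<bullet>
      (inverse_arr (D1 D) (path_coh D (fst c') (fst d')) \<bullet> (snd (snd c') \<star> snd (snd d')) \<bullet>
         path_coh D (fst (snd c')) (fst (snd d')))"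
      using h f by (simp add: strictify_cells interchange D1.cmp_inverse_cancel)
    then show ?thesis using h by simp
  qed
  have C0: "category (D0 ?S)"
    by unfold_locales (simp_all add: Hom_def)
  have C1: "category (D1 ?S)"
    by unfold_locales (auto simp: Hom_def strictify_cells)
  have fncs: "is_functor (D1 ?S) (D0 ?S) (psrc ?S) (csrc ?S)" "is_functor (D1 ?S) (D0 ?S) (ptgt ?S) (ctgt ?S)"
    "is_functor (D0 ?S) (D1 ?S) (idp ?S) (idc ?S)"
    unfolding is_functor_def by (auto simp: Hom_def strictify_cells idc_ide idc_comp)
  have src_id: "csrc ?S (idcell ?S p) = ide (D0 ?S) (psrc ?S p)" "ctgt ?S (idcell ?S p) = ide (D0 ?S) (ptgt ?S p)"
    if "p \<in> Pros ?S" for p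
    using that by simp_all
  have od: "odot ?S p q \<in> Pros ?S \<and> psrc ?S (odot ?S p q) = psrc ?S p \<and> ptgt ?S (odot ?S p q) = ptgt ?S q"
    if "p \<in> Pros ?S" "q \<in> Pros ?S" "ptgt ?S p = psrc ?S q" for p q
    using that by simp
  have oda: "odot ?S (odot ?S p q) r = odot ?S p (odot ?S q r)" for p q r
    by simp
  have odu: "odot ?S (idp ?S (psrc ?S p)) p = p" "odot ?S p (idp ?S (ptgt ?S p)) = p" for p
    by simp_all
  have coherence_ids: "assoc ?S p q r = idcell ?S (odot ?S p (odot ?S q r))" "lun ?S p = idcell ?S p" "run ?S p = idcell ?S p" for p q r
    by (simp_all add: Let_def)
  have idp: "x \<in> Objs ?S \<Longrightarrow> psrc ?S (idp ?S x) = x \<and> ptgt ?S (idp ?S x) = x"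
    and idc: "f \<in> Arrs ?S \<Longrightarrow> csrc ?S (idc ?S f) = f \<and> ctgt ?S (idc ?S f) = f" for x f
    by simp_all
  have st': "star ?S c d \<in> cell ?S (odot ?S (Dom (D1 ?S) c) (Dom (D1 ?S) d)) (odot ?S (Cod (D1 ?S) c) (Cod (D1 ?S) d)) (csrc ?S c) (ctgt ?S d)"
    if h: "c \<in> Cells ?S" "d \<in> Cells ?S" "ctgt ?S c = csrc ?S d" for c d
    using st[OF h] by simp
  interpret C0: category "D0 ?S" by (rule C0)
  interpret C1: category "D1 ?S" by (rule C1)
  have [simp]: "psrc ?S p \<in> Objs ?S" "ptgt ?S p \<in> Objs ?S" if "p \<in> Pros ?S" for p
    using that by simp_all
  \<comment> \<open>From here on the construction is opaque: the remaining axioms follow abstractly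
    from the equations for \<open>star\<close> and \<open>odot\<close> established above.\<close>
  note [simp del] = strictify_simps
  have glob: "idcell ?S p \<in> globular ?S p p" if "p \<in> Pros ?S" for p
    using that by (simp add: globular_def cell_def Hom_def src_id)
  have frm: "ptgt ?S (Dom (D1 ?S) c) = psrc ?S (Dom (D1 ?S) d)" "ptgt ?S (Cod (D1 ?S) c) = psrc ?S (Cod (D1 ?S) d)"
    if "c \<in> Cells ?S" "d \<in> Cells ?S" "ctgt ?S c = csrc ?S d" for c d
    using fr[OF that] by (simp_all add: strictify_simps)
  have stc: "star ?S c d \<in> Cells ?S" "Dom (D1 ?S) (star ?S c d) = odot ?S (Dom (D1 ?S) c) (Dom (D1 ?S) d)"
    "Cod (D1 ?S) (star ?S c d) = odot ?S (Cod (D1 ?S) c) (Cod (D1 ?S) d)" "csrc ?S (star ?S c d) = csrc ?S c" "ctgt ?S (star ?S c d) = ctgt ?S d"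
    if "c \<in> Cells ?S" "d \<in> Cells ?S" "ctgt ?S c = csrc ?S d" for c d
    using st'[OF that] by (simp_all add: cell_def Hom_def)
  show ?thesis
  proof (intro strict_double_category.intro double_category.intro strict_double_category_axioms.intro, goal_cases)
    case 1 show ?case by (rule C0)
  next
    case 2 show ?case by (rule C1)
  next
    case 3 show ?case by (rule fncs)
  next
    case 4 show ?case by (rule fncs)
  next
    case 5 show ?case by (rule fncs)
  next
    case 6 then show ?case by (rule idp)
  next
    case 7 then show ?case by (rule idc)
  next
    case 8 then show ?case by (rule od)
  next
    case 9 then show ?case by (rule st')
  next
    case 10 then show ?case by (rule idst)
  next
    case 11 then show ?case by (rule int)
  next
    case 12 then show ?case by (simp add: coherence_ids od oda glob)
  next
    case 13 then show ?case by (simp add: coherence_ids odu glob)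
  next
    case 14 then show ?case by (simp add: coherence_ids odu glob)
  next
    case (15 c d e) then show ?case by (simp add: coherence_ids sta stc od frm)
  next
    case (16 c) then show ?case by (simp add: coherence_ids idl)
  next
    case (17 c) then show ?case by (simp add: coherence_ids idr)
  next
    case 18 then show ?case by (simp add: coherence_ids oda od idst)
  next
    case (19 m n) then show ?case by (simp add: coherence_ids odu od idst)
  next
    case 20 then show ?case by (simp add: oda)
  next
    case 21 then show ?case by (simp add: odu)
  next
    case 22 then show ?case by (simp add: odu)
  next
    case 23 then show ?case by (simp add: sta)
  next
    case 24 then show ?case by (simp add: idl)
  next
    case 25 then show ?case by (simp add: idr)
  qed
qed

section \<open>Paths of cells and canonical isomorphisms for paths cut into blocks\<close>

lemma cpath_simps [simp]:
  "cpath D f [] g \<longleftrightarrow> f \<in> Arrs D \<and> f = g"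
  "cpath D f (c # cs) g \<longleftrightarrow> c \<in> Cells D \<and> csrc D c = f \<and> cpath D (ctgt D c) cs g"
  by (auto simp: cpath_def)

lemma cpath_append: "cpath D f (cs @ ds) h \<longleftrightarrow> (\<exists>g. cpath D f cs g \<and> cpath D g ds h)"
proof (induction cs arbitrary: f)
  case Nil
  then show ?case by (auto simp: cpath_def)
qed auto

lemma cpath_ends: "cpath D f cs g \<Longrightarrow> f \<in> Arrs D \<and> g \<in> Arrs D"
  by (induction cs arbitrary: f) auto

lemma cohs_closed:
  "ppath D x (concat bs) y \<Longrightarrow> cohs D x bs \<in> Cells D \<and> Dom (D1 D) (cohs D x bs) = odots D x (blocks D x bs) \<and>
     Cod (D1 D) (cohs D x bs) = odots D x (concat bs) \<and> csrc D (cohs D x bs) = ide (D0 D) x \<and>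
     ctgt D (cohs D x bs) = ide (D0 D) y \<and> is_iso (D1 D) (cohs D x bs)"
proof (induction bs arbitrary: x rule: induct_list012)
  case (2 b)
  then show ?case using odots_closed[OF 2[simplified]] by auto
next
  case (3 b b' bs)
  obtain z where z: "ppath D x b z" "ppath D z (concat (b' # bs)) y"
    using 3(3) by (auto simp: ppath_append)
  note IH = 3(2)[OF z(2)]
  have e: "chain_end (ptgt D) x b = z" using ppath_ends[OF z(1)] by simp
  note o = odots_closed[OF z(1)] odots_closed[OF z(2)] ppath_ends[OF z(1)] ppath_ends[OF z(2)] coh_closed[OF z]
  have "is_iso (D1 D) (idcell D (odots D x b) \<star> cohs D z (b' # bs))"
    by (rule iso_star_globular) (use IH o in simp_all)
  then show ?case using IH o by (auto simp: e simp del: ppath_simps intro!: D1.iso_cmp)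
qed auto

end

context strict_double_category
begin

lemma idc_star' [simp]: "c \<in> Cells S \<Longrightarrow> csrc S c = f \<Longrightarrow> idc S f \<star> c = c"
  using idc_star by blast

lemma star_idc' [simp]: "c \<in> Cells S \<Longrightarrow> ctgt S c = f \<Longrightarrow> c \<star> idc S f = c"
  using star_idc by blast

declare star_assoc [simp]

text \<open>Strict units make the one-element clause of \<open>stars\<close> an instance of the
  general one: the tail is then an external identity. Inductions over paths of cells need no
  separate case for singletons afterwards.\<close>

lemma stars_Cons: "cpath S f (c # cs) g \<Longrightarrow> stars S f (c # cs) = c \<star> stars S (ctgt S c) cs"
  by (cases cs) auto

lemma stars_closed:
  "cpath S f cs g \<Longrightarrow> stars S f cs \<in> Cells S \<and> csrc S (stars S f cs) = f \<and> ctgt S (stars S f cs) = g"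
proof (induction cs arbitrary: f)
  case (Cons c cs)
  then show ?case using stars_Cons[OF Cons(2)] by auto
qed auto

lemma stars_append:
  "cpath S f cs g \<Longrightarrow> cpath S g ds h \<Longrightarrow> stars S f (cs @ ds) = stars S f cs \<star> stars S g ds"
proof (induction cs arbitrary: f)
  case Nil
  then show ?case using stars_closed[OF Nil(2)] by auto
next
  case (Cons c cs)
  have "cpath S f (c # cs @ ds) h" using Cons by (auto simp: cpath_append)
  then have "stars S f ((c # cs) @ ds) = c \<star> stars S (ctgt S c) (cs @ ds)"
    using stars_Cons[of f c "cs @ ds" h] by simp
  then show ?case using Cons.IH[of "ctgt S c"] Cons.prems stars_closed[OF Cons.prems(2)] stars_closed[of "ctgt S c" cs g]
    stars_Cons[OF Cons.prems(1)] by auto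
qed

end

abbreviation ucell :: "'p \<times> 'p \<times> 'c \<Rightarrow> 'c" where "ucell c \<equiv> snd (snd c)"

context double_category
begin

lemma strictify_eqI:
  "Dom (D1 (strictify D)) c = Dom (D1 (strictify D)) d \<Longrightarrow> Cod (D1 (strictify D)) c = Cod (D1 (strictify D)) d \<Longrightarrow>
    ucell c = ucell d \<Longrightarrow> c = d"
  by (auto simp: strictify_simps prod_eq_iff)

lemma strictify_stars:
  assumes "cpath (strictify D) f cs g"
  shows "Dom (D1 (strictify D)) (stars (strictify D) f cs) = (Dom (D0 D) f, concat (map (\<lambda>c. snd (fst c)) cs)) \<and>
    Cod (D1 (strictify D)) (stars (strictify D) f cs) = (Cod (D0 D) f, concat (map (\<lambda>c. snd (fst (snd c))) cs))"
proof -
  interpret S: strict_double_category "strictify D" by (rule strictify_strict)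
  show ?thesis using assms
  proof (induction cs arbitrary: f)
    case (Cons c cs)
    note st = S.stars_Cons[OF Cons(2)] S.stars_closed[of "ctgt (strictify D) c" cs g]
    have "Dom (D0 D) (csrc (strictify D) c) = fst (Dom (D1 (strictify D)) c)"
      "Cod (D0 D) (csrc (strictify D) c) = fst (Cod (D1 (strictify D)) c)"
      using S.csrc_in[of c] Cons(2) by (simp_all add: strictify_simps)
    then show ?case using Cons st by (simp add: strictify_simps)
  qed (simp add: strictify_simps)
qed

text \<open>Cells with a single proarrow as codomain form iterated composites in the strictification that
  need no coherence on the codomain side.\<close>

lemma strictify_stars_cohs:
  assumes "cpath (strictify D) f cs g" "\<forall>c\<in>set cs. length (snd (fst (snd c))) = 1"
  shows "cohs D (Dom (D0 D) f) (map (\<lambda>c. snd (fst c)) cs) \<bullet> ucell (stars (strictify D) f cs) = stars D f (map ucell cs)"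
proof -
  interpret S: strict_double_category "strictify D" by (rule strictify_strict)
  show ?thesis using assms
  proof (induction cs arbitrary: f rule: induct_list012)
    case 1
    then show ?case by (auto simp: strictify_simps)
  next
    case (2 c)
    then have "c \<in> Cells (strictify D)" "f = csrc D (ucell c)" by (auto simp: strictify_simps)
    then show ?case by (auto simp: strictify_simps strictify_cells)
  next
    case (3 c d cs)
    let ?r = "stars (strictify D) (ctgt (strictify D) c) (d # cs)"
    have pr: "cpath (strictify D) (ctgt (strictify D) c) (d # cs) g" using 3(3) by simp
    have c: "c \<in> Cells (strictify D)" "csrc (strictify D) c = f" using 3(3) by simp_all
    obtain m where m: "snd (fst (snd c)) = [m]" using 3(4) by (auto simp: length_Suc_conv)
    have cr: "?r \<in> Cells (strictify D)" "csrc (strictify D) ?r = ctgt (strictify D) c"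
      using S.stars_closed[OF pr] by auto
    note r = strictify_stars[OF pr]
    let ?x = "Dom (D0 D) f" let ?z = "Dom (D0 D) (ctgt D (ucell c))"
    have x: "?x = fst (fst c)" "?z = path_tgt D (fst c)" "path_tgt D (fst (snd c)) = fst (fst (snd ?r))"
      "fst (fst ?r) = ?z" "fst (fst (snd ?r)) = Cod (D0 D) (ctgt D (ucell c))"
      using S.csrc_in[of c] S.ctgt_in[of c] c S.composable_frames[OF c(1) cr(1)] cr(2) r
      by (simp_all add: strictify_simps)
    have ne: "snd (fst (snd ?r)) \<noteq> []" using r 3(4) by (auto simp: strictify_simps)
    let ?bs = "map (\<lambda>c. snd (fst c)) (d # cs)"
    have rd: "fst ?r = (?z, concat ?bs)" using r by (simp add: strictify_simps)
    have rp: "fst ?r \<in> paths D" "fst (snd ?r) \<in> paths D" using cr by (simp_all add: strictify_cells)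
    have pp: "ppath D ?z (concat ?bs) (path_tgt D (fst ?r))" using rp(1) unfolding rd by (simp add: paths_def)
    note co = cohs_closed[OF pp]
    have cp: "fst c \<in> paths D" "fst (snd c) \<in> paths D" "ucell c \<in> Cells D" "Dom (D1 D) (ucell c) = path_odot D (fst c)"
       "Cod (D1 D) (ucell c) = path_odot D (fst (snd c))"
      using c by (simp_all add: strictify_cells)
    have rc: "ucell ?r \<in> Cells D" "Dom (D1 D) (ucell ?r) = path_odot D (fst ?r)" "Cod (D1 D) (ucell ?r) = path_odot D (fst (snd ?r))"
      "csrc D (ucell ?r) = ctgt D (ucell c)"
      using cr by (simp_all add: strictify_cells strictify_simps)
    have IH: "cohs D ?z ?bs \<bullet> ucell ?r = stars D (ctgt D (ucell c)) (map ucell (d # cs))"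
      using 3(2)[OF pr] 3(4) by (simp add: strictify_simps)
    \<comment> \<open>The codomain of \<open>c\<close> is a single proarrow and that of the
      remainder is a non-empty path, so the coherence on the codomain side is an identity and only
      the one on the domain side survives.\<close>
    have k: "path_coh D (fst (snd c)) (fst (snd ?r)) = idcell D (odots D (fst (fst (snd c))) (m # snd (fst (snd ?r))))"
      using coh_singleton[OF ne] by (simp add: m)
    have k': "odots D (fst (fst (snd c))) (m # snd (fst (snd ?r))) = path_odot D (fst (snd c)) \<odot> path_odot D (fst (snd ?r))"
      using x(3) by (simp add: odots_Cons[OF ne] m chain_end_def)
    have su: "ucell (stars (strictify D) f (c # d # cs)) =
        inverse_arr (D1 D) (path_coh D (fst c) (fst ?r)) \<bullet> (ucell c \<star> ucell ?r)"
      unfolding S.stars_Cons[OF 3(3)] using k k' cp rc rp x by (simp add: strictify_simps)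
    have ch: "cohs D ?x (map (\<lambda>c. snd (fst c)) (c # d # cs)) =
        (idcell D (path_odot D (fst c)) \<star> cohs D ?z ?bs) \<bullet> path_coh D (fst c) (fst ?r)"
      using x rd by simp
    have zz: "path_tgt D (fst c) = fst (fst ?r)" using x by simp
    define h k C R where "h = path_coh D (fst c) (fst ?r)" "k = cohs D ?z ?bs" "C = ucell c" "R = ucell ?r"
    note h_defs = this
    define P Q W where "P = path_odot D (fst c)" "Q = path_odot D (fst ?r)" "W = odots D ?z (blocks D ?z ?bs)"
    note P_defs = this
    have T: "is_iso (D1 D) h" "h \<in> Cells D" "Dom (D1 D) h = P \<odot> Q" "P \<in> Pros D" "Q \<in> Pros D" "ptgt D P = psrc D Q"
      "csrc D C \<in> Arrs D" "C \<in> Cells D" "R \<in> Cells D" "Dom (D1 D) C = P" "Dom (D1 D) R = Q" "csrc D R = ctgt D C"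
      "k \<in> Cells D" "Dom (D1 D) k = W" "Cod (D1 D) k = Q" "csrc D k = ide (D0 D) (psrc D Q)"
    proof -
      show "is_iso (D1 D) h" "h \<in> Cells D" "Dom (D1 D) h = P \<odot> Q"
        unfolding h_defs P_defs by (rule path_coh_closed[OF cp(1) rp(1) zz])+
      show "P \<in> Pros D" "Q \<in> Pros D" "C \<in> Cells D" "R \<in> Cells D" "Dom (D1 D) C = P" "Dom (D1 D) R = Q"
        "csrc D R = ctgt D C"
        unfolding h_defs P_defs by (fact path_odot_closed(1)[OF cp(1)] path_odot_closed(1)[OF rp(1)] cp rc)+
      show "ptgt D P = psrc D Q"
        unfolding P_defs path_odot_closed(3)[OF cp(1)] path_odot_closed(2)[OF rp(1)] by (rule zz)
      show "csrc D C \<in> Arrs D"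
        unfolding h_defs by (rule csrc_in(1)[OF cp(3)])
      have Q: "Q = odots D ?z (concat ?bs)" unfolding P_defs rd by simp
      have "psrc D Q = ?z" unfolding Q using odots_closed[OF pp] by blast
      then show "k \<in> Cells D" "Dom (D1 D) k = W" "Cod (D1 D) k = Q" "csrc D k = ide (D0 D) (psrc D Q)"
        unfolding h_defs P_defs(3) Q using co by simp_all
    qed
    have "cohs D ?x (map (\<lambda>c. snd (fst c)) (c # d # cs)) \<bullet> ucell (stars (strictify D) f (c # d # cs)) =
       (idcell D P \<star> k) \<bullet> (C \<star> R)"
      unfolding su ch unfolding h_defs(1,2)[symmetric] P_defs(1)[symmetric] unfolding h_defs(3,4)[symmetric] by (simp add: T D1.cmp_inverse_cancel)
    also have "\<dots> = (idcell D P \<bullet> C) \<star> (k \<bullet> R)"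
      by (rule interchange[symmetric]) (simp_all add: T)
    also have "idcell D P \<bullet> C = ucell c" by (simp add: T) (simp add: h_defs)
    also have "k \<bullet> R = stars D (ctgt D (ucell c)) (map ucell (d # cs))"
      unfolding IH[symmetric] h_defs ..
    finally show ?case by simp
  qed
qed

text \<open>The same relation solved for the strict composite. Its left side has exactly the shape
  in which \<open>comp_multimod\<close> writes its components, an inverse \<open>cohs\<close>
  followed by \<open>stars\<close>.\<close>

lemma strictify_stars_inverse:
  assumes "cpath (strictify D) f cs g" "\<forall>c\<in>set cs. length (snd (fst (snd c))) = 1"
  shows "inverse_arr (D1 D) (cohs D (Dom (D0 D) f) (map (\<lambda>c. snd (fst c)) cs)) \<bullet> stars D f (map ucell cs) =
    ucell (stars (strictify D) f cs)"
proof -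
  interpret S: strict_double_category "strictify D" by (rule strictify_strict)
  let ?s = "stars (strictify D) f cs"
  have s: "?s \<in> Cells (strictify D)" "fst ?s = (Dom (D0 D) f, concat (map (\<lambda>c. snd (fst c)) cs))"
    using S.stars_closed[OF assms(1)] strictify_stars[OF assms(1)] by (auto simp: strictify_simps)
  then have "ppath D (Dom (D0 D) f) (concat (map (\<lambda>c. snd (fst c)) cs)) (path_tgt D (fst ?s))"
    by (simp add: strictify_cells paths_def)
  note c = cohs_closed[OF this]
  show ?thesis
    unfolding strictify_stars_cohs[OF assms, symmetric] using c s
    by (simp add: D1.inverse_cmp_cancel strictify_cells)
qed

end

section \<open>The vertical double category of a 2-category\<close>

context two_category
begin

interpretation A0: category "A0 A" by (rule A0_category)
interpretation A1: category "A1 A" by (rule A1_category)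

lemma hcmp_closed:
  assumes "s \<in> Arr (A1 A)" "t \<in> Arr (A1 A)" "cod0 A s = dom0 A t"
  shows "s \<ast> t \<in> Arr (A1 A)" "Dom (A1 A) (s \<ast> t) = Dom (A1 A) s \<cdot>\<^bsub>A0 A\<^esub> Dom (A1 A) t"
    "Cod (A1 A) (s \<ast> t) = Cod (A1 A) s \<cdot>\<^bsub>A0 A\<^esub> Cod (A1 A) t" "dom0 A (s \<ast> t) = dom0 A s" "cod0 A (s \<ast> t) = cod0 A t"
proof -
  show 1: "s \<ast> t \<in> Arr (A1 A)" "Dom (A1 A) (s \<ast> t) = Dom (A1 A) s \<cdot>\<^bsub>A0 A\<^esub> Dom (A1 A) t"
    "Cod (A1 A) (s \<ast> t) = Cod (A1 A) s \<cdot>\<^bsub>A0 A\<^esub> Cod (A1 A) t"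
    using hcmp_in[OF assms] by (auto simp: Hom_def)
  have "Dom (A1 A) s \<in> Arr (A0 A)" "Dom (A1 A) t \<in> Arr (A0 A)"
    using assms A1.Dom_in A1_objects by blast+
  then show "dom0 A (s \<ast> t) = dom0 A s" "cod0 A (s \<ast> t) = cod0 A t"
    using assms unfolding dom0_def cod0_def 1(2) by simp_all
qed

end

context cartesian_two_category
begin

interpretation A0: category "A0 A" by (rule A0_category)
interpretation A1: category "A1 A" by (rule A1_category)

text \<open>Associativity and units of the external composition of cells are those of vertical
  composition in \<open>A1 A\<close>, and interchange is the middle-four law read from right to
  left. The coherence cells are identities by construction.\<close>

lemma VerDbl_strict: "strict_double_category (VerDbl A)"
proof -
  let ?D = "VerDbl A"
  have arr [simp]: "Dom (A1 A) s \<in> Arr (A0 A)" "Cod (A1 A) s \<in> Arr (A0 A)" "dom0 A s \<in> Ob (A0 A)" "cod0 A s \<in> Ob (A0 A)"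
    if "s \<in> Arr (A1 A)" for s
    using A1.Dom_in[OF that] A1.Cod_in[OF that] A1_objects by (simp_all add: dom0_def cod0_def)
  have ob [simp]: "ide (A1 A) f \<in> Arr (A1 A)" "Dom (A1 A) (ide (A1 A) f) = f" "Cod (A1 A) (ide (A1 A) f) = f"
    "dom0 A (ide (A1 A) f) = Dom (A0 A) f" "cod0 A (ide (A1 A) f) = Cod (A0 A) f"
    if "f \<in> Arr (A0 A)" for f
    using that A1_objects by (simp_all add: dom0_def cod0_def)
  have cod [simp]: "Dom (A0 A) (Cod (A1 A) s) = dom0 A s" "Cod (A0 A) (Cod (A1 A) s) = cod0 A s"
    "Dom (A0 A) (Dom (A1 A) s) = dom0 A s" "Cod (A0 A) (Dom (A1 A) s) = cod0 A s"
    if "s \<in> Arr (A1 A)" for s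
    using parallel[OF that] by (simp_all add: dom0_def cod0_def)
  have v [simp]: "dom0 A (s \<cdot>\<^bsub>A1 A\<^esub> t) = dom0 A s" "cod0 A (s \<cdot>\<^bsub>A1 A\<^esub> t) = cod0 A s"
    if "s \<in> Arr (A1 A)" "t \<in> Arr (A1 A)" "Cod (A1 A) s = Dom (A1 A) t" for s t
    unfolding dom0_def cod0_def using that by simp_all
  \<comment> \<open>Since \<open>odot\<close> returns its first argument, typing a vertical
    composite requires that the two 2-cells have the same source object and the same target
    object.\<close>
  have vd: "dom0 A s = dom0 A t" "cod0 A s = cod0 A t"
    if "s \<in> Arr (A1 A)" "t \<in> Arr (A1 A)" "Cod (A1 A) s = Dom (A1 A) t" for s t
    using cod(1,2)[OF that(1)] cod(3,4)[OF that(2)] that(3) by simp_all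
  note [simp] = hcmp_closed
  have sel: "D0 ?D = A0 A" "Pros ?D = Ob (A0 A)" "Cells ?D = Arr (A1 A)" "Dom (D1 ?D) = dom0 A" "Cod (D1 ?D) = cod0 A"
    "ide (D1 ?D) = (\<lambda>x. ide (A1 A) (ide (A0 A) x))" "cmp (D1 ?D) = hcmp A" "psrc ?D = id" "ptgt ?D = id"
    "csrc ?D = Dom (A1 A)" "ctgt ?D = Cod (A1 A)" "idp ?D = id" "idc ?D = ide (A1 A)" "odot ?D = (\<lambda>x y. x)"
    "star ?D = cmp (A1 A)" "assoc ?D = (\<lambda>x y z. ide (A1 A) (ide (A0 A) x))"
    "lun ?D = (\<lambda>x. ide (A1 A) (ide (A0 A) x))" "run ?D = (\<lambda>x. ide (A1 A) (ide (A0 A) x))"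
    by (simp_all add: VerDbl_def)
  have C1: "category (D1 ?D)"
    by unfold_locales (simp_all add: sel Hom_def hcmp_assoc ide_hcmp hcmp_ide)
  interpret C1: category "D1 ?D" by (rule C1)
  have iso: "is_iso (D1 ?D) (ide (A1 A) (ide (A0 A) x))" if "x \<in> Ob (A0 A)" for x
    using C1.iso_ide[of x] that by (simp add: sel)
  have iid: "ide (A1 A) (ide (A0 A) x) \<ast> ide (A1 A) (ide (A0 A) x) = ide (A1 A) (ide (A0 A) x)" if "x \<in> Ob (A0 A)" for x
    using that by (simp add: hcmp_id)
  have u: "dom0 A s = x \<Longrightarrow> ide (A1 A) (ide (A0 A) x) \<ast> s = s" "cod0 A s = x \<Longrightarrow> s \<ast> ide (A1 A) (ide (A0 A) x) = s"
    if "s \<in> Arr (A1 A)" for s x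
    using that by (auto simp: ide_hcmp hcmp_ide)
  show ?thesis
    apply (intro strict_double_category.intro double_category.intro strict_double_category_axioms.intro)
    unfolding is_functor_def globular_def cell_def Hom_def sel
    by (auto simp: A0_category C1[unfolded sel] iso iid hcmp_id middle_four ide_hcmp hcmp_ide  A1.ide_cmp A1.cmp_ide vd u)
qed

end

text \<open>Interchange, applied after splitting \<open>idc S h\<close> into its external composite
  with itself, as strict units permit.\<close>

lemma (in strict_double_category) star_cmp_idc:
  assumes "c \<in> Cells S" "d \<in> Cells S" "ctgt S c = csrc S d" "h \<in> Arrs S"
    "Cod (D1 S) c = idp S (Dom (D0 S) h)" "Cod (D1 S) d = idp S (Dom (D0 S) h)"
  shows "(c \<star> d) \<bullet> idc S h = (c \<bullet> idc S h) \<star> (d \<bullet> idc S h)"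
  using assms by (subst interchange) simp_all

lemma (in strict_double_category) idc_cmp_star:
  assumes "c \<in> Cells S" "d \<in> Cells S" "ctgt S c = csrc S d" "h \<in> Arrs S"
    "Dom (D1 S) c = idp S (Cod (D0 S) h)" "Dom (D1 S) d = idp S (Cod (D0 S) h)"
  shows "idc S h \<bullet> (c \<star> d) = (idc S h \<bullet> c) \<star> (idc S h \<bullet> d)"
  using assms by (subst interchange) simp_all

section \<open>Unitary lax functors and their transformations\<close>

locale vertical_cart_lax = A: cartesian_two_category A + E: cartesian_double_category E
  for A :: "('o, 'f, 't) ctwo_cat" and E :: "('x, 'a, 'p, 'c) cdbl"
begin

abbreviation "D \<equiv> VerDbl A"
abbreviation "S \<equiv> strictify E"

sublocale D: strict_double_category D by (rule A.VerDbl_strict)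
sublocale S: strict_double_category S by (rule E.strictify_strict)

abbreviation scomp (infixl "\<^bold>\<cdot>" 70) where "c \<^bold>\<cdot> d \<equiv> c \<bullet>\<^bsub>S\<^esub> d"
abbreviation sstar (infixl "\<^bold>\<star>" 75) where "c \<^bold>\<star> d \<equiv> c \<star>\<^bsub>S\<^esub> d"

lemma VerDbl_sel [simp]:
  "Pros D = Objs D" "psrc D x = x" "ptgt D x = x" "idp D x = x" "x \<odot>\<^bsub>D\<^esub> y = x"
  "assoc D x y z = idcell D x" "lun D x = idcell D x" "run D x = idcell D x"
  by (simp_all add: VerDbl_def)

lemma composable_VerDbl [simp]: "(x, y) \<in> composable D \<longleftrightarrow> x \<in> Objs D \<and> y = x"
  by (auto simp: composable_def)

lemma D_idc_ide [simp]: "x \<in> Objs D \<Longrightarrow> idc D (ide (D0 D) x) = idcell D x"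
  using D.idc_ide[of x] by simp

lemma S_sel [simp]:
  "Objs S = Objs E" "Arrs S = Arrs E" "Dom (D0 S) = Dom (D0 E)"
  "Cod (D0 S) = Cod (D0 E)" "ide (D0 S) = ide (D0 E)" "cmp (D0 S) = cmp (D0 E)"
  "Pros S = paths E" "psrc S p = fst p" "idp S x = (x, [])" "p \<odot>\<^bsub>S\<^esub> q = (fst p, snd p @ snd q)"
  "ptgt S p = path_tgt E p"
  by (simp_all add: E.strictify_simps)

lemma path_tgt_single [simp]: "chain_end (ptgt E) x [m] = ptgt E m"
  by (simp add: chain_end_def)

lemma paths_single [simp]: "(x, [m]) \<in> paths E \<longleftrightarrow> m \<in> Pros E \<and> psrc E m = x"
  by (auto simp: paths_def)

lemma S_frame [simp]:
  assumes "c \<in> Cells S"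
  shows "csrc S c \<in> Arrs E" "ctgt S c \<in> Arrs E"
    "Dom (D0 E) (csrc S c) = fst (Dom (D1 S) c)" "Cod (D0 E) (csrc S c) = fst (Cod (D1 S) c)"
    "Dom (D0 E) (ctgt S c) = path_tgt E (Dom (D1 S) c)" "Cod (D0 E) (ctgt S c) = path_tgt E (Cod (D1 S) c)"
  using S.csrc_in[OF assms] S.ctgt_in[OF assms] by simp_all

lemma S_cell [simp]:
  "(p, q, c) \<in> Cells S \<longleftrightarrow> p \<in> paths E \<and> q \<in> paths E \<and> c \<in> Cells E \<and>
     Dom (D1 E) c = path_odot E p \<and> Cod (D1 E) c = path_odot E q"
  "Dom (D1 S) (p, q, c) = p" "Cod (D1 S) (p, q, c) = q" "csrc S (p, q, c) = csrc E c" "ctgt S (p, q, c) = ctgt E c"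
  by (auto simp: E.strictify_cells E.strictify_simps)

lemma ucell_S:
  "ucell (c \<^bold>\<cdot> d) = ucell c \<bullet>\<^bsub>E\<^esub> ucell d" "ucell (idcell S p) = idcell E (path_odot E p)"
  "ucell (idc S f) = idc E f"
  "ucell (c \<^bold>\<star> d) = inverse_arr (D1 E) (path_coh E (Dom (D1 S) c) (Dom (D1 S) d)) \<bullet>\<^bsub>E\<^esub> (ucell c \<star>\<^bsub>E\<^esub> ucell d) \<bullet>\<^bsub>E\<^esub>
         path_coh E (Cod (D1 S) c) (Cod (D1 S) d)"
  by (simp_all add: E.strictify_simps)

lemma ucell_closed:
  assumes "c \<in> Cells S"
  shows "ucell c \<in> Cells E" "Dom (D1 E) (ucell c) = path_odot E (Dom (D1 S) c)"
    "Cod (D1 E) (ucell c) = path_odot E (Cod (D1 S) c)" "csrc E (ucell c) = csrc S c" "ctgt E (ucell c) = ctgt S c"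
  using assms by (simp_all add: E.strictify_cells E.strictify_simps)

lemma S_eqI: "Dom (D1 S) c = Dom (D1 S) d \<Longrightarrow> Cod (D1 S) c = Cod (D1 S) d \<Longrightarrow> ucell c = ucell d \<Longrightarrow> c = d"
  by (rule E.strictify_eqI)

text \<open>Unitary lax functors before products enter; the objects of the virtual double category
  are those among them that preserve finite products.\<close>

definition uobj where "uobj F \<longleftrightarrow> lax_functor D E F \<and> unitary D E F"

text \<open>Unitarity determines much of the structure. With the unitor an identity, left unitality
  leaves \<open>lun\<close> as the only possible laxator at \<open>(x, x)\<close>, and naturality of
  the unitor fixes the value on external identities.\<close>

lemma uobj_simps [simp]:
  assumes F: "uobj F"
  shows "x \<in> Objs D \<Longrightarrow> onOb F x \<in> Objs E" "f \<in> Arrs D \<Longrightarrow> onArr F f \<in> Arrs E"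
    "f \<in> Arrs D \<Longrightarrow> Dom (D0 E) (onArr F f) = onOb F (Dom (D0 D) f)"
    "f \<in> Arrs D \<Longrightarrow> Cod (D0 E) (onArr F f) = onOb F (Cod (D0 D) f)"
    "x \<in> Objs D \<Longrightarrow> onArr F (ide (D0 D) x) = ide (D0 E) (onOb F x)"
    "f \<in> Arrs D \<Longrightarrow> g \<in> Arrs D \<Longrightarrow> Cod (D0 D) f = Dom (D0 D) g \<Longrightarrow>
       onArr F (f \<cdot>\<^bsub>D0 D\<^esub> g) = onArr F f \<cdot>\<^bsub>D0 E\<^esub> onArr F g"
    "x \<in> Objs D \<Longrightarrow> onPro F x = idp E (onOb F x)"
    "x \<in> Objs D \<Longrightarrow> unitor F x = idcell E (idp E (onOb F x))"
    "s \<in> Cells D \<Longrightarrow> onCell F s \<in> Cells E"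
    "s \<in> Cells D \<Longrightarrow> Dom (D1 E) (onCell F s) = idp E (onOb F (Dom (D1 D) s))"
    "s \<in> Cells D \<Longrightarrow> Cod (D1 E) (onCell F s) = idp E (onOb F (Cod (D1 D) s))"
    "s \<in> Cells D \<Longrightarrow> csrc E (onCell F s) = onArr F (csrc D s)"
    "s \<in> Cells D \<Longrightarrow> ctgt E (onCell F s) = onArr F (ctgt D s)"
    "x \<in> Objs D \<Longrightarrow> onCell F (idcell D x) = idcell E (idp E (onOb F x))"
    "s \<in> Cells D \<Longrightarrow> t \<in> Cells D \<Longrightarrow> Cod (D1 D) s = Dom (D1 D) t \<Longrightarrow>
       onCell F (s \<bullet>\<^bsub>D\<^esub> t) = onCell F s \<bullet>\<^bsub>E\<^esub> onCell F t"
    "x \<in> Objs D \<Longrightarrow> laxator F (x, x) = lun E (idp E (onOb F x))"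
    "f \<in> Arrs D \<Longrightarrow> onCell F (idc D f) = idc E (onArr F f)"
proof -
  interpret F: lax_functor D E F using F by (simp add: uobj_def)
  have u: "onPro F x = idp E (onOb F x)" "unitor F x = idcell E (idp E (onOb F x))" if "x \<in> Objs D" for x
    using F that by (auto simp: uobj_def unitary_def)
  note f0 = F.functor0[unfolded is_functor_def Hom_def] and f1 = F.functor1[unfolded is_functor_def Hom_def]
  have ob: "x \<in> Objs D \<Longrightarrow> onOb F x \<in> Objs E" for x using f0 by auto
  show "x \<in> Objs D \<Longrightarrow> onOb F x \<in> Objs E" by (rule ob)
  show "f \<in> Arrs D \<Longrightarrow> onArr F f \<in> Arrs E"
    "f \<in> Arrs D \<Longrightarrow> Dom (D0 E) (onArr F f) = onOb F (Dom (D0 D) f)"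
    and fc: "f \<in> Arrs D \<Longrightarrow> Cod (D0 E) (onArr F f) = onOb F (Cod (D0 D) f)"
    "x \<in> Objs D \<Longrightarrow> onArr F (ide (D0 D) x) = ide (D0 E) (onOb F x)"
    "f \<in> Arrs D \<Longrightarrow> g \<in> Arrs D \<Longrightarrow> Cod (D0 D) f = Dom (D0 D) g \<Longrightarrow>
       onArr F (f \<cdot>\<^bsub>D0 D\<^esub> g) = onArr F f \<cdot>\<^bsub>D0 E\<^esub> onArr F g"
    using f0 by auto
  show "x \<in> Objs D \<Longrightarrow> onPro F x = idp E (onOb F x)"
    "x \<in> Objs D \<Longrightarrow> unitor F x = idcell E (idp E (onOb F x))"
    using u by auto
  show c: "s \<in> Cells D \<Longrightarrow> onCell F s \<in> Cells E"
    "s \<in> Cells D \<Longrightarrow> Dom (D1 E) (onCell F s) = idp E (onOb F (Dom (D1 D) s))"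
    "s \<in> Cells D \<Longrightarrow> Cod (D1 E) (onCell F s) = idp E (onOb F (Cod (D1 D) s))" for s
    using f1 D.D1.Dom_in[of s] D.D1.Cod_in[of s] u by auto
  show "s \<in> Cells D \<Longrightarrow> csrc E (onCell F s) = onArr F (csrc D s)"
    "s \<in> Cells D \<Longrightarrow> ctgt E (onCell F s) = onArr F (ctgt D s)"
    using F.fun_csrc_ctgt by auto
  show ci: "x \<in> Objs D \<Longrightarrow> onCell F (idcell D x) = idcell E (idp E (onOb F x))" for x
    using f1 u by auto
  show "s \<in> Cells D \<Longrightarrow> t \<in> Cells D \<Longrightarrow> Cod (D1 D) s = Dom (D1 D) t \<Longrightarrow>
       onCell F (s \<bullet>\<^bsub>D\<^esub> t) = onCell F s \<bullet>\<^bsub>E\<^esub> onCell F t"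
    using f1 by auto
  show "laxator F (x, x) = lun E (idp E (onOb F x))" if x: "x \<in> Objs D"
  proof -
    have "laxator F (x, x) \<in> globular E (onPro F x \<odot>\<^bsub>E\<^esub> onPro F x) (onPro F x)"
      using F.laxator_in[of x x] x by simp
    then have l: "laxator F (x, x) \<in> Cells E" "Dom (D1 E) (laxator F (x, x)) = idp E (onOb F x) \<odot>\<^bsub>E\<^esub> idp E (onOb F x)"
      "Cod (D1 E) (laxator F (x, x)) = idp E (onOb F x)"
      using x by (simp_all add: globular_def cell_def Hom_def u)
    show ?thesis
      using F.left_unital[of x] x l by (simp add: u ci E.star_id ob)
  qed
  show "onCell F (idc D f) = idc E (onArr F f)" if f: "f \<in> Arrs D"
    using F.unitor_natural[OF f] f f0 c[of "idc D f"] by (auto simp: u)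
qed

text \<open>The proarrow values of \<open>F\<close> are external identities, so the value on a
  2-cell can be placed between empty paths instead of one-element paths. Over empty paths both
  compositions are preserved on the nose.\<close>

definition fcell :: "('o, 'f, 'o, 't, 'x, 'a, 'p, 'c) lax_fun \<Rightarrow> 't \<Rightarrow> ('x \<times> 'p list) \<times> ('x \<times> 'p list) \<times> 'c" where
  "fcell F s = ((onOb F (Dom (D1 D) s), []), (onOb F (Cod (D1 D) s), []), onCell F s)"

lemma ucell_fcell [simp]: "ucell (fcell F s) = onCell F s"
  by (simp add: fcell_def)

lemma fcell_closed [simp]:
  assumes "uobj F" "s \<in> Cells D"
  shows "fcell F s \<in> Cells S" "Dom (D1 S) (fcell F s) = (onOb F (Dom (D1 D) s), [])"
    "Cod (D1 S) (fcell F s) = (onOb F (Cod (D1 D) s), [])"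
    "csrc S (fcell F s) = onArr F (csrc D s)" "ctgt S (fcell F s) = onArr F (ctgt D s)"
  using assms D.D1.Dom_in[of s] D.D1.Cod_in[of s] by (simp_all add: fcell_def)

lemma D_Dom_Cod_in [simp]: "s \<in> Cells D \<Longrightarrow> Dom (D1 D) s \<in> Objs D" "s \<in> Cells D \<Longrightarrow> Cod (D1 D) s \<in> Objs D"
  using D.D1.Dom_in[of s] D.D1.Cod_in[of s] by simp_all

lemma idc_S [simp]:
  assumes "f \<in> Arrs E"
  shows "idc S f \<in> Cells S" "Dom (D1 S) (idc S f) = (Dom (D0 E) f, [])" "Cod (D1 S) (idc S f) = (Cod (D0 E) f, [])"
    "csrc S (idc S f) = f" "ctgt S (idc S f) = f"
  using S.idc_in[of f] S.idp_src_tgt(3,4)[of f] assms by simp_all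

lemma S_idc_comp: "f \<in> Arrs E \<Longrightarrow> g \<in> Arrs E \<Longrightarrow> Cod (D0 E) f = Dom (D0 E) g \<Longrightarrow>
    idc S (f \<cdot>\<^bsub>D0 E\<^esub> g) = idc S f \<^bold>\<cdot> idc S g"
  using S.idc_comp[of f g] by simp

lemma S_idc_ide: "x \<in> Objs E \<Longrightarrow> idc S (ide (D0 E) x) = idcell S (x, [])"
  using S.idc_ide[of x] by simp

lemma S_idcell [simp]:
  assumes "p \<in> paths E"
  shows "idcell S p \<in> Cells S" "Dom (D1 S) (idcell S p) = p" "Cod (D1 S) (idcell S p) = p"
    "csrc S (idcell S p) = ide (D0 E) (fst p)" "ctgt S (idcell S p) = ide (D0 E) (path_tgt E p)"
  using S.D1.ide_closed[of p] S.csrc_idcell[of p] S.ctgt_idcell[of p] assms by simp_all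

lemma D_star_frames:
  assumes "s \<in> Cells D" "t \<in> Cells D" "ctgt D s = csrc D t"
  shows "Dom (D1 D) s = Dom (D1 D) t" "Cod (D1 D) s = Cod (D1 D) t"
  using D.composable_frames[OF assms] by simp_all

lemma fcell_cmp:
  assumes "uobj F" "s \<in> Cells D" "t \<in> Cells D" "Cod (D1 D) s = Dom (D1 D) t"
  shows "fcell F (s \<bullet>\<^bsub>D\<^esub> t) = fcell F s \<^bold>\<cdot> fcell F t"
  by (rule S_eqI) (use assms in \<open>simp_all add: ucell_S\<close>)

lemma fcell_idc: "uobj F \<Longrightarrow> f \<in> Arrs D \<Longrightarrow> fcell F (idc D f) = idc S (onArr F f)"
  by (rule S_eqI) (simp_all add: ucell_S)

text \<open>The laxators involved are all \<open>lun\<close>, and conjugation by \<open>lun\<close>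
  is precisely what external composition over empty paths does in the strictification. Naturality of
  the laxators therefore becomes strict preservation.\<close>

lemma fcell_star:
  assumes "uobj F" "s \<in> Cells D" "t \<in> Cells D" "ctgt D s = csrc D t"
  shows "fcell F (s \<star>\<^bsub>D\<^esub> t) = fcell F s \<^bold>\<star> fcell F t"
proof -
  note fr = D_star_frames[OF assms(2-)]
  interpret F: lax_functor D E F using assms by (simp add: uobj_def)
  have "(onCell F s \<star>\<^bsub>E\<^esub> onCell F t) \<bullet>\<^bsub>E\<^esub> lun E (idp E (onOb F (Cod (D1 D) s))) =
     lun E (idp E (onOb F (Dom (D1 D) s))) \<bullet>\<^bsub>E\<^esub> onCell F (s \<star>\<^bsub>D\<^esub> t)"
    using F.laxator_natural[OF assms(2-4)] assms fr by simp
  then show ?thesis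
    by (intro S_eqI) (use assms fr in \<open>simp_all add: ucell_S E.D1.inverse_cmp_cancel\<close>)
qed

section \<open>Lax transformations as families of cells over empty paths\<close>

definition tcell :: "('o, 'f, 'o, 't, 'x, 'a, 'p, 'c) lax_trans \<Rightarrow> 'f \<Rightarrow> ('x \<times> 'p list) \<times> ('x \<times> 'p list) \<times> 'c" where
  "tcell \<alpha> f = ((onOb (tdom \<alpha>) (Dom (D0 D) f), []), (onOb (tcod \<alpha>) (Cod (D0 D) f), []), atArr \<alpha> f)"

lemma ucell_tcell [simp]: "ucell (tcell \<alpha> f) = atArr \<alpha> f"
  by (simp add: tcell_def)

definition utrans where
  "utrans \<alpha> \<longleftrightarrow> uobj (tdom \<alpha>) \<and> uobj (tcod \<alpha>) \<and> lax_transformation D E (tdom \<alpha>) (tcod \<alpha>) \<alpha>"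

lemma utrans_uobj [simp]: "utrans \<alpha> \<Longrightarrow> uobj (tdom \<alpha>)" "utrans \<alpha> \<Longrightarrow> uobj (tcod \<alpha>)"
  unfolding utrans_def by simp_all

lemma utrans_lax: "utrans \<alpha> \<Longrightarrow> lax_transformation D E (tdom \<alpha>) (tcod \<alpha>) \<alpha>"
  unfolding utrans_def by simp

lemma laxator_idl_uobj: "uobj G \<Longrightarrow> x \<in> Objs D \<Longrightarrow> laxator_idl D E G x = lun E (idp E (onOb G x))"
  by (simp add: laxator_idl_def)

lemma laxator_idr_uobj: "uobj G \<Longrightarrow> x \<in> Objs D \<Longrightarrow> laxator_idr D E G x = lun E (idp E (onOb G x))"
  by (simp add: laxator_idr_def)

text \<open>Compatibility with unitors that are identities leaves only one possible component at a
  proarrow: the external identity on the component at the object.\<close>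

lemma utrans_ob [simp]:
  assumes "utrans \<alpha>" "x \<in> Objs D"
  shows "atOb \<alpha> x \<in> Arrs E" "Dom (D0 E) (atOb \<alpha> x) = onOb (tdom \<alpha>) x" "Cod (D0 E) (atOb \<alpha> x) = onOb (tcod \<alpha>) x"
    "atPro \<alpha> x = idc E (atOb \<alpha> x)"
proof -
  interpret lax_transformation D E "tdom \<alpha>" "tcod \<alpha>" \<alpha> by (rule utrans_lax[OF assms(1)])
  show ob: "atOb \<alpha> x \<in> Arrs E" "Dom (D0 E) (atOb \<alpha> x) = onOb (tdom \<alpha>) x" "Cod (D0 E) (atOb \<alpha> x) = onOb (tcod \<alpha>) x"
    using atOb_in[OF assms(2)] by (simp_all add: Hom_def)
  have "atPro \<alpha> x \<in> cell E (onPro (tdom \<alpha>) x) (onPro (tcod \<alpha>) x) (atOb \<alpha> x) (atOb \<alpha> x)"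
    using atPro_in[of x] assms by simp
  then have "atPro \<alpha> x \<in> Cells E" "Dom (D1 E) (atPro \<alpha> x) = idp E (onOb (tdom \<alpha>) x)"
    using assms by (simp_all add: cell_def Hom_def)
  then show "atPro \<alpha> x = idc E (atOb \<alpha> x)"
    using atPro_idp[OF assms(2)] assms ob by simp
qed

lemma tcell_closed [simp]:
  assumes "utrans \<alpha>" "f \<in> Arrs D"
  shows "tcell \<alpha> f \<in> Cells S" "Dom (D1 S) (tcell \<alpha> f) = (onOb (tdom \<alpha>) (Dom (D0 D) f), [])"
    "Cod (D1 S) (tcell \<alpha> f) = (onOb (tcod \<alpha>) (Cod (D0 D) f), [])"
    "csrc S (tcell \<alpha> f) = atOb \<alpha> (Dom (D0 D) f) \<cdot>\<^bsub>D0 E\<^esub> onArr (tcod \<alpha>) f"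
    "ctgt S (tcell \<alpha> f) = onArr (tdom \<alpha>) f \<cdot>\<^bsub>D0 E\<^esub> atOb \<alpha> (Cod (D0 D) f)"
proof -
  interpret lax_transformation D E "tdom \<alpha>" "tcod \<alpha>" \<alpha> by (rule utrans_lax[OF assms(1)])
  have "f \<in> Hom (D0 D) (Dom (D0 D) f) (Cod (D0 D) f)" using assms by (simp add: Hom_def)
  from atArr_in[OF this]
  show "tcell \<alpha> f \<in> Cells S" "Dom (D1 S) (tcell \<alpha> f) = (onOb (tdom \<alpha>) (Dom (D0 D) f), [])"
    "Cod (D1 S) (tcell \<alpha> f) = (onOb (tcod \<alpha>) (Cod (D0 D) f), [])"
    "csrc S (tcell \<alpha> f) = atOb \<alpha> (Dom (D0 D) f) \<cdot>\<^bsub>D0 E\<^esub> onArr (tcod \<alpha>) f"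
    "ctgt S (tcell \<alpha> f) = onArr (tdom \<alpha>) f \<cdot>\<^bsub>D0 E\<^esub> atOb \<alpha> (Cod (D0 D) f)"
    using assms by (simp_all add: tcell_def cell_def Hom_def)
qed

lemma ucell_star_Nil:
  assumes "c \<in> Cells S" "d \<in> Cells S" "ctgt S c = csrc S d" "Dom (D1 S) c = (x, [])"
    "Cod (D1 S) c = (y, [])" "Dom (D1 S) d = (x, ms)" "Cod (D1 S) d = (y, ns)"
  shows "ucell (c \<^bold>\<star> d) = lun_inv E (odots E x ms) \<bullet>\<^bsub>E\<^esub> (ucell c \<star>\<^bsub>E\<^esub> ucell d) \<bullet>\<^bsub>E\<^esub> lun E (odots E y ns)"
  using assms by (simp add: ucell_S)

lemma run_idp [simp]: "x \<in> Objs E \<Longrightarrow> run E (idp E x) = lun E (idp E x)"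
  using E.lun_idp by simp

text \<open>The laxators of the target at identity proarrows are \<open>lun\<close>, so the two
  sides of the naturality axiom are the underlying cells of external composites over empty
  paths.\<close>

lemma tcell_natural:
  assumes "utrans \<alpha>" "s \<in> Cells D"
  shows "tcell \<alpha> (csrc D s) \<^bold>\<star> (fcell (tdom \<alpha>) s \<^bold>\<cdot> idc S (atOb \<alpha> (Cod (D1 D) s))) =
    (idc S (atOb \<alpha> (Dom (D1 D) s)) \<^bold>\<cdot> fcell (tcod \<alpha>) s) \<^bold>\<star> tcell \<alpha> (ctgt D s)"
proof -
  interpret lax_transformation D E "tdom \<alpha>" "tcod \<alpha>" \<alpha> by (rule utrans_lax[OF assms(1)])
  have "s \<in> cell D (Dom (D1 D) s) (Cod (D1 D) s) (csrc D s) (ctgt D s)"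
    using assms by (simp add: cell_def Hom_def)
  from cell_naturality[OF this] show ?thesis
    by (intro S_eqI) (use assms in
        \<open>simp_all add: ucell_star_Nil laxator_idl_uobj laxator_idr_uobj ucell_S\<close>)
qed

lemma tcell_comp:
  assumes "utrans \<alpha>" "f \<in> Arrs D" "g \<in> Arrs D" "Cod (D0 D) f = Dom (D0 D) g"
  shows "tcell \<alpha> (f \<cdot>\<^bsub>D0 D\<^esub> g) =
    (tcell \<alpha> f \<^bold>\<cdot> idc S (onArr (tcod \<alpha>) g)) \<^bold>\<star> (idc S (onArr (tdom \<alpha>) f) \<^bold>\<cdot> tcell \<alpha> g)"
proof -
  interpret lax_transformation D E "tdom \<alpha>" "tcod \<alpha>" \<alpha> by (rule utrans_lax[OF assms(1)])
  have "f \<in> Hom (D0 D) (Dom (D0 D) f) (Cod (D0 D) f)" "g \<in> Hom (D0 D) (Cod (D0 D) f) (Cod (D0 D) g)"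
    using assms by (simp_all add: Hom_def)
  from atArr_comp[OF this] show ?thesis
    by (intro S_eqI) (use assms in
        \<open>simp_all add: ucell_star_Nil laxator_idl_uobj laxator_idr_uobj ucell_S\<close>)
qed

lemma tcell_ide:
  assumes "utrans \<alpha>" "x \<in> Objs D"
  shows "tcell \<alpha> (ide (D0 D) x) = idc S (atOb \<alpha> x)"
proof -
  interpret lax_transformation D E "tdom \<alpha>" "tcod \<alpha>" \<alpha> by (rule utrans_lax[OF assms(1)])
  show ?thesis
    using atArr_ide[OF assms(2)] by (intro S_eqI) (use assms in \<open>simp_all add: ucell_S\<close>)
qed

text \<open>The strict equations together with the stated form of \<open>atPro\<close> contain all
  the axioms of a lax transformation: compatibility with laxators is naturality of
  \<open>lun\<close> at an external identity, and the other equations are underlying cells of the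
  hypotheses.\<close>

lemma utransI:
  assumes F: "uobj (tdom \<alpha>)" and G: "uobj (tcod \<alpha>)"
    and ob: "\<And>x. x \<in> Objs D \<Longrightarrow> atOb \<alpha> x \<in> Hom (D0 E) (onOb (tdom \<alpha>) x) (onOb (tcod \<alpha>) x)"
    and pro: "\<And>x. x \<in> Objs D \<Longrightarrow> atPro \<alpha> x = idc E (atOb \<alpha> x)"
    and cell: "\<And>f. f \<in> Arrs D \<Longrightarrow> tcell \<alpha> f \<in> Cells S \<and>
      csrc S (tcell \<alpha> f) = atOb \<alpha> (Dom (D0 D) f) \<cdot>\<^bsub>D0 E\<^esub> onArr (tcod \<alpha>) f \<and>
      ctgt S (tcell \<alpha> f) = onArr (tdom \<alpha>) f \<cdot>\<^bsub>D0 E\<^esub> atOb \<alpha> (Cod (D0 D) f)"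
    and nat: "\<And>s. s \<in> Cells D \<Longrightarrow> tcell \<alpha> (csrc D s) \<^bold>\<star> (fcell (tdom \<alpha>) s \<^bold>\<cdot> idc S (atOb \<alpha> (Cod (D1 D) s))) =
      (idc S (atOb \<alpha> (Dom (D1 D) s)) \<^bold>\<cdot> fcell (tcod \<alpha>) s) \<^bold>\<star> tcell \<alpha> (ctgt D s)"
    and comp: "\<And>f g. f \<in> Arrs D \<Longrightarrow> g \<in> Arrs D \<Longrightarrow> Cod (D0 D) f = Dom (D0 D) g \<Longrightarrow> tcell \<alpha> (f \<cdot>\<^bsub>D0 D\<^esub> g) =
      (tcell \<alpha> f \<^bold>\<cdot> idc S (onArr (tcod \<alpha>) g)) \<^bold>\<star> (idc S (onArr (tdom \<alpha>) f) \<^bold>\<cdot> tcell \<alpha> g)"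
    and ide: "\<And>x. x \<in> Objs D \<Longrightarrow> tcell \<alpha> (ide (D0 D) x) = idc S (atOb \<alpha> x)"
    and ext: "atOb \<alpha> \<in> extensional (Objs D)" "atPro \<alpha> \<in> extensional (Objs D)" "atArr \<alpha> \<in> extensional (Arrs D)"
  shows "utrans \<alpha>"
proof -
  have ob' [simp]: "atOb \<alpha> x \<in> Arrs E" "Dom (D0 E) (atOb \<alpha> x) = onOb (tdom \<alpha>) x" "Cod (D0 E) (atOb \<alpha> x) = onOb (tcod \<alpha>) x"
    if "x \<in> Objs D" for x using ob[OF that] by (auto simp: Hom_def)
  have c [simp]: "tcell \<alpha> f \<in> Cells S" "Dom (D1 S) (tcell \<alpha> f) = (onOb (tdom \<alpha>) (Dom (D0 D) f), [])"
    "Cod (D1 S) (tcell \<alpha> f) = (onOb (tcod \<alpha>) (Cod (D0 D) f), [])"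
    "csrc S (tcell \<alpha> f) = atOb \<alpha> (Dom (D0 D) f) \<cdot>\<^bsub>D0 E\<^esub> onArr (tcod \<alpha>) f"
    "ctgt S (tcell \<alpha> f) = onArr (tdom \<alpha>) f \<cdot>\<^bsub>D0 E\<^esub> atOb \<alpha> (Cod (D0 D) f)"
    if "f \<in> Arrs D" for f
    using cell[OF that] by (simp_all add: tcell_def)
  have "lax_transformation D E (tdom \<alpha>) (tcod \<alpha>) \<alpha>"
  proof (intro lax_transformation.intro lax_transformation_axioms.intro)
    show "lax_functor D E (tdom \<alpha>)" "lax_functor D E (tcod \<alpha>)" using F G by (simp_all add: uobj_def)
    show "tdom \<alpha> = tdom \<alpha>" "tcod \<alpha> = tcod \<alpha>" by simp_all
    show "atOb \<alpha> x \<in> Hom (D0 E) (onOb (tdom \<alpha>) x) (onOb (tcod \<alpha>) x)" if "x \<in> Objs D" for x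
      using that by (rule ob)
    show "atPro \<alpha> m \<in> cell E (onPro (tdom \<alpha>) m) (onPro (tcod \<alpha>) m) (atOb \<alpha> (psrc D m)) (atOb \<alpha> (ptgt D m))"
      if "m \<in> Pros D" for m
      using that F G by (simp add: pro cell_def Hom_def)
    show "atArr \<alpha> f \<in> cell E (idp E (onOb (tdom \<alpha>) x)) (onPro (tcod \<alpha>) (idp D y))
        (atOb \<alpha> x \<cdot>\<^bsub>D0 E\<^esub> onArr (tcod \<alpha>) f) (onArr (tdom \<alpha>) f \<cdot>\<^bsub>D0 E\<^esub> atOb \<alpha> y)" if "f \<in> Hom (D0 D) x y" for f x y
      using that cell[of f] F G by (auto simp: cell_def Hom_def tcell_def)
    show "lun_inv E (onPro (tdom \<alpha>) m) \<bullet>\<^bsub>E\<^esub>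
        (atArr \<alpha> f \<star>\<^bsub>E\<^esub> (onCell (tdom \<alpha>) \<gamma> \<bullet>\<^bsub>E\<^esub> atPro \<alpha> n)) \<bullet>\<^bsub>E\<^esub> laxator_idl D E (tcod \<alpha>) n =
      run_inv E (onPro (tdom \<alpha>) m) \<bullet>\<^bsub>E\<^esub>
        ((atPro \<alpha> m \<bullet>\<^bsub>E\<^esub> onCell (tcod \<alpha>) \<gamma>) \<star>\<^bsub>E\<^esub> atArr \<alpha> g) \<bullet>\<^bsub>E\<^esub> laxator_idr D E (tcod \<alpha>) n"
      if \<gamma>: "\<gamma> \<in> cell D m n f g" for \<gamma> m n f g
    proof -
      have s: "\<gamma> \<in> Cells D" "m = Dom (D1 D) \<gamma>" "n = Cod (D1 D) \<gamma>" "f = csrc D \<gamma>" "g = ctgt D \<gamma>"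
        using \<gamma> by (auto simp: cell_def Hom_def)
      show ?thesis unfolding s(2-) using arg_cong[OF nat[OF s(1)], of ucell] s(1) F G
        by (simp add: ucell_star_Nil laxator_idl_uobj laxator_idr_uobj ucell_S pro)
    qed
    show "laxator (tdom \<alpha>) (m, n) \<bullet>\<^bsub>E\<^esub> atPro \<alpha> (m \<odot>\<^bsub>D\<^esub> n) = (atPro \<alpha> m \<star>\<^bsub>E\<^esub> atPro \<alpha> n) \<bullet>\<^bsub>E\<^esub> laxator (tcod \<alpha>) (m, n)"
      if "(m, n) \<in> composable D" for m n
      using that F G E.lun_natural[of "idc E (atOb \<alpha> m)"] by (auto simp: pro)
    show "unitor (tdom \<alpha>) x \<bullet>\<^bsub>E\<^esub> atPro \<alpha> (idp D x) = idc E (atOb \<alpha> x) \<bullet>\<^bsub>E\<^esub> unitor (tcod \<alpha>) x"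
      if "x \<in> Objs D" for x
      using that F G by (simp add: pro)
    show "atArr \<alpha> (f \<cdot>\<^bsub>D0 D\<^esub> g) = lun_inv E (idp E (onOb (tdom \<alpha>) x)) \<bullet>\<^bsub>E\<^esub>
        ((atArr \<alpha> f \<bullet>\<^bsub>E\<^esub> onCell (tcod \<alpha>) (idc D g)) \<star>\<^bsub>E\<^esub> (idc E (onArr (tdom \<alpha>) f) \<bullet>\<^bsub>E\<^esub> atArr \<alpha> g)) \<bullet>\<^bsub>E\<^esub>
        laxator_idl D E (tcod \<alpha>) (idp D z)"
      if "f \<in> Hom (D0 D) x y" "g \<in> Hom (D0 D) y z" for f x y g z
    proof -
      have s: "f \<in> Arrs D" "g \<in> Arrs D" "Cod (D0 D) f = Dom (D0 D) g" "x = Dom (D0 D) f" "z = Cod (D0 D) g"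
        using that by (auto simp: Hom_def)
      show ?thesis unfolding s(4-) using arg_cong[OF comp[OF s(1-3)], of ucell] s(1-3) F G
        by (simp add: ucell_star_Nil laxator_idl_uobj ucell_S)
    qed
    show "atArr \<alpha> (ide (D0 D) x) = idc E (atOb \<alpha> x) \<bullet>\<^bsub>E\<^esub> unitor (tcod \<alpha>) x" if "x \<in> Objs D" for x
      using arg_cong[OF ide[OF that], of ucell] that F G by (simp add: ucell_S)
    show "atOb \<alpha> \<in> extensional (Objs D)" "atPro \<alpha> \<in> extensional (Pros D)" "atArr \<alpha> \<in> extensional (Arrs D)"
      using ext by simp_all
  qed
  then show ?thesis using F G unfolding utrans_def by simp
qed

text \<open>Components at proarrows are determined by those at objects, and extensionality settles
  the values outside the carriers.\<close>

lemma utrans_eqI: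
  assumes "utrans \<alpha>" "utrans \<beta>" "tdom \<alpha> = tdom \<beta>" "tcod \<alpha> = tcod \<beta>"
    "\<And>x. x \<in> Objs D \<Longrightarrow> atOb \<alpha> x = atOb \<beta> x" "\<And>f. f \<in> Arrs D \<Longrightarrow> tcell \<alpha> f = tcell \<beta> f"
  shows "\<alpha> = \<beta>"
proof -
  have e: "atOb \<alpha> \<in> extensional (Objs D)" "atPro \<alpha> \<in> extensional (Objs D)" "atArr \<alpha> \<in> extensional (Arrs D)"
    if "utrans \<alpha>" for \<alpha>
    using lax_transformation.trans_ext[OF utrans_lax[OF that]] by simp_all
  have 1: "atOb \<alpha> = atOb \<beta>" using e assms by (intro extensionalityI[of _ "Objs D"]) auto
  have 2: "atPro \<alpha> = atPro \<beta>" using e assms by (intro extensionalityI[of _ "Objs D"]) auto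
  have 3: "atArr \<alpha> = atArr \<beta>"
    using e assms by (intro extensionalityI[of _ "Arrs D"]) (auto simp: tcell_def)
  show ?thesis using 1 2 3 assms(3,4) by (cases \<alpha>, cases \<beta>) simp
qed

section \<open>Identity and composite transformations\<close>

lemma tdom_tcod_simps [simp]:
  "tdom (id_trans D E F) = F" "tcod (id_trans D E F) = F"
  "tdom (comp_trans D E \<alpha> \<beta>) = tdom \<alpha>" "tcod (comp_trans D E \<alpha> \<beta>) = tcod \<beta>"
  by (simp_all add: id_trans_def comp_trans_def)

lemma atOb_simps [simp]:
  "x \<in> Objs D \<Longrightarrow> atOb (id_trans D E F) x = ide (D0 E) (onOb F x)"
  "x \<in> Objs D \<Longrightarrow> atOb (comp_trans D E \<alpha> \<beta>) x = atOb \<alpha> x \<cdot>\<^bsub>D0 E\<^esub> atOb \<beta> x"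
  by (simp_all add: id_trans_def comp_trans_def)

lemma tcell_id: "uobj F \<Longrightarrow> f \<in> Arrs D \<Longrightarrow> tcell (id_trans D E F) f = idc S (onArr F f)"
  by (rule S_eqI) (simp_all add: tcell_def ucell_S id_trans_def)

lemma tcell_comp_trans:
  assumes "utrans \<alpha>" "utrans \<beta>" "tcod \<alpha> = tdom \<beta>" "f \<in> Arrs D"
  shows "tcell (comp_trans D E \<alpha> \<beta>) f =
    (idc S (atOb \<alpha> (Dom (D0 D) f)) \<^bold>\<cdot> tcell \<beta> f) \<^bold>\<star> (tcell \<alpha> f \<^bold>\<cdot> idc S (atOb \<beta> (Cod (D0 D) f)))"
proof -
  have G: "uobj (tdom \<beta>)" using assms by simp
  have "tcell (comp_trans D E \<alpha> \<beta>) f = ((onOb (tdom \<alpha>) (Dom (D0 D) f), []), (onOb (tcod \<beta>) (Cod (D0 D) f), []),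
      lun_inv E (idp E (onOb (tdom \<alpha>) (Dom (D0 D) f))) \<bullet>\<^bsub>E\<^esub>
      ((idc E (atOb \<alpha> (Dom (D0 D) f)) \<bullet>\<^bsub>E\<^esub> atArr \<beta> f) \<star>\<^bsub>E\<^esub> (atArr \<alpha> f \<bullet>\<^bsub>E\<^esub> idc E (atOb \<beta> (Cod (D0 D) f)))) \<bullet>\<^bsub>E\<^esub>
      lun E (idp E (onOb (tcod \<beta>) (Cod (D0 D) f))))"
    using assms by (simp add: tcell_def comp_trans_def laxator_idl_uobj Let_def)
  then show ?thesis
    by (intro S_eqI) (use assms G in \<open>simp_all add: ucell_star_Nil ucell_S\<close>)
qed

lemma utrans_id:
  assumes F: "uobj F" shows "utrans (id_trans D E F)"
proof (rule utransI, goal_cases)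
  case (7 f g)
  then show ?case using F by (simp add: tcell_id flip: S_idc_comp)
next
  case (6 s)
  have "idc S (ide (D0 E) (onOb F x)) = idcell S (onOb F x, [])" if "x \<in> Objs D" for x
    using S_idc_ide F that by simp
  then show ?case using 6 F by (simp add: tcell_id)
qed (use F in \<open>simp_all add: tcell_id\<close>, (simp_all add: id_trans_def Hom_def E.idc_ide)?)

lemma utrans_comp:
  assumes t: "utrans \<alpha>" "utrans \<beta>" "tcod \<alpha> = tdom \<beta>" shows "utrans (comp_trans D E \<alpha> \<beta>)"
proof (rule utransI, goal_cases)
  case (5 f)
  then show ?case using t by (simp add: tcell_comp_trans)
next
  case (6 s)
  let ?x = "Dom (D1 D) s" and ?y = "Cod (D1 D) s" and ?f = "csrc D s" and ?g = "ctgt D s"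
  let ?a = "\<lambda>x. idc S (atOb \<alpha> x)" and ?b = "\<lambda>x. idc S (atOb \<beta> x)"
  let ?F = "fcell (tdom \<alpha>) s" and ?G = "fcell (tdom \<beta>) s" and ?H = "fcell (tcod \<beta>) s"
  note [simp] = t S.star_cmp_idc S.idc_cmp_star
  \<comment> \<open>Naturality of \<alpha> followed by a component of \<beta>; the next fact is
    naturality of \<beta> preceded by a component of \<alpha>. External associativity lets a 2-cell
    cross the two factors of the composite transformation one after the other.\<close>
  have 1: "(tcell \<alpha> ?f \<^bold>\<cdot> ?b ?y) \<^bold>\<star> (?F \<^bold>\<cdot> ?a ?y \<^bold>\<cdot> ?b ?y) = (?a ?x \<^bold>\<cdot> ?G \<^bold>\<cdot> ?b ?y) \<^bold>\<star> (tcell \<alpha> ?g \<^bold>\<cdot> ?b ?y)"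
    using arg_cong[OF tcell_natural[OF t(1) 6], of "\<lambda>c. c \<^bold>\<cdot> ?b ?y"] 6 by simp
  have 2: "(?a ?x \<^bold>\<cdot> tcell \<beta> ?f) \<^bold>\<star> (?a ?x \<^bold>\<cdot> (?G \<^bold>\<cdot> ?b ?y)) = (?a ?x \<^bold>\<cdot> (?b ?x \<^bold>\<cdot> ?H)) \<^bold>\<star> (?a ?x \<^bold>\<cdot> tcell \<beta> ?g)"
    using arg_cong[OF tcell_natural[OF t(2) 6], of "\<lambda>c. ?a ?x \<^bold>\<cdot> c"] 6 by simp
  have "tcell (comp_trans D E \<alpha> \<beta>) ?f \<^bold>\<star> (?F \<^bold>\<cdot> idc S (atOb \<alpha> ?y \<cdot>\<^bsub>D0 E\<^esub> atOb \<beta> ?y)) =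
     (?a ?x \<^bold>\<cdot> tcell \<beta> ?f) \<^bold>\<star> ((tcell \<alpha> ?f \<^bold>\<cdot> ?b ?y) \<^bold>\<star> (?F \<^bold>\<cdot> ?a ?y \<^bold>\<cdot> ?b ?y))"
    using 6 by (simp add: tcell_comp_trans S_idc_comp)
  also have "\<dots> = ((?a ?x \<^bold>\<cdot> tcell \<beta> ?f) \<^bold>\<star> (?a ?x \<^bold>\<cdot> (?G \<^bold>\<cdot> ?b ?y))) \<^bold>\<star> (tcell \<alpha> ?g \<^bold>\<cdot> ?b ?y)"
    unfolding 1 using 6 by simp
  also have "\<dots> = (idc S (atOb \<alpha> ?x \<cdot>\<^bsub>D0 E\<^esub> atOb \<beta> ?x) \<^bold>\<cdot> ?H) \<^bold>\<star> tcell (comp_trans D E \<alpha> \<beta>) ?g"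
    unfolding 2 using 6 by (simp add: tcell_comp_trans S_idc_comp)
  finally show ?case using 6 by simp
next
  case (7 f g)
  let ?x = "Dom (D0 D) f" and ?y = "Cod (D0 D) f" and ?z = "Cod (D0 D) g"
  let ?a = "\<lambda>x. idc S (atOb \<alpha> x)" and ?b = "\<lambda>x. idc S (atOb \<beta> x)"
  let ?F = "\<lambda>f. idc S (onArr (tdom \<alpha>) f)" and ?G = "\<lambda>f. idc S (onArr (tdom \<beta>) f)" and ?H = "\<lambda>f. idc S (onArr (tcod \<beta>) f)"
  note [simp] = t S.star_cmp_idc S.idc_cmp_star
  have fg [simp]: "Dom (D0 D) g = ?y" using 7 by simp
  \<comment> \<open>The component at a composite arrow and the composite of the components differ
    only in their middle pair of factors. Both pairs are interchange forms of the single cell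
    \<open>?M\<close>.\<close>
  let ?M = "tcell \<alpha> f \<^bold>\<cdot> tcell \<beta> g"
  have 1: "(?a ?x \<^bold>\<cdot> (?G f \<^bold>\<cdot> tcell \<beta> g)) \<^bold>\<star> (tcell \<alpha> f \<^bold>\<cdot> (?G g \<^bold>\<cdot> ?b ?z)) = ?M"
  proof -
    have "(idc S (atOb \<alpha> ?x \<cdot>\<^bsub>D0 E\<^esub> onArr (tdom \<beta>) f) \<^bold>\<cdot> tcell \<beta> g) \<^bold>\<star>
       (tcell \<alpha> f \<^bold>\<cdot> idc S (onArr (tdom \<beta>) g \<cdot>\<^bsub>D0 E\<^esub> atOb \<beta> ?z)) = ?M"
      using 7(1,2) by (subst S.interchange) simp_all
    then show ?thesis using 7(1,2) by (simp add: S_idc_comp)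
  qed
  have 2: "(tcell \<alpha> f \<^bold>\<cdot> (?b ?y \<^bold>\<cdot> ?H g)) \<^bold>\<star> (?F f \<^bold>\<cdot> (?a ?y \<^bold>\<cdot> tcell \<beta> g)) = ?M"
  proof -
    have "(tcell \<alpha> f \<^bold>\<cdot> idc S (atOb \<beta> ?y \<cdot>\<^bsub>D0 E\<^esub> onArr (tcod \<beta>) g)) \<^bold>\<star>
        (idc S (onArr (tdom \<alpha>) f \<cdot>\<^bsub>D0 E\<^esub> atOb \<alpha> ?y) \<^bold>\<cdot> tcell \<beta> g) = ?M"
      using 7(1,2) by (subst S.interchange) simp_all
    then show ?thesis using 7(1,2) by (simp add: S_idc_comp)
  qed
  let ?u = "?a ?x \<^bold>\<cdot> (tcell \<beta> f \<^bold>\<cdot> ?H g)" and ?v = "?F f \<^bold>\<cdot> (tcell \<alpha> g \<^bold>\<cdot> ?b ?z)"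
  have "tcell (comp_trans D E \<alpha> \<beta>) (f \<cdot>\<^bsub>D0 D\<^esub> g) =
     ?u \<^bold>\<star> ((?a ?x \<^bold>\<cdot> (?G f \<^bold>\<cdot> tcell \<beta> g)) \<^bold>\<star> (tcell \<alpha> f \<^bold>\<cdot> (?G g \<^bold>\<cdot> ?b ?z))) \<^bold>\<star> ?v"
    using 7(1,2) by (simp add: tcell_comp_trans tcell_comp)
  also have "\<dots> = ?u \<^bold>\<star> ((tcell \<alpha> f \<^bold>\<cdot> (?b ?y \<^bold>\<cdot> ?H g)) \<^bold>\<star> (?F f \<^bold>\<cdot> (?a ?y \<^bold>\<cdot> tcell \<beta> g))) \<^bold>\<star> ?v"
    unfolding 1 2 ..
  also have "\<dots> = (tcell (comp_trans D E \<alpha> \<beta>) f \<^bold>\<cdot> ?H g) \<^bold>\<star> (?F f \<^bold>\<cdot> tcell (comp_trans D E \<alpha> \<beta>) g)"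
    using 7(1,2) by (simp add: tcell_comp_trans)
  finally show ?case by simp
next
  case (8 x)
  then show ?case using t by (simp add: tcell_comp_trans tcell_ide flip: S_idc_comp)
next
  case (4 x)
  then show ?case using t by (simp add: comp_trans_def E.idc_comp)
qed (use t in \<open>simp_all add: Hom_def\<close>, (simp_all add: comp_trans_def)?)

lemma comp_trans_id_left:
  assumes "utrans \<alpha>" "tdom \<alpha> = F" shows "comp_trans D E (id_trans D E F) \<alpha> = \<alpha>"
proof (rule utrans_eqI)
  have F: "uobj F" using assms utrans_uobj by blast
  show "utrans (comp_trans D E (id_trans D E F) \<alpha>)"
    by (rule utrans_comp) (use F assms utrans_id in simp_all)
  show "tcell (comp_trans D E (id_trans D E F) \<alpha>) f = tcell \<alpha> f" if "f \<in> Arrs D" for f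
    using that assms F by (simp add: tcell_comp_trans utrans_id tcell_id S_idc_ide S_idc_comp[symmetric])
qed (use assms in simp_all)

lemma comp_trans_id_right:
  assumes "utrans \<alpha>" "tcod \<alpha> = F" shows "comp_trans D E \<alpha> (id_trans D E F) = \<alpha>"
proof (rule utrans_eqI)
  have F: "uobj F" using assms utrans_uobj by blast
  show "utrans (comp_trans D E \<alpha> (id_trans D E F))"
    by (rule utrans_comp) (use F assms utrans_id in simp_all)
  show "tcell (comp_trans D E \<alpha> (id_trans D E F)) f = tcell \<alpha> f" if "f \<in> Arrs D" for f
    using that assms F by (simp add: tcell_comp_trans utrans_id tcell_id S_idc_ide S_idc_comp[symmetric])
qed (use assms in simp_all)

lemma comp_trans_assoc:
  assumes t: "utrans \<alpha>" "utrans \<beta>" "utrans \<gamma>" "tcod \<alpha> = tdom \<beta>" "tcod \<beta> = tdom \<gamma>"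
  shows "comp_trans D E (comp_trans D E \<alpha> \<beta>) \<gamma> = comp_trans D E \<alpha> (comp_trans D E \<beta> \<gamma>)"
proof (rule utrans_eqI)
  note c = utrans_comp[OF t(1,2,4)] utrans_comp[OF t(2,3,5)]
  show "utrans (comp_trans D E (comp_trans D E \<alpha> \<beta>) \<gamma>)" "utrans (comp_trans D E \<alpha> (comp_trans D E \<beta> \<gamma>))"
    using t c by (auto intro!: utrans_comp)
  show "tcell (comp_trans D E (comp_trans D E \<alpha> \<beta>) \<gamma>) f = tcell (comp_trans D E \<alpha> (comp_trans D E \<beta> \<gamma>)) f"
    if "f \<in> Arrs D" for f
    using that t c by (simp add: tcell_comp_trans S_idc_comp S.star_cmp_idc S.idc_cmp_star)
qed (use t in simp_all)

section \<open>Cartesian transformations and the category of objects and arrows\<close>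

lemma cart_objects_uobj [simp]: "F \<in> cart_objects D E \<Longrightarrow> uobj F"
  by (simp add: cart_objects_def uobj_def)

lemma cart_arrows_iff:
  "\<alpha> \<in> cart_arrows D E \<longleftrightarrow> utrans \<alpha> \<and> tdom \<alpha> \<in> cart_objects D E \<and> tcod \<alpha> \<in> cart_objects D E \<and> cartesian_transformation D E \<alpha>"
  unfolding cart_arrows_def utrans_def by auto

lemma proj_arr [simp]:
  assumes "x \<in> Objs D" "x' \<in> Objs D"
  shows "proj1 (P0 D) x x' \<in> Arrs D" "proj2 (P0 D) x x' \<in> Arrs D"
  using A.A0_products assms by (auto simp: VerDbl_def finite_products_def Hom_def)

lemma strictly_natural_iff:
  assumes "utrans \<alpha>" "f \<in> Arrs D"
  shows "strictly_natural_at D E \<alpha> f \<longleftrightarrow>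
    atOb \<alpha> (Dom (D0 D) f) \<cdot>\<^bsub>D0 E\<^esub> onArr (tcod \<alpha>) f = onArr (tdom \<alpha>) f \<cdot>\<^bsub>D0 E\<^esub> atOb \<alpha> (Cod (D0 D) f) \<and>
    tcell \<alpha> f = idc S (onArr (tdom \<alpha>) f \<cdot>\<^bsub>D0 E\<^esub> atOb \<alpha> (Cod (D0 D) f))"
proof -
  have "tcell \<alpha> f = idc S (onArr (tdom \<alpha>) f \<cdot>\<^bsub>D0 E\<^esub> atOb \<alpha> (Cod (D0 D) f)) \<longleftrightarrow>
     atArr \<alpha> f = idc E (onArr (tdom \<alpha>) f \<cdot>\<^bsub>D0 E\<^esub> atOb \<alpha> (Cod (D0 D) f))"
    using assms by (simp add: tcell_def E.strictify_simps)
  then show ?thesis using assms by (simp add: strictly_natural_at_def Let_def)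
qed

lemma strictly_natural_id:
  "uobj F \<Longrightarrow> f \<in> Arrs D \<Longrightarrow> strictly_natural_at D E (id_trans D E F) f"
  by (simp add: strictly_natural_iff utrans_id tcell_id)

text \<open>Both factors of the composite component are external identities. The two naturality
  squares show that they are identities on the same arrow, so their external composite is that
  identity again.\<close>

lemma strictly_natural_comp:
  assumes t: "utrans \<alpha>" "utrans \<beta>" "tcod \<alpha> = tdom \<beta>" "f \<in> Arrs D"
    and s: "strictly_natural_at D E \<alpha> f" "strictly_natural_at D E \<beta> f"
  shows "strictly_natural_at D E (comp_trans D E \<alpha> \<beta>) f"
proof -
  let ?x = "Dom (D0 D) f" and ?y = "Cod (D0 D) f"
  note a = s(1)[unfolded strictly_natural_iff[OF t(1,4)]] and b = s(2)[unfolded strictly_natural_iff[OF t(2,4)]]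
  have e: "atOb \<alpha> ?x \<cdot>\<^bsub>D0 E\<^esub> (onArr (tdom \<beta>) f \<cdot>\<^bsub>D0 E\<^esub> atOb \<beta> ?y) = onArr (tdom \<alpha>) f \<cdot>\<^bsub>D0 E\<^esub> (atOb \<alpha> ?y \<cdot>\<^bsub>D0 E\<^esub> atOb \<beta> ?y)"
    using arg_cong[OF conjunct1[OF a], of "\<lambda>h. h \<cdot>\<^bsub>D0 E\<^esub> atOb \<beta> ?y"] t by simp
  have "tcell (comp_trans D E \<alpha> \<beta>) f = idc S (atOb \<alpha> ?x \<cdot>\<^bsub>D0 E\<^esub> (onArr (tdom \<beta>) f \<cdot>\<^bsub>D0 E\<^esub> atOb \<beta> ?y)) \<^bold>\<star>
     idc S (onArr (tdom \<alpha>) f \<cdot>\<^bsub>D0 E\<^esub> (atOb \<alpha> ?y \<cdot>\<^bsub>D0 E\<^esub> atOb \<beta> ?y))"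
    using t a b by (simp add: tcell_comp_trans S_idc_comp)
  also have "\<dots> = idc S (onArr (tdom \<alpha>) f \<cdot>\<^bsub>D0 E\<^esub> (atOb \<alpha> ?y \<cdot>\<^bsub>D0 E\<^esub> atOb \<beta> ?y))"
    unfolding e using t by simp
  finally show ?thesis
    using t e b by (simp add: strictly_natural_iff utrans_comp)
qed

lemma id_trans_cart: "F \<in> cart_objects D E \<Longrightarrow> id_trans D E F \<in> cart_arrows D E"
  by (simp add: cart_arrows_iff utrans_id cartesian_transformation_def strictly_natural_id)

lemma comp_trans_cart:
  "\<alpha> \<in> cart_arrows D E \<Longrightarrow> \<beta> \<in> cart_arrows D E \<Longrightarrow> tcod \<alpha> = tdom \<beta> \<Longrightarrow> comp_trans D E \<alpha> \<beta> \<in> cart_arrows D E"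
  by (simp add: cart_arrows_iff utrans_comp cartesian_transformation_def strictly_natural_comp)

abbreviation "V \<equiv> vCartLax D E"

lemma V_sel [simp]:
  "Ob (V0 V) = cart_objects D E" "Arr (V0 V) = cart_arrows D E" "Dom (V0 V) = tdom" "Cod (V0 V) = tcod"
  "ide (V0 V) = id_trans D E" "cmp (V0 V) = comp_trans D E" "vpro V = cart_proarrows D E"
  "vsrc V = msrc D" "vtgt V = mtgt D" "vcell V = cart_multicells D E" "vin V = mmin" "vout V = mmout"
  "vleft V = mml" "vright V = mmr" "vid V = id_multimod D E" "vcmp V = comp_multimod D E"
  by (simp_all add: vCartLax_def)

lemma V0_cat: "category (V0 V)"
proof (unfold_locales, goal_cases)
  case (1 f) then show ?case by (simp add: cart_arrows_iff)
next
  case (2 f) then show ?case by (simp add: cart_arrows_iff)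
next
  case (3 x) then show ?case by (simp add: Hom_def id_trans_cart)
next
  case (4 f g) then show ?case by (simp add: Hom_def comp_trans_cart)
next
  case (5 f) then show ?case by (simp add: cart_arrows_iff comp_trans_id_left)
next
  case (6 f) then show ?case by (simp add: cart_arrows_iff comp_trans_id_right)
next
  case (7 f g h) then show ?case by (simp add: cart_arrows_iff comp_trans_assoc)
qed

end

section \<open>Modules between unitary lax functors\<close>

lemma prod_walking_sel [simp]:
  "Objs (prod_dbl D walking) = Objs D \<times> UNIV" "Arrs (prod_dbl D walking) = Arrs D \<times> UNIV"
  "Pros (prod_dbl D walking) = Pros D \<times> UNIV" "Cells (prod_dbl D walking) = Cells D \<times> UNIV"
  "Dom (D0 (prod_dbl D walking)) (f, w) = (Dom (D0 D) f, w)" "Cod (D0 (prod_dbl D walking)) (f, w) = (Cod (D0 D) f, w)"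
  "Dom (D1 (prod_dbl D walking)) (c, v) = (Dom (D1 D) c, v)" "Cod (D1 (prod_dbl D walking)) (c, v) = (Cod (D1 D) c, v)"
  "ide (D0 (prod_dbl D walking)) (x, w) = (ide (D0 D) x, w)" "idcell (prod_dbl D walking) (m, v) = (idcell D m, v)"
  "(f, w) \<cdot>\<^bsub>D0 (prod_dbl D walking)\<^esub> (g, w') = (f \<cdot>\<^bsub>D0 D\<^esub> g, w)"
  "(c, v) \<bullet>\<^bsub>prod_dbl D walking\<^esub> (d, v') = (c \<bullet>\<^bsub>D\<^esub> d, v)"
  "psrc (prod_dbl D walking) (m, v) = (psrc D m, wsrc v)" "ptgt (prod_dbl D walking) (m, v) = (ptgt D m, wtgt v)"
  "csrc (prod_dbl D walking) (c, v) = (csrc D c, wsrc v)" "ctgt (prod_dbl D walking) (c, v) = (ctgt D c, wtgt v)"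
  "idp (prod_dbl D walking) (x, w) = (idp D x, Idw w)" "idc (prod_dbl D walking) (f, w) = (idc D f, Idw w)"
  "(m, v) \<odot>\<^bsub>prod_dbl D walking\<^esub> (n, v') = (m \<odot>\<^bsub>D\<^esub> n, wodot v v')"
  "(c, v) \<star>\<^bsub>prod_dbl D walking\<^esub> (d, v') = (c \<star>\<^bsub>D\<^esub> d, wodot v v')"
  "assoc (prod_dbl D walking) (m, v) (n, v') (p, v'') = (assoc D m n p, wodot v (wodot v' v''))"
  "lun (prod_dbl D walking) (m, v) = (lun D m, v)" "run (prod_dbl D walking) (m, v) = (run D m, v)"
  by (simp_all add: prod_dbl_def prod_cat_def walking_def discrete_def)

lemma composable_prod_walking:
  "((m, v), (n, v')) \<in> composable (prod_dbl D walking) \<longleftrightarrow> (m, n) \<in> composable D \<and> wtgt v = wsrc v'"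
  by (auto simp: composable_def)

text \<open>\<open>Gen\<close> cannot be composed with itself, so the laxators of a module split
  into those of its source, those of its target, the left action and the right action.\<close>

lemma walking_pairs:
  assumes "wtgt v = wsrc v'"
  obtains "v = Idw Zero" "v' = Idw Zero" | "v = Idw Zero" "v' = Gen" | "v = Gen" "v' = Idw One" | "v = Idw One" "v' = Idw One"
proof -
  obtain w where "v = Idw w \<or> v = Gen" by (cases v) auto
  moreover obtain w' where "v' = Idw w' \<or> v' = Gen" by (cases v') auto
  ultimately show ?thesis using that assms by (cases w; cases w') auto
qed

context vertical_cart_lax
begin

definition umod where "umod M \<longleftrightarrow> is_module D E M \<and> uobj (msrc D M) \<and> uobj (mtgt D M)"

lemma umod_uobj [simp]: "umod M \<Longrightarrow> uobj (msrc D M)" "umod M \<Longrightarrow> uobj (mtgt D M)"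
  unfolding umod_def by simp_all

lemma umod_lax: "umod M \<Longrightarrow> lax_functor (prod_dbl D walking) E M"
  unfolding umod_def is_module_def by simp

definition mdcell :: "('o, 'f, 'o, 't, 'x, 'a, 'p, 'c) bimod \<Rightarrow> 't \<Rightarrow> ('x \<times> 'p list) \<times> ('x \<times> 'p list) \<times> 'c" where
  "mdcell M s = ((onOb (msrc D M) (Dom (D1 D) s), [mpro M (Dom (D1 D) s)]),
     (onOb (msrc D M) (Cod (D1 D) s), [mpro M (Cod (D1 D) s)]), mcell M s)"

lemma ucell_mdcell [simp]: "ucell (mdcell M s) = mcell M s"
  by (simp add: mdcell_def)

text \<open>The unitors of \<open>M\<close> are those of its source and target, hence identities.
  The two unit laws at \<open>(x, Gen)\<close> then force the left action to be \<open>lun\<close>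
  and the right action to be \<open>run\<close>; the equivariance axioms thereby turn into coherence
  statements.\<close>

lemma umod_simps [simp]:
  assumes M: "umod M"
  shows "x \<in> Objs D \<Longrightarrow> mpro M x \<in> Pros E"
    "x \<in> Objs D \<Longrightarrow> psrc E (mpro M x) = onOb (msrc D M) x"
    "x \<in> Objs D \<Longrightarrow> ptgt E (mpro M x) = onOb (mtgt D M) x"
    "s \<in> Cells D \<Longrightarrow> mcell M s \<in> Cells E"
    "s \<in> Cells D \<Longrightarrow> Dom (D1 E) (mcell M s) = mpro M (Dom (D1 D) s)"
    "s \<in> Cells D \<Longrightarrow> Cod (D1 E) (mcell M s) = mpro M (Cod (D1 D) s)"
    "s \<in> Cells D \<Longrightarrow> csrc E (mcell M s) = onArr (msrc D M) (csrc D s)"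
    "s \<in> Cells D \<Longrightarrow> ctgt E (mcell M s) = onArr (mtgt D M) (ctgt D s)"
    "x \<in> Objs D \<Longrightarrow> mcell M (idcell D x) = idcell E (mpro M x)"
    "s \<in> Cells D \<Longrightarrow> t \<in> Cells D \<Longrightarrow> Cod (D1 D) s = Dom (D1 D) t \<Longrightarrow>
       mcell M (s \<bullet>\<^bsub>D\<^esub> t) = mcell M s \<bullet>\<^bsub>E\<^esub> mcell M t"
    "x \<in> Objs D \<Longrightarrow> lact M x x = lun E (mpro M x)"
    "x \<in> Objs D \<Longrightarrow> ract M x x = run E (mpro M x)"
proof -
  interpret M: lax_functor "prod_dbl D walking" E M using umod_lax[OF M] .
  note f1 = M.functor1[unfolded is_functor_def Hom_def, simplified]
  show t: "x \<in> Objs D \<Longrightarrow> mpro M x \<in> Pros E"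
    "x \<in> Objs D \<Longrightarrow> psrc E (mpro M x) = onOb (msrc D M) x"
    "x \<in> Objs D \<Longrightarrow> ptgt E (mpro M x) = onOb (mtgt D M) x" for x
    using f1 M.fun_src_tgt[of "(x, Gen)"] by (auto simp: mod_at_def)
  show c: "s \<in> Cells D \<Longrightarrow> mcell M s \<in> Cells E"
    "s \<in> Cells D \<Longrightarrow> Dom (D1 E) (mcell M s) = mpro M (Dom (D1 D) s)"
    "s \<in> Cells D \<Longrightarrow> Cod (D1 E) (mcell M s) = mpro M (Cod (D1 D) s)" for s
    using f1 by fastforce+
  show "s \<in> Cells D \<Longrightarrow> csrc E (mcell M s) = onArr (msrc D M) (csrc D s)"
    "s \<in> Cells D \<Longrightarrow> ctgt E (mcell M s) = onArr (mtgt D M) (ctgt D s)"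
    using M.fun_csrc_ctgt[of "(s, Gen)"] by (auto simp: mod_at_def)
  show i: "x \<in> Objs D \<Longrightarrow> mcell M (idcell D x) = idcell E (mpro M x)" for x
    using f1 by (metis UNIV_I prod_walking_sel(10) SigmaI)
  show "s \<in> Cells D \<Longrightarrow> t \<in> Cells D \<Longrightarrow> Cod (D1 D) s = Dom (D1 D) t \<Longrightarrow>
       mcell M (s \<bullet>\<^bsub>D\<^esub> t) = mcell M s \<bullet>\<^bsub>E\<^esub> mcell M t"
    using f1 by (metis UNIV_I prod_walking_sel(7,8,12) SigmaI)
  have u: "unitor M (x, Zero) = idcell E (idp E (onOb (msrc D M) x))" "unitor M (x, One) = idcell E (idp E (onOb (mtgt D M) x))"
    if "x \<in> Objs D" for x
    using uobj_simps(8)[OF umod_uobj(1)[OF M] that] uobj_simps(8)[OF umod_uobj(2)[OF M] that] that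
    by (simp_all add: mod_at_def)
  have o: "onPro M (x, Idw Zero) = idp E (onOb (msrc D M) x)" "onPro M (x, Idw One) = idp E (onOb (mtgt D M) x)"
    if "x \<in> Objs D" for x
    using uobj_simps(7)[OF umod_uobj(1)[OF M] that] uobj_simps(7)[OF umod_uobj(2)[OF M] that] that
    by (simp_all add: mod_at_def)
  show "lact M x x = lun E (mpro M x)" if x: "x \<in> Objs D"
  proof -
    have "lact M x x \<in> globular E (onPro M (x, Idw Zero) \<odot>\<^bsub>E\<^esub> mpro M x) (mpro M x)"
      using M.laxator_in[of "(x, Idw Zero)" "(x, Gen)"] x by (simp add: composable_prod_walking)
    then have l: "lact M x x \<in> Cells E" "Dom (D1 E) (lact M x x) = idp E (onOb (msrc D M) x) \<odot>\<^bsub>E\<^esub> mpro M x"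
      "Cod (D1 E) (lact M x x) = mpro M x"
      using x by (simp_all add: globular_def cell_def Hom_def o)
    show ?thesis
      using M.left_unital[of "(x, Gen)"] x l M by (simp add: u i t E.star_id)
  qed
  show "ract M x x = run E (mpro M x)" if x: "x \<in> Objs D"
  proof -
    have "ract M x x \<in> globular E (mpro M x \<odot>\<^bsub>E\<^esub> onPro M (x, Idw One)) (mpro M x)"
      using M.laxator_in[of "(x, Gen)" "(x, Idw One)"] x by (simp add: composable_prod_walking)
    then have l: "ract M x x \<in> Cells E" "Dom (D1 E) (ract M x x) = mpro M x \<odot>\<^bsub>E\<^esub> idp E (onOb (mtgt D M) x)"
      "Cod (D1 E) (ract M x x) = mpro M x"
      using x by (simp_all add: globular_def cell_def Hom_def o)
    show ?thesis
      using M.right_unital[of "(x, Gen)"] x l M by (simp add: u i t E.star_id)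
  qed
qed

lemma mdcell_closed [simp]:
  assumes "umod M" "s \<in> Cells D"
  shows "mdcell M s \<in> Cells S" "Dom (D1 S) (mdcell M s) = (onOb (msrc D M) (Dom (D1 D) s), [mpro M (Dom (D1 D) s)])"
    "Cod (D1 S) (mdcell M s) = (onOb (msrc D M) (Cod (D1 D) s), [mpro M (Cod (D1 D) s)])"
    "csrc S (mdcell M s) = onArr (msrc D M) (csrc D s)" "ctgt S (mdcell M s) = onArr (mtgt D M) (ctgt D s)"
  using assms by (simp_all add: mdcell_def)

lemma mdcell_cmp:
  assumes "umod M" "s \<in> Cells D" "t \<in> Cells D" "Cod (D1 D) s = Dom (D1 D) t"
  shows "mdcell M (s \<bullet>\<^bsub>D\<^esub> t) = mdcell M s \<^bold>\<cdot> mdcell M t"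
  by (rule S_eqI) (use assms in \<open>simp_all add: ucell_S\<close>)

lemma mdcell_idcell:
  assumes "umod M" "x \<in> Objs D"
  shows "mdcell M (idcell D x) = idcell S (onOb (msrc D M) x, [mpro M x])"
proof -
  have "Dom (D1 D) (idcell D x) = x" "Cod (D1 D) (idcell D x) = x" "idcell D x \<in> Cells D"
    using D.D1.ide_closed[of x] assms by simp_all
  then show ?thesis by (intro S_eqI) (use assms in \<open>simp_all add: ucell_S\<close>)
qed

text \<open>Naturality of the left action. As that action is \<open>lun\<close>, the external
  composite with an empty path in the strictification absorbs it completely.\<close>

lemma mdcell_star_left:
  assumes M: "umod M" and st: "s \<in> Cells D" "t \<in> Cells D" "ctgt D s = csrc D t"
  shows "mdcell M (s \<star>\<^bsub>D\<^esub> t) = fcell (msrc D M) s \<^bold>\<star> mdcell M t"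
proof -
  interpret M: lax_functor "prod_dbl D walking" E M using umod_lax[OF M] .
  note fr = D_star_frames[OF st]
  have "onCell M (s, Idw Zero) = onCell (msrc D M) s" using st by (simp add: mod_at_def)
  then have "(onCell (msrc D M) s \<star>\<^bsub>E\<^esub> mcell M t) \<bullet>\<^bsub>E\<^esub> lun E (mpro M (Cod (D1 D) s)) =
     lun E (mpro M (Dom (D1 D) s)) \<bullet>\<^bsub>E\<^esub> mcell M (s \<star>\<^bsub>D\<^esub> t)"
    using M.laxator_natural[of "(s, Idw Zero)" "(t, Gen)"] M st fr[symmetric] by simp
  then show ?thesis
    by (intro S_eqI) (use M st fr in \<open>simp_all add: ucell_star_Nil E.D1.inverse_cmp_cancel\<close>)
qed

lemma ucell_star_Nil_right:
  assumes "c \<in> Cells S" "d \<in> Cells S" "ctgt S c = csrc S d" "Dom (D1 S) d = (x, [])"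
    "Cod (D1 S) d = (y, [])"
  shows "ucell (c \<^bold>\<star> d) = run_inv E (path_odot E (Dom (D1 S) c)) \<bullet>\<^bsub>E\<^esub> (ucell c \<star>\<^bsub>E\<^esub> ucell d) \<bullet>\<^bsub>E\<^esub> run E (path_odot E (Cod (D1 S) c))"
  using assms S.D1.Dom_in[of c] S.D1.Cod_in[of c] by (simp add: ucell_S E.path_coh_Nil)

lemma mdcell_star_right:
  assumes M: "umod M" and st: "s \<in> Cells D" "t \<in> Cells D" "ctgt D s = csrc D t"
  shows "mdcell M (s \<star>\<^bsub>D\<^esub> t) = mdcell M s \<^bold>\<star> fcell (mtgt D M) t"
proof -
  interpret M: lax_functor "prod_dbl D walking" E M using umod_lax[OF M] .
  note fr = D_star_frames[OF st]
  have "onCell M (t, Idw One) = onCell (mtgt D M) t" using st by (simp add: mod_at_def)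
  then have "(mcell M s \<star>\<^bsub>E\<^esub> onCell (mtgt D M) t) \<bullet>\<^bsub>E\<^esub> run E (mpro M (Cod (D1 D) s)) =
     run E (mpro M (Dom (D1 D) s)) \<bullet>\<^bsub>E\<^esub> mcell M (s \<star>\<^bsub>D\<^esub> t)"
    using M.laxator_natural[of "(s, Gen)" "(t, Idw One)"] M st fr[symmetric] by simp
  then show ?thesis
    by (intro S_eqI) (use M st fr in \<open>simp_all add: ucell_star_Nil_right E.D1.inverse_cmp_cancel\<close>)
qed

text \<open>A lax functor on \<open>prod_dbl D walking\<close> glued from its two end functors and
  the values \<open>Mp\<close>, \<open>Mc\<close> over \<open>Gen\<close>. The actions are filled in
  as unit isomorphisms, the only choice compatible with unitary ends.\<close>

definition mk_mod where
  "mk_mod F G Mp Mc = \<lparr>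
     onOb = (\<lambda>(x, w)\<in>Objs D \<times> UNIV. case w of Zero \<Rightarrow> onOb F x | One \<Rightarrow> onOb G x),
     onArr = (\<lambda>(f, w)\<in>Arrs D \<times> UNIV. case w of Zero \<Rightarrow> onArr F f | One \<Rightarrow> onArr G f),
     onPro = (\<lambda>(x, v)\<in>Objs D \<times> UNIV. case v of Gen \<Rightarrow> Mp x | Idw w \<Rightarrow> (case w of Zero \<Rightarrow> onPro F x | One \<Rightarrow> onPro G x)),
     onCell = (\<lambda>(s, v)\<in>Cells D \<times> UNIV. case v of Gen \<Rightarrow> Mc s | Idw w \<Rightarrow> (case w of Zero \<Rightarrow> onCell F s | One \<Rightarrow> onCell G s)),
     laxator = (\<lambda>((x, v), (y, v'))\<in>composable (prod_dbl D walking).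
       case v of Gen \<Rightarrow> run E (Mp x)
       | Idw w \<Rightarrow> (case v' of Gen \<Rightarrow> lun E (Mp x) | Idw w' \<Rightarrow> (case w of Zero \<Rightarrow> laxator F (x, y) | One \<Rightarrow> laxator G (x, y)))),
     unitor = (\<lambda>(x, w)\<in>Objs D \<times> UNIV. case w of Zero \<Rightarrow> unitor F x | One \<Rightarrow> unitor G x) \<rparr>"

lemma mk_mod_simps [simp]:
  "x \<in> Objs D \<Longrightarrow> onOb (mk_mod F G Mp Mc) (x, Zero) = onOb F x"
  "x \<in> Objs D \<Longrightarrow> onOb (mk_mod F G Mp Mc) (x, One) = onOb G x"
  "f \<in> Arrs D \<Longrightarrow> onArr (mk_mod F G Mp Mc) (f, Zero) = onArr F f"
  "f \<in> Arrs D \<Longrightarrow> onArr (mk_mod F G Mp Mc) (f, One) = onArr G f"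
  "x \<in> Objs D \<Longrightarrow> onPro (mk_mod F G Mp Mc) (x, Idw Zero) = onPro F x"
  "x \<in> Objs D \<Longrightarrow> onPro (mk_mod F G Mp Mc) (x, Idw One) = onPro G x"
  "x \<in> Objs D \<Longrightarrow> mpro (mk_mod F G Mp Mc) x = Mp x"
  "s \<in> Cells D \<Longrightarrow> onCell (mk_mod F G Mp Mc) (s, Idw Zero) = onCell F s"
  "s \<in> Cells D \<Longrightarrow> onCell (mk_mod F G Mp Mc) (s, Idw One) = onCell G s"
  "s \<in> Cells D \<Longrightarrow> mcell (mk_mod F G Mp Mc) s = Mc s"
  "x \<in> Objs D \<Longrightarrow> laxator (mk_mod F G Mp Mc) ((x, Idw Zero), (x, Idw Zero)) = laxator F (x, x)"
  "x \<in> Objs D \<Longrightarrow> laxator (mk_mod F G Mp Mc) ((x, Idw One), (x, Idw One)) = laxator G (x, x)"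
  "x \<in> Objs D \<Longrightarrow> lact (mk_mod F G Mp Mc) x x = lun E (Mp x)"
  "x \<in> Objs D \<Longrightarrow> ract (mk_mod F G Mp Mc) x x = run E (Mp x)"
  "x \<in> Objs D \<Longrightarrow> unitor (mk_mod F G Mp Mc) (x, Zero) = unitor F x"
  "x \<in> Objs D \<Longrightarrow> unitor (mk_mod F G Mp Mc) (x, One) = unitor G x"
  by (simp_all add: mk_mod_def composable_prod_walking)

lemma lax_fun_ext: "uobj F \<Longrightarrow> onOb F \<in> extensional (Objs D) \<and> onArr F \<in> extensional (Arrs D) \<and>
    onPro F \<in> extensional (Objs D) \<and> onCell F \<in> extensional (Cells D) \<and>
    laxator F \<in> extensional (composable D) \<and> unitor F \<in> extensional (Objs D)"
  using lax_functor.fun_ext[of D E F] by (simp add: uobj_def)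

text \<open>Equality with \<open>F\<close> and \<open>G\<close> holds as records: both sides are
  \<open>undefined\<close> off the carriers, and over \<open>VerDbl A\<close> the composable pairs
  are just the diagonal ones.\<close>

lemma mod_at_mk_mod:
  assumes "uobj F" "uobj G"
  shows "msrc D (mk_mod F G Mp Mc) = F" "mtgt D (mk_mod F G Mp Mc) = G"
proof -
  have e: "(\<lambda>x\<in>Objs D. onOb F x) = onOb F" "(\<lambda>x\<in>Arrs D. onArr F x) = onArr F" "(\<lambda>x\<in>Objs D. onPro F x) = onPro F"
    "(\<lambda>x\<in>Cells D. onCell F x) = onCell F" "(\<lambda>x\<in>Objs D. unitor F x) = unitor F" if "uobj F" for F
    using lax_fun_ext[OF that] by (auto intro: extensional_restrict)
  have l: "(\<lambda>(m, n)\<in>composable D. laxator (mk_mod F G Mp Mc) ((m, Idw Zero), (n, Idw Zero))) = laxator F"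
    "(\<lambda>(m, n)\<in>composable D. laxator (mk_mod F G Mp Mc) ((m, Idw One), (n, Idw One))) = laxator G"
    using lax_fun_ext[OF assms(1)] lax_fun_ext[OF assms(2)]
    by (auto intro!: extensionalityI[of _ "composable D"])
  show "msrc D (mk_mod F G Mp Mc) = F" unfolding mod_at_def l
    using e[OF assms(1)] by (cases F) (simp cong: restrict_cong)
  show "mtgt D (mk_mod F G Mp Mc) = G" unfolding mod_at_def l
    using e[OF assms(2)] by (cases G) (simp cong: restrict_cong)
qed

text \<open>Only naturality of the two actions has to be supplied. Associativity of the laxators is
  a fact about units of \<open>E\<close>: triples with \<open>Gen\<close> at an end reduce to the
  triangle, and the triple with \<open>Gen\<close> in the middle to \<open>lun_odot\<close> with
  naturality of \<open>lun\<close>.\<close>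

lemma mk_mod_umod:
  assumes F: "uobj F" and G: "uobj G"
    and pro: "\<And>x. x \<in> Objs D \<Longrightarrow> Mp x \<in> Pros E \<and> psrc E (Mp x) = onOb F x \<and> ptgt E (Mp x) = onOb G x"
    and cell: "\<And>s. s \<in> Cells D \<Longrightarrow> Mc s \<in> Cells E \<and> Dom (D1 E) (Mc s) = Mp (Dom (D1 D) s) \<and>
      Cod (D1 E) (Mc s) = Mp (Cod (D1 D) s) \<and> csrc E (Mc s) = onArr F (csrc D s) \<and> ctgt E (Mc s) = onArr G (ctgt D s)"
    and cmp: "\<And>s t. s \<in> Cells D \<Longrightarrow> t \<in> Cells D \<Longrightarrow> Cod (D1 D) s = Dom (D1 D) t \<Longrightarrow> Mc (s \<bullet>\<^bsub>D\<^esub> t) = Mc s \<bullet>\<^bsub>E\<^esub> Mc t"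
    and idc: "\<And>x. x \<in> Objs D \<Longrightarrow> Mc (idcell D x) = idcell E (Mp x)"
    and left: "\<And>s t. s \<in> Cells D \<Longrightarrow> t \<in> Cells D \<Longrightarrow> ctgt D s = csrc D t \<Longrightarrow>
      (onCell F s \<star>\<^bsub>E\<^esub> Mc t) \<bullet>\<^bsub>E\<^esub> lun E (Mp (Cod (D1 D) s)) = lun E (Mp (Dom (D1 D) s)) \<bullet>\<^bsub>E\<^esub> Mc (s \<star>\<^bsub>D\<^esub> t)"
    and right: "\<And>s t. s \<in> Cells D \<Longrightarrow> t \<in> Cells D \<Longrightarrow> ctgt D s = csrc D t \<Longrightarrow>
      (Mc s \<star>\<^bsub>E\<^esub> onCell G t) \<bullet>\<^bsub>E\<^esub> run E (Mp (Cod (D1 D) s)) = run E (Mp (Dom (D1 D) s)) \<bullet>\<^bsub>E\<^esub> Mc (s \<star>\<^bsub>D\<^esub> t)"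
  shows "umod (mk_mod F G Mp Mc)"
proof -
  let ?M = "mk_mod F G Mp Mc"
  interpret F: lax_functor D E F using F by (simp add: uobj_def)
  interpret G: lax_functor D E G using G by (simp add: uobj_def)
  have ID: "idcell D x \<in> Cells D" "Dom (D1 D) (idcell D x) = x" "Cod (D1 D) (idcell D x) = x" if "x \<in> Objs D" for x
    using D.D1.ide_closed[of x] that by simp_all
  note [simp] = F G pro cell ID
  have w: "w = Zero \<or> w = One" for w by (cases w) auto
  have v: "v = Idw Zero \<or> v = Idw One \<or> v = Gen" for v by (cases v) (auto simp: w)
  have [simp]: "laxator F (x, x) = lun E (idp E (onOb F x))" "laxator G (x, x) = lun E (idp E (onOb G x))" if "x \<in> Objs D" for x
    using that by simp_all
  have as: "(lun E (idp E (psrc E m)) \<star>\<^bsub>E\<^esub> idcell E m) \<bullet>\<^bsub>E\<^esub> lun E m = assoc E (idp E (psrc E m)) (idp E (psrc E m)) m \<bullet>\<^bsub>E\<^esub>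
      ((idcell E (idp E (psrc E m)) \<star>\<^bsub>E\<^esub> lun E m) \<bullet>\<^bsub>E\<^esub> lun E m)"
    "(lun E m \<star>\<^bsub>E\<^esub> idcell E (idp E (ptgt E m))) \<bullet>\<^bsub>E\<^esub> run E m = assoc E (idp E (psrc E m)) m (idp E (ptgt E m)) \<bullet>\<^bsub>E\<^esub>
      ((idcell E (idp E (psrc E m)) \<star>\<^bsub>E\<^esub> run E m) \<bullet>\<^bsub>E\<^esub> lun E m)"
    "(run E m \<star>\<^bsub>E\<^esub> idcell E (idp E (ptgt E m))) \<bullet>\<^bsub>E\<^esub> run E m = assoc E m (idp E (ptgt E m)) (idp E (ptgt E m)) \<bullet>\<^bsub>E\<^esub>
      ((idcell E m \<star>\<^bsub>E\<^esub> lun E (idp E (ptgt E m))) \<bullet>\<^bsub>E\<^esub> run E m)" if m: "m \<in> Pros E" for m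
  proof -
    let ?I = "idp E (psrc E m)" and ?J = "idp E (ptgt E m)"
    show "(lun E ?I \<star>\<^bsub>E\<^esub> idcell E m) \<bullet>\<^bsub>E\<^esub> lun E m = assoc E ?I ?I m \<bullet>\<^bsub>E\<^esub> ((idcell E ?I \<star>\<^bsub>E\<^esub> lun E m) \<bullet>\<^bsub>E\<^esub> lun E m)"
      using E.triangle[of ?I m, symmetric] m by simp
    have "(idcell E ?I \<star>\<^bsub>E\<^esub> run E m) \<bullet>\<^bsub>E\<^esub> lun E m = lun E (m \<odot>\<^bsub>E\<^esub> ?J) \<bullet>\<^bsub>E\<^esub> run E m"
      using E.lun_natural[of "run E m"] m by (simp add: E.idc_ide)
    then have "assoc E ?I m ?J \<bullet>\<^bsub>E\<^esub> ((idcell E ?I \<star>\<^bsub>E\<^esub> run E m) \<bullet>\<^bsub>E\<^esub> lun E m) = (assoc E ?I m ?J \<bullet>\<^bsub>E\<^esub> lun E (m \<odot>\<^bsub>E\<^esub> ?J)) \<bullet>\<^bsub>E\<^esub> run E m"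
      using m by simp
    also have "assoc E ?I m ?J \<bullet>\<^bsub>E\<^esub> lun E (m \<odot>\<^bsub>E\<^esub> ?J) = lun E m \<star>\<^bsub>E\<^esub> idcell E ?J"
      using E.lun_odot[of m ?J] m by simp
    finally show "(lun E m \<star>\<^bsub>E\<^esub> idcell E ?J) \<bullet>\<^bsub>E\<^esub> run E m = assoc E ?I m ?J \<bullet>\<^bsub>E\<^esub> ((idcell E ?I \<star>\<^bsub>E\<^esub> run E m) \<bullet>\<^bsub>E\<^esub> lun E m)"
      by simp
    show "(run E m \<star>\<^bsub>E\<^esub> idcell E ?J) \<bullet>\<^bsub>E\<^esub> run E m = assoc E m ?J ?J \<bullet>\<^bsub>E\<^esub> ((idcell E m \<star>\<^bsub>E\<^esub> lun E ?J) \<bullet>\<^bsub>E\<^esub> run E m)"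
      using E.triangle[of m ?J, symmetric] m by simp
  qed
  have asF: "(lun E (idp E x) \<star>\<^bsub>E\<^esub> idcell E (idp E x)) \<bullet>\<^bsub>E\<^esub> lun E (idp E x) = assoc E (idp E x) (idp E x) (idp E x) \<bullet>\<^bsub>E\<^esub>
      ((idcell E (idp E x) \<star>\<^bsub>E\<^esub> lun E (idp E x)) \<bullet>\<^bsub>E\<^esub> lun E (idp E x))" if "x \<in> Objs E" for x
    using as(1)[of "idp E x"] that by simp
  have as': "(lun E (idp E (onOb F x)) \<star>\<^bsub>E\<^esub> idcell E (Mp x)) \<bullet>\<^bsub>E\<^esub> lun E (Mp x) = assoc E (idp E (onOb F x)) (idp E (onOb F x)) (Mp x) \<bullet>\<^bsub>E\<^esub>
      ((idcell E (idp E (onOb F x)) \<star>\<^bsub>E\<^esub> lun E (Mp x)) \<bullet>\<^bsub>E\<^esub> lun E (Mp x))"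
    "(lun E (Mp x) \<star>\<^bsub>E\<^esub> idcell E (idp E (onOb G x))) \<bullet>\<^bsub>E\<^esub> run E (Mp x) = assoc E (idp E (onOb F x)) (Mp x) (idp E (onOb G x)) \<bullet>\<^bsub>E\<^esub>
      ((idcell E (idp E (onOb F x)) \<star>\<^bsub>E\<^esub> run E (Mp x)) \<bullet>\<^bsub>E\<^esub> lun E (Mp x))"
    "(run E (Mp x) \<star>\<^bsub>E\<^esub> idcell E (idp E (onOb G x))) \<bullet>\<^bsub>E\<^esub> run E (Mp x) = assoc E (Mp x) (idp E (onOb G x)) (idp E (onOb G x)) \<bullet>\<^bsub>E\<^esub>
      ((idcell E (Mp x) \<star>\<^bsub>E\<^esub> lun E (idp E (onOb G x))) \<bullet>\<^bsub>E\<^esub> run E (Mp x))" if "x \<in> Objs D" for x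
    using as[of "Mp x"] that by simp_all
  have "lax_functor (prod_dbl D walking) E ?M"
  proof (unfold_locales, goal_cases)
    case 1
    show ?case unfolding is_functor_def
    proof (intro conjI ballI impI, goal_cases)
      case (1 p) then show ?case using w[of "snd p"] by (cases p) auto
    next
      case (2 p) then show ?case using w[of "snd p"] by (cases p) (auto simp: Hom_def)
    next
      case (3 p) then show ?case using w[of "snd p"] by (cases p) auto
    next
      case (4 p q) then show ?case using w[of "snd p"] by (cases p; cases q) auto
    qed
  next
    case 2
    show ?case unfolding is_functor_def
    proof (intro conjI ballI impI, goal_cases)
      case (1 p) then show ?case using v[of "snd p"] by (cases p) auto
    next
      case (2 p) then show ?case using v[of "snd p"] by (cases p) (auto simp: Hom_def)
    next
      case (3 p) then show ?case using v[of "snd p"] by (cases p) (auto simp: idc)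
    next
      case (4 p q) then show ?case using v[of "snd p"] by (cases p; cases q) (auto simp: cmp)
    qed
  next
    case (3 p) then show ?case using v[of "snd p"] by (cases p) auto
  next
    case (4 p) then show ?case using v[of "snd p"] by (cases p) auto
  next
    case (5 p q)
    obtain x v y v' where pq: "p = (x, v)" "q = (y, v')" by (cases p; cases q) auto
    have h: "x \<in> Objs D" "y = x" "wtgt v = wsrc v'" using 5 by (simp_all add: pq composable_prod_walking)
    show ?case unfolding pq h(2) using h(3)
      by (cases rule: walking_pairs) (simp_all add: h(1) globular_def cell_def Hom_def)
  next
    case (6 p) then show ?case using w[of "snd p"] by (cases p) (auto simp: globular_def cell_def Hom_def)
  next
    case (7 p q)
    obtain s v t v' where pq: "p = (s, v)" "q = (t, v')" by (cases p; cases q) auto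
    have h: "s \<in> Cells D" "t \<in> Cells D" "ctgt D s = csrc D t" "wtgt v = wsrc v'" using 7 by (simp_all add: pq)
    note fr = D_star_frames[OF h(1-3)]
    show ?case using h(4)
    proof (cases rule: walking_pairs)
      case 1
      then show ?thesis using F.laxator_natural[OF h(1-3)] h fr pq by simp
    next
      case 2
      then show ?thesis using left[OF h(1-3)] h fr pq by simp
    next
      case 3
      then show ?thesis using right[OF h(1-3)] h fr pq by simp
    next
      case 4
      then show ?thesis using G.laxator_natural[OF h(1-3)] h fr pq by simp
    qed
  next
    case (8 p) then show ?case using w[of "snd p"] by (cases p) auto
  next
    case (9 p q r)
    obtain x v y v' z v'' where pq: "p = (x, v)" "q = (y, v')" "r = (z, v'')" by (cases p; cases q; cases r) auto
    have h: "x \<in> Objs D" "y = x" "z = x" "wtgt v = wsrc v'" "wtgt v' = wsrc v''"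
      using 9 by (simp_all add: pq composable_prod_walking)
    show ?case unfolding pq h(2,3) using h(4)
      by (cases rule: walking_pairs) (use h(1) h(5) v[of v''] in \<open>auto simp: as' asF idc\<close>)
  next
    case (10 p) then show ?case using v[of "snd p"] by (cases p) (auto simp: idc E.star_id)
  next
    case (11 p) then show ?case using v[of "snd p"] by (cases p) (auto simp: idc E.star_id)
  qed (simp_all add: mk_mod_def)
  then show ?thesis unfolding umod_def is_module_def mod_at_mk_mod[OF F G] using F G by simp
qed

end

section \<open>Multimodulations\<close>

text \<open>Blocks of length one leave a path as it is, and \<open>coh\<close> of a single proarrow
  with a non-empty path is an identity.\<close>

lemma (in double_category) cohs_singles:
  "ppath D x ms y \<Longrightarrow> cohs D x (singles ms) = idcell D (odots D x ms)"
proof (induction ms arbitrary: x rule: induct_list012)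
  case (3 m n ms)
  have p: "ppath D (ptgt D m) (n # ms) y" "m \<in> Pros D" using 3(3) by auto
  have IH: "cohs D (ptgt D m) (singles (n # ms)) = idcell D (odots D (ptgt D m) (n # ms))"
    by (rule 3(2)[OF p(1)])
  have "concat (singles (n # ms)) = n # ms" by (induction ms) auto
  then have "cohs D x (singles (m # n # ms)) =
      (idcell D m \<star> idcell D (odots D (ptgt D m) (n # ms))) \<bullet> coh D x [m] (n # ms)"
    using IH by (simp add: chain_end_def)
  then show ?case using odots_closed[OF p(1)] p(2) by (simp add: star_id)
qed auto

context vertical_cart_lax
begin

text \<open>Every proarrow of \<open>VerDbl A\<close> is an identity, so a path is a constant list.
  Components of a multimodulation are thereby indexed by objects alone, which explains the
  \<open>replicate\<close> terms below.\<close>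

lemma ppath_D: "ppath D x ms y \<longleftrightarrow> x \<in> Objs D \<and> ms = replicate (length ms) x \<and> y = x"
  by (induction ms arbitrary: x) auto

lemma odots_D: "x \<in> Objs D \<Longrightarrow> odots D x (replicate k x) = x"
  using D.odots_closed[of x "replicate k x" x] ppath_D[of x "replicate k x" x] by simp

text \<open>Associators and unit isomorphisms of \<open>VerDbl A\<close> are identities, and so is
  everything assembled from them; all rebracketings on the side of the base disappear.\<close>

lemma cohs_D:
  assumes "x \<in> Objs D" "concat bs = replicate k x"
  shows "cohs D x bs = idcell D x"
  using assms
proof (induction bs arbitrary: k rule: induct_list012)
  case 1
  then show ?case by simp
next
  case (2 b)
  then show ?case by (simp add: odots_D)
next
  case (3 b b' bs)
  have coh: "coh D x (replicate i x) (replicate j x) = idcell D x" for i j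
  proof -
    have "coh D x (replicate i x) (replicate j x) = idcell D (odots D x (replicate i x))"
    proof (induction i rule: induct_nat_012)
      case 0 then show ?case using 3 by (simp add: odots_D)
    next
      case 1 then show ?case using 3 odots_D[of x "Suc j"] by (cases j) auto
    next
      case (ge2 n)
      have "coh D x (x # replicate (Suc n) x) (replicate j x) = idcell D x"
        using D.coh_Cons[of x x "replicate (Suc n) x" x "replicate j x" x] ge2 3
          ppath_D[of x "replicate (Suc n) x" x] ppath_D[of x "replicate j x" x] odots_D[of x "Suc n"]
        by (simp add: D.star_id)
      then show ?case using 3 odots_D[of x "Suc (Suc n)"] by simp
    qed
    then show ?thesis using 3 by (simp add: odots_D)
  qed
  have b: "b = replicate (length b) x" "concat (b' # bs) = replicate (length (concat (b' # bs))) x"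
    using 3(4) by (metis append_eq_conv_conj concat.simps(2) take_replicate length_take length_replicate drop_replicate)+
  have e: "chain_end (ptgt D) x b = x"
    using b(1) by (metis D.ppath_ends ppath_D 3(3))
  have "cohs D x (b' # bs) = idcell D x" using 3(2)[OF 3(3) b(2)] .
  moreover have "coh D x b (concat (b' # bs)) = idcell D x" using coh b by metis
  moreover have "odots D x b = x" using odots_D[OF 3(3)] b(1) by metis
  ultimately show ?case using 3(3) e by (simp add: D.star_id)
qed

lemma rebracket_D: "x \<in> Objs D \<Longrightarrow> concat bs = replicate k x \<Longrightarrow> concat bs' = replicate k x \<Longrightarrow>
    rebracket D x bs bs' = idcell D x"
  using D.D1.inverse_ide[of x] by (simp add: rebracket_def cohs_D)

section \<open>Paths of modules and their values at objects and arrows\<close>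

definition mpath where "mpath F Ms G \<longleftrightarrow> uobj F \<and> chain {M. umod M} (msrc D) (mtgt D) F Ms G"

lemma mpath_simps [simp]:
  "mpath F [] G \<longleftrightarrow> uobj F \<and> F = G"
  "mpath F (M # Ms) G \<longleftrightarrow> umod M \<and> msrc D M = F \<and> mpath (mtgt D M) Ms G"
  by (auto simp: mpath_def)

lemma mpath_uobj: "mpath F Ms G \<Longrightarrow> uobj F \<and> uobj G"
  by (induction Ms arbitrary: F) auto

lemma mpath_append: "mpath F (Ms @ Ns) H \<longleftrightarrow> (\<exists>G. mpath F Ms G \<and> mpath G Ns H)"
  by (induction Ms arbitrary: F) (auto dest: mpath_uobj)

definition mvals :: "('o, 'f, 'o, 't, 'x, 'a, 'p, 'c) bimod list \<Rightarrow> 'o \<Rightarrow> 'p list" where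
  "mvals Ms x = map (\<lambda>M. mpro M x) Ms"

lemma mvals_simps [simp]: "mvals [] x = []" "mvals (M # Ms) x = mpro M x # mvals Ms x"
  "mvals (Ms @ Ns) x = mvals Ms x @ mvals Ns x"
  by (simp_all add: mvals_def)

lemma mpros_replicate: "length Ms = k \<Longrightarrow> mpros Ms (replicate k x) = mvals Ms x"
  by (induction Ms arbitrary: k) auto

lemma mpath_ppath:
  "mpath F Ms G \<Longrightarrow> x \<in> Objs D \<Longrightarrow> ppath E (onOb F x) (mvals Ms x) (onOb G x)"
  by (induction Ms arbitrary: F) auto

lemma mpath_paths [simp]:
  assumes "mpath F Ms G" "x \<in> Objs D"
  shows "(onOb F x, mvals Ms x) \<in> paths E" "chain_end (ptgt E) (onOb F x) (mvals Ms x) = onOb G x"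
  using E.paths_ppath[OF mpath_ppath[OF assms]] by simp_all

definition mdids :: "('o, 'f, 'o, 't, 'x, 'a, 'p, 'c) bimod list \<Rightarrow> 'f \<Rightarrow> (('x \<times> 'p list) \<times> ('x \<times> 'p list) \<times> 'c) list" where
  "mdids Ms f = map (\<lambda>M. mdcell M (idc D f)) Ms"

lemma mdids_simps [simp]: "mdids [] f = []" "mdids (M # Ms) f = mdcell M (idc D f) # mdids Ms f"
  "mdids (Ms @ Ns) f = mdids Ms f @ mdids Ns f"
  by (simp_all add: mdids_def)

lemma idc_D [simp]:
  assumes "f \<in> Arrs D"
  shows "idc D f \<in> Cells D" "Dom (D1 D) (idc D f) = Dom (D0 D) f" "Cod (D1 D) (idc D f) = Cod (D0 D) f"
    "csrc D (idc D f) = f" "ctgt D (idc D f) = f"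
  using D.idc_in[of f] D.idp_src_tgt(3,4)[of f] assms by simp_all

lemma map2_mdcell_cpath:
  assumes "mpath F Ms G" "cpath D f \<gamma>s g" "length \<gamma>s = length Ms"
  shows "cpath S (onArr F f) (map2 mdcell Ms \<gamma>s) (onArr G g)"
  using assms(3,1,2)
proof (induction \<gamma>s Ms arbitrary: F f rule: list_induct2)
  case (Cons \<gamma> \<gamma>s M Ms)
  then show ?case by auto
qed auto

lemma mdids_map2: "mdids Ms f = map2 mdcell Ms (replicate (length Ms) (idc D f))"
  by (induction Ms) auto

lemma cpath_idcs: "f \<in> Arrs D \<Longrightarrow> cpath D f (replicate k (idc D f)) f"
  by (induction k) auto

lemma stars_idcs: "f \<in> Arrs D \<Longrightarrow> stars D f (replicate k (idc D f)) = idc D f"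
proof (induction k)
  case (Suc k)
  then show ?case using D.stars_Cons[of f "idc D f" "replicate k (idc D f)" f] cpath_idcs[of f k] by simp
qed simp

lemma mdids_cpath: "mpath F Ms G \<Longrightarrow> f \<in> Arrs D \<Longrightarrow> cpath S (onArr F f) (mdids Ms f) (onArr G f)"
  unfolding mdids_map2 by (rule map2_mdcell_cpath) (simp_all add: cpath_idcs)

lemma D_frame [simp]:
  assumes "s \<in> Cells D"
  shows "csrc D s \<in> Arrs D" "ctgt D s \<in> Arrs D"
    "Dom (D0 D) (csrc D s) = Dom (D1 D) s" "Cod (D0 D) (csrc D s) = Cod (D1 D) s"
    "Dom (D0 D) (ctgt D s) = Dom (D1 D) s" "Cod (D0 D) (ctgt D s) = Cod (D1 D) s"
  using D.csrc_in[OF assms] D.ctgt_in[OF assms] by simp_all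

lemma cpath_D_frames: "cpath D f \<gamma>s g \<Longrightarrow> map (Dom (D1 D)) \<gamma>s = replicate (length \<gamma>s) (Dom (D0 D) f) \<and>
    map (Cod (D1 D)) \<gamma>s = replicate (length \<gamma>s) (Cod (D0 D) f) \<and> Dom (D0 D) g = Dom (D0 D) f \<and> Cod (D0 D) g = Cod (D0 D) f"
proof (induction \<gamma>s arbitrary: f)
  case (Cons \<gamma> \<gamma>s)
  then have h: "\<gamma> \<in> Cells D" "csrc D \<gamma> = f" "cpath D (ctgt D \<gamma>) \<gamma>s g" by simp_all
  show ?case unfolding h(2)[symmetric] using Cons.IH[OF h(3)] D_frame[OF h(1)] by simp
qed auto

text \<open>A 2-cell is its own vertical composite with the identity 2-cell on its target, and with
  the one on its source. Pulling the 2-cell out through the left action in the first case and the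
  right action in the second leaves only an identity 2-cell inside the module.\<close>

lemma mdcell_slide:
  assumes "umod M" "s \<in> Cells D"
  shows "mdcell M s = fcell (msrc D M) s \<^bold>\<star> mdcell M (idc D (ctgt D s))"
    "mdcell M s = mdcell M (idc D (csrc D s)) \<^bold>\<star> fcell (mtgt D M) s"
  using mdcell_star_left[OF assms(1,2), of "idc D (ctgt D s)"]
    mdcell_star_right[OF assms(1) _ assms(2), of "idc D (csrc D s)"] assms(2) D.star_idc D.idc_star by simp_all

text \<open>Only the first factor needs a 2-cell: all others slide to the left through the actions.\<close>

lemma map2_mdcell_slide:
  assumes "mpath F Ms G" "cpath D f \<gamma>s g" "length \<gamma>s = length Ms"
  shows "stars S (onArr F f) (map2 mdcell Ms \<gamma>s) = fcell F (stars D f \<gamma>s) \<^bold>\<star> stars S (onArr F g) (mdids Ms g)"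
  using assms(3,1,2)
proof (induction \<gamma>s Ms arbitrary: F f rule: list_induct2)
  case Nil
  then show ?case by (auto simp: fcell_idc)
next
  case (Cons \<gamma> \<gamma>s M Ms)
  let ?G = "mtgt D M"
  have M: "umod M" "msrc D M = F" "mpath ?G Ms G" and g: "\<gamma> \<in> Cells D" "csrc D \<gamma> = f" "cpath D (ctgt D \<gamma>) \<gamma>s g"
    using Cons by auto
  note cp = map2_mdcell_cpath[OF M(3) g(3) Cons(1)]
  define \<delta> where "\<delta> = stars D (ctgt D \<gamma>) \<gamma>s"
  have d: "\<delta> \<in> Cells D" "csrc D \<delta> = ctgt D \<gamma>" "ctgt D \<delta> = g" using D.stars_closed[OF g(3)] by (auto simp: \<delta>_def)
  have ga: "g \<in> Arrs D" using D.cpath_ends[OF g(3)] by simp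
  note dm = mdids_cpath[OF M(3) ga]
  define R where "R = stars S (onArr ?G g) (mdids Ms g)"
  have R: "R \<in> Cells S" "csrc S R = onArr ?G g" using S.stars_closed[OF dm] by (auto simp: R_def)
  have s: "stars D f (\<gamma> # \<gamma>s) = \<gamma> \<star>\<^bsub>D\<^esub> \<delta>" using D.stars_Cons[of f \<gamma> \<gamma>s g] g by (simp add: \<delta>_def)
  have "cpath S (onArr F f) (mdcell M \<gamma> # map2 mdcell Ms \<gamma>s) (onArr G g)"
    using cp M g by auto
  from S.stars_Cons[OF this]
  have "stars S (onArr F f) (map2 mdcell (M # Ms) (\<gamma> # \<gamma>s)) = mdcell M \<gamma> \<^bold>\<star> stars S (onArr ?G (ctgt D \<gamma>)) (map2 mdcell Ms \<gamma>s)"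
    using M g by simp
  also have "\<dots> = mdcell M \<gamma> \<^bold>\<star> (fcell ?G \<delta> \<^bold>\<star> R)"
    using Cons.IH[OF M(3) g(3)] by (simp add: \<delta>_def R_def)
  also have "\<dots> = (mdcell M \<gamma> \<^bold>\<star> fcell ?G \<delta>) \<^bold>\<star> R"
    using M g d R by simp
  \<comment> \<open>The 2-cell collected from the tail enters \<open>M\<close> through the right
    action; the enlarged 2-cell then leaves \<open>M\<close> through the left action in the next
    step.\<close>
  also have "mdcell M \<gamma> \<^bold>\<star> fcell ?G \<delta> = mdcell M (\<gamma> \<star>\<^bsub>D\<^esub> \<delta>)"
    using mdcell_star_right[OF M(1) g(1) d(1)] d by simp
  also have "\<dots> = fcell F (\<gamma> \<star>\<^bsub>D\<^esub> \<delta>) \<^bold>\<star> mdcell M (idc D g)"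
    using mdcell_slide(1)[OF M(1), of "\<gamma> \<star>\<^bsub>D\<^esub> \<delta>"] M g d by simp
  also have "(fcell F (\<gamma> \<star>\<^bsub>D\<^esub> \<delta>) \<^bold>\<star> mdcell M (idc D g)) \<^bold>\<star> R = fcell F (\<gamma> \<star>\<^bsub>D\<^esub> \<delta>) \<^bold>\<star> (mdcell M (idc D g) \<^bold>\<star> R)"
    using M g d R ga mpath_uobj[OF M(3)] umod_uobj(1)[OF M(1)] by simp
  also have "mdcell M (idc D g) \<^bold>\<star> R = stars S (onArr F g) (mdids (M # Ms) g)"
  proof -
    have "cpath S (onArr F g) (mdcell M (idc D g) # mdids Ms g) (onArr G g)" using mdids_cpath[of F "M # Ms" G g] M ga by auto
    from S.stars_Cons[OF this] show ?thesis using M ga by (simp add: R_def)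
  qed
  finally show ?case unfolding s .
qed

definition mucell :: "('o, 'f, 'o, 't, 'x, 'a, 'p, 'c) multimod \<Rightarrow> 'o \<Rightarrow> ('x \<times> 'p list) \<times> ('x \<times> 'p list) \<times> 'c" where
  "mucell \<mu> x = ((onOb (tdom (mml \<mu>)) x, mvals (mmin \<mu>) x), (onOb (tcod (mml \<mu>)) x, [mpro (mmout \<mu>) x]),
     mmc \<mu> (x, replicate (length (mmin \<mu>)) x))"

lemma mucell_sel [simp]: "ucell (mucell \<mu> x) = mmc \<mu> (x, replicate (length (mmin \<mu>)) x)"
  "Dom (D1 S) (mucell \<mu> x) = (onOb (tdom (mml \<mu>)) x, mvals (mmin \<mu>) x)"
  "Cod (D1 S) (mucell \<mu> x) = (onOb (tcod (mml \<mu>)) x, [mpro (mmout \<mu>) x])"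
  by (simp_all add: mucell_def)

text \<open>Over \<open>VerDbl A\<close> a multimodulation is a family of cells indexed by objects, with a single
  naturality condition for identity 2-cells; the equivariance conditions hold by coherence.\<close>

definition ummod where
  "ummod \<mu> \<longleftrightarrow> utrans (mml \<mu>) \<and> utrans (mmr \<mu>) \<and> umod (mmout \<mu>) \<and>
     tcod (mml \<mu>) = msrc D (mmout \<mu>) \<and> tcod (mmr \<mu>) = mtgt D (mmout \<mu>) \<and>
     mpath (tdom (mml \<mu>)) (mmin \<mu>) (tdom (mmr \<mu>)) \<and>
     (\<forall>x\<in>Objs D. mucell \<mu> x \<in> Cells S \<and> csrc S (mucell \<mu> x) = atOb (mml \<mu>) x \<and> ctgt S (mucell \<mu> x) = atOb (mmr \<mu>) x) \<and>
     (\<forall>f\<in>Arrs D. tcell (mml \<mu>) f \<^bold>\<star> (stars S (onArr (tdom (mml \<mu>)) f) (mdids (mmin \<mu>) f) \<^bold>\<cdot> mucell \<mu> (Cod (D0 D) f)) =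
        (mucell \<mu> (Dom (D0 D) f) \<^bold>\<cdot> mdcell (mmout \<mu>) (idc D f)) \<^bold>\<star> tcell (mmr \<mu>) f) \<and>
     mmc \<mu> \<in> extensional (paths_of_length D (length (mmin \<mu>)))"

lemma ummodD:
  assumes "ummod \<mu>"
  shows "utrans (mml \<mu>)" "utrans (mmr \<mu>)" "umod (mmout \<mu>)"
     "tcod (mml \<mu>) = msrc D (mmout \<mu>)" "tcod (mmr \<mu>) = mtgt D (mmout \<mu>)"
     "mpath (tdom (mml \<mu>)) (mmin \<mu>) (tdom (mmr \<mu>))"
     "x \<in> Objs D \<Longrightarrow> mucell \<mu> x \<in> Cells S" "x \<in> Objs D \<Longrightarrow> csrc S (mucell \<mu> x) = atOb (mml \<mu>) x"
     "x \<in> Objs D \<Longrightarrow> ctgt S (mucell \<mu> x) = atOb (mmr \<mu>) x"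
     "f \<in> Arrs D \<Longrightarrow> tcell (mml \<mu>) f \<^bold>\<star> (stars S (onArr (tdom (mml \<mu>)) f) (mdids (mmin \<mu>) f) \<^bold>\<cdot> mucell \<mu> (Cod (D0 D) f)) =
        (mucell \<mu> (Dom (D0 D) f) \<^bold>\<cdot> mdcell (mmout \<mu>) (idc D f)) \<^bold>\<star> tcell (mmr \<mu>) f"
     "mmc \<mu> \<in> extensional (paths_of_length D (length (mmin \<mu>)))"
  using assms unfolding ummod_def by blast+

lemma ummod_frames [simp]:
  assumes "ummod \<mu>"
  shows "utrans (mml \<mu>)" "utrans (mmr \<mu>)" "umod (mmout \<mu>)"
     "tcod (mml \<mu>) = msrc D (mmout \<mu>)" "tcod (mmr \<mu>) = mtgt D (mmout \<mu>)"
     "x \<in> Objs D \<Longrightarrow> mucell \<mu> x \<in> Cells S" "x \<in> Objs D \<Longrightarrow> csrc S (mucell \<mu> x) = atOb (mml \<mu>) x"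
     "x \<in> Objs D \<Longrightarrow> ctgt S (mucell \<mu> x) = atOb (mmr \<mu>) x"
  using ummodD[OF assms] by blast+

lemma paths_of_length_D: "(x, ms) \<in> paths_of_length D k \<longleftrightarrow> x \<in> Objs D \<and> ms = replicate k x"
  unfolding paths_of_length_def using ppath_D by auto

text \<open>All paths over \<open>VerDbl A\<close> are constant, so agreement at objects together
  with extensionality gives equality of the component functions.\<close>

lemma ummod_eqI:
  assumes "ummod \<mu>" "ummod \<nu>" "mmin \<mu> = mmin \<nu>" "mmout \<mu> = mmout \<nu>" "mml \<mu> = mml \<nu>" "mmr \<mu> = mmr \<nu>"
    "\<And>x. x \<in> Objs D \<Longrightarrow> mucell \<mu> x = mucell \<nu> x"
  shows "\<mu> = \<nu>"
proof -
  have "mmc \<mu> = mmc \<nu>"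
  proof (rule extensionalityI)
    show "mmc \<mu> \<in> extensional (paths_of_length D (length (mmin \<mu>)))"
      "mmc \<nu> \<in> extensional (paths_of_length D (length (mmin \<mu>)))"
      using ummodD(11)[OF assms(1)] ummodD(11)[OF assms(2)] assms(3) by simp_all
    fix p assume "p \<in> paths_of_length D (length (mmin \<mu>))"
    then obtain x where x: "x \<in> Objs D" "p = (x, replicate (length (mmin \<mu>)) x)"
      by (cases p) (auto simp: paths_of_length_D)
    show "mmc \<mu> p = mmc \<nu> p" using arg_cong[OF assms(7)[OF x(1)], of ucell] x(2) assms(3) by simp
  qed
  then show ?thesis using assms(3-6) by (cases \<mu>, cases \<nu>) simp
qed

text \<open>Recovers naturality for arbitrary 2-cells from the case of identities. The given 2-cells
  slide left and merge into one, which crosses the left transformation by naturality of that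
  transformation and finally acts on the output module from the left.\<close>

lemma ummod_natural:
  assumes \<mu>: "ummod \<mu>" and c: "cpath D f \<gamma>s g" and l: "length \<gamma>s = length (mmin \<mu>)"
  shows "tcell (mml \<mu>) f \<^bold>\<star> (stars S (onArr (tdom (mml \<mu>)) f) (map2 mdcell (mmin \<mu>) \<gamma>s) \<^bold>\<cdot> mucell \<mu> (Cod (D0 D) f)) =
    (mucell \<mu> (Dom (D0 D) f) \<^bold>\<cdot> mdcell (mmout \<mu>) (stars D f \<gamma>s)) \<^bold>\<star> tcell (mmr \<mu>) g"
proof -
  note [simp] = \<mu>
  let ?F = "tdom (mml \<mu>)" and ?G = "msrc D (mmout \<mu>)"
  let ?x = "Dom (D0 D) f" and ?y = "Cod (D0 D) f"
  have fg: "f \<in> Arrs D" "g \<in> Arrs D" "Dom (D0 D) g = ?x" "Cod (D0 D) g = ?y"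
    using cpath_D_frames[OF c] D.cpath_ends[OF c] by auto
  define \<delta> where "\<delta> = stars D f \<gamma>s"
  have d: "\<delta> \<in> Cells D" "csrc D \<delta> = f" "ctgt D \<delta> = g" using D.stars_closed[OF c] by (auto simp: \<delta>_def)
  have dd: "Dom (D1 D) \<delta> = ?x" "Cod (D1 D) \<delta> = ?y" using D_frame(3,4)[OF d(1)] d(2) by simp_all
  note mp = ummodD(6)[OF \<mu>]
  note cp = mdids_cpath[OF mp fg(2)]
  define T where "T = stars S (onArr ?F g) (mdids (mmin \<mu>) g)"
  have mdm: "map (\<lambda>c. snd (fst c)) (mdids Ms g) = map (\<lambda>m. [m]) (mvals Ms ?x)"
    "map (\<lambda>c. snd (fst (snd c))) (mdids Ms g) = map (\<lambda>m. [m]) (mvals Ms ?y)" for Ms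
    using fg by (induction Ms) (auto simp: mdcell_def)
  have cs: "concat (map (\<lambda>m. [m]) ms) = ms" for ms by (induction ms) auto
  have T: "T \<in> Cells S" "csrc S T = onArr ?F g" "ctgt S T = onArr (tdom (mmr \<mu>)) g"
    "Dom (D1 S) T = (onOb ?F ?x, mvals (mmin \<mu>) ?x)" "Cod (D1 S) T = (onOb ?F ?y, mvals (mmin \<mu>) ?y)"
    using S.stars_closed[OF cp] E.strictify_stars[OF cp] fg by (auto simp: T_def mdm cs)
  let ?m = "mucell \<mu> ?y" and ?a = "\<lambda>x. idc S (atOb (mml \<mu>) x)"
  have xy: "?x \<in> Objs D" "?y \<in> Objs D" using fg by simp_all
  \<comment> \<open>The component of \<mu> is padded on the left with the external identity of its
    left boundary, so that interchange can separate the merged 2-cell from the identity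
    parts.\<close>
  have "tcell (mml \<mu>) f \<^bold>\<star> (stars S (onArr ?F f) (map2 mdcell (mmin \<mu>) \<gamma>s) \<^bold>\<cdot> ?m)
     = tcell (mml \<mu>) f \<^bold>\<star> ((fcell ?F \<delta> \<^bold>\<star> T) \<^bold>\<cdot> (?a ?y \<^bold>\<star> ?m))"
    unfolding map2_mdcell_slide[OF mp c l] T_def \<delta>_def using xy by simp
  also have "(fcell ?F \<delta> \<^bold>\<star> T) \<^bold>\<cdot> (?a ?y \<^bold>\<star> ?m) = (fcell ?F \<delta> \<^bold>\<cdot> ?a ?y) \<^bold>\<star> (T \<^bold>\<cdot> ?m)"
    by (rule S.interchange[symmetric]) (use d dd T xy in simp_all)
  also have "tcell (mml \<mu>) f \<^bold>\<star> ((fcell ?F \<delta> \<^bold>\<cdot> ?a ?y) \<^bold>\<star> (T \<^bold>\<cdot> ?m)) =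
      (tcell (mml \<mu>) f \<^bold>\<star> (fcell ?F \<delta> \<^bold>\<cdot> ?a ?y)) \<^bold>\<star> (T \<^bold>\<cdot> ?m)"
    using d dd T xy fg by simp
  also have "tcell (mml \<mu>) f \<^bold>\<star> (fcell ?F \<delta> \<^bold>\<cdot> ?a ?y) = (?a ?x \<^bold>\<cdot> fcell ?G \<delta>) \<^bold>\<star> tcell (mml \<mu>) g"
    using tcell_natural[OF ummodD(1)[OF \<mu>] d(1)] d dd by simp
  also have "\<dots> \<^bold>\<star> (T \<^bold>\<cdot> ?m) = (?a ?x \<^bold>\<cdot> fcell ?G \<delta>) \<^bold>\<star> (tcell (mml \<mu>) g \<^bold>\<star> (T \<^bold>\<cdot> ?m))"
    using d dd T xy fg by simp
  also have "tcell (mml \<mu>) g \<^bold>\<star> (T \<^bold>\<cdot> ?m) = (mucell \<mu> ?x \<^bold>\<cdot> mdcell (mmout \<mu>) (idc D g)) \<^bold>\<star> tcell (mmr \<mu>) g"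
    using ummodD(10)[OF \<mu> fg(2)] fg by (simp add: T_def)
  also have "(?a ?x \<^bold>\<cdot> fcell ?G \<delta>) \<^bold>\<star> \<dots> =
      ((?a ?x \<^bold>\<cdot> fcell ?G \<delta>) \<^bold>\<star> (mucell \<mu> ?x \<^bold>\<cdot> mdcell (mmout \<mu>) (idc D g))) \<^bold>\<star> tcell (mmr \<mu>) g"
    using d dd xy fg by simp
  also have "(?a ?x \<^bold>\<cdot> fcell ?G \<delta>) \<^bold>\<star> (mucell \<mu> ?x \<^bold>\<cdot> mdcell (mmout \<mu>) (idc D g)) =
      (?a ?x \<^bold>\<star> mucell \<mu> ?x) \<^bold>\<cdot> (fcell ?G \<delta> \<^bold>\<star> mdcell (mmout \<mu>) (idc D g))"
    by (rule S.interchange) (use d dd xy fg in simp_all)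
  also have "fcell ?G \<delta> \<^bold>\<star> mdcell (mmout \<mu>) (idc D g) = mdcell (mmout \<mu>) \<delta>"
    using mdcell_slide(1)[OF ummodD(3)[OF \<mu>] d(1)] d by simp
  finally show ?thesis using xy by (simp add: \<delta>_def)
qed

section \<open>Translating the axioms in \<open>E\<close> into equations in the
  strictification\<close>

lemma concat_singles: "concat (singles ms) = ms"
  by (induction ms) auto

lemma ucell_star_Nil':
  assumes "c \<in> Cells S" "d \<in> Cells S" "ctgt S c = csrc S d" "snd (Dom (D1 S) c) = []" "snd (Cod (D1 S) c) = []"
  shows "ucell (c \<^bold>\<star> d) = lun_inv E (path_odot E (Dom (D1 S) d)) \<bullet>\<^bsub>E\<^esub> (ucell c \<star>\<^bsub>E\<^esub> ucell d) \<bullet>\<^bsub>E\<^esub>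
    lun E (path_odot E (Cod (D1 S) d))"
  using S.composable_frames[OF assms(1-3)] assms by (simp add: ucell_S)

lemma ucell_star_Nil_right':
  assumes "c \<in> Cells S" "d \<in> Cells S" "ctgt S c = csrc S d" "snd (Dom (D1 S) d) = []" "snd (Cod (D1 S) d) = []"
  shows "ucell (c \<^bold>\<star> d) = run_inv E (path_odot E (Dom (D1 S) c)) \<bullet>\<^bsub>E\<^esub> (ucell c \<star>\<^bsub>E\<^esub> ucell d) \<bullet>\<^bsub>E\<^esub>
    run E (path_odot E (Cod (D1 S) c))"
  using assms S.D1.Dom_in[of c] S.D1.Cod_in[of c] by (simp add: ucell_S E.path_coh_Nil)

text \<open>Connects the \<open>stars E\<close> of the definition of naturality with a strict
  composite. Each module cell runs between one-element paths, so no coherence cell occurs on either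
  side.\<close>

lemma map2_mdcell_stars:
  assumes mp: "mpath F Ms G" and c: "cpath D f \<gamma>s g" and l: "length \<gamma>s = length Ms"
  defines "T \<equiv> stars S (onArr F f) (map2 mdcell Ms \<gamma>s)"
  shows "T \<in> Cells S" "csrc S T = onArr F f" "ctgt S T = onArr G g"
    "Dom (D1 S) T = (onOb F (Dom (D0 D) f), mvals Ms (Dom (D0 D) f))"
    "Cod (D1 S) T = (onOb F (Cod (D0 D) f), mvals Ms (Cod (D0 D) f))"
    "ucell T = stars E (onArr F f) (map2 mcell Ms \<gamma>s)"
proof -
  let ?cs = "map2 mdcell Ms \<gamma>s"
  note cp = map2_mdcell_cpath[OF mp c l]
  have F: "uobj F" using mpath_uobj[OF mp] by simp
  have f: "f \<in> Arrs D" using D.cpath_ends[OF c] by simp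
  note cf = cpath_D_frames[OF c]
  have 1: "map (\<lambda>c. snd (fst c)) ?cs = singles (mvals Ms (Dom (D0 D) f))"
    and 2: "map (\<lambda>c. snd (fst (snd c))) ?cs = singles (mvals Ms (Cod (D0 D) f))"
    and 3: "map ucell ?cs = map2 mcell Ms \<gamma>s"
    using l cf by (induction \<gamma>s Ms rule: list_induct2) (auto simp: mdcell_def)
  show T: "T \<in> Cells S" "csrc S T = onArr F f" "ctgt S T = onArr G g"
    using S.stars_closed[OF cp] by (auto simp: T_def)
  show dc: "Dom (D1 S) T = (onOb F (Dom (D0 D) f), mvals Ms (Dom (D0 D) f))"
    "Cod (D1 S) T = (onOb F (Cod (D0 D) f), mvals Ms (Cod (D0 D) f))"
    using E.strictify_stars[OF cp] F f unfolding T_def 1 2 by (simp_all add: concat_singles)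
  have "\<forall>c\<in>set ?cs. length (snd (fst (snd c))) = 1"
    using 2 by (auto simp: mdcell_def dest!: in_set_zipE)
  note co = E.strictify_stars_cohs[OF cp this]
  have "cohs E (onOb F (Dom (D0 D) f)) (singles (mvals Ms (Dom (D0 D) f))) =
      idcell E (odots E (onOb F (Dom (D0 D) f)) (mvals Ms (Dom (D0 D) f)))"
    using E.cohs_singles[OF mpath_ppath[OF mp]] f by simp
  then have "idcell E (odots E (onOb F (Dom (D0 D) f)) (mvals Ms (Dom (D0 D) f))) \<bullet>\<^bsub>E\<^esub> ucell T = stars E (onArr F f) (map2 mcell Ms \<gamma>s)"
    using co F f unfolding 1 3 T_def by simp
  then show "ucell T = stars E (onArr F f) (map2 mcell Ms \<gamma>s)"
    using ucell_closed[OF T(1)] dc by simp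
qed

lemma mdids_stars:
  assumes mp: "mpath F Ms G" and f: "f \<in> Arrs D"
  defines "T \<equiv> stars S (onArr F f) (mdids Ms f)"
  shows "T \<in> Cells S" "csrc S T = onArr F f" "ctgt S T = onArr G f"
    "Dom (D1 S) T = (onOb F (Dom (D0 D) f), mvals Ms (Dom (D0 D) f))"
    "Cod (D1 S) T = (onOb F (Cod (D0 D) f), mvals Ms (Cod (D0 D) f))"
  using map2_mdcell_stars[OF mp cpath_idcs[OF f, of "length Ms"]] unfolding T_def mdids_map2 by simp_all

text \<open>The typed data of a multimodulation without any equation. The equivariance conditions
  are derived from this predicate, and naturality is translated relative to it.\<close>

definition mmframe where
  "mmframe \<mu> \<longleftrightarrow> utrans (mml \<mu>) \<and> utrans (mmr \<mu>) \<and> umod (mmout \<mu>) \<and>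
     tcod (mml \<mu>) = msrc D (mmout \<mu>) \<and> tcod (mmr \<mu>) = mtgt D (mmout \<mu>) \<and>
     mpath (tdom (mml \<mu>)) (mmin \<mu>) (tdom (mmr \<mu>)) \<and>
     (\<forall>x\<in>Objs D. mucell \<mu> x \<in> Cells S \<and> csrc S (mucell \<mu> x) = atOb (mml \<mu>) x \<and> ctgt S (mucell \<mu> x) = atOb (mmr \<mu>) x) \<and>
     mmc \<mu> \<in> extensional (paths_of_length D (length (mmin \<mu>)))"

lemma mmframeD:
  assumes "mmframe \<mu>"
  shows "utrans (mml \<mu>)" "utrans (mmr \<mu>)" "umod (mmout \<mu>)"
     "tcod (mml \<mu>) = msrc D (mmout \<mu>)" "tcod (mmr \<mu>) = mtgt D (mmout \<mu>)"
     "mpath (tdom (mml \<mu>)) (mmin \<mu>) (tdom (mmr \<mu>))"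
     "x \<in> Objs D \<Longrightarrow> mucell \<mu> x \<in> Cells S" "x \<in> Objs D \<Longrightarrow> csrc S (mucell \<mu> x) = atOb (mml \<mu>) x"
     "x \<in> Objs D \<Longrightarrow> ctgt S (mucell \<mu> x) = atOb (mmr \<mu>) x"
  using assms unfolding mmframe_def by blast+

lemma mmframe_cell:
  assumes \<mu>: "mmframe \<mu>" and x: "x \<in> Objs D"
  defines "m \<equiv> mmc \<mu> (x, replicate (length (mmin \<mu>)) x)"
  shows "m \<in> Cells E" "Dom (D1 E) m = odots E (onOb (tdom (mml \<mu>)) x) (mvals (mmin \<mu>) x)"
    "Cod (D1 E) m = mpro (mmout \<mu>) x" "csrc E m = atOb (mml \<mu>) x" "ctgt E m = atOb (mmr \<mu>) x"
  using ucell_closed[OF mmframeD(7)[OF \<mu> x]] mmframeD(8,9)[OF \<mu> x] by (simp_all add: m_def)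

definition snatural where
  "snatural \<mu> f \<gamma>s g \<longleftrightarrow>
    tcell (mml \<mu>) f \<^bold>\<star> (stars S (onArr (tdom (mml \<mu>)) f) (map2 mdcell (mmin \<mu>) \<gamma>s) \<^bold>\<cdot> mucell \<mu> (Cod (D0 D) f)) =
    (mucell \<mu> (Dom (D0 D) f) \<^bold>\<cdot> mdcell (mmout \<mu>) (stars D f \<gamma>s)) \<^bold>\<star> tcell (mmr \<mu>) g"

lemma mpros_map:
  assumes "map h \<gamma>s = replicate (length \<gamma>s) x" "length \<gamma>s = length Ms"
  shows "mpros Ms (map h \<gamma>s) = mvals Ms x"
  unfolding assms(1) assms(2) by (rule mpros_replicate) simp

text \<open>The unit isomorphisms in the axiom are exactly the coherence of composing with an empty
  path: the inverse ones on the domain side, and the actions of the output module, equal to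
  \<open>lun\<close> and \<open>run\<close>, on the codomain side. The equation is thus an equality
  of underlying cells.\<close>

lemma multi_natural_iff:
  assumes \<mu>: "mmframe \<mu>"
  shows "multi_natural D E \<mu> \<longleftrightarrow> (\<forall>f \<gamma>s g. cpath D f \<gamma>s g \<and> length \<gamma>s = length (mmin \<mu>) \<longrightarrow> snatural \<mu> f \<gamma>s g)"
proof -
  have eq: "(let N = mmout \<mu>; F = tdom (mml \<mu>); x = Dom (D0 D) f; y = Cod (D0 D) f; y' = Cod (D0 D) g;
            ms = map (Dom (D1 D)) \<gamma>s; ns = map (Cod (D1 D)) \<gamma>s; n = odots D y ns;
            Mms = odots E (onOb F x) (mpros (mmin \<mu>) ms) in
         lun_inv E Mms \<bullet>\<^bsub>E\<^esub>
           (atArr (mml \<mu>) f \<star>\<^bsub>E\<^esub> (stars E (onArr F f) (map2 mcell (mmin \<mu>) \<gamma>s) \<bullet>\<^bsub>E\<^esub> mmc \<mu> (y, ns))) \<bullet>\<^bsub>E\<^esub>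
           lact N (idp D y) n \<bullet>\<^bsub>E\<^esub> mcell N (lun D n) =
         run_inv E Mms \<bullet>\<^bsub>E\<^esub>
           ((mmc \<mu> (x, ms) \<bullet>\<^bsub>E\<^esub> mcell N (stars D f \<gamma>s)) \<star>\<^bsub>E\<^esub> atArr (mmr \<mu>) g) \<bullet>\<^bsub>E\<^esub>
           ract N n (idp D y') \<bullet>\<^bsub>E\<^esub> mcell N (run D n)) \<longleftrightarrow> snatural \<mu> f \<gamma>s g"
    if c: "cpath D f \<gamma>s g" and l: "length \<gamma>s = length (mmin \<mu>)" for f \<gamma>s g
  proof -
    let ?F = "tdom (mml \<mu>)" and ?N = "mmout \<mu>" and ?x = "Dom (D0 D) f" and ?y = "Cod (D0 D) f"
    let ?k = "length (mmin \<mu>)"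
    let ?s = "stars D f \<gamma>s"
    have fg: "f \<in> Arrs D" "g \<in> Arrs D" "Dom (D0 D) g = ?x" "Cod (D0 D) g = ?y"
      using cpath_D_frames[OF c] D.cpath_ends[OF c] by auto
    have s: "?s \<in> Cells D" "csrc D ?s = f" "ctgt D ?s = g" using D.stars_closed[OF c] by auto
    have ss: "Dom (D1 D) ?s = ?x" "Cod (D1 D) ?s = ?y" using D_frame(3,4)[OF s(1)] s(2) by simp_all
    have xy: "?x \<in> Objs D" "?y \<in> Objs D" using fg by simp_all
    note fr = mmframeD[OF \<mu>] mmframe_cell[OF \<mu> xy(1)] mmframe_cell[OF \<mu> xy(2)]
    note ms = cpath_D_frames[OF c, unfolded l]
    define T where "T = stars S (onArr ?F f) (map2 mdcell (mmin \<mu>) \<gamma>s)"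
    note T = map2_mdcell_stars[OF mmframeD(6)[OF \<mu>] c l, folded T_def]
    have id: "idcell D ?y \<in> Cells D" by (rule D.D1.ide_closed) (simp add: xy)
    have ml: "mpros (mmin \<mu>) (map (Dom (D1 D)) \<gamma>s) = mvals (mmin \<mu>) ?x"
      by (rule mpros_map) (use ms l in simp_all)
    have L: "ucell (tcell (mml \<mu>) f \<^bold>\<star> (T \<^bold>\<cdot> mucell \<mu> ?y)) =
      lun_inv E (odots E (onOb ?F ?x) (mvals (mmin \<mu>) ?x)) \<bullet>\<^bsub>E\<^esub>
           (atArr (mml \<mu>) f \<star>\<^bsub>E\<^esub> (stars E (onArr ?F f) (map2 mcell (mmin \<mu>) \<gamma>s) \<bullet>\<^bsub>E\<^esub> mmc \<mu> (?y, replicate ?k ?y))) \<bullet>\<^bsub>E\<^esub>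
           lun E (mpro ?N ?y)"
      using fr T xy fg by (subst ucell_star_Nil') (simp_all add: ucell_S)
    have R: "ucell ((mucell \<mu> ?x \<^bold>\<cdot> mdcell ?N ?s) \<^bold>\<star> tcell (mmr \<mu>) g) =
      run_inv E (odots E (onOb ?F ?x) (mvals (mmin \<mu>) ?x)) \<bullet>\<^bsub>E\<^esub>
           ((mmc \<mu> (?x, replicate ?k ?x) \<bullet>\<^bsub>E\<^esub> mcell ?N ?s) \<star>\<^bsub>E\<^esub> atArr (mmr \<mu>) g) \<bullet>\<^bsub>E\<^esub> run E (mpro ?N ?y)"
      using fr s ss xy fg by (subst ucell_star_Nil_right') (simp_all add: ucell_S)
    have tl: "atArr (mml \<mu>) f \<in> Cells E" "csrc E (atArr (mml \<mu>) f) = atOb (mml \<mu>) ?x \<cdot>\<^bsub>D0 E\<^esub> onArr (tcod (mml \<mu>)) f"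
       "ctgt E (atArr (mml \<mu>) f) = onArr (tdom (mml \<mu>)) f \<cdot>\<^bsub>D0 E\<^esub> atOb (mml \<mu>) ?y"
       "Cod (D1 E) (atArr (mml \<mu>) f) = idp E (onOb (tcod (mml \<mu>)) ?y)"
       "Dom (D1 E) (atArr (mml \<mu>) f) = idp E (onOb (tdom (mml \<mu>)) ?x)"
      using tcell_closed[OF fr(1) fg(1)] unfolding tcell_def by simp_all
    have tr: "atArr (mmr \<mu>) g \<in> Cells E" "csrc E (atArr (mmr \<mu>) g) = atOb (mmr \<mu>) ?x \<cdot>\<^bsub>D0 E\<^esub> onArr (tcod (mmr \<mu>)) g"
       "ctgt E (atArr (mmr \<mu>) g) = onArr (tdom (mmr \<mu>)) g \<cdot>\<^bsub>D0 E\<^esub> atOb (mmr \<mu>) ?y"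
       "Cod (D1 E) (atArr (mmr \<mu>) g) = idp E (onOb (tcod (mmr \<mu>)) ?y)"
       "Dom (D1 E) (atArr (mmr \<mu>) g) = idp E (onOb (tdom (mmr \<mu>)) ?x)"
      using tcell_closed[OF fr(2) fg(2)] fg(3,4) unfolding tcell_def by simp_all
    have "snatural \<mu> f \<gamma>s g \<longleftrightarrow> ucell (tcell (mml \<mu>) f \<^bold>\<star> (T \<^bold>\<cdot> mucell \<mu> ?y)) =
        ucell ((mucell \<mu> ?x \<^bold>\<cdot> mdcell ?N ?s) \<^bold>\<star> tcell (mmr \<mu>) g)"
      unfolding snatural_def T_def[symmetric]
      using fr T s ss xy fg by (auto intro: S_eqI)
    moreover have nN: "mcell ?N (lun D ?y) = idcell E (mpro ?N ?y)" "mcell ?N (run D ?y) = idcell E (mpro ?N ?y)"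
      using fr xy by simp_all
    have od: "odots D ?y (replicate ?k ?y) = ?y" by (rule odots_D[OF xy(2)])
    have lr: "lact ?N ?y ?y = lun E (mpro ?N ?y)" "ract ?N ?y ?y = run E (mpro ?N ?y)" using fr xy by simp_all
    have NP: "mpro ?N ?y \<in> Pros E" using fr(3) xy by simp
    have su: "stars E (onArr ?F f) (map2 mcell (mmin \<mu>) \<gamma>s) \<in> Cells E"
      "Dom (D1 E) (stars E (onArr ?F f) (map2 mcell (mmin \<mu>) \<gamma>s)) = odots E (onOb ?F ?x) (mvals (mmin \<mu>) ?x)"
      "Cod (D1 E) (stars E (onArr ?F f) (map2 mcell (mmin \<mu>) \<gamma>s)) = odots E (onOb ?F ?y) (mvals (mmin \<mu>) ?y)"
      "csrc E (stars E (onArr ?F f) (map2 mcell (mmin \<mu>) \<gamma>s)) = onArr ?F f"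
      using ucell_closed[OF T(1)] T(2,4,5) unfolding T(6) by simp_all
    have lr2: "lun E (mpro ?N ?y) \<bullet>\<^bsub>E\<^esub> idcell E (mpro ?N ?y) = lun E (mpro ?N ?y)"
      "run E (mpro ?N ?y) \<bullet>\<^bsub>E\<^esub> idcell E (mpro ?N ?y) = run E (mpro ?N ?y)"
      using NP by simp_all
    \<comment> \<open>Both sides of the axiom end in \<open>mcell\<close> of an identity. The law
      that drops it is stated for variables, which keeps the long composites opaque to
      rewriting.\<close>
    have as: "(a \<bullet>\<^bsub>E\<^esub> b \<bullet>\<^bsub>E\<^esub> c) \<bullet>\<^bsub>E\<^esub> d = a \<bullet>\<^bsub>E\<^esub> b \<bullet>\<^bsub>E\<^esub> c" if "c \<bullet>\<^bsub>E\<^esub> d = c" "a \<in> Cells E" "b \<in> Cells E" "c \<in> Cells E" "d \<in> Cells E"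
      "Cod (D1 E) a = Dom (D1 E) b" "Cod (D1 E) b = Dom (D1 E) c" "Cod (D1 E) c = Dom (D1 E) d" for a b c d
      using that by simp
    have pth: "(onOb ?F ?x, mvals (mmin \<mu>) ?x) \<in> paths E" "(onOb ?F ?y, mvals (mmin \<mu>) ?y) \<in> paths E"
      using mpath_paths(1)[OF fr(6)] xy by simp_all
    note po = E.path_odot_closed[OF pth(1), simplified] E.path_odot_closed[OF pth(2), simplified]
    have cl: "chain_end (ptgt E) (onOb ?F ?x) (mvals (mmin \<mu>) ?x) = onOb (tdom (mmr \<mu>)) ?x" using mpath_paths(2)[OF fr(6) xy(1)] .
    have 1: "lun_inv E (odots E (onOb ?F ?x) (mvals (mmin \<mu>) ?x)) \<bullet>\<^bsub>E\<^esub>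
           (atArr (mml \<mu>) f \<star>\<^bsub>E\<^esub> (stars E (onArr ?F f) (map2 mcell (mmin \<mu>) \<gamma>s) \<bullet>\<^bsub>E\<^esub> mmc \<mu> (?y, replicate ?k ?y))) \<bullet>\<^bsub>E\<^esub>
           lun E (mpro ?N ?y) \<bullet>\<^bsub>E\<^esub> idcell E (mpro ?N ?y) = lun_inv E (odots E (onOb ?F ?x) (mvals (mmin \<mu>) ?x)) \<bullet>\<^bsub>E\<^esub>
           (atArr (mml \<mu>) f \<star>\<^bsub>E\<^esub> (stars E (onArr ?F f) (map2 mcell (mmin \<mu>) \<gamma>s) \<bullet>\<^bsub>E\<^esub> mmc \<mu> (?y, replicate ?k ?y))) \<bullet>\<^bsub>E\<^esub>
           lun E (mpro ?N ?y)"
      by (rule as) (use lr2 su tl po NP fr xy in simp_all)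
    have 2: "run_inv E (odots E (onOb ?F ?x) (mvals (mmin \<mu>) ?x)) \<bullet>\<^bsub>E\<^esub>
           ((mmc \<mu> (?x, replicate ?k ?x) \<bullet>\<^bsub>E\<^esub> mcell ?N ?s) \<star>\<^bsub>E\<^esub> atArr (mmr \<mu>) g) \<bullet>\<^bsub>E\<^esub> run E (mpro ?N ?y) \<bullet>\<^bsub>E\<^esub> idcell E (mpro ?N ?y) =
          run_inv E (odots E (onOb ?F ?x) (mvals (mmin \<mu>) ?x)) \<bullet>\<^bsub>E\<^esub>
           ((mmc \<mu> (?x, replicate ?k ?x) \<bullet>\<^bsub>E\<^esub> mcell ?N ?s) \<star>\<^bsub>E\<^esub> atArr (mmr \<mu>) g) \<bullet>\<^bsub>E\<^esub> run E (mpro ?N ?y)"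
      by (rule as) (use lr2 tr po cl NP fr xy s ss fg in simp_all)
    show ?thesis
      unfolding Let_def ml calculation L R
      using ms 1 2 by (simp add: od lr nN[simplified] fg(4) del: umod_simps uobj_simps E.D1.cmp_assoc E.D1.cmp_ide')
  qed
  show ?thesis unfolding multi_natural_def using eq by blast
qed

definition sid :: "'p \<Rightarrow> ('x \<times> 'p list) \<times> ('x \<times> 'p list) \<times> 'c" where
  "sid p = idcell S (psrc E p, [p])"

lemma sid_closed [simp]:
  assumes "p \<in> Pros E"
  shows "sid p \<in> Cells S" "Dom (D1 S) (sid p) = (psrc E p, [p])" "Cod (D1 S) (sid p) = (psrc E p, [p])"
    "csrc S (sid p) = ide (D0 E) (psrc E p)" "ctgt S (sid p) = ide (D0 E) (ptgt E p)" "ucell (sid p) = idcell E p"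
  using assms by (simp_all add: sid_def ucell_S)

lemma stars_sids:
  "ppath E x ps y \<Longrightarrow> cpath S (ide (D0 E) x) (map sid ps) (ide (D0 E) y) \<and>
    stars S (ide (D0 E) x) (map sid ps) = idcell S (x, ps)"
proof (induction ps arbitrary: x)
  case Nil
  then show ?case by (auto simp: S_idc_ide)
next
  case (Cons p ps)
  have p: "p \<in> Pros E" "psrc E p = x" "ppath E (ptgt E p) ps y" using Cons(2) by auto
  note IH = Cons.IH[OF p(3)]
  have c: "cpath S (ide (D0 E) x) (sid p # map sid ps) (ide (D0 E) y)" using IH p by auto
  have pp: "(ptgt E p, ps) \<in> paths E" using E.paths_ppath[OF p(3)] by simp
  have "sid p \<^bold>\<star> idcell S (ptgt E p, ps) = idcell S (x, p # ps)"
    using S.star_id[of "(x, [p])" "(ptgt E p, ps)"] p pp unfolding sid_def by simp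
  then show ?case using c IH p S.stars_Cons[OF c] by simp
qed

text \<open>The identity of \<open>idp E x\<close>, as a cell from the path consisting of \<open>idp E x\<close> to the empty path.
  Whiskering it yields the unit isomorphisms.\<close>

definition ucoh :: "'x \<Rightarrow> ('x \<times> 'p list) \<times> ('x \<times> 'p list) \<times> 'c" where
  "ucoh x = ((x, [idp E x]), (x, []), idcell E (idp E x))"

lemma ucoh_closed [simp]:
  assumes "x \<in> Objs E"
  shows "ucoh x \<in> Cells S" "Dom (D1 S) (ucoh x) = (x, [idp E x])" "Cod (D1 S) (ucoh x) = (x, [])"
    "csrc S (ucoh x) = ide (D0 E) x" "ctgt S (ucoh x) = ide (D0 E) x" "ucell (ucoh x) = idcell E (idp E x)"
  using assms by (simp_all add: ucoh_def)

definition slun :: "'p \<Rightarrow> ('x \<times> 'p list) \<times> ('x \<times> 'p list) \<times> 'c" where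
  "slun p = ((psrc E p, [idp E (psrc E p), p]), (psrc E p, [p]), lun E p)"

definition srun :: "'p \<Rightarrow> ('x \<times> 'p list) \<times> ('x \<times> 'p list) \<times> 'c" where
  "srun p = ((psrc E p, [p, idp E (ptgt E p)]), (psrc E p, [p]), run E p)"

text \<open>The unit isomorphism arises from the codomain of \<open>ucoh\<close>: the
  \<open>coh\<close> of an empty path with \<open>[p]\<close> is \<open>lun p\<close>, while the
  domain coherence is an identity.\<close>

lemma slun_eq:
  assumes "p \<in> Pros E" shows "slun p = ucoh (psrc E p) \<^bold>\<star> sid p"
  by (rule S_eqI) (use assms in \<open>simp_all add: ucell_S E.star_id, simp_all add: slun_def\<close>)

lemma srun_eq:
  assumes "p \<in> Pros E" shows "srun p = sid p \<^bold>\<star> ucoh (ptgt E p)"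
  by (rule S_eqI) (use assms in \<open>simp_all add: ucell_S E.star_id, simp_all add: srun_def\<close>)

lemma slun_closed [simp]:
  assumes "p \<in> Pros E"
  shows "slun p \<in> Cells S" "csrc S (slun p) = ide (D0 E) (psrc E p)" "ctgt S (slun p) = ide (D0 E) (ptgt E p)"
    "ucell (slun p) = lun E p" "fst (slun p) = (psrc E p, [idp E (psrc E p), p])" "fst (snd (slun p)) = (psrc E p, [p])"
  using assms by (simp_all add: slun_eq) (simp_all flip: slun_eq, simp_all add: slun_def)

lemma srun_closed [simp]:
  assumes "p \<in> Pros E"
  shows "srun p \<in> Cells S" "csrc S (srun p) = ide (D0 E) (psrc E p)" "ctgt S (srun p) = ide (D0 E) (ptgt E p)"
    "ucell (srun p) = run E p" "fst (srun p) = (psrc E p, [p, idp E (ptgt E p)])" "fst (snd (srun p)) = (psrc E p, [p])"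
  using assms by (simp_all add: srun_eq) (simp_all flip: srun_eq, simp_all add: srun_def)

lemma fst_sid [simp]: "fst (sid p) = (psrc E p, [p])" "fst (snd (sid p)) = (psrc E p, [p])"
  by (simp_all add: sid_def E.strictify_simps)

lemma ucell_sids: "ppath E x ps y \<Longrightarrow> map ucell (map sid ps) = map (idcell E) ps"
  by (induction ps arbitrary: x) auto

lemma fst_sids: "map (\<lambda>c. snd (fst c)) (map sid ps) = singles ps"
  by (induction ps) auto

text \<open>One side of the axiom removes the unit proarrow after the component of \<mu> has been
  applied, the other side before. Both are the same interchange of \<open>ucoh\<close> with that
  component, the action of the first module being \<open>slun\<close>.\<close>

lemma left_equivariantI:
  assumes \<mu>: "mmframe \<mu>"
  shows "left_equivariant D E \<mu>"
  unfolding left_equivariant_def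
proof (intro allI impI, elim conjE)
  fix M Ms w m0 m ms y
  assume min: "mmin \<mu> = M # Ms" and p: "ppath D w (m0 # m # ms) y" and l: "length ms = length Ms"
  have w: "w \<in> Objs D" "m0 = w" "m = w" "ms = replicate (length Ms) w" using p l ppath_D[of m ms y] by auto
  let ?F = "tdom (mml \<mu>)" and ?N = "mmout \<mu>"
  define X where "X = onOb ?F w"
  define qs where "qs = mvals Ms w"
  define m' where "m' = mmc \<mu> (w, replicate (Suc (length Ms)) w)"
  note fr = mmframeD[OF \<mu>]
  note mc = mmframe_cell[OF \<mu> w(1), unfolded min, simplified, folded m'_def[simplified] X_def qs_def]
  have M: "umod M" "msrc D M = ?F" "mpath (mtgt D M) Ms (tdom (mmr \<mu>))" using fr(6) unfolding min by auto
  have F: "uobj ?F" using umod_uobj(1)[OF M(1)] M(2) by simp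
  have pM: "mpro M w \<in> Pros E" "psrc E (mpro M w) = X" "ptgt E (mpro M w) = onOb (mtgt D M) w" "X \<in> Objs E"
    using M w F by (simp_all add: X_def)
  have pq: "ppath E (onOb (mtgt D M) w) qs (onOb (tdom (mmr \<mu>)) w)"
    unfolding qs_def by (rule mpath_ppath[OF M(3) w(1)])
  have pp: "ppath E X (mpro M w # qs) (onOb (tdom (mmr \<mu>)) w)" using pM pq by simp
  have path: "(X, mpro M w # qs) \<in> paths E" using E.paths_ppath[OF pp] by simp
  define P where "P = odots E X (mpro M w # qs)"
  have P: "P \<in> Pros E" "psrc E P = X" using E.odots_closed[OF pp] by (auto simp: P_def)
  have a: "atOb (mml \<mu>) w \<in> Arrs E" "Dom (D0 E) (atOb (mml \<mu>) w) = X" using fr(1) w by (simp_all add: X_def)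
  have mu: "mucell \<mu> w \<in> Cells S" "csrc S (mucell \<mu> w) = atOb (mml \<mu>) w" "Dom (D1 S) (mucell \<mu> w) = (X, mpro M w # qs)"
    using fr(7,8) w by (simp_all add: min X_def qs_def)
  have N: "mpro ?N w \<in> Pros E" using fr(3) w by simp
  have cod: "Cod (D0 E) (atOb (mml \<mu>) w) = onOb (msrc D ?N) w" using fr(1,4) w by simp
  have "(ucoh X \<^bold>\<cdot> idc S (atOb (mml \<mu>) w)) \<^bold>\<star> (idcell S (X, mpro M w # qs) \<^bold>\<cdot> mucell \<mu> w) =
      (ucoh X \<^bold>\<star> idcell S (X, mpro M w # qs)) \<^bold>\<cdot> (idc S (atOb (mml \<mu>) w) \<^bold>\<star> mucell \<mu> w)"
    by (rule S.interchange) (use pM a mu path in simp_all)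
  then have key: "(ucoh X \<^bold>\<cdot> idc S (atOb (mml \<mu>) w)) \<^bold>\<star> mucell \<mu> w = (ucoh X \<^bold>\<star> idcell S (X, mpro M w # qs)) \<^bold>\<cdot> mucell \<mu> w"
    using mu path S.D1.ide_cmp'[of "mucell \<mu> w" "(X, mpro M w # qs)"] by simp
  \<comment> \<open>The left factor has an empty codomain path, so \<open>lun\<close> at the output
    proarrow, which is the left action of the output module, appears here as codomain
    coherence.\<close>
  have L: "ucell ((ucoh X \<^bold>\<cdot> idc S (atOb (mml \<mu>) w)) \<^bold>\<star> mucell \<mu> w) = (idc E (atOb (mml \<mu>) w) \<star>\<^bsub>E\<^esub> m') \<bullet>\<^bsub>E\<^esub> lun E (mpro ?N w)"
  proof -
    have "path_coh E (X, [idp E X]) (X, mpro M w # qs) = idcell E (idp E X \<odot>\<^bsub>E\<^esub> P)"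
      using E.coh_singleton[of "mpro M w # qs" X "idp E X"] pM by (simp add: P_def)
    then show ?thesis
      using pM a mu cod P mc N fr(4) w unfolding ucell_S(4)
      by (simp add: ucell_S min m'_def P_def[symmetric] del: coh.simps(3,4))
  qed
  let ?cs = "slun (mpro M w) # map sid qs"
  have cp: "cpath S (ide (D0 E) X) ?cs (ide (D0 E) (onOb (tdom (mmr \<mu>)) w))"
    using stars_sids[OF pq] pM by simp
  have st: "stars S (ide (D0 E) X) ?cs = ucoh X \<^bold>\<star> idcell S (X, mpro M w # qs)"
  proof -
    have "stars S (ide (D0 E) X) ?cs = slun (mpro M w) \<^bold>\<star> idcell S (onOb (mtgt D M) w, qs)"
      using S.stars_Cons[OF cp] stars_sids[OF pq] pM by simp
    also have "\<dots> = ucoh X \<^bold>\<star> (sid (mpro M w) \<^bold>\<star> idcell S (onOb (mtgt D M) w, qs))"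
      using pM E.paths_ppath[OF pq] by (simp add: slun_eq)
    also have "sid (mpro M w) \<^bold>\<star> idcell S (onOb (mtgt D M) w, qs) = idcell S (X, mpro M w # qs)"
      using S.star_id[of "(X, [mpro M w])" "(onOb (mtgt D M) w, qs)"] pM E.paths_ppath[OF pq] unfolding sid_def by simp
    finally show ?thesis .
  qed
  have "\<forall>c\<in>set ?cs. length (snd (fst (snd c))) = 1" using pM by auto
  note inv = E.strictify_stars_inverse[OF cp this, unfolded st]
  have R: "inverse_arr (D1 E) (cohs E X ([idp E X, mpro M w] # singles qs)) \<bullet>\<^bsub>E\<^esub>
     stars E (ide (D0 E) X) (lun E (mpro M w) # map (idcell E) qs) = ucell (ucoh X \<^bold>\<star> idcell S (X, mpro M w # qs))"
    using inv[unfolded list.map(2) fst_sids ucell_sids[OF pq]] pM by simp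
  have c1: "cohs E X [[idp E X], mpro M w # qs] = idcell E (idp E X \<odot>\<^bsub>E\<^esub> P)"
    using pM P by (simp add: E.star_id chain_end_def P_def)
  have c2: "is_iso (D1 E) (cohs E X ([idp E X, mpro M w] # singles qs))"
      "Dom (D1 E) (inverse_arr (D1 E) (cohs E X ([idp E X, mpro M w] # singles qs))) = idp E X \<odot>\<^bsub>E\<^esub> P"
  proof -
    have "ppath E X (concat ([idp E X, mpro M w] # singles qs)) (onOb (tdom (mmr \<mu>)) w)"
      using pM pq by (simp add: concat_singles)
    note c = E.cohs_closed[OF this]
    show "is_iso (D1 E) (cohs E X ([idp E X, mpro M w] # singles qs))"
      "Dom (D1 E) (inverse_arr (D1 E) (cohs E X ([idp E X, mpro M w] # singles qs))) = idp E X \<odot>\<^bsub>E\<^esub> P"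
      using c pM by (auto simp: concat_singles P_def)
  qed
  \<comment> \<open>The first bracketing has a single proarrow as its first block and hence is
    already bracketed to the right. Its coherence is an identity, and only the inverse for the other
    bracketing remains.\<close>
  have R': "rebracket E X [[idp E X], mpro M w # qs] ([idp E X, mpro M w] # singles qs) =
    inverse_arr (D1 E) (cohs E X ([idp E X, mpro M w] # singles qs))"
    unfolding rebracket_def c1 using c2 P pM by simp
  have reb: "mcell ?N (rebracket D w [[w], w # ms] ([w, w] # singles ms)) = idcell E (mpro ?N w)"
    using rebracket_D[OF w(1), of "[[w], w # ms]" "Suc (Suc (length ms))" "[w, w] # singles ms"] fr(3) w(1) w(4) l
    by (simp add: concat_singles)
  have lhs: "(idc E (atOb (mml \<mu>) w) \<star>\<^bsub>E\<^esub> m') \<bullet>\<^bsub>E\<^esub> lun E (mpro ?N w) \<bullet>\<^bsub>E\<^esub> idcell E (mpro ?N w) =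
      (idc E (atOb (mml \<mu>) w) \<star>\<^bsub>E\<^esub> m') \<bullet>\<^bsub>E\<^esub> lun E (mpro ?N w)"
    using a mc N fr(3,4) w cod P by simp
  have od: "odots D w (w # ms) = w" using odots_D[OF w(1), of "Suc (length Ms)"] w(4) by simp
  have mp: "mpros Ms ms = qs" "mpros (M # Ms) (w # ms) = mpro M w # qs"
    using mpros_replicate[of Ms "length Ms" w] w(4) by (simp_all add: qs_def)
  have mm: "mmc \<mu> (w, w # ms) = m'" using w(4) by (simp add: m'_def)
  have "(idc E (atOb (mml \<mu>) w) \<star>\<^bsub>E\<^esub> m') \<bullet>\<^bsub>E\<^esub> lun E (mpro ?N w) \<bullet>\<^bsub>E\<^esub> idcell E (mpro ?N w) =
     rebracket E X [[idp E X], mpro M w # qs] ([idp E X, mpro M w] # singles qs) \<bullet>\<^bsub>E\<^esub>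
     stars E (ide (D0 E) X) (lun E (mpro M w) # map (idcell E) qs) \<bullet>\<^bsub>E\<^esub> m'"
    unfolding lhs R' R using L key by (simp add: ucell_S min m'_def)
  then show "let N = mmout \<mu>; F = tdom (mml \<mu>); x = psrc D m
        in (atPro (mml \<mu>) m0 \<star>\<^bsub>E\<^esub> mmc \<mu> (x, m # ms)) \<bullet>\<^bsub>E\<^esub> lact N m0 (odots D x (m # ms)) \<bullet>\<^bsub>E\<^esub>
           mcell N (rebracket D w [[m0], m # ms] ([m0, m] # singles ms)) =
         rebracket E (onOb F w) [[onPro F m0], mpros (M # Ms) (m # ms)]
             ([onPro F m0, mpro M m] # singles (mpros Ms ms)) \<bullet>\<^bsub>E\<^esub>
           stars E (ide (D0 E) (onOb F w)) (lact M m0 m # map (idcell E) (mpros Ms ms)) \<bullet>\<^bsub>E\<^esub>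
           mmc \<mu> (w, (m0 \<odot>\<^bsub>D\<^esub> m) # ms)"
    unfolding Let_def w(2,3) VerDbl_sel od mp reb mm X_def[symmetric]
    using fr(1,3) M F w(1) by (simp add: X_def)
qed

text \<open>The interchange is mirrored, but right bracketing breaks the symmetry: appending a unit
  at the far end of the path needs the coherence \<open>h\<close>. It occurs inverted in the strict
  composite and as the first factor of \<open>rebracket\<close>, and the two occurrences
  match.\<close>

lemma right_equivariantI:
  assumes \<mu>: "mmframe \<mu>"
  shows "right_equivariant D E \<mu>"
  unfolding right_equivariant_def
proof (intro allI impI, elim conjE)
  fix M Ms w ms m m2 y
  assume min: "mmin \<mu> = Ms @ [M]" and p: "ppath D w (ms @ [m, m2]) y" and l: "length ms = length Ms"
  have w: "w \<in> Objs D" "m2 = w" "m = w" "ms = replicate (length Ms) w"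
  proof -
    obtain z where z: "ppath D w ms z" "ppath D z [m, m2] y" using p by (auto simp: D.ppath_append)
    show "w \<in> Objs D" "m2 = w" "m = w" "ms = replicate (length Ms) w"
      using z l ppath_D[of w ms z] by auto
  qed
  let ?F = "tdom (mml \<mu>)" and ?N = "mmout \<mu>" and ?G = "tdom (mmr \<mu>)"
  define X Y where "X = onOb ?F w" and "Y = onOb ?G w"
  define qs where "qs = mvals Ms w"
  define m' where "m' = mmc \<mu> (w, replicate (Suc (length Ms)) w)"
  note fr = mmframeD[OF \<mu>]
  note mc = mmframe_cell[OF \<mu> w(1), unfolded min, simplified, folded m'_def[simplified] X_def qs_def]
  obtain H where M: "umod M" "msrc D M = H" "mtgt D M = ?G" "mpath ?F Ms H" "uobj ?G"
    using fr(6) unfolding min by (auto simp: mpath_append)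
  have F: "uobj ?F" using mpath_uobj[OF M(4)] by simp
  have pM: "mpro M w \<in> Pros E" "psrc E (mpro M w) = onOb H w" "ptgt E (mpro M w) = Y" "X \<in> Objs E" "Y \<in> Objs E"
    using M w F by (auto simp: X_def Y_def)
  have pq: "ppath E X qs (onOb H w)" unfolding qs_def X_def by (rule mpath_ppath[OF M(4) w(1)])
  have pp: "ppath E X (qs @ [mpro M w]) Y" using pM pq by (auto simp: E.ppath_append)
  have path: "(X, qs @ [mpro M w]) \<in> paths E" "chain_end (ptgt E) X (qs @ [mpro M w]) = Y"
    using E.paths_ppath[OF pp] by simp_all
  define P where "P = odots E X (qs @ [mpro M w])"
  have P: "P \<in> Pros E" "psrc E P = X" "ptgt E P = Y" using E.odots_closed[OF pp] by (auto simp: P_def)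
  have b: "atOb (mmr \<mu>) w \<in> Arrs E" "Dom (D0 E) (atOb (mmr \<mu>) w) = Y" using fr(2) w by (simp_all add: Y_def)
  have mu: "mucell \<mu> w \<in> Cells S" "ctgt S (mucell \<mu> w) = atOb (mmr \<mu>) w" "Dom (D1 S) (mucell \<mu> w) = (X, qs @ [mpro M w])"
    using fr(7,9) w by (simp_all add: min X_def qs_def)
  have N: "mpro ?N w \<in> Pros E" "ptgt E (mpro ?N w) = onOb (mtgt D ?N) w" using fr(3) w by simp_all
  have cod: "Cod (D0 E) (atOb (mmr \<mu>) w) = onOb (mtgt D ?N) w" using fr(2,5) w by simp
  have "(idcell S (X, qs @ [mpro M w]) \<^bold>\<cdot> mucell \<mu> w) \<^bold>\<star> (ucoh Y \<^bold>\<cdot> idc S (atOb (mmr \<mu>) w)) =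
      (idcell S (X, qs @ [mpro M w]) \<^bold>\<star> ucoh Y) \<^bold>\<cdot> (mucell \<mu> w \<^bold>\<star> idc S (atOb (mmr \<mu>) w))"
    by (rule S.interchange) (use pM b mu path in simp_all)
  then have key: "mucell \<mu> w \<^bold>\<star> (ucoh Y \<^bold>\<cdot> idc S (atOb (mmr \<mu>) w)) = (idcell S (X, qs @ [mpro M w]) \<^bold>\<star> ucoh Y) \<^bold>\<cdot> mucell \<mu> w"
    using mu path S.D1.ide_cmp'[of "mucell \<mu> w" "(X, qs @ [mpro M w])"] by simp
  define h where "h = coh E X (qs @ [mpro M w]) [idp E Y]"
  have pY: "(Y, [idp E Y]) \<in> paths E" using pM by simp
  have h: "is_iso (D1 E) h" "h \<in> Cells E" "Dom (D1 E) h = P \<odot>\<^bsub>E\<^esub> idp E Y" "Cod (D1 E) h = odots E X (qs @ [mpro M w, idp E Y])"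
    using E.path_coh_closed[OF path(1) pY] path(2) by (simp_all add: h_def P_def)
  have L: "ucell (mucell \<mu> w \<^bold>\<star> (ucoh Y \<^bold>\<cdot> idc S (atOb (mmr \<mu>) w))) =
     inverse_arr (D1 E) h \<bullet>\<^bsub>E\<^esub> (m' \<star>\<^bsub>E\<^esub> idc E (atOb (mmr \<mu>) w)) \<bullet>\<^bsub>E\<^esub> run E (mpro ?N w)"
    using pM b mu cod P mc N fr(5) w unfolding ucell_S(4)
    by (simp add: ucell_S min m'_def h_def)
  let ?cs = "map sid qs @ [srun (mpro M w)]"
  have cp1: "cpath S (ide (D0 E) (onOb H w)) [srun (mpro M w)] (ide (D0 E) Y)" using pM by simp
  have cp: "cpath S (ide (D0 E) X) ?cs (ide (D0 E) Y)"
    using stars_sids[OF pq] cp1 by (auto simp: S.cpath_append)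
  have pathq: "(X, qs) \<in> paths E" "chain_end (ptgt E) X qs = onOb H w" using E.paths_ppath[OF pq] by simp_all
  have st: "stars S (ide (D0 E) X) ?cs = idcell S (X, qs @ [mpro M w]) \<^bold>\<star> ucoh Y"
  proof -
    have "stars S (ide (D0 E) X) ?cs = idcell S (X, qs) \<^bold>\<star> srun (mpro M w)"
      using S.stars_append[OF conjunct1[OF stars_sids[OF pq]] cp1] stars_sids[OF pq] by simp
    also have "\<dots> = (idcell S (X, qs) \<^bold>\<star> sid (mpro M w)) \<^bold>\<star> ucoh Y"
      using pM pathq by (simp add: srun_eq)
    also have "idcell S (X, qs) \<^bold>\<star> sid (mpro M w) = idcell S (X, qs @ [mpro M w])"
      using S.star_id[of "(X, qs)" "(onOb H w, [mpro M w])"] pM pathq unfolding sid_def by simp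
    finally show ?thesis .
  qed
  have one: "\<forall>c\<in>set ?cs. length (snd (fst (snd c))) = 1" using pM by auto
  note inv = E.strictify_stars_inverse[OF cp one, unfolded st]
  let ?B = "singles qs @ [[mpro M w, idp E Y]]"
  have R: "inverse_arr (D1 E) (cohs E X ?B) \<bullet>\<^bsub>E\<^esub>
     stars E (ide (D0 E) X) (map (idcell E) qs @ [run E (mpro M w)]) = ucell (idcell S (X, qs @ [mpro M w]) \<^bold>\<star> ucoh Y)"
    using inv[unfolded map_append fst_sids ucell_sids[OF pq]] pM by simp
  have ce: "chain_end (ptgt E) X (qs @ [mpro M w]) = Y" by (rule path(2))
  have c1: "cohs E X [qs @ [mpro M w], [idp E Y]] = h"
    using pM P h unfolding h_def by (simp add: E.star_id ce flip: P_def)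
  have c2: "is_iso (D1 E) (cohs E X ?B)" "Dom (D1 E) (inverse_arr (D1 E) (cohs E X ?B)) = Cod (D1 E) h"
    "Cod (D1 E) (inverse_arr (D1 E) (cohs E X ?B)) = odots E X (blocks E X ?B)"
  proof -
    have "ppath E X (concat ?B) Y"
      using pM pq by (auto simp: concat_singles E.ppath_append)
    note c = E.cohs_closed[OF this]
    show "is_iso (D1 E) (cohs E X ?B)" "Dom (D1 E) (inverse_arr (D1 E) (cohs E X ?B)) = Cod (D1 E) h"
     "Cod (D1 E) (inverse_arr (D1 E) (cohs E X ?B)) = odots E X (blocks E X ?B)"
      using c pM h by (auto simp: concat_singles)
  qed
  have stE: "stars E (ide (D0 E) X) (map (idcell E) qs @ [run E (mpro M w)]) \<in> Cells E"
    "Dom (D1 E) (stars E (ide (D0 E) X) (map (idcell E) qs @ [run E (mpro M w)])) = odots E X (blocks E X ?B)"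
    "Cod (D1 E) (stars E (ide (D0 E) X) (map (idcell E) qs @ [run E (mpro M w)])) = P"
  proof -
    have s1: "stars S (ide (D0 E) X) ?cs \<in> Cells S" using S.stars_closed[OF cp] by simp
    have sc: "Dom (D1 S) (stars S (ide (D0 E) X) ?cs) = (X, qs @ [mpro M w, idp E Y])"
      "Cod (D1 S) (stars S (ide (D0 E) X) ?cs) = (X, qs @ [mpro M w])"
      unfolding st using path pM by simp_all
    have e: "stars E (ide (D0 E) X) (map (idcell E) qs @ [run E (mpro M w)]) = cohs E X ?B \<bullet>\<^bsub>E\<^esub> ucell (stars S (ide (D0 E) X) ?cs)"
      using E.strictify_stars_cohs[OF cp one, unfolded map_append fst_sids ucell_sids[OF pq]] pM by simp
    have "ppath E X (concat ?B) Y"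
      using pM pq by (auto simp: concat_singles E.ppath_append)
    note c = E.cohs_closed[OF this]
    show "stars E (ide (D0 E) X) (map (idcell E) qs @ [run E (mpro M w)]) \<in> Cells E"
    "Dom (D1 E) (stars E (ide (D0 E) X) (map (idcell E) qs @ [run E (mpro M w)])) = odots E X (blocks E X ?B)"
    "Cod (D1 E) (stars E (ide (D0 E) X) (map (idcell E) qs @ [run E (mpro M w)])) = P"
      unfolding e using c ucell_closed[OF s1] sc by (simp_all add: concat_singles P_def)
  qed
  have rr: "replicate n w @ [w, w] = w # w # replicate n w" for n by (induction n) auto
  have reb: "mcell ?N (rebracket D w [ms @ [w], [w]] (singles ms @ [[w, w]])) = idcell E (mpro ?N w)"
    using rebracket_D[OF w(1), of "[ms @ [w], [w]]" "Suc (Suc (length ms))" "singles ms @ [[w, w]]"] fr(3) w(1) w(4) l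
    by (simp add: concat_singles replicate_append_same rr)
  have lhs: "(m' \<star>\<^bsub>E\<^esub> idc E (atOb (mmr \<mu>) w)) \<bullet>\<^bsub>E\<^esub> run E (mpro ?N w) \<bullet>\<^bsub>E\<^esub> idcell E (mpro ?N w) =
      (m' \<star>\<^bsub>E\<^esub> idc E (atOb (mmr \<mu>) w)) \<bullet>\<^bsub>E\<^esub> run E (mpro ?N w)"
    using b mc N fr(3,5) w cod P by simp
  have od: "odots D w (ms @ [w]) = w" using odots_D[OF w(1), of "Suc (length Ms)"] w(4) by (simp add: replicate_append_same)
  have mp: "mpros Ms ms = qs" "mpros (Ms @ [M]) (ms @ [w]) = qs @ [mpro M w]"
    using mpros_replicate[of Ms "length Ms" w] mpros_replicate[of "Ms @ [M]" "Suc (length Ms)" w] w(4)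
    by (simp_all add: qs_def replicate_append_same)
  have "ms @ [w] = replicate (Suc (length Ms)) w" using w(4) by (simp add: replicate_append_same)
  then have mm: "mmc \<mu> (w, ms @ [w]) = m'" by (simp add: m'_def)
  have mt: "m' \<in> Cells E" "Dom (D1 E) m' = P" "ctgt E m' = atOb (mmr \<mu>) w" "Cod (D1 E) m' = mpro ?N w" using mc by (simp_all add: P_def)
  have "(m' \<star>\<^bsub>E\<^esub> idc E (atOb (mmr \<mu>) w)) \<bullet>\<^bsub>E\<^esub> run E (mpro ?N w) =
     h \<bullet>\<^bsub>E\<^esub> ucell (mucell \<mu> w \<^bold>\<star> (ucoh Y \<^bold>\<cdot> idc S (atOb (mmr \<mu>) w)))"
    unfolding L using h mt b cod N P pM by (simp add: E.D1.cmp_inverse_cancel)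
  also have "\<dots> = h \<bullet>\<^bsub>E\<^esub> (ucell (idcell S (X, qs @ [mpro M w]) \<^bold>\<star> ucoh Y) \<bullet>\<^bsub>E\<^esub> m')"
    unfolding key by (simp add: ucell_S min m'_def)
  also have "\<dots> = rebracket E X [qs @ [mpro M w], [idp E Y]] ?B \<bullet>\<^bsub>E\<^esub>
     stars E (ide (D0 E) X) (map (idcell E) qs @ [run E (mpro M w)]) \<bullet>\<^bsub>E\<^esub> m'"
    unfolding R[symmetric] rebracket_def c1 using c2 h stE mt by simp
  finally have "(m' \<star>\<^bsub>E\<^esub> idc E (atOb (mmr \<mu>) w)) \<bullet>\<^bsub>E\<^esub> run E (mpro ?N w) \<bullet>\<^bsub>E\<^esub> idcell E (mpro ?N w) =
     rebracket E X [qs @ [mpro M w], [idp E Y]] ?B \<bullet>\<^bsub>E\<^esub>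
     stars E (ide (D0 E) X) (map (idcell E) qs @ [run E (mpro M w)]) \<bullet>\<^bsub>E\<^esub> m'"
    unfolding lhs .
  then show "let N = mmout \<mu>; F = tdom (mml \<mu>); F' = tdom (mmr \<mu>)
        in (mmc \<mu> (w, ms @ [m]) \<star>\<^bsub>E\<^esub> atPro (mmr \<mu>) m2) \<bullet>\<^bsub>E\<^esub> ract N (odots D w (ms @ [m])) m2 \<bullet>\<^bsub>E\<^esub>
           mcell N (rebracket D w [ms @ [m], [m2]] (singles ms @ [[m, m2]])) =
         rebracket E (onOb F w) [mpros (Ms @ [M]) (ms @ [m]), [onPro F' m2]]
             (singles (mpros Ms ms) @ [[mpro M m, onPro F' m2]]) \<bullet>\<^bsub>E\<^esub>
           stars E (ide (D0 E) (onOb F w)) (map (idcell E) (mpros Ms ms) @ [ract M m m2]) \<bullet>\<^bsub>E\<^esub>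
           mmc \<mu> (w, ms @ [m \<odot>\<^bsub>D\<^esub> m2])"
    unfolding Let_def w(2,3) VerDbl_sel od mp reb mm X_def[symmetric]
    using fr(2,3) M F w(1) by (simp add: X_def Y_def)
qed

text \<open>Both actions consume the same unit between the two modules, and in the strictification
  \<open>srun k\<close> beside \<open>sid j\<close> is \<open>sid k\<close> beside
  \<open>slun j\<close> by associativity alone. The axiom says that the two bracketings present one
  strict cell.\<close>

lemma inner_equivariantI:
  assumes \<mu>: "mmframe \<mu>"
  shows "inner_equivariant D E \<mu>"
  unfolding inner_equivariant_def
proof (intro allI impI, elim conjE)
  fix Ms M M' Ms' w ms m p m2 ms' y
  assume min: "mmin \<mu> = Ms @ [M, M'] @ Ms'" and pth: "ppath D w (ms @ [m, p, m2] @ ms') y"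
    and l: "length ms = length Ms" "length ms' = length Ms'"
  have w: "w \<in> Objs D" "m = w" "p = w" "m2 = w" "ms = replicate (length Ms) w" "ms' = replicate (length Ms') w"
  proof -
    obtain z where z: "ppath D w ms z" "ppath D z ([m, p, m2] @ ms') y" using pth by (auto simp: D.ppath_append)
    show "w \<in> Objs D" "m = w" "p = w" "m2 = w" "ms = replicate (length Ms) w" "ms' = replicate (length Ms') w"
      using z l ppath_D[of w ms z] ppath_D[of m2 ms' y] by auto
  qed
  let ?F = "tdom (mml \<mu>)" and ?N = "mmout \<mu>"
  define X where "X = onOb ?F w"
  define as bs where "as = mvals Ms w" and "bs = mvals Ms' w"
  define m' where "m' = mmc \<mu> (w, replicate (length (mmin \<mu>)) w)"
  note fr = mmframeD[OF \<mu>]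
  obtain H where M: "umod M" "msrc D M = H" "mpath ?F Ms H" "umod M'" "msrc D M' = mtgt D M" "mpath (mtgt D M') Ms' (tdom (mmr \<mu>))"
    using fr(6) unfolding min by (auto simp: mpath_append)
  define K where "K = mtgt D M"
  have K: "uobj K" "uobj ?F" "uobj H" using M mpath_uobj[OF M(3)] by (auto simp: K_def)
  define J where "J = mtgt D M'"
  define k j where "k = mpro M w" and "j = mpro M' w"
  have pM: "k \<in> Pros E" "psrc E k = onOb H w" "ptgt E k = onOb K w"
    "j \<in> Pros E" "psrc E j = onOb K w" "ptgt E j = onOb J w" "onOb K w \<in> Objs E"
    using M w K by (auto simp: K_def J_def k_def j_def)
  have pa: "ppath E X as (onOb H w)" unfolding as_def X_def by (rule mpath_ppath[OF M(3) w(1)])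
  have pb: "ppath E (onOb J w) bs (onOb (tdom (mmr \<mu>)) w)" unfolding bs_def J_def by (rule mpath_ppath[OF M(6) w(1)])
  let ?I = "idp E (onOb K w)"
  let ?c1 = "map sid as @ [srun k, sid j] @ map sid bs" and ?c2 = "map sid as @ [sid k, slun j] @ map sid bs"
  have d1: "cpath S (ide (D0 E) (onOb H w)) ([srun k, sid j] @ map sid bs) (ide (D0 E) (onOb (tdom (mmr \<mu>)) w))"
    and d2: "cpath S (ide (D0 E) (onOb H w)) ([sid k, slun j] @ map sid bs) (ide (D0 E) (onOb (tdom (mmr \<mu>)) w))"
    using pM stars_sids[OF pb] by simp_all
  have cp: "cpath S (ide (D0 E) X) ?c1 (ide (D0 E) (onOb (tdom (mmr \<mu>)) w))"
    "cpath S (ide (D0 E) X) ?c2 (ide (D0 E) (onOb (tdom (mmr \<mu>)) w))"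
    using stars_sids[OF pa] d1 d2 S.cpath_append by blast+
  have eq: "stars S (ide (D0 E) X) ?c1 = stars S (ide (D0 E) X) ?c2"
  proof -
    let ?r = "stars S (ide (D0 E) (onOb J w)) (map sid bs)"
    have r: "?r \<in> Cells S" "csrc S ?r = ide (D0 E) (onOb J w)" using S.stars_closed[OF conjunct1[OF stars_sids[OF pb]]] by auto
    have t1: "cpath S (ide (D0 E) (onOb H w)) (srun k # sid j # map sid bs) (ide (D0 E) (onOb (tdom (mmr \<mu>)) w))"
      "cpath S (ide (D0 E) (onOb K w)) (sid j # map sid bs) (ide (D0 E) (onOb (tdom (mmr \<mu>)) w))"
      "cpath S (ide (D0 E) (onOb H w)) (sid k # slun j # map sid bs) (ide (D0 E) (onOb (tdom (mmr \<mu>)) w))"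
      "cpath S (ide (D0 E) (onOb K w)) (slun j # map sid bs) (ide (D0 E) (onOb (tdom (mmr \<mu>)) w))"
      using d1 d2 pM by simp_all
    have "stars S (ide (D0 E) (onOb H w)) (srun k # sid j # map sid bs) = srun k \<^bold>\<star> (sid j \<^bold>\<star> ?r)"
      using S.stars_Cons[OF t1(1)] S.stars_Cons[OF t1(2)] pM by simp
    also have "\<dots> = sid k \<^bold>\<star> (slun j \<^bold>\<star> ?r)"
      using pM r by (simp add: srun_eq slun_eq)
    also have "\<dots> = stars S (ide (D0 E) (onOb H w)) (sid k # slun j # map sid bs)"
      using S.stars_Cons[OF t1(3)] S.stars_Cons[OF t1(4)] pM by simp
    finally show ?thesis
      using S.stars_append[OF conjunct1[OF stars_sids[OF pa]] d1] S.stars_append[OF conjunct1[OF stars_sids[OF pa]] d2] by simp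
  qed
  have one: "\<forall>c\<in>set ?c1. length (snd (fst (snd c))) = 1" "\<forall>c\<in>set ?c2. length (snd (fst (snd c))) = 1" using pM by auto
  let ?B1 = "singles as @ [[k, ?I], [j]] @ singles bs" and ?B2 = "singles as @ [[k], [?I, j]] @ singles bs"
  let ?u = "ucell (stars S (ide (D0 E) X) ?c1)"
  have XE: "X \<in> Objs E" using K w by (simp add: X_def)
  have E1: "cohs E X ?B1 \<bullet>\<^bsub>E\<^esub> ?u = stars E (ide (D0 E) X) (map (idcell E) as @ [run E k, idcell E j] @ map (idcell E) bs)"
    using E.strictify_stars_cohs[OF cp(1) one(1), unfolded map_append fst_sids ucell_sids[OF pa] ucell_sids[OF pb]] pM XE by simp
  have E2: "cohs E X ?B2 \<bullet>\<^bsub>E\<^esub> ?u = stars E (ide (D0 E) X) (map (idcell E) as @ [idcell E k, lun E j] @ map (idcell E) bs)"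
    using E.strictify_stars_cohs[OF cp(2) one(2), unfolded map_append fst_sids ucell_sids[OF pa] ucell_sids[OF pb]] pM XE
    unfolding eq by simp
  have pc: "ppath E X (concat ?B1) (onOb (tdom (mmr \<mu>)) w)" "ppath E X (concat ?B2) (onOb (tdom (mmr \<mu>)) w)"
    using pM pa pb by (auto simp: concat_singles E.ppath_append)
  note c1 = E.cohs_closed[OF pc(1)] and c2 = E.cohs_closed[OF pc(2)]
  have us: "?u \<in> Cells E" "Dom (D1 E) ?u = odots E X (as @ [k, ?I, j] @ bs)" "Cod (D1 E) ?u = odots E X (as @ [k, j] @ bs)"
  proof -
    have s1: "stars S (ide (D0 E) X) ?c1 \<in> Cells S" using S.stars_closed[OF cp(1)] by simp
    have m1: "map (\<lambda>c. snd (fst c)) ?c1 = ?B1" "map (\<lambda>c. snd (fst (snd c))) ?c1 = singles (as @ [k, j] @ bs)"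
      using pM fst_sids[of as] fst_sids[of bs] by simp_all
    have "Dom (D1 S) (stars S (ide (D0 E) X) ?c1) = (X, as @ [k, ?I, j] @ bs)"
      "Cod (D1 S) (stars S (ide (D0 E) X) ?c1) = (X, as @ [k, j] @ bs)"
      using E.strictify_stars[OF cp(1)] XE unfolding m1 by (simp_all add: concat_singles)
    then show "?u \<in> Cells E" "Dom (D1 E) ?u = odots E X (as @ [k, ?I, j] @ bs)" "Cod (D1 E) ?u = odots E X (as @ [k, j] @ bs)"
      using ucell_closed[OF s1] by simp_all
  qed
  have mc: "m' \<in> Cells E" "Dom (D1 E) m' = odots E X (as @ [k, j] @ bs)" "Cod (D1 E) m' = mpro ?N w"
    using mmframe_cell[OF \<mu> w(1), folded m'_def] by (simp_all add: min X_def as_def bs_def k_def j_def)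
  have N: "mpro ?N w \<in> Pros E" using fr(3) w by simp
  have main: "stars E (ide (D0 E) X) (map (idcell E) as @ [run E k, idcell E j] @ map (idcell E) bs) \<bullet>\<^bsub>E\<^esub> m' \<bullet>\<^bsub>E\<^esub> idcell E (mpro ?N w) =
    rebracket E X ?B1 ?B2 \<bullet>\<^bsub>E\<^esub> stars E (ide (D0 E) X) (map (idcell E) as @ [idcell E k, lun E j] @ map (idcell E) bs) \<bullet>\<^bsub>E\<^esub> m'"
    unfolding E1[symmetric] E2[symmetric] rebracket_def
    using c1 c2 us mc N by (simp add: concat_singles E.D1.inverse_cmp_cancel)
  have reb: "mcell ?N (rebracket D w (singles ms @ [[w, w], [w]] @ singles ms') (singles ms @ [[w], [w, w]] @ singles ms')) = idcell E (mpro ?N w)"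
  proof -
    have "ms @ [w, w, w] @ ms' = replicate (length (ms @ [w, w, w] @ ms')) w"
      using w(5,6) by (intro replicate_eqI) auto
    then obtain n where n: "ms @ [w, w, w] @ ms' = replicate n w" by blast
    show ?thesis using rebracket_D[OF w(1), of "singles ms @ [[w, w], [w]] @ singles ms'" n "singles ms @ [[w], [w, w]] @ singles ms'"] n fr(3) w(1)
      by (simp add: concat_singles)
  qed
  have mm: "mmc \<mu> (w, ms @ [w, w] @ ms') = m'"
  proof -
    have "ms @ [w, w] @ ms' = replicate (length (mmin \<mu>)) w"
      using w(5,6) by (intro replicate_eqI) (auto simp: min)
    then show ?thesis by (simp add: m'_def)
  qed
  have mp: "mpros Ms ms = as" "mpros Ms' ms' = bs"
    using mpros_replicate[of Ms "length Ms" w] mpros_replicate[of Ms' "length Ms'" w] w(5,6)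
    by (simp_all add: as_def bs_def)
  have Ip: "onPro K w = ?I" using K w by simp
  have ra: "ract M w w = run E k" "lact M' w w = lun E j" using M w(1) by (simp_all add: k_def j_def)
  show "let N = mmout \<mu>; F = tdom (mml \<mu>); Fp = onPro (mtgt D M) p; as = mpros Ms ms; bs = mpros Ms' ms' in
         stars E (ide (D0 E) (onOb F w))
             (map (idcell E) as @ [ract M m p, idcell E (mpro M' m2)] @ map (idcell E) bs) \<bullet>\<^bsub>E\<^esub>
           mmc \<mu> (w, ms @ [m \<odot>\<^bsub>D\<^esub> p, m2] @ ms') \<bullet>\<^bsub>E\<^esub>
           mcell N (rebracket D w (singles ms @ [[m, p], [m2]] @ singles ms')
                                  (singles ms @ [[m], [p, m2]] @ singles ms')) =
         rebracket E (onOb F w) (singles as @ [[mpro M m, Fp], [mpro M' m2]] @ singles bs)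
                                (singles as @ [[mpro M m], [Fp, mpro M' m2]] @ singles bs) \<bullet>\<^bsub>E\<^esub>
           stars E (ide (D0 E) (onOb F w))
             (map (idcell E) as @ [idcell E (mpro M m), lact M' p m2] @ map (idcell E) bs) \<bullet>\<^bsub>E\<^esub>
           mmc \<mu> (w, ms @ [m, p \<odot>\<^bsub>D\<^esub> m2] @ ms')"
    unfolding Let_def w(2,3,4) VerDbl_sel mp mm reb ra K_def[symmetric] Ip k_def[symmetric] j_def[symmetric] X_def[symmetric]
    by (rule main)
qed

text \<open>The two sides are the component of \<mu>, composed externally with the identity of its
  right boundary or of its left boundary; strict units make both equal to the component
  itself.\<close>

lemma nullary_equivariantI:
  assumes \<mu>: "mmframe \<mu>"
  shows "nullary_equivariant D E \<mu>"
  unfolding nullary_equivariant_def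
proof (intro impI ballI)
  fix w
  assume min: "mmin \<mu> = []" and "w \<in> Pros D"
  then have w: "w \<in> Objs D" by simp
  let ?F = "tdom (mml \<mu>)" and ?N = "mmout \<mu>"
  note fr = mmframeD[OF \<mu>]
  note mc = mmframe_cell[OF \<mu> w, unfolded min, simplified]
  have tr: "tdom (mmr \<mu>) = ?F" using fr(6) by (simp add: min)
  have F: "uobj ?F" using fr(1) by simp
  have N: "mpro ?N w \<in> Pros E" using fr(3) w by simp
  have mu: "mucell \<mu> w \<in> Cells S" "Dom (D1 S) (mucell \<mu> w) = (onOb ?F w, [])" "csrc S (mucell \<mu> w) = atOb (mml \<mu>) w"
    "ctgt S (mucell \<mu> w) = atOb (mmr \<mu>) w" "Cod (D1 S) (mucell \<mu> w) = (onOb (tcod (mml \<mu>)) w, [mpro ?N w])"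
    "ucell (mucell \<mu> w) = mmc \<mu> (w, [])"
    using fr(7-9)[OF w] by (simp_all add: min)
  have "ucell (mucell \<mu> w \<^bold>\<star> idc S (atOb (mmr \<mu>) w)) =
      lun_inv E (idp E (onOb ?F w)) \<bullet>\<^bsub>E\<^esub> (mmc \<mu> (w, []) \<star>\<^bsub>E\<^esub> idc E (atOb (mmr \<mu>) w)) \<bullet>\<^bsub>E\<^esub> run E (mpro ?N w)"
    using mu fr(1,2) w F tr by (subst ucell_star_Nil_right') (simp_all add: ucell_S)
  moreover have "ucell (idc S (atOb (mml \<mu>) w) \<^bold>\<star> mucell \<mu> w) =
      lun_inv E (idp E (onOb ?F w)) \<bullet>\<^bsub>E\<^esub> (idc E (atOb (mml \<mu>) w) \<star>\<^bsub>E\<^esub> mmc \<mu> (w, [])) \<bullet>\<^bsub>E\<^esub> lun E (mpro ?N w)"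
    using mu fr(1,2) w F tr by (subst ucell_star_Nil') (simp_all add: ucell_S)
  ultimately have e: "lun_inv E (idp E (onOb ?F w)) \<bullet>\<^bsub>E\<^esub> (mmc \<mu> (w, []) \<star>\<^bsub>E\<^esub> idc E (atOb (mmr \<mu>) w)) \<bullet>\<^bsub>E\<^esub> run E (mpro ?N w) =
      lun_inv E (idp E (onOb ?F w)) \<bullet>\<^bsub>E\<^esub> (idc E (atOb (mml \<mu>) w) \<star>\<^bsub>E\<^esub> mmc \<mu> (w, [])) \<bullet>\<^bsub>E\<^esub> lun E (mpro ?N w)"
    using mu by simp
  have ty: "mmc \<mu> (w, []) \<star>\<^bsub>E\<^esub> idc E (atOb (mmr \<mu>) w) \<in> Cells E"
      "Dom (D1 E) (mmc \<mu> (w, []) \<star>\<^bsub>E\<^esub> idc E (atOb (mmr \<mu>) w)) = idp E (onOb ?F w) \<odot>\<^bsub>E\<^esub> idp E (onOb ?F w)"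
      "Cod (D1 E) (mmc \<mu> (w, []) \<star>\<^bsub>E\<^esub> idc E (atOb (mmr \<mu>) w)) = mpro ?N w \<odot>\<^bsub>E\<^esub> idp E (ptgt E (mpro ?N w))"
      "idc E (atOb (mml \<mu>) w) \<star>\<^bsub>E\<^esub> mmc \<mu> (w, []) \<in> Cells E"
      "Dom (D1 E) (idc E (atOb (mml \<mu>) w) \<star>\<^bsub>E\<^esub> mmc \<mu> (w, [])) = idp E (onOb ?F w) \<odot>\<^bsub>E\<^esub> idp E (onOb ?F w)"
      "Cod (D1 E) (idc E (atOb (mml \<mu>) w) \<star>\<^bsub>E\<^esub> mmc \<mu> (w, [])) = idp E (psrc E (mpro ?N w)) \<odot>\<^bsub>E\<^esub> mpro ?N w"
    using mc fr(1-5) w F tr by simp_all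
  show "let N = mmout \<mu>; F = tdom (mml \<mu>); x = psrc D w; y = ptgt D w in
         lun_inv E (onPro F w) \<bullet>\<^bsub>E\<^esub> (mmc \<mu> (x, []) \<star>\<^bsub>E\<^esub> atPro (mmr \<mu>) w) \<bullet>\<^bsub>E\<^esub>
           ract N (idp D x) w \<bullet>\<^bsub>E\<^esub> mcell N (lun D w) =
         run_inv E (onPro F w) \<bullet>\<^bsub>E\<^esub> (atPro (mml \<mu>) w \<star>\<^bsub>E\<^esub> mmc \<mu> (y, [])) \<bullet>\<^bsub>E\<^esub>
           lact N w (idp D y) \<bullet>\<^bsub>E\<^esub> mcell N (run D w)"
    unfolding Let_def VerDbl_sel using e fr(1-3) w F N ty by simp
qed

section \<open>Passing between multimodulations and their reduced form\<close>

lemma umod_is_module: "umod M \<Longrightarrow> is_module D E M"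
  unfolding umod_def by simp

lemma chain_module: "mpath F Ms G \<Longrightarrow> chain {M. is_module D E M} (msrc D) (mtgt D) F Ms G"
  by (induction Ms arbitrary: F) (auto simp: umod_is_module)

lemma mpath_chain: "uobj F \<Longrightarrow> \<forall>M\<in>set Ms. umod M \<Longrightarrow> chain X (msrc D) (mtgt D) F Ms G \<Longrightarrow> mpath F Ms G"
  by (induction Ms arbitrary: F) auto

lemma ummod_mmframe: "ummod \<mu> \<Longrightarrow> mmframe \<mu>"
  unfolding ummod_def mmframe_def by blast

lemma ummod_multimodulation:
  assumes "ummod \<mu>" shows "multimodulation D E \<mu>"
proof -
  have fr: "mmframe \<mu>" by (rule ummod_mmframe[OF assms])
  note d = mmframeD[OF fr]
  have nat: "multi_natural D E \<mu>"
    unfolding multi_natural_iff[OF fr] snatural_def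
    by (intro allI impI, elim conjE) (rule ummod_natural[OF assms])
  have c: "mmc \<mu> (x, ms) \<in> cell E (odots E (onOb (tdom (mml \<mu>)) x) (mpros (mmin \<mu>) ms)) (mpro (mmout \<mu>) (odots D x ms))
            (atOb (mml \<mu>) x) (atOb (mmr \<mu>) y)"
    if "ppath D x ms y" "length ms = length (mmin \<mu>)" for x ms y
  proof -
    have p: "x \<in> Objs D" "ms = replicate (length (mmin \<mu>)) x" "y = x" using that ppath_D[of x ms y] by auto
    show ?thesis unfolding p(3) using mmframe_cell[OF fr p(1)] p(1) odots_D[OF p(1), of "length (mmin \<mu>)"]
      by (subst p(2), subst p(2), subst p(2)) (simp add: cell_def Hom_def mpros_replicate)
  qed
  have t: "lax_transformation D E (tdom (mml \<mu>)) (msrc D (mmout \<mu>)) (mml \<mu>)"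
    "lax_transformation D E (tdom (mmr \<mu>)) (mtgt D (mmout \<mu>)) (mmr \<mu>)"
    using utrans_lax[OF d(1)] utrans_lax[OF d(2)] d(4,5) by simp_all
  show ?thesis
    unfolding multimodulation_def Let_def
    using t chain_module[OF d(6)] d(3) c nat left_equivariantI[OF fr] right_equivariantI[OF fr]
      inner_equivariantI[OF fr] nullary_equivariantI[OF fr] ummodD(11)[OF assms]
    by (simp add: umod_is_module)
qed

text \<open>The single naturality condition of the reduced form is the instance of the naturality
  axiom at a constant list of identity 2-cells on an arrow; \<open>stars_idcs\<close> collapses the
  list on the side of the base.\<close>

lemma multimodulation_ummod:
  assumes "multimodulation D E \<mu>" "utrans (mml \<mu>)" "utrans (mmr \<mu>)" "umod (mmout \<mu>)" "\<forall>M\<in>set (mmin \<mu>). umod M"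
  shows "ummod \<mu>"
proof -
  note m = assms(1)[unfolded multimodulation_def Let_def]
  have t: "lax_transformation D E (tdom (mml \<mu>)) (msrc D (mmout \<mu>)) (mml \<mu>)"
    "lax_transformation D E (tdom (mmr \<mu>)) (mtgt D (mmout \<mu>)) (mmr \<mu>)" using m by blast+
  have tc: "tcod (mml \<mu>) = msrc D (mmout \<mu>)" "tcod (mmr \<mu>) = mtgt D (mmout \<mu>)"
    using lax_transformation.tdom_tcod[OF t(1)] lax_transformation.tdom_tcod[OF t(2)] by simp_all
  have mp: "mpath (tdom (mml \<mu>)) (mmin \<mu>) (tdom (mmr \<mu>))"
    by (rule mpath_chain[of _ _ "{M. is_module D E M}"]) (use assms m in auto)
  have ext: "mmc \<mu> \<in> extensional (paths_of_length D (length (mmin \<mu>)))" using m by blast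
  have cc: "\<forall>x ms y. ppath D x ms y \<and> length ms = length (mmin \<mu>) \<longrightarrow>
      mmc \<mu> (x, ms) \<in> cell E (odots E (onOb (tdom (mml \<mu>)) x) (mpros (mmin \<mu>) ms)) (mpro (mmout \<mu>) (odots D x ms))
            (atOb (mml \<mu>) x) (atOb (mmr \<mu>) y)"
    using m by (elim conjE)
  have c: "mucell \<mu> x \<in> Cells S \<and> csrc S (mucell \<mu> x) = atOb (mml \<mu>) x \<and> ctgt S (mucell \<mu> x) = atOb (mmr \<mu>) x"
    if x: "x \<in> Objs D" for x
  proof -
    let ?ms = "replicate (length (mmin \<mu>)) x"
    have "ppath D x ?ms x" using ppath_D[of x ?ms x] x by simp
    then have "mmc \<mu> (x, ?ms) \<in> cell E (odots E (onOb (tdom (mml \<mu>)) x) (mpros (mmin \<mu>) ?ms)) (mpro (mmout \<mu>) (odots D x ?ms))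
            (atOb (mml \<mu>) x) (atOb (mmr \<mu>) x)"
      using cc[rule_format, of x ?ms x] by simp
    then show ?thesis
      using x mp odots_D[OF x, of "length (mmin \<mu>)"] assms(2-4) tc
      by (simp add: mucell_def cell_def Hom_def mpros_replicate)
  qed
  have fr: "mmframe \<mu>" unfolding mmframe_def using assms(2-4) tc mp c ext by blast
  have "multi_natural D E \<mu>" using m by (elim conjE)
  note nt = this[unfolded multi_natural_iff[OF fr]]
  have "snatural \<mu> f (replicate (length (mmin \<mu>)) (idc D f)) f" if "f \<in> Arrs D" for f
    using nt[rule_format, of f "replicate (length (mmin \<mu>)) (idc D f)" f] cpath_idcs[OF that] by simp
  then have "\<forall>f\<in>Arrs D. tcell (mml \<mu>) f \<^bold>\<star> (stars S (onArr (tdom (mml \<mu>)) f) (mdids (mmin \<mu>) f) \<^bold>\<cdot> mucell \<mu> (Cod (D0 D) f)) =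
        (mucell \<mu> (Dom (D0 D) f) \<^bold>\<cdot> mdcell (mmout \<mu>) (idc D f)) \<^bold>\<star> tcell (mmr \<mu>) f"
    unfolding snatural_def mdids_map2 by (simp add: stars_idcs)
  then show ?thesis unfolding ummod_def using assms(2-4) tc mp c ext by blast
qed

end

section \<open>The virtual double category\<close>

lemma chain_chain_end: "chain X s t x ms y \<Longrightarrow> chain_end t x ms = y"
proof (induction ms arbitrary: x)
  case (Cons m ms)
  then show ?case by (cases ms) (auto simp: chain_end_def)
qed (simp add: chain_end_def)

context vertical_cart_lax
begin

section \<open>Chains of multimodulations and their composites\<close>

lemma mpath_unique: "mpath F Ms G \<Longrightarrow> mpath F Ms H \<Longrightarrow> G = H"
  by (induction Ms arbitrary: F) auto

definition mchain where "mchain \<alpha> \<mu>s \<beta> \<longleftrightarrow> utrans \<alpha> \<and> chain {\<mu>. ummod \<mu>} mml mmr \<alpha> \<mu>s \<beta>"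

lemma mchain_simps [simp]:
  "mchain \<alpha> [] \<beta> \<longleftrightarrow> utrans \<alpha> \<and> \<alpha> = \<beta>"
  "mchain \<alpha> (\<mu> # \<mu>s) \<beta> \<longleftrightarrow> ummod \<mu> \<and> mml \<mu> = \<alpha> \<and> mchain (mmr \<mu>) \<mu>s \<beta>"
  by (auto simp: mchain_def)

lemma mchain_append: "mchain \<alpha> (\<mu>s @ \<nu>s) \<gamma> \<longleftrightarrow> (\<exists>\<beta>. mchain \<alpha> \<mu>s \<beta> \<and> mchain \<beta> \<nu>s \<gamma>)"
proof (induction \<mu>s arbitrary: \<alpha>)
  case Nil
  then show ?case by (cases \<nu>s) auto
qed auto

lemma mchain_end: "mchain \<alpha> \<mu>s \<beta> \<Longrightarrow> chain_end mmr \<alpha> \<mu>s = \<beta>"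
  unfolding mchain_def by (elim conjE) (rule chain_chain_end)

lemma mchain_frames:
  "mchain \<alpha> \<mu>s \<beta> \<Longrightarrow> utrans \<alpha> \<and> utrans \<beta> \<and> mpath (tdom \<alpha>) (concat (map mmin \<mu>s)) (tdom \<beta>) \<and>
    mpath (tcod \<alpha>) (map mmout \<mu>s) (tcod \<beta>)"
proof (induction \<mu>s arbitrary: \<alpha>)
  case (Cons \<mu> \<mu>s)
  then have \<mu>: "ummod \<mu>" "mml \<mu> = \<alpha>" "mchain (mmr \<mu>) \<mu>s \<beta>" by auto
  note d = ummodD(1-6)[OF \<mu>(1)]
  show ?case using Cons.IH[OF \<mu>(3)] d \<mu>(2) by (auto simp: mpath_append)
qed auto

definition mus :: "('o, 'f, 'o, 't, 'x, 'a, 'p, 'c) multimod list \<Rightarrow> 'o \<Rightarrow> (('x \<times> 'p list) \<times> ('x \<times> 'p list) \<times> 'c) list" where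
  "mus \<mu>s x = map (\<lambda>\<mu>. mucell \<mu> x) \<mu>s"

lemma mus_simps [simp]: "mus [] x = []" "mus (\<mu> # \<mu>s) x = mucell \<mu> x # mus \<mu>s x"
  "mus (\<mu>s @ \<nu>s) x = mus \<mu>s x @ mus \<nu>s x"
  by (simp_all add: mus_def)

lemma mus_cpath:
  assumes "mchain \<alpha> \<mu>s \<beta>" "x \<in> Objs D"
  shows "cpath S (atOb \<alpha> x) (mus \<mu>s x) (atOb \<beta> x)"
  using assms(1)
proof (induction \<mu>s arbitrary: \<alpha>)
  case (Cons \<mu> \<mu>s)
  then show ?case using assms(2) by auto
qed (use assms(2) in auto)

lemma mus_stars:
  assumes m: "mchain \<alpha> \<mu>s \<beta>" and x: "x \<in> Objs D"
  defines "T \<equiv> stars S (atOb \<alpha> x) (mus \<mu>s x)"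
  shows "T \<in> Cells S" "csrc S T = atOb \<alpha> x" "ctgt S T = atOb \<beta> x"
    "Dom (D1 S) T = (onOb (tdom \<alpha>) x, mvals (concat (map mmin \<mu>s)) x)"
    "Cod (D1 S) T = (onOb (tcod \<alpha>) x, mvals (map mmout \<mu>s) x)"
proof -
  note cp = mus_cpath[OF m x]
  show "T \<in> Cells S" "csrc S T = atOb \<alpha> x" "ctgt S T = atOb \<beta> x"
    using S.stars_closed[OF cp] by (auto simp: T_def)
  have 1: "concat (map (\<lambda>c. snd (fst c)) (mus \<mu>s x)) = mvals (concat (map mmin \<mu>s)) x"
    "concat (map (\<lambda>c. snd (fst (snd c))) (mus \<mu>s x)) = mvals (map mmout \<mu>s) x"
    by (induction \<mu>s) (auto simp: mucell_def)
  have a: "utrans \<alpha>" using mchain_frames[OF m] by simp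
  show "Dom (D1 S) T = (onOb (tdom \<alpha>) x, mvals (concat (map mmin \<mu>s)) x)"
    "Cod (D1 S) T = (onOb (tcod \<alpha>) x, mvals (map mmout \<mu>s) x)"
    using E.strictify_stars[OF cp] x a unfolding T_def 1 by simp_all
qed

lemma comp_multimod_sel [simp]:
  "mmin (comp_multimod D E \<alpha> \<mu>s \<nu>) = concat (map mmin \<mu>s)" "mmout (comp_multimod D E \<alpha> \<mu>s \<nu>) = mmout \<nu>"
  "mml (comp_multimod D E \<alpha> \<mu>s \<nu>) = comp_trans D E \<alpha> (mml \<nu>)"
  "mmr (comp_multimod D E \<alpha> \<mu>s \<nu>) = comp_trans D E (chain_end mmr \<alpha> \<mu>s) (mmr \<nu>)"
  by (simp_all add: comp_multimod_def)

lemma split_by_replicate: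
  "split_by (map (\<lambda>\<mu>. length (mmin \<mu>)) \<mu>s) (replicate (length (concat (map mmin \<mu>s))) x) =
    map (\<lambda>\<mu>. replicate (length (mmin \<mu>)) x) \<mu>s"
  by (induction \<mu>s) (auto simp: min_def)

lemma chain_end_replicate [simp]: "chain_end (ptgt D) x (replicate k x) = x"
  by (cases k) (auto simp: chain_end_def)

lemma mm_cells_D: "mm_cells D x \<mu>s (map (\<lambda>\<mu>. replicate (length (mmin \<mu>)) x) \<mu>s) = map ucell (mus \<mu>s x)"
  by (induction \<mu>s) simp_all

lemma blocks_D: "x \<in> Objs D \<Longrightarrow> blocks D x (map (\<lambda>\<mu>. replicate (length (mmin \<mu>)) x) \<mu>s) = replicate (length \<mu>s) x"
  by (induction \<mu>s) (simp_all add: odots_D)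

lemma concat_replicates: "concat (map (\<lambda>\<mu>. replicate (length (mmin \<mu>)) x) \<mu>s) = replicate (length (concat (map mmin \<mu>s))) x"
  by (induction \<mu>s) (auto simp: replicate_add)

text \<open>The inverse \<open>cohs\<close> and the \<open>stars\<close> in the definition of
  composition are together the strict composite of the chain, and the trailing \<open>cohs\<close>
  on the side of the base is an identity. Composition of multimodulations thus becomes composition
  in the strictification.\<close>

lemma mucell_comp:
  assumes m: "mchain \<alpha> \<mu>s \<beta>" and n: "ummod \<nu>" "map mmout \<mu>s = mmin \<nu>" "tcod \<alpha> = tdom (mml \<nu>)" and x: "x \<in> Objs D"
  shows "mucell (comp_multimod D E \<alpha> \<mu>s \<nu>) x = stars S (atOb \<alpha> x) (mus \<mu>s x) \<^bold>\<cdot> mucell \<nu> x"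
proof -
  let ?k = "length (concat (map mmin \<mu>s))" and ?\<kappa> = "comp_multimod D E \<alpha> \<mu>s \<nu>"
  let ?mss = "map (\<lambda>\<mu>. replicate (length (mmin \<mu>)) x) \<mu>s"
  note cp = mus_cpath[OF m x]
  note T = mus_stars[OF m x]
  have Mss: "map2 (\<lambda>\<mu> b. mpros (mmin \<mu>) b) \<mu>s ?mss = map (\<lambda>c. snd (fst c)) (mus \<mu>s x)"
    by (induction \<mu>s) (auto simp: mpros_replicate mucell_def)
  have one: "\<forall>c\<in>set (mus \<mu>s x). length (snd (fst (snd c))) = 1" by (auto simp: mus_def mucell_def)
  have a: "utrans \<alpha>" using mchain_frames[OF m] by simp
  have l: "length \<mu>s = length (mmin \<nu>)" using arg_cong[OF n(2), of length] by simp
  have "mmc ?\<kappa> (x, replicate ?k x) = inverse_arr (D1 E) (cohs E (onOb (tdom \<alpha>) x) (map (\<lambda>c. snd (fst c)) (mus \<mu>s x))) \<bullet>\<^bsub>E\<^esub>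
         stars E (atOb \<alpha> x) (map ucell (mus \<mu>s x)) \<bullet>\<^bsub>E\<^esub> mmc \<nu> (x, replicate (length \<mu>s) x) \<bullet>\<^bsub>E\<^esub> mcell (mmout \<nu>) (idcell D x)"
    using x by (simp add: comp_multimod_def paths_of_length_D split_by_replicate Let_def Mss mm_cells_D blocks_D
        cohs_D[OF x concat_replicates] del: length_concat)
  also have "\<dots> = ucell (stars S (atOb \<alpha> x) (mus \<mu>s x)) \<bullet>\<^bsub>E\<^esub> mmc \<nu> (x, replicate (length \<mu>s) x) \<bullet>\<^bsub>E\<^esub> mcell (mmout \<nu>) (idcell D x)"
    using E.strictify_stars_inverse[OF cp one] a x by simp
  also have "\<dots> = ucell (stars S (atOb \<alpha> x) (mus \<mu>s x)) \<bullet>\<^bsub>E\<^esub> mmc \<nu> (x, replicate (length \<mu>s) x)"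
    using ucell_closed[OF T(1)] T(5) mmframe_cell[OF ummod_mmframe[OF n(1)] x] n x l by simp
  finally have u: "mmc ?\<kappa> (x, replicate ?k x) = \<dots>" .
  show ?thesis
    by (rule S_eqI) (use T n x l u in \<open>simp_all add: ucell_S del: length_concat\<close>)
qed

text \<open>The naturality conditions of adjacent multimodulations paste, because the right boundary
  of one is the left boundary of the next. For the empty chain both sides reduce to the component of
  \<alpha>, composed with external identities.\<close>

lemma mchain_natural:
  assumes "mchain \<alpha> \<mu>s \<beta>" and f: "f \<in> Arrs D"
  shows "tcell \<alpha> f \<^bold>\<star> (stars S (onArr (tdom \<alpha>) f) (mdids (concat (map mmin \<mu>s)) f) \<^bold>\<cdot> stars S (atOb \<alpha> (Cod (D0 D) f)) (mus \<mu>s (Cod (D0 D) f))) =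
    (stars S (atOb \<alpha> (Dom (D0 D) f)) (mus \<mu>s (Dom (D0 D) f)) \<^bold>\<cdot> stars S (onArr (tcod \<alpha>) f) (mdids (map mmout \<mu>s) f)) \<^bold>\<star> tcell \<beta> f"
  using assms(1)
proof (induction \<mu>s arbitrary: \<alpha>)
  case Nil
  then have e: "utrans \<alpha>" "\<beta> = \<alpha>" by auto
  show ?case unfolding e(2) using e(1) f by (simp flip: S_idc_comp)
next
  case (Cons \<mu> \<mu>s)
  let ?x = "Dom (D0 D) f" and ?y = "Cod (D0 D) f"
  have xy: "?x \<in> Objs D" "?y \<in> Objs D" using f by simp_all
  have \<mu>: "ummod \<mu>" "mml \<mu> = \<alpha>" and ms: "mchain (mmr \<mu>) \<mu>s \<beta>" using Cons(2) by auto
  note d = ummodD[OF \<mu>(1), unfolded \<mu>(2)]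
  note fr = mchain_frames[OF ms]
  let ?\<gamma> = "mmr \<mu>"
  define T1 where "T1 = stars S (onArr (tdom \<alpha>) f) (mdids (mmin \<mu>) f)"
  define T2 where "T2 = stars S (onArr (tdom ?\<gamma>) f) (mdids (concat (map mmin \<mu>s)) f)"
  define N2 where "N2 = stars S (onArr (tcod ?\<gamma>) f) (mdids (map mmout \<mu>s) f)"
  define m where "m x = stars S (atOb ?\<gamma> x) (mus \<mu>s x)" for x
  note T1 = mdids_stars[OF d(6) f, folded T1_def] and T2 = mdids_stars[OF _ f, of "tdom ?\<gamma>" "concat (map mmin \<mu>s)" "tdom \<beta>", folded T2_def]
    and N2 = mdids_stars[OF _ f, of "tcod ?\<gamma>" "map mmout \<mu>s" "tcod \<beta>", folded N2_def]
  note mx = mus_stars[OF ms xy(1), folded m_def] mus_stars[OF ms xy(2), folded m_def]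
  have IH: "tcell ?\<gamma> f \<^bold>\<star> (T2 \<^bold>\<cdot> m ?y) = (m ?x \<^bold>\<cdot> N2) \<^bold>\<star> tcell \<beta> f"
    using Cons.IH[OF ms] by (simp add: T2_def N2_def m_def)
  have sm: "stars S (atOb \<alpha> x) (mus (\<mu> # \<mu>s) x) = mucell \<mu> x \<^bold>\<star> m x" if "x \<in> Objs D" for x
    using S.stars_Cons[OF mus_cpath[OF Cons(2) that, unfolded mus_simps]] \<mu> that by (simp add: m_def)
  have sT: "stars S (onArr (tdom \<alpha>) f) (mdids (concat (map mmin (\<mu> # \<mu>s))) f) = T1 \<^bold>\<star> T2"
    using S.stars_append[OF mdids_cpath[OF d(6) f] mdids_cpath[OF conjunct1[OF conjunct2[OF conjunct2[OF fr]]] f]]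
    by (simp add: T1_def T2_def)
  have sN: "stars S (onArr (tcod \<alpha>) f) (mdids (map mmout (\<mu> # \<mu>s)) f) = mdcell (mmout \<mu>) (idc D f) \<^bold>\<star> N2"
  proof -
    have "mpath (tcod \<alpha>) (map mmout (\<mu> # \<mu>s)) (tcod \<beta>)" using mchain_frames[OF Cons(2)] by simp
    from S.stars_Cons[OF mdids_cpath[OF this f, unfolded list.map(2) mdids_simps]] show ?thesis using d f by (simp add: N2_def)
  qed
  note t = d(1-5) fr \<mu> T1 T2[OF conjunct1[OF conjunct2[OF conjunct2[OF fr]]]] N2[OF conjunct2[OF conjunct2[OF conjunct2[OF fr]]]] mx xy f
  have mc: "mucell \<mu> ?x \<in> Cells S" "csrc S (mucell \<mu> ?x) = atOb \<alpha> ?x" "ctgt S (mucell \<mu> ?x) = atOb ?\<gamma> ?x"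
    "mucell \<mu> ?y \<in> Cells S" "csrc S (mucell \<mu> ?y) = atOb \<alpha> ?y" "ctgt S (mucell \<mu> ?y) = atOb ?\<gamma> ?y"
    using d(7-9) xy by simp_all
  have a: "tcell \<alpha> f \<in> Cells S" "ctgt S (tcell \<alpha> f) = onArr (tdom \<alpha>) f \<cdot>\<^bsub>D0 E\<^esub> atOb \<alpha> ?y"
    using tcell_closed[OF d(1) f] by simp_all
  have k: "(T1 \<^bold>\<star> T2) \<^bold>\<cdot> (mucell \<mu> ?y \<^bold>\<star> m ?y) = (T1 \<^bold>\<cdot> mucell \<mu> ?y) \<^bold>\<star> (T2 \<^bold>\<cdot> m ?y)"
    by (rule S.interchange[symmetric]) (simp_all add: t mc)
  have k': "(mucell \<mu> ?x \<^bold>\<cdot> mdcell (mmout \<mu>) (idc D f)) \<^bold>\<star> (m ?x \<^bold>\<cdot> N2) =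
     (mucell \<mu> ?x \<^bold>\<star> m ?x) \<^bold>\<cdot> (mdcell (mmout \<mu>) (idc D f) \<^bold>\<star> N2)"
    by (rule S.interchange) (simp_all add: t mc)
  have "tcell \<alpha> f \<^bold>\<star> ((T1 \<^bold>\<star> T2) \<^bold>\<cdot> (mucell \<mu> ?y \<^bold>\<star> m ?y)) = (tcell \<alpha> f \<^bold>\<star> (T1 \<^bold>\<cdot> mucell \<mu> ?y)) \<^bold>\<star> (T2 \<^bold>\<cdot> m ?y)"
    unfolding k by (simp add: t mc a)
  also have "tcell \<alpha> f \<^bold>\<star> (T1 \<^bold>\<cdot> mucell \<mu> ?y) = (mucell \<mu> ?x \<^bold>\<cdot> mdcell (mmout \<mu>) (idc D f)) \<^bold>\<star> tcell ?\<gamma> f"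
    using d(10)[OF f] by (simp add: T1_def)
  also have "\<dots> \<^bold>\<star> (T2 \<^bold>\<cdot> m ?y) = (mucell \<mu> ?x \<^bold>\<cdot> mdcell (mmout \<mu>) (idc D f)) \<^bold>\<star> (tcell ?\<gamma> f \<^bold>\<star> (T2 \<^bold>\<cdot> m ?y))"
    by (simp add: t mc)
  also have "\<dots> = ((mucell \<mu> ?x \<^bold>\<cdot> mdcell (mmout \<mu>) (idc D f)) \<^bold>\<star> (m ?x \<^bold>\<cdot> N2)) \<^bold>\<star> tcell \<beta> f"
    unfolding IH by (simp add: t mc)
  finally show ?case unfolding sT sN sm[OF xy(1)] sm[OF xy(2)] k' .
qed

text \<open>Naturality of the chain and naturality of \<nu> are combined by interchange, following
  the two factors in the composite boundary transformations. The match of the right boundaries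
  follows from that of the left ones, because a path of modules determines its end.\<close>

lemma ummod_comp:
  assumes m: "mchain \<alpha> \<mu>s \<beta>" and n: "ummod \<nu>" "map mmout \<mu>s = mmin \<nu>" "tcod \<alpha> = tdom (mml \<nu>)"
  shows "ummod (comp_multimod D E \<alpha> \<mu>s \<nu>)" "tcod \<beta> = tdom (mmr \<nu>)"
proof -
  let ?\<kappa> = "comp_multimod D E \<alpha> \<mu>s \<nu>"
  note d = ummodD[OF n(1)] and fr = mchain_frames[OF m]
  show be: "tcod \<beta> = tdom (mmr \<nu>)"
    using mpath_unique[of "tcod \<alpha>" "mmin \<nu>" "tcod \<beta>" "tdom (mmr \<nu>)"] fr d(6) n(2,3) by simp
  have r: "mmr ?\<kappa> = comp_trans D E \<beta> (mmr \<nu>)" using mchain_end[OF m] by simp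
  show "ummod ?\<kappa>"
    unfolding ummod_def
  proof (intro conjI ballI)
    show "utrans (mml ?\<kappa>)" "utrans (mmr ?\<kappa>)" unfolding r using fr d(1,2) n(3) be by (simp_all add: utrans_comp)
    show "umod (mmout ?\<kappa>)" "tcod (mml ?\<kappa>) = msrc D (mmout ?\<kappa>)" "tcod (mmr ?\<kappa>) = mtgt D (mmout ?\<kappa>)"
      "mpath (tdom (mml ?\<kappa>)) (mmin ?\<kappa>) (tdom (mmr ?\<kappa>))"
      unfolding r using fr d(3-5) by simp_all
    show "mmc ?\<kappa> \<in> extensional (paths_of_length D (length (mmin ?\<kappa>)))"
      by (simp add: comp_multimod_def)
  next
    fix x assume x: "x \<in> Objs D"
    show "mucell ?\<kappa> x \<in> Cells S" "csrc S (mucell ?\<kappa> x) = atOb (mml ?\<kappa>) x" "ctgt S (mucell ?\<kappa> x) = atOb (mmr ?\<kappa>) x"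
      unfolding mucell_comp[OF m n x] r using mus_stars[OF m x] n x d(7-9)[OF x] by simp_all
  next
    fix f assume f: "f \<in> Arrs D"
    let ?x = "Dom (D0 D) f" and ?y = "Cod (D0 D) f"
    have xy: "?x \<in> Objs D" "?y \<in> Objs D" using f by simp_all
    define T where "T = stars S (onArr (tdom \<alpha>) f) (mdids (concat (map mmin \<mu>s)) f)"
    define N where "N = stars S (onArr (tcod \<alpha>) f) (mdids (map mmout \<mu>s) f)"
    define m' where "m' x = stars S (atOb \<alpha> x) (mus \<mu>s x)" for x
    note T = mdids_stars[OF conjunct1[OF conjunct2[OF conjunct2[OF fr]]] f, folded T_def]
    note N = mdids_stars[OF conjunct2[OF conjunct2[OF conjunct2[OF fr]]] f, folded N_def]
    note mx = mus_stars[OF m xy(1), folded m'_def] mus_stars[OF m xy(2), folded m'_def]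
    have nat: "tcell \<alpha> f \<^bold>\<star> (T \<^bold>\<cdot> m' ?y) = (m' ?x \<^bold>\<cdot> N) \<^bold>\<star> tcell \<beta> f"
      using mchain_natural[OF m f] by (simp add: T_def N_def m'_def)
    have nat': "tcell (mml \<nu>) f \<^bold>\<star> (N \<^bold>\<cdot> mucell \<nu> ?y) = (mucell \<nu> ?x \<^bold>\<cdot> mdcell (mmout \<nu>) (idc D f)) \<^bold>\<star> tcell (mmr \<nu>) f"
      using d(10)[OF f] n(2,3) by (simp add: N_def)
    have ab: "utrans \<alpha>" "utrans \<beta>" using fr by simp_all
    note t = ab d(1-5) n(1,2) n(3)[symmetric] be[symmetric] T N mx xy f d(7-9)[OF xy(1)] d(7-9)[OF xy(2)]
    let ?a = "\<lambda>x. idc S (atOb \<alpha> x)" and ?b = "\<lambda>x. idc S (atOb \<beta> x)"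
      and ?l = "\<lambda>x. idc S (atOb (mml \<nu>) x)" and ?r = "\<lambda>x. idc S (atOb (mmr \<nu>) x)"
    have tl: "tcell (mml ?\<kappa>) f = (?a ?x \<^bold>\<cdot> tcell (mml \<nu>) f) \<^bold>\<star> (tcell \<alpha> f \<^bold>\<cdot> ?l ?y)"
      using tcell_comp_trans[OF ab(1) d(1) n(3) f] by simp
    have tr: "tcell (mmr ?\<kappa>) f = (?b ?x \<^bold>\<cdot> tcell (mmr \<nu>) f) \<^bold>\<star> (tcell \<beta> f \<^bold>\<cdot> ?r ?y)"
      unfolding r using tcell_comp_trans[OF ab(2) d(2) be f] by simp
    have ac: "tcell \<alpha> f \<in> Cells S" "tcell \<beta> f \<in> Cells S" "tcell (mml \<nu>) f \<in> Cells S" "tcell (mmr \<nu>) f \<in> Cells S"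
      using t by simp_all
    let ?m = "mucell \<nu>"
    \<comment> \<open>These four interchanges separate the layer of the chain from the layer of
      \<nu>, so that each naturality equation applies to its own layer; the facts \<open>u\<close>
      remove the external identities used as padding.\<close>
    have 1: "(tcell \<alpha> f \<^bold>\<cdot> ?l ?y) \<^bold>\<star> (T \<^bold>\<cdot> m' ?y \<^bold>\<cdot> ?m ?y) = (tcell \<alpha> f \<^bold>\<star> (T \<^bold>\<cdot> m' ?y)) \<^bold>\<cdot> (?l ?y \<^bold>\<star> ?m ?y)"
      by (rule S.interchange) (simp_all add: t)
    have 2: "((m' ?x \<^bold>\<cdot> N) \<^bold>\<star> tcell \<beta> f) \<^bold>\<cdot> (?m ?y \<^bold>\<star> ?r ?y) = (m' ?x \<^bold>\<cdot> N \<^bold>\<cdot> ?m ?y) \<^bold>\<star> (tcell \<beta> f \<^bold>\<cdot> ?r ?y)"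
      by (rule S.interchange[symmetric]) (simp_all add: t)
    have 3: "(?a ?x \<^bold>\<cdot> tcell (mml \<nu>) f) \<^bold>\<star> (m' ?x \<^bold>\<cdot> (N \<^bold>\<cdot> ?m ?y)) = (?a ?x \<^bold>\<star> m' ?x) \<^bold>\<cdot> (tcell (mml \<nu>) f \<^bold>\<star> (N \<^bold>\<cdot> ?m ?y))"
      by (rule S.interchange) (simp_all add: t)
    have 4: "(m' ?x \<^bold>\<star> ?b ?x) \<^bold>\<cdot> ((?m ?x \<^bold>\<cdot> mdcell (mmout \<nu>) (idc D f)) \<^bold>\<star> tcell (mmr \<nu>) f) =
        (m' ?x \<^bold>\<cdot> (?m ?x \<^bold>\<cdot> mdcell (mmout \<nu>) (idc D f))) \<^bold>\<star> (?b ?x \<^bold>\<cdot> tcell (mmr \<nu>) f)"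
      by (rule S.interchange[symmetric]) (simp_all add: t)
    have u: "?l ?y \<^bold>\<star> ?m ?y = ?m ?y" "?m ?y \<^bold>\<star> ?r ?y = ?m ?y" "?a ?x \<^bold>\<star> m' ?x = m' ?x" "m' ?x \<^bold>\<star> ?b ?x = m' ?x"
      by (simp_all add: t)
    have "tcell (mml ?\<kappa>) f \<^bold>\<star> (T \<^bold>\<cdot> (m' ?y \<^bold>\<cdot> ?m ?y)) =
       (?a ?x \<^bold>\<cdot> tcell (mml \<nu>) f) \<^bold>\<star> ((tcell \<alpha> f \<^bold>\<cdot> ?l ?y) \<^bold>\<star> (T \<^bold>\<cdot> m' ?y \<^bold>\<cdot> ?m ?y))"
      unfolding tl by (simp add: t)
    also have "\<dots> = (?a ?x \<^bold>\<cdot> tcell (mml \<nu>) f) \<^bold>\<star> ((m' ?x \<^bold>\<cdot> N \<^bold>\<cdot> ?m ?y) \<^bold>\<star> (tcell \<beta> f \<^bold>\<cdot> ?r ?y))"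
      unfolding 1 u nat 2[symmetric] ..
    also have "\<dots> = ((?a ?x \<^bold>\<cdot> tcell (mml \<nu>) f) \<^bold>\<star> (m' ?x \<^bold>\<cdot> (N \<^bold>\<cdot> ?m ?y))) \<^bold>\<star> (tcell \<beta> f \<^bold>\<cdot> ?r ?y)"
      by (simp add: t)
    also have "\<dots> = ((m' ?x \<^bold>\<star> ?b ?x) \<^bold>\<cdot> ((?m ?x \<^bold>\<cdot> mdcell (mmout \<nu>) (idc D f)) \<^bold>\<star> tcell (mmr \<nu>) f)) \<^bold>\<star> (tcell \<beta> f \<^bold>\<cdot> ?r ?y)"
      unfolding 3 u nat' ..
    also have "\<dots> = (m' ?x \<^bold>\<cdot> ?m ?x \<^bold>\<cdot> mdcell (mmout \<nu>) (idc D f)) \<^bold>\<star> tcell (mmr ?\<kappa>) f"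
      unfolding 4 tr by (simp add: t)
    finally show "tcell (mml ?\<kappa>) f \<^bold>\<star> (stars S (onArr (tdom (mml ?\<kappa>)) f) (mdids (mmin ?\<kappa>) f) \<^bold>\<cdot> mucell ?\<kappa> ?y) =
        (mucell ?\<kappa> ?x \<^bold>\<cdot> mdcell (mmout ?\<kappa>) (idc D f)) \<^bold>\<star> tcell (mmr ?\<kappa>) f"
      unfolding mucell_comp[OF m n xy(1)] mucell_comp[OF m n xy(2)] comp_multimod_sel(1,2,3) tdom_tcod_simps
        T_def[symmetric] m'_def .
  qed
qed

section \<open>Cartesian multicells, identities and the axioms of a virtual double category\<close>

lemma cart_proarrows_umod: "M \<in> cart_proarrows D E \<Longrightarrow> umod M"
  unfolding umod_def cart_proarrows_def using cart_objects_uobj by blast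

lemma cart_arrows_utrans: "\<alpha> \<in> cart_arrows D E \<Longrightarrow> utrans \<alpha>"
  by (simp add: cart_arrows_iff)

lemma cart_multicells_iff:
  "\<mu> \<in> cart_multicells D E \<longleftrightarrow> ummod \<mu> \<and> set (mmin \<mu>) \<subseteq> cart_proarrows D E \<and>
     mmout \<mu> \<in> cart_proarrows D E \<and> mml \<mu> \<in> cart_arrows D E \<and> mmr \<mu> \<in> cart_arrows D E"
proof
  assume m: "\<mu> \<in> cart_multicells D E"
  note c = m[unfolded cart_multicells_def mem_Collect_eq]
  have "ummod \<mu>"
    by (rule multimodulation_ummod) (use c cart_proarrows_umod cart_arrows_utrans in auto)
  then show "ummod \<mu> \<and> set (mmin \<mu>) \<subseteq> cart_proarrows D E \<and>
     mmout \<mu> \<in> cart_proarrows D E \<and> mml \<mu> \<in> cart_arrows D E \<and> mmr \<mu> \<in> cart_arrows D E" using c by simp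
next
  assume "ummod \<mu> \<and> set (mmin \<mu>) \<subseteq> cart_proarrows D E \<and>
     mmout \<mu> \<in> cart_proarrows D E \<and> mml \<mu> \<in> cart_arrows D E \<and> mmr \<mu> \<in> cart_arrows D E"
  then show "\<mu> \<in> cart_multicells D E"
    unfolding cart_multicells_def using ummod_multimodulation by simp
qed

lemma mpath_vpath:
  assumes "mpath F Ms G" "set Ms \<subseteq> cart_proarrows D E" "F \<in> cart_objects D E"
  shows "vpath V F Ms G"
  unfolding vpath_def using assms
proof (induction Ms arbitrary: F)
  case (Cons M Ms)
  then show ?case by (auto simp: cart_proarrows_def)
qed auto

lemma vpath_mpath:
  assumes "vpath V F Ms G"
  shows "mpath F Ms G" "set Ms \<subseteq> cart_proarrows D E" "F \<in> cart_objects D E" "G \<in> cart_objects D E"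
proof -
  have c: "chain (cart_proarrows D E) (msrc D) (mtgt D) F Ms G" "F \<in> cart_objects D E"
    using assms by (simp_all add: vpath_def)
  then show "mpath F Ms G" "set Ms \<subseteq> cart_proarrows D E" "F \<in> cart_objects D E" "G \<in> cart_objects D E"
    by (induction Ms arbitrary: F) (auto simp: cart_proarrows_umod, auto simp: cart_proarrows_def)
qed

lemma vcpath_mchain:
  assumes "vcpath V f \<mu>s g"
  shows "mchain f \<mu>s g" "set \<mu>s \<subseteq> cart_multicells D E" "f \<in> cart_arrows D E" "g \<in> cart_arrows D E"
proof -
  have c: "chain (cart_multicells D E) mml mmr f \<mu>s g" "f \<in> cart_arrows D E"
    using assms by (simp_all add: vcpath_def)
  then show "mchain f \<mu>s g" "set \<mu>s \<subseteq> cart_multicells D E" "f \<in> cart_arrows D E" "g \<in> cart_arrows D E"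
    by (induction \<mu>s arbitrary: f) (auto simp: cart_multicells_iff cart_arrows_utrans)
qed

lemma id_multimod_sel [simp]:
  "mmin (id_multimod D E M) = [M]" "mmout (id_multimod D E M) = M"
  "mml (id_multimod D E M) = id_trans D E (msrc D M)" "mmr (id_multimod D E M) = id_trans D E (mtgt D M)"
  by (simp_all add: id_multimod_def)

lemma mucell_id:
  assumes "umod M" "x \<in> Objs D"
  shows "mucell (id_multimod D E M) x = sid (mpro M x)"
proof -
  have "mmc (id_multimod D E M) (x, [x]) = idcell E (mpro M x)"
    using assms by (simp add: id_multimod_def paths_of_length_D)
  then show ?thesis by (intro S_eqI) (use assms in simp_all)
qed

lemma mdcell_idc_frame:
  assumes "umod M" "f \<in> Arrs D"
  shows "sid (mpro M (Dom (D0 D) f)) \<^bold>\<cdot> mdcell M (idc D f) = mdcell M (idc D f)"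
    "mdcell M (idc D f) \<^bold>\<cdot> sid (mpro M (Cod (D0 D) f)) = mdcell M (idc D f)"
proof -
  have s: "psrc E (mpro M x) = onOb (msrc D M) x" if "x \<in> Objs D" for x using assms that by simp
  show "sid (mpro M (Dom (D0 D) f)) \<^bold>\<cdot> mdcell M (idc D f) = mdcell M (idc D f)"
    unfolding sid_def by (rule S.D1.ide_cmp') (use assms s in simp_all)
  show "mdcell M (idc D f) \<^bold>\<cdot> sid (mpro M (Cod (D0 D) f)) = mdcell M (idc D f)"
    unfolding sid_def by (rule S.D1.cmp_ide') (use assms s in simp_all)
qed

lemma ummod_id:
  assumes M: "umod M" shows "ummod (id_multimod D E M)"
  unfolding ummod_def
proof (intro conjI ballI)
  show "utrans (mml (id_multimod D E M))" "utrans (mmr (id_multimod D E M))"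
    "umod (mmout (id_multimod D E M))" "tcod (mml (id_multimod D E M)) = msrc D (mmout (id_multimod D E M))"
    "tcod (mmr (id_multimod D E M)) = mtgt D (mmout (id_multimod D E M))"
    "mpath (tdom (mml (id_multimod D E M))) (mmin (id_multimod D E M)) (tdom (mmr (id_multimod D E M)))"
    using M by (simp_all add: utrans_id)
  show "mmc (id_multimod D E M) \<in> extensional (paths_of_length D (length (mmin (id_multimod D E M))))"
    by (simp add: id_multimod_def)
next
  fix x assume "x \<in> Objs D"
  then show "mucell (id_multimod D E M) x \<in> Cells S" "csrc S (mucell (id_multimod D E M) x) = atOb (mml (id_multimod D E M)) x"
    "ctgt S (mucell (id_multimod D E M) x) = atOb (mmr (id_multimod D E M)) x"
    using M by (simp_all add: mucell_id)
next
  fix f assume f: "f \<in> Arrs D"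
  then show "tcell (mml (id_multimod D E M)) f \<^bold>\<star> (stars S (onArr (tdom (mml (id_multimod D E M))) f) (mdids (mmin (id_multimod D E M)) f) \<^bold>\<cdot>
        mucell (id_multimod D E M) (Cod (D0 D) f)) =
      (mucell (id_multimod D E M) (Dom (D0 D) f) \<^bold>\<cdot> mdcell (mmout (id_multimod D E M)) (idc D f)) \<^bold>\<star> tcell (mmr (id_multimod D E M)) f"
    using M by (simp add: mucell_id mdcell_idc_frame tcell_id)
qed

lemma id_multimod_cart: "M \<in> cart_proarrows D E \<Longrightarrow> id_multimod D E M \<in> cart_multicells D E"
  unfolding cart_multicells_iff using cart_proarrows_umod[of M] ummod_id[of M] id_trans_cart[of "msrc D M"] id_trans_cart[of "mtgt D M"]
  by (simp add: cart_proarrows_def)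

lemma comp_multimod_cart:
  assumes "vcomposable V f \<mu>s g \<nu>"
  shows "mchain f \<mu>s g" "ummod \<nu>" "map mmout \<mu>s = mmin \<nu>" "tcod f = tdom (mml \<nu>)"
    "comp_multimod D E f \<mu>s \<nu> \<in> cart_multicells D E"
    "mmr (comp_multimod D E f \<mu>s \<nu>) = comp_trans D E g (mmr \<nu>)"
proof -
  note v = assms[unfolded vcomposable_def V_sel]
  note c = vcpath_mchain[of f \<mu>s g]
  show m: "mchain f \<mu>s g" and n: "ummod \<nu>" "map mmout \<mu>s = mmin \<nu>" "tcod f = tdom (mml \<nu>)"
    using v c by (auto simp: cart_multicells_iff)
  show r: "mmr (comp_multimod D E f \<mu>s \<nu>) = comp_trans D E g (mmr \<nu>)"
    using mchain_end[OF m] by simp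
  have "set (concat (map mmin \<mu>s)) \<subseteq> cart_proarrows D E"
  proof -
    have "set (mmin \<mu>) \<subseteq> cart_proarrows D E" if "\<mu> \<in> set \<mu>s" for \<mu>
      using v c(2) that cart_multicells_iff[of \<mu>] by blast
    then show ?thesis by auto
  qed
  then show "comp_multimod D E f \<mu>s \<nu> \<in> cart_multicells D E"
    unfolding cart_multicells_iff r
    using ummod_comp[OF m n] v c(3,4) by (simp add: cart_multicells_iff comp_trans_cart)
qed

lemma comp_multimod_id:
  assumes \<mu>: "ummod \<mu>" shows "comp_multimod D E (mml \<mu>) [\<mu>] (id_multimod D E (mmout \<mu>)) = \<mu>"
proof (rule ummod_eqI)
  have m: "mchain (mml \<mu>) [\<mu>] (mmr \<mu>)" using \<mu> by simp
  note d = ummodD(1-5)[OF \<mu>]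
  have n: "ummod (id_multimod D E (mmout \<mu>))" using ummod_id[OF d(3)] .
  show "ummod (comp_multimod D E (mml \<mu>) [\<mu>] (id_multimod D E (mmout \<mu>)))"
    by (rule ummod_comp(1)[OF m n]) (simp_all add: d)
  show "ummod \<mu>" by (rule \<mu>)
  show "mmr (comp_multimod D E (mml \<mu>) [\<mu>] (id_multimod D E (mmout \<mu>))) = mmr \<mu>"
    using d mchain_end[OF m] comp_trans_id_right[of "mmr \<mu>" "mtgt D (mmout \<mu>)"] by simp
  show "mml (comp_multimod D E (mml \<mu>) [\<mu>] (id_multimod D E (mmout \<mu>))) = mml \<mu>"
    using d comp_trans_id_right[of "mml \<mu>" "msrc D (mmout \<mu>)"] by simp
  show "mucell (comp_multimod D E (mml \<mu>) [\<mu>] (id_multimod D E (mmout \<mu>))) x = mucell \<mu> x" if x: "x \<in> Objs D" for x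
  proof -
    have "mucell (comp_multimod D E (mml \<mu>) [\<mu>] (id_multimod D E (mmout \<mu>))) x = mucell \<mu> x \<^bold>\<cdot> sid (mpro (mmout \<mu>) x)"
      using mucell_comp[OF m n _ _ x] d x by (simp add: mucell_id)
    also have "\<dots> = mucell \<mu> x"
      unfolding sid_def by (rule S.D1.cmp_ide') (use \<mu> d x in simp_all)
    finally show ?thesis .
  qed
qed simp_all

lemma ids_mchain:
  assumes "mpath F Ms G"
  shows "mchain (id_trans D E F) (map (id_multimod D E) Ms) (id_trans D E G)"
    "map mmout (map (id_multimod D E) Ms) = Ms" "concat (map mmin (map (id_multimod D E) Ms)) = Ms"
proof -
  show "mchain (id_trans D E F) (map (id_multimod D E) Ms) (id_trans D E G)"
    using assms by (induction Ms arbitrary: F) (auto simp: ummod_id utrans_id)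
  show "map mmout (map (id_multimod D E) Ms) = Ms" "concat (map mmin (map (id_multimod D E) Ms)) = Ms"
    by (induction Ms) auto
qed

lemma mus_ids:
  assumes "mpath F Ms G" "x \<in> Objs D"
  shows "mus (map (id_multimod D E) Ms) x = map sid (mvals Ms x)"
  using assms(1) by (induction Ms arbitrary: F) (auto simp: mucell_id assms(2))

lemma stars_mus_ids:
  assumes "mpath F Ms G" "x \<in> Objs D"
  shows "stars S (ide (D0 E) (onOb F x)) (mus (map (id_multimod D E) Ms) x) = idcell S (onOb F x, mvals Ms x)"
  unfolding mus_ids[OF assms] using stars_sids[OF mpath_ppath[OF assms]] by simp

lemma id_comp_multimod:
  assumes \<mu>: "ummod \<mu>"
  shows "comp_multimod D E (id_trans D E (tdom (mml \<mu>))) (map (id_multimod D E) (mmin \<mu>)) \<mu> = \<mu>"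
proof (rule ummod_eqI)
  note d = ummodD(1-6)[OF \<mu>]
  note i = ids_mchain[OF d(6)]
  let ?\<kappa> = "comp_multimod D E (id_trans D E (tdom (mml \<mu>))) (map (id_multimod D E) (mmin \<mu>)) \<mu>"
  have c: "tcod (id_trans D E (tdom (mml \<mu>))) = tdom (mml \<mu>)" by simp
  show "ummod ?\<kappa>" by (rule ummod_comp(1)[OF i(1) \<mu> i(2) c])
  show "ummod \<mu>" by (rule \<mu>)
  show "mmin ?\<kappa> = mmin \<mu>" using i(3) by simp
  show "mmr ?\<kappa> = mmr \<mu>" using mchain_end[OF i(1)] comp_trans_id_left[OF d(2) refl] by simp
  show "mml ?\<kappa> = mml \<mu>" using comp_trans_id_left[OF d(1) refl] by simp
  show "mucell ?\<kappa> x = mucell \<mu> x" if x: "x \<in> Objs D" for x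
  proof -
    have "mucell ?\<kappa> x = idcell S (onOb (tdom (mml \<mu>)) x, mvals (mmin \<mu>) x) \<^bold>\<cdot> mucell \<mu> x"
      using mucell_comp[OF i(1) \<mu> i(2) c x] stars_mus_ids[OF d(6) x] x by simp
    also have "\<dots> = mucell \<mu> x"
      by (rule S.D1.ide_cmp') (use \<mu> x in simp_all)
    finally show ?thesis .
  qed
qed simp_all

text \<open>A two-layer grid of multimodulations. Composing each group with its cell and then along
  the row gives the same strict cell as composing the two rows first, by interchange in the
  strictification. The frame statements travel along in the same induction because the tail is
  entered at the right boundary of its first group.\<close>

lemma vcmps_mchain:
  assumes "mchain g \<mu>s g'" "mchain f (concat \<kappa>ss) f'" "map (map mmout) \<kappa>ss = map mmin \<mu>s" "tcod f = tdom g"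
  shows "mchain (comp_trans D E f g) (vcmps V f \<kappa>ss \<mu>s) (comp_trans D E f' g') \<and>
    concat (map mmin (vcmps V f \<kappa>ss \<mu>s)) = concat (map mmin (concat \<kappa>ss)) \<and>
    map mmout (vcmps V f \<kappa>ss \<mu>s) = map mmout \<mu>s \<and>
    (\<forall>x\<in>Objs D. stars S (atOb (comp_trans D E f g) x) (mus (vcmps V f \<kappa>ss \<mu>s) x) =
       stars S (atOb f x) (mus (concat \<kappa>ss) x) \<^bold>\<cdot> stars S (atOb g x) (mus \<mu>s x)) \<and> tcod f' = tdom g'"
  using assms
proof (induction \<mu>s arbitrary: f g \<kappa>ss)
  case Nil
  then have "\<kappa>ss = []" "f' = f" "g' = g" "utrans f" "utrans g" by auto
  then show ?case using Nil(4) by (auto simp: utrans_comp S_idc_comp)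
next
  case (Cons \<mu> \<mu>s)
  obtain \<kappa>s \<kappa>ss' where ks: "\<kappa>ss = \<kappa>s # \<kappa>ss'" "map mmout \<kappa>s = mmin \<mu>" "map (map mmout) \<kappa>ss' = map mmin \<mu>s"
    using Cons(4) by auto
  have \<mu>: "ummod \<mu>" "mml \<mu> = g" "mchain (mmr \<mu>) \<mu>s g'" using Cons(2) by auto
  obtain h where h: "mchain f \<kappa>s h" "mchain h (concat \<kappa>ss') f'" using Cons(3) by (auto simp: ks mchain_append)
  have fg: "tcod f = tdom (mml \<mu>)" using Cons(5) \<mu> by simp
  note k = ummod_comp[OF h(1) \<mu>(1) ks(2) fg]
  let ?\<kappa> = "comp_multimod D E f \<kappa>s \<mu>"
  have e: "chain_end mmr f \<kappa>s = h" by (rule mchain_end[OF h(1)])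
  have v: "vcmps V f \<kappa>ss (\<mu> # \<mu>s) = ?\<kappa> # vcmps V h \<kappa>ss' \<mu>s" by (simp add: ks e)
  note IH = Cons.IH[OF \<mu>(3) h(2) ks(3) k(2)]
  have c: "mchain (comp_trans D E f g) (?\<kappa> # vcmps V h \<kappa>ss' \<mu>s) (comp_trans D E f' g')"
    using IH k(1) e \<mu>(2) by simp
  have ut: "utrans f" "utrans g" "utrans h" "utrans (mmr \<mu>)"
    using mchain_frames[OF h(1)] mchain_frames[OF Cons(2)] \<mu>(1) by simp_all
  have st: "stars S (atOb (comp_trans D E f g) x) (mus (?\<kappa> # vcmps V h \<kappa>ss' \<mu>s) x) =
      stars S (atOb f x) (mus (concat \<kappa>ss) x) \<^bold>\<cdot> stars S (atOb g x) (mus (\<mu> # \<mu>s) x)" if x: "x \<in> Objs D" for x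
  proof -
    define a where "a = stars S (atOb f x) (mus \<kappa>s x)"
    define b where "b = stars S (atOb h x) (mus (concat \<kappa>ss') x)"
    define c' where "c' = stars S (atOb (mmr \<mu>) x) (mus \<mu>s x)"
    note t = mus_stars[OF h(1) x, folded a_def] mus_stars[OF h(2) x, folded b_def] mus_stars[OF \<mu>(3) x, folded c'_def]
    have kc: "mucell ?\<kappa> x = a \<^bold>\<cdot> mucell \<mu> x" using mucell_comp[OF h(1) \<mu>(1) ks(2) fg x] by (simp add: a_def)
    have "stars S (atOb (comp_trans D E f g) x) (mus (?\<kappa> # vcmps V h \<kappa>ss' \<mu>s) x) =
      mucell ?\<kappa> x \<^bold>\<star> stars S (atOb (mmr ?\<kappa>) x) (mus (vcmps V h \<kappa>ss' \<mu>s) x)"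
      using S.stars_Cons[OF mus_cpath[OF c x, unfolded mus_simps]] k(1) x by simp
    also have "\<dots> = (a \<^bold>\<cdot> mucell \<mu> x) \<^bold>\<star> (b \<^bold>\<cdot> c')"
      using IH x e unfolding kc by (simp add: b_def c'_def)
    also have "\<dots> = (a \<^bold>\<star> b) \<^bold>\<cdot> (mucell \<mu> x \<^bold>\<star> c')"
    proof (rule S.interchange)
      have mf: "map mmout (concat \<kappa>ss') = concat (map mmin \<mu>s)" using ks(3) by (metis map_concat)
      show "Cod (D1 S) b = Dom (D1 S) c'" using t mf k(2) by simp
      show "Cod (D1 S) a = Dom (D1 S) (mucell \<mu> x)" using t ks(2) fg by simp
    qed (use t \<mu> x in simp_all)
    also have "a \<^bold>\<star> b = stars S (atOb f x) (mus (concat \<kappa>ss) x)"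
      using S.stars_append[OF mus_cpath[OF h(1) x] mus_cpath[OF h(2) x]] by (simp add: ks a_def b_def)
    also have "mucell \<mu> x \<^bold>\<star> c' = stars S (atOb g x) (mus (\<mu> # \<mu>s) x)"
      using S.stars_Cons[OF mus_cpath[OF Cons(2) x, unfolded mus_simps]] \<mu> x by (simp add: c'_def)
    finally show ?thesis .
  qed
  show ?case unfolding v using c st IH by (simp add: ks)
qed

text \<open>On components both sides are the composite of three rows, so associativity of
  composition of cells in the strictification is enough; the boundaries agree by associativity of
  transformations.\<close>

lemma comp_multimod_assoc:
  assumes m: "mchain g \<mu>s g'" and n: "ummod \<nu>" "map mmout \<mu>s = mmin \<nu>" "tcod g = tdom (mml \<nu>)"
    and k: "mchain f (concat \<kappa>ss) f'" "map (map mmout) \<kappa>ss = map mmin \<mu>s" and fg: "tcod f = tdom g"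
  shows "comp_multimod D E (comp_trans D E f g) (vcmps V f \<kappa>ss \<mu>s) \<nu> = comp_multimod D E f (concat \<kappa>ss) (comp_multimod D E g \<mu>s \<nu>)"
proof -
  note v = vcmps_mchain[OF m k fg]
  have vm: "mchain (comp_trans D E f g) (vcmps V f \<kappa>ss \<mu>s) (comp_trans D E f' g')"
    "concat (map mmin (vcmps V f \<kappa>ss \<mu>s)) = concat (map mmin (concat \<kappa>ss))"
    "map mmout (vcmps V f \<kappa>ss \<mu>s) = map mmout \<mu>s"
    "\<And>x. x \<in> Objs D \<Longrightarrow> stars S (atOb (comp_trans D E f g) x) (mus (vcmps V f \<kappa>ss \<mu>s) x) =
       stars S (atOb f x) (mus (concat \<kappa>ss) x) \<^bold>\<cdot> stars S (atOb g x) (mus \<mu>s x)" "tcod f' = tdom g'"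
    using v by blast+
  note c1 = ummod_comp[OF m n]
  have n1: "map mmout (concat \<kappa>ss) = mmin (comp_multimod D E g \<mu>s \<nu>)" using k(2) by (simp add: map_concat)
  have n2: "tcod f = tdom (mml (comp_multimod D E g \<mu>s \<nu>))" using fg by simp
  have n3: "map mmout (vcmps V f \<kappa>ss \<mu>s) = mmin \<nu>" "tcod (comp_trans D E f g) = tdom (mml \<nu>)"
    using vm(3) n by simp_all
  note ut = mchain_frames[OF m] mchain_frames[OF k(1)]
  show ?thesis
  proof (rule ummod_eqI)
    show "ummod (comp_multimod D E (comp_trans D E f g) (vcmps V f \<kappa>ss \<mu>s) \<nu>)"
      by (rule ummod_comp(1)[OF vm(1) n(1) n3])
    show "ummod (comp_multimod D E f (concat \<kappa>ss) (comp_multimod D E g \<mu>s \<nu>))"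
      by (rule ummod_comp(1)[OF k(1) c1(1) n1 n2])
    show "mmin (comp_multimod D E (comp_trans D E f g) (vcmps V f \<kappa>ss \<mu>s) \<nu>) = mmin (comp_multimod D E f (concat \<kappa>ss) (comp_multimod D E g \<mu>s \<nu>))"
      using vm(2) by simp
    show "mml (comp_multimod D E (comp_trans D E f g) (vcmps V f \<kappa>ss \<mu>s) \<nu>) = mml (comp_multimod D E f (concat \<kappa>ss) (comp_multimod D E g \<mu>s \<nu>))"
      using ut n fg by (simp add: comp_trans_assoc)
    show "mmr (comp_multimod D E (comp_trans D E f g) (vcmps V f \<kappa>ss \<mu>s) \<nu>) = mmr (comp_multimod D E f (concat \<kappa>ss) (comp_multimod D E g \<mu>s \<nu>))"
      using ut n c1(2) vm(5) mchain_end[OF vm(1)] mchain_end[OF k(1)] mchain_end[OF m] by (simp add: comp_trans_assoc)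
    fix x assume x: "x \<in> Objs D"
    have "Cod (D1 S) (stars S (atOb f x) (mus (concat \<kappa>ss) x)) = Dom (D1 S) (stars S (atOb g x) (mus \<mu>s x))"
      using mus_stars[OF m x] mus_stars[OF k(1) x] n1 fg by simp
    then show "mucell (comp_multimod D E (comp_trans D E f g) (vcmps V f \<kappa>ss \<mu>s) \<nu>) x =
        mucell (comp_multimod D E f (concat \<kappa>ss) (comp_multimod D E g \<mu>s \<nu>)) x"
      unfolding mucell_comp[OF vm(1) n(1) n3 x] mucell_comp[OF k(1) c1(1) n1 n2 x] mucell_comp[OF m n x] vm(4)[OF x]
      using mus_stars[OF m x] mus_stars[OF k(1) x] n x by simp
  qed simp
qed

lemma V_vdc: "virtual_double_category V"
proof (rule virtual_double_category.intro)
  show "category (V0 V)" by (rule V0_cat)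
  show "vsrc V p \<in> Ob (V0 V) \<and> vtgt V p \<in> Ob (V0 V)" if "p \<in> vpro V" for p
    using that by (simp add: cart_proarrows_def)
  show "vout V \<mu> \<in> vpro V \<and> (\<exists>x y. vpath V x (vin V \<mu>) y \<and> vleft V \<mu> \<in> Hom (V0 V) x (vsrc V (vout V \<mu>)) \<and>
        vright V \<mu> \<in> Hom (V0 V) y (vtgt V (vout V \<mu>)))" if "\<mu> \<in> vcell V" for \<mu>
  proof -
    have c: "\<mu> \<in> cart_multicells D E" using that by simp
    note i = c[unfolded cart_multicells_iff]
    have "vpath V (tdom (mml \<mu>)) (mmin \<mu>) (tdom (mmr \<mu>))"
      by (rule mpath_vpath) (use i ummodD(6)[of \<mu>] in \<open>auto simp: cart_arrows_iff\<close>)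
    then show ?thesis using i by (auto simp: Hom_def)
  qed
  show "vid V p \<in> vhom V [p] p (ide (V0 V) (vsrc V p)) (ide (V0 V) (vtgt V p))" if "p \<in> vpro V" for p
    using that id_multimod_cart by (simp add: vhom_def)
  show "vcmp V f \<mu>s \<nu> \<in> vhom V (concat (map (vin V) \<mu>s)) (vout V \<nu>) (f \<cdot>\<^bsub>V0 V\<^esub> vleft V \<nu>) (g \<cdot>\<^bsub>V0 V\<^esub> vright V \<nu>)"
    if "vcomposable V f \<mu>s g \<nu>" for f \<mu>s g \<nu>
    using comp_multimod_cart(5,6)[OF that] by (simp add: vhom_def)
  show "vcmp V (vleft V \<mu>) [\<mu>] (vid V (vout V \<mu>)) = \<mu>" if "\<mu> \<in> vcell V" for \<mu>
    using that comp_multimod_id by (simp add: cart_multicells_iff)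
  show "vcmp V (ide (V0 V) (Dom (V0 V) (vleft V \<mu>))) (map (vid V) (vin V \<mu>)) \<mu> = \<mu>" if "\<mu> \<in> vcell V" for \<mu>
    using that id_comp_multimod by (simp add: cart_multicells_iff)
  show "vcmp V (f \<cdot>\<^bsub>V0 V\<^esub> g) (vcmps V f \<kappa>ss \<mu>s) \<nu> = vcmp V f (concat \<kappa>ss) (vcmp V g \<mu>s \<nu>)"
    if "vcomposable V g \<mu>s g' \<nu>" "vcpath V f (concat \<kappa>ss) f'" "map (map (vout V)) \<kappa>ss = map (vin V) \<mu>s"
      "Cod (V0 V) f = Dom (V0 V) g" for f g \<kappa>ss \<mu>s \<nu> f' g'
    using comp_multimod_assoc[OF comp_multimod_cart(1-4)[OF that(1)] vcpath_mchain(1)[OF that(2)]] that(3,4) by simp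
qed

end

section \<open>Products and external composition\<close>

lemma ex1_unique: "\<exists>!x. P x \<Longrightarrow> P a \<Longrightarrow> P b \<Longrightarrow> a = b"
  by blast

context category
begin

lemma finite_products_obs:
  assumes "finite_products C P" "x \<in> Ob C" "y \<in> Ob C"
  shows "proj1 P x y \<in> Arr C" "Dom C (proj1 P x y) = prod_ob P x y" "Cod C (proj1 P x y) = x"
    "proj2 P x y \<in> Arr C" "Dom C (proj2 P x y) = prod_ob P x y" "Cod C (proj2 P x y) = y"
    "prod_ob P x y \<in> Ob C"
proof -
  show *: "proj1 P x y \<in> Arr C" "Dom C (proj1 P x y) = prod_ob P x y" "Cod C (proj1 P x y) = x"
    "proj2 P x y \<in> Arr C" "Dom C (proj2 P x y) = prod_ob P x y" "Cod C (proj2 P x y) = y"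
    using assms by (auto simp: finite_products_def Hom_def)
  show "prod_ob P x y \<in> Ob C" using Dom_in[OF *(1)] *(2) by simp
qed

lemma pairing_ex1:
  assumes P: "finite_products C P" and f: "f \<in> Arr C" "g \<in> Arr C" "Dom C f = Dom C g"
  shows "\<exists>!h. h \<in> Hom C (Dom C f) (prod_ob P (Cod C f) (Cod C g)) \<and>
     h \<cdot> proj1 P (Cod C f) (Cod C g) = f \<and> h \<cdot> proj2 P (Cod C f) (Cod C g) = g"
proof -
  note o = finite_products_obs[OF P Cod_in[OF f(1)] Cod_in[OF f(2)]]
  have "is_product C (proj1 P (Cod C f) (Cod C g)) (proj2 P (Cod C f) (Cod C g))"
    using P Cod_in[OF f(1)] Cod_in[OF f(2)] by (simp add: finite_products_def)
  then have "\<forall>a\<in>Arr C. \<forall>b\<in>Arr C. Dom C a = Dom C b \<and> Cod C a = Cod C f \<and> Cod C b = Cod C g \<longrightarrow>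
     (\<exists>!h. h \<in> Hom C (Dom C a) (prod_ob P (Cod C f) (Cod C g)) \<and> h \<cdot> proj1 P (Cod C f) (Cod C g) = a \<and> h \<cdot> proj2 P (Cod C f) (Cod C g) = b)"
    unfolding is_product_def o by simp
  from this[rule_format, OF f(1,2)] show ?thesis using f by simp
qed

lemma pairing:
  assumes P: "finite_products C P" and f: "f \<in> Arr C" "g \<in> Arr C" "Dom C f = Dom C g"
  shows "pairing C P f g \<in> Arr C" "Dom C (pairing C P f g) = Dom C f" "Cod C (pairing C P f g) = prod_ob P (Cod C f) (Cod C g)"
    "pairing C P f g \<cdot> proj1 P (Cod C f) (Cod C g) = f" "pairing C P f g \<cdot> proj2 P (Cod C f) (Cod C g) = g"
  using theI'[OF pairing_ex1[OF assms]] unfolding pairing_def[symmetric] by (simp_all add: Hom_def)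

lemma pairing_unique:
  assumes P: "finite_products C P" and f: "f \<in> Arr C" "g \<in> Arr C" "Dom C f = Dom C g"
    and h: "h \<in> Arr C" "Dom C h = Dom C f" "Cod C h = prod_ob P (Cod C f) (Cod C g)"
    "h \<cdot> proj1 P (Cod C f) (Cod C g) = f" "h \<cdot> proj2 P (Cod C f) (Cod C g) = g"
  shows "pairing C P f g = h"
  unfolding pairing_def by (rule the1_equality[OF pairing_ex1[OF P f]]) (use h in \<open>simp add: Hom_def\<close>)

text \<open>Two product cones over the same pair of objects. The inverse \<open>k\<close> is the map
  induced into the cone \<open>f\<close>, \<open>g\<close> by the chosen projections, and uniqueness
  on each cone gives the two identities.\<close>

lemma product_iso_pairing:
  assumes P: "finite_products C P" and prod: "is_product C f g"
  shows "is_iso C (pairing C P f g)"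
proof -
  have f: "f \<in> Arr C" "g \<in> Arr C" "Dom C f = Dom C g" using prod by (simp_all add: is_product_def)
  let ?x = "Cod C f" and ?y = "Cod C g"
  note o = finite_products_obs[OF P Cod_in[OF f(1)] Cod_in[OF f(2)]]
  note p = pairing[OF P f]
  have u: "\<forall>a\<in>Arr C. \<forall>b\<in>Arr C. Dom C a = Dom C b \<and> Cod C a = ?x \<and> Cod C b = ?y \<longrightarrow>
        (\<exists>!h. h \<in> Hom C (Dom C a) (Dom C f) \<and> h \<cdot> f = a \<and> h \<cdot> g = b)"
    using prod unfolding is_product_def by blast
  obtain k where k: "k \<in> Arr C" "Dom C k = prod_ob P ?x ?y" "Cod C k = Dom C f" "k \<cdot> f = proj1 P ?x ?y" "k \<cdot> g = proj2 P ?x ?y"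
    using u[rule_format, OF o(1,4)] o by (auto simp: Hom_def)
  have 1: "pairing C P f g \<cdot> k = ide C (Dom C f)"
  proof -
    have "\<exists>!h. h \<in> Hom C (Dom C f) (Dom C f) \<and> h \<cdot> f = f \<and> h \<cdot> g = g"
      using u[rule_format, OF f(1,2)] f by simp
    then show ?thesis
      by (rule ex1_unique) (use p k f in \<open>simp_all add: Hom_def\<close>)
  qed
  have 2: "k \<cdot> pairing C P f g = ide C (prod_ob P ?x ?y)"
  proof -
    have q: "pairing C P (proj1 P ?x ?y) (proj2 P ?x ?y) = h"
      if "h \<in> Arr C" "Dom C h = prod_ob P ?x ?y" "Cod C h = prod_ob P ?x ?y" "h \<cdot> proj1 P ?x ?y = proj1 P ?x ?y" "h \<cdot> proj2 P ?x ?y = proj2 P ?x ?y" for h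
      by (rule pairing_unique[OF P]) (use o that in simp_all)
    have "pairing C P (proj1 P ?x ?y) (proj2 P ?x ?y) = k \<cdot> pairing C P f g"
      by (rule q) (use p k f o in simp_all)
    moreover have "pairing C P (proj1 P ?x ?y) (proj2 P ?x ?y) = ide C (prod_ob P ?x ?y)"
      by (rule q) (use o in simp_all)
    ultimately show ?thesis by simp
  qed
  have "inverses C (pairing C P f g) k" unfolding inverses_def Hom_def using p k 1 2 by simp
  then show ?thesis by (rule inverses_is_iso)
qed

lemma to_term:
  assumes P: "finite_products C P" and x: "x \<in> Ob C"
  shows "to_term C P x \<in> Arr C" "Dom C (to_term C P x) = x" "Cod C (to_term C P x) = term_ob P"
    "h \<in> Arr C \<Longrightarrow> Dom C h = x \<Longrightarrow> Cod C h = term_ob P \<Longrightarrow> to_term C P x = h" "term_ob P \<in> Ob C"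
proof -
  have t: "is_terminal C (term_ob P)" using P by (simp add: finite_products_def)
  then have e: "\<exists>!h. h \<in> Hom C x (term_ob P)" using x by (simp add: is_terminal_def)
  show "to_term C P x \<in> Arr C" "Dom C (to_term C P x) = x" "Cod C (to_term C P x) = term_ob P"
    using theI'[OF e] unfolding to_term_def[symmetric] by (simp_all add: Hom_def)
  show "h \<in> Arr C \<Longrightarrow> Dom C h = x \<Longrightarrow> Cod C h = term_ob P \<Longrightarrow> to_term C P x = h"
    unfolding to_term_def by (rule the1_equality[OF e]) (simp add: Hom_def)
  show "term_ob P \<in> Ob C" using t by (simp add: is_terminal_def)
qed

lemma terminal_iso_to_term:
  assumes P: "finite_products C P" and t: "is_terminal C t"
  shows "is_iso C (to_term C P t)"
proof -
  have tO: "t \<in> Ob C" and u: "\<And>x. x \<in> Ob C \<Longrightarrow> \<exists>!h. h \<in> Hom C x t" using t by (auto simp: is_terminal_def)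
  note p = to_term[OF P tO]
  obtain k where k: "k \<in> Arr C" "Dom C k = term_ob P" "Cod C k = t" using u[OF p(5)] by (auto simp: Hom_def)
  have 1: "to_term C P t \<cdot> k = ide C t"
    by (rule ex1_unique[OF u[OF tO]]) (use p(1-3) k tO in \<open>simp_all add: Hom_def\<close>)
  have "to_term C P (term_ob P) = k \<cdot> to_term C P t"
    by (rule to_term(4)[OF P p(5)]) (use p(1-3) k in simp_all)
  moreover have "to_term C P (term_ob P) = ide C (term_ob P)"
    by (rule to_term(4)[OF P p(5)]) (use p(5) in simp_all)
  ultimately have 2: "k \<cdot> to_term C P t = ide C (term_ob P)" by simp
  have "inverses C (to_term C P t) k" unfolding inverses_def Hom_def using p(1-3) k 1 2 by simp
  then show ?thesis by (rule inverses_is_iso)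
qed

end

context double_category
begin

text \<open>The inner boundary may be any arrow, so the two inverses must be shown to meet. By
  functoriality their inner arrows are both inverse to the shared arrow, hence equal. The comparison
  maps for products need this generality, since their boundaries are pairings.\<close>

lemma iso_star:
  assumes "is_iso (D1 D) c" "is_iso (D1 D) d" "ctgt D c = csrc D d"
  shows "is_iso (D1 D) (c \<star> d)"
proof -
  note c = D1.inverses_inverse_arr[OF assms(1)] and d = D1.inverses_inverse_arr[OF assms(2)]
  note c' = c[unfolded inverses_def Hom_def] and d' = d[unfolded inverses_def Hom_def]
  have 1: "inverses (D0 D) (ctgt D c) (ctgt D (inverse_arr (D1 D) c))"
  proof -
    have "ctgt D c \<cdot>\<^bsub>D0 D\<^esub> ctgt D (inverse_arr (D1 D) c) = ide (D0 D) (ptgt D (Dom (D1 D) c))"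
      using ctgt_comp[of c "inverse_arr (D1 D) c"] c' by simp
    moreover have "ctgt D (inverse_arr (D1 D) c) \<cdot>\<^bsub>D0 D\<^esub> ctgt D c = ide (D0 D) (ptgt D (Cod (D1 D) c))"
      using ctgt_comp[of "inverse_arr (D1 D) c" c] c' by simp
    ultimately show ?thesis using c' by (simp add: inverses_def Hom_def)
  qed
  have 2: "inverses (D0 D) (csrc D d) (csrc D (inverse_arr (D1 D) d))"
  proof -
    have "csrc D d \<cdot>\<^bsub>D0 D\<^esub> csrc D (inverse_arr (D1 D) d) = ide (D0 D) (psrc D (Dom (D1 D) d))"
      using csrc_comp[of d "inverse_arr (D1 D) d"] d' by simp
    moreover have "csrc D (inverse_arr (D1 D) d) \<cdot>\<^bsub>D0 D\<^esub> csrc D d = ide (D0 D) (psrc D (Cod (D1 D) d))"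
      using csrc_comp[of "inverse_arr (D1 D) d" d] d' by simp
    ultimately show ?thesis using d' by (simp add: inverses_def Hom_def)
  qed
  have "ctgt D (inverse_arr (D1 D) c) = csrc D (inverse_arr (D1 D) d)"
    by (rule D0.inverses_unique[OF 1]) (use 2 assms(3) in simp)
  from D1.inverses_is_iso[OF inverses_star[OF c d assms(3) this]] show ?thesis .
qed

end

context cartesian_double_category
begin

text \<open>The chosen products of proarrows lie over the chosen products of objects, so the
  boundary of a pairing satisfies the equations that characterise the pairing of the boundaries.
  Comparison cells of adjacent proarrows can therefore be composed externally.\<close>

lemma pairing_csrc_ctgt:
  assumes c: "c \<in> Cells D" "d \<in> Cells D" "Dom (D1 D) c = Dom (D1 D) d"
  shows "csrc D (pairing (D1 D) (P1 D) c d) = pairing (D0 D) (P0 D) (csrc D c) (csrc D d)"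
    "ctgt D (pairing (D1 D) (P1 D) c d) = pairing (D0 D) (P0 D) (ctgt D c) (ctgt D d)"
proof -
  let ?m = "Cod (D1 D) c" and ?n = "Cod (D1 D) d" and ?h = "pairing (D1 D) (P1 D) c d"
  have mn: "?m \<in> Pros D" "?n \<in> Pros D" using c by simp_all
  note p = D1.pairing[OF D1_products c] and o = D1.finite_products_obs[OF D1_products mn]
  note s = prod_src_tgt[OF mn] proj_src[OF mn] proj_tgt[OF mn]
  have "csrc D (?h \<bullet> proj1 (P1 D) ?m ?n) = csrc D c" "csrc D (?h \<bullet> proj2 (P1 D) ?m ?n) = csrc D d"
    "ctgt D (?h \<bullet> proj1 (P1 D) ?m ?n) = ctgt D c" "ctgt D (?h \<bullet> proj2 (P1 D) ?m ?n) = ctgt D d"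
    using p by simp_all
  then have e: "csrc D ?h \<cdot>\<^bsub>D0 D\<^esub> proj1 (P0 D) (psrc D ?m) (psrc D ?n) = csrc D c" "csrc D ?h \<cdot>\<^bsub>D0 D\<^esub> proj2 (P0 D) (psrc D ?m) (psrc D ?n) = csrc D d"
    "ctgt D ?h \<cdot>\<^bsub>D0 D\<^esub> proj1 (P0 D) (ptgt D ?m) (ptgt D ?n) = ctgt D c" "ctgt D ?h \<cdot>\<^bsub>D0 D\<^esub> proj2 (P0 D) (ptgt D ?m) (ptgt D ?n) = ctgt D d"
    using p(1-3) o s by simp_all
  show "csrc D ?h = pairing (D0 D) (P0 D) (csrc D c) (csrc D d)"
    by (rule D0.pairing_unique[OF D0_products, symmetric]) (use c p(1-3) s e in simp_all)
  show "ctgt D ?h = pairing (D0 D) (P0 D) (ctgt D c) (ctgt D d)"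
    by (rule D0.pairing_unique[OF D0_products, symmetric]) (use c p(1-3) s e in simp_all)
qed

text \<open>The pairing of the external composites factors as the external composite of the two
  pairings, followed by the canonical comparison \<open>z\<close> of \<open>odot_prod\<close>; both
  factors are invertible.\<close>

lemma iso_pairing_star:
  assumes c: "c \<in> Cells D" "c' \<in> Cells D" "Dom (D1 D) c = Dom (D1 D) c'"
    and d: "d \<in> Cells D" "d' \<in> Cells D" "Dom (D1 D) d = Dom (D1 D) d'"
    and t: "ctgt D c = csrc D d" "ctgt D c' = csrc D d'"
    and iso: "is_iso (D1 D) (pairing (D1 D) (P1 D) c c')" "is_iso (D1 D) (pairing (D1 D) (P1 D) d d')"
  shows "is_iso (D1 D) (pairing (D1 D) (P1 D) (c \<star> d) (c' \<star> d'))"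
proof -
  let ?m = "Cod (D1 D) c" and ?m' = "Cod (D1 D) c'" and ?n = "Cod (D1 D) d" and ?n' = "Cod (D1 D) d'"
  define h k where "h = pairing (D1 D) (P1 D) c c'" and "k = pairing (D1 D) (P1 D) d d'"
  have ob: "?m \<in> Pros D" "?m' \<in> Pros D" "?n \<in> Pros D" "?n' \<in> Pros D" using c d by simp_all
  have e: "ptgt D ?m = psrc D ?n" "ptgt D ?m' = psrc D ?n'" using composable_frames(2) c d t by blast+
  note hp = D1.pairing[OF D1_products c, folded h_def] and kp = D1.pairing[OF D1_products d, folded k_def]
  have hk: "ctgt D h = csrc D k" unfolding h_def k_def using pairing_csrc_ctgt[OF c] pairing_csrc_ctgt[OF d] t by simp
  define p q p' q' where "p = proj1 (P1 D) ?m ?m'" and "q = proj1 (P1 D) ?n ?n'"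
    and "p' = proj2 (P1 D) ?m ?m'" and "q' = proj2 (P1 D) ?n ?n'"
  note mo = D1.finite_products_obs[OF D1_products ob(1,2), folded p_def p'_def]
    and no = D1.finite_products_obs[OF D1_products ob(3,4), folded q_def q'_def]
  have pq: "ctgt D p = csrc D q" "ctgt D p' = csrc D q'"
    using proj_tgt[OF ob(1,2)] proj_src[OF ob(3,4)] e by (simp_all add: p_def q_def p'_def q'_def)
  define z where "z = pairing (D1 D) (P1 D) (p \<star> q) (p' \<star> q')"
  have zi: "is_iso (D1 D) z" unfolding z_def p_def q_def p'_def q'_def by (rule odot_prod[OF ob(1,3,2,4) e])
  have pc: "p \<star> q \<in> Cells D" "p' \<star> q' \<in> Cells D" "Dom (D1 D) (p \<star> q) = Dom (D1 D) (p' \<star> q')"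
    using mo no pq by simp_all
  note zp = D1.pairing[OF D1_products pc, folded z_def]
  have hki: "is_iso (D1 D) (h \<star> k)" using iso_star[OF iso[folded h_def k_def] hk] .
  have c1: "c \<star> d = (h \<star> k) \<bullet> (p \<star> q)" "c' \<star> d' = (h \<star> k) \<bullet> (p' \<star> q')"
    using interchange[of h p k q] interchange[of h p' k q'] hp kp mo no hk pq by (simp_all add: p_def q_def p'_def q'_def)
  have "pairing (D1 D) (P1 D) (c \<star> d) (c' \<star> d') = (h \<star> k) \<bullet> z"
  proof (rule D1.pairing_unique[OF D1_products])
    have co: "Cod (D1 D) (c \<star> d) = Cod (D1 D) (p \<star> q)" "Cod (D1 D) (c' \<star> d') = Cod (D1 D) (p' \<star> q')"
      using c d t mo no pq by simp_all
    show "(h \<star> k) \<bullet> z \<bullet> proj1 (P1 D) (Cod (D1 D) (c \<star> d)) (Cod (D1 D) (c' \<star> d')) = c \<star> d"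
      "(h \<star> k) \<bullet> z \<bullet> proj2 (P1 D) (Cod (D1 D) (c \<star> d)) (Cod (D1 D) (c' \<star> d')) = c' \<star> d'"
      using zp hp kp hk mo no pq D1.finite_products_obs[OF D1_products D1.Cod_in[OF pc(1)] D1.Cod_in[OF pc(2)]] unfolding co c1 by simp_all
    show "Cod (D1 D) ((h \<star> k) \<bullet> z) = prod_ob (P1 D) (Cod (D1 D) (c \<star> d)) (Cod (D1 D) (c' \<star> d'))"
      unfolding co using zp hp kp hk mo no pq by simp
  qed (use c d t zp hp kp hk mo no pq in simp_all)
  moreover have "is_iso (D1 D) ((h \<star> k) \<bullet> z)"
    by (rule D1.iso_cmp[OF hki zi]) (use zp hp kp hk mo no pq in simp)
  ultimately show ?thesis by simp
qed

text \<open>The nullary counterpart: the two maps to the terminal proarrow meet along the unique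
  arrow to the terminal object, and the comparison of \<open>odot_term\<close> follows their
  external composite.\<close>

lemma iso_to_term_odot:
  assumes m: "m \<in> Pros D" "n \<in> Pros D" "ptgt D m = psrc D n"
    and iso: "is_iso (D1 D) (to_term (D1 D) (P1 D) m)" "is_iso (D1 D) (to_term (D1 D) (P1 D) n)"
  shows "is_iso (D1 D) (to_term (D1 D) (P1 D) (m \<odot> n))"
proof -
  let ?I = "term_ob (P1 D)"
  define h k where "h = to_term (D1 D) (P1 D) m" and "k = to_term (D1 D) (P1 D) n"
  note hp = D1.to_term[OF D1_products m(1), folded h_def] and kp = D1.to_term[OF D1_products m(2), folded k_def]
  have x: "ptgt D m \<in> Objs D" using m by simp
  have "to_term (D0 D) (P0 D) (ptgt D m) = ctgt D h"
    by (rule D0.to_term(4)[OF D0_products x]) (use hp(1-3) term_src_tgt in simp_all)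
  moreover have "to_term (D0 D) (P0 D) (ptgt D m) = csrc D k"
    by (rule D0.to_term(4)[OF D0_products x]) (use kp(1-3) m term_src_tgt in simp_all)
  ultimately have hk: "ctgt D h = csrc D k" by simp
  have I: "?I \<in> Pros D" by (rule hp(5))
  have II: "?I \<odot> ?I \<in> Pros D" using I term_src_tgt by simp
  define z where "z = to_term (D1 D) (P1 D) (?I \<odot> ?I)"
  note zp = D1.to_term[OF D1_products II, folded z_def]
  have mn: "m \<odot> n \<in> Pros D" using m by simp
  have "to_term (D1 D) (P1 D) (m \<odot> n) = (h \<star> k) \<bullet> z"
    by (rule D1.to_term(4)[OF D1_products mn]) (use hp(1-3) kp(1-3) hk zp(1-3) in simp_all)
  moreover have "is_iso (D1 D) ((h \<star> k) \<bullet> z)"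
    by (rule D1.iso_cmp[OF iso_star[OF iso[folded h_def k_def] hk] odot_term[folded z_def]])
      (use hp(1-3) kp(1-3) hk zp(1-3) in simp)
  ultimately show ?thesis by simp
qed

end

section \<open>Composites of modules\<close>

context vertical_cart_lax
begin

definition tmods :: "('o, 'f, 'o, 't, 'x, 'a, 'p, 'c) lax_fun \<Rightarrow> ('o, 'f, 'o, 't, 'x, 'a, 'p, 'c) bimod list \<Rightarrow> 'f \<Rightarrow> ('x \<times> 'p list) \<times> ('x \<times> 'p list) \<times> 'c" where
  "tmods F Ms f = stars S (onArr F f) (mdids Ms f)"

lemma tmods_simps:
  assumes "mpath F Ms G" "f \<in> Arrs D"
  shows "tmods F Ms f \<in> Cells S" "csrc S (tmods F Ms f) = onArr F f" "ctgt S (tmods F Ms f) = onArr G f"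
    "Dom (D1 S) (tmods F Ms f) = (onOb F (Dom (D0 D) f), mvals Ms (Dom (D0 D) f))"
    "Cod (D1 S) (tmods F Ms f) = (onOb F (Cod (D0 D) f), mvals Ms (Cod (D0 D) f))"
  using mdids_stars[OF assms] by (simp_all add: tmods_def)

lemma tmods_Nil: "tmods F [] f = idc S (onArr F f)"
  by (simp add: tmods_def)

lemma tmods_Cons:
  assumes "mpath F (M # Ms) G" "f \<in> Arrs D"
  shows "tmods F (M # Ms) f = mdcell M (idc D f) \<^bold>\<star> tmods (mtgt D M) Ms f"
  using S.stars_Cons[OF mdids_cpath[OF assms, unfolded mdids_simps]] assms by (simp add: tmods_def)

lemma tmods_append:
  assumes "mpath F Ms G" "mpath G Ns H" "f \<in> Arrs D"
  shows "tmods F (Ms @ Ns) f = tmods F Ms f \<^bold>\<star> tmods G Ns f"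
  using S.stars_append[OF mdids_cpath[OF assms(1,3)] mdids_cpath[OF assms(2,3)]] by (simp add: tmods_def)

lemma tmods_cmp:
  assumes "mpath F Ms G" and fg: "f \<in> Arrs D" "g \<in> Arrs D" "Cod (D0 D) f = Dom (D0 D) g"
  shows "tmods F Ms (f \<cdot>\<^bsub>D0 D\<^esub> g) = tmods F Ms f \<^bold>\<cdot> tmods F Ms g"
  using assms(1)
proof (induction Ms arbitrary: F)
  case Nil
  then show ?case using fg by (auto simp: tmods_Nil S_idc_comp)
next
  case (Cons M Ms)
  have M: "umod M" "mpath (mtgt D M) Ms G" using Cons(2) by auto
  have c: "f \<cdot>\<^bsub>D0 D\<^esub> g \<in> Arrs D" using fg by simp
  note t = tmods_simps[OF M(2) fg(1)] tmods_simps[OF M(2) fg(2)]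
  have "idc D (f \<cdot>\<^bsub>D0 D\<^esub> g) = idc D f \<bullet>\<^bsub>D\<^esub> idc D g" using D.idc_comp fg by blast
  then have "mdcell M (idc D (f \<cdot>\<^bsub>D0 D\<^esub> g)) = mdcell M (idc D f) \<^bold>\<cdot> mdcell M (idc D g)"
    using mdcell_cmp[OF M(1), of "idc D f" "idc D g"] fg by simp
  then show ?case
    unfolding tmods_Cons[OF Cons(2) c] tmods_Cons[OF Cons(2) fg(1)] tmods_Cons[OF Cons(2) fg(2)] Cons.IH[OF M(2)]
    using S.interchange[of "mdcell M (idc D f)" "mdcell M (idc D g)" "tmods (mtgt D M) Ms f" "tmods (mtgt D M) Ms g"] M(1) fg t
    by simp
qed

lemma tmods_ide:
  assumes "mpath F Ms G" "x \<in> Objs D"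
  shows "tmods F Ms (ide (D0 D) x) = idcell S (onOb F x, mvals Ms x)"
proof -
  have "mdids Ns (ide (D0 D) x) = map sid (mvals Ns x)" if "mpath H Ns G" for H Ns
    using that
  proof (induction Ns arbitrary: H)
    case (Cons M Ns)
    then show ?case using assms(2) mdcell_idcell[of M x] by (auto simp: sid_def)
  qed simp
  from this[OF assms(1)] show ?thesis
    using stars_sids[OF mpath_ppath[OF assms]] mpath_uobj[OF assms(1)] assms(2) by (simp add: tmods_def)
qed

text \<open>A 2-cell at the right end of the path passes every module in turn, entering through a
  right action and leaving through a left action. This supplies the right action of the composite
  module.\<close>

lemma tmods_slide:
  assumes "mpath F Ms G" and t: "t \<in> Cells D"
  shows "tmods F Ms (csrc D t) \<^bold>\<star> fcell G t = fcell F t \<^bold>\<star> tmods F Ms (ctgt D t)"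
  using assms(1)
proof (induction Ms arbitrary: F)
  case Nil
  then show ?case using t by (auto simp: tmods_Nil)
next
  case (Cons M Ms)
  let ?K = "mtgt D M" and ?f = "csrc D t" and ?g = "ctgt D t"
  have M: "umod M" "mpath ?K Ms G" "msrc D M = F" using Cons(2) by auto
  have u: "uobj F" "uobj G" "uobj ?K" using mpath_uobj[OF Cons(2)] M by auto
  have fg: "?f \<in> Arrs D" "?g \<in> Arrs D" using t by simp_all
  note tm = tmods_simps[OF M(2) fg(1)] tmods_simps[OF M(2) fg(2)]
  have "tmods F (M # Ms) ?f \<^bold>\<star> fcell G t = mdcell M (idc D ?f) \<^bold>\<star> (tmods ?K Ms ?f \<^bold>\<star> fcell G t)"
    unfolding tmods_Cons[OF Cons(2) fg(1)] using M t tm u by simp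
  also have "\<dots> = (mdcell M (idc D ?f) \<^bold>\<star> fcell ?K t) \<^bold>\<star> tmods ?K Ms ?g"
    unfolding Cons.IH[OF M(2)] using M t tm u by simp
  also have "mdcell M (idc D ?f) \<^bold>\<star> fcell ?K t = fcell F t \<^bold>\<star> mdcell M (idc D ?g)"
    using mdcell_slide[OF M(1) t] M(3) by simp
  also have "\<dots> \<^bold>\<star> tmods ?K Ms ?g = fcell F t \<^bold>\<star> tmods F (M # Ms) ?g"
    unfolding tmods_Cons[OF Cons(2) fg(2)] using M t tm u by simp
  finally show ?case .
qed

text \<open>The composite acts on a 2-cell by placing it to the left of the whole path, with
  identity 2-cells inside the modules. The left action law then holds by construction, and
  \<open>tmods_slide\<close> shows that the right end would have served equally.\<close>

definition tmcell :: "('o, 'f, 'o, 't, 'x, 'a, 'p, 'c) lax_fun \<Rightarrow> ('o, 'f, 'o, 't, 'x, 'a, 'p, 'c) bimod list \<Rightarrow> 't \<Rightarrow> ('x \<times> 'p list) \<times> ('x \<times> 'p list) \<times> 'c" where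
  "tmcell F Ms s = fcell F s \<^bold>\<star> tmods F Ms (ctgt D s)"

lemma tmcell_simps:
  assumes "mpath F Ms G" "s \<in> Cells D"
  shows "tmcell F Ms s \<in> Cells S" "csrc S (tmcell F Ms s) = onArr F (csrc D s)" "ctgt S (tmcell F Ms s) = onArr G (ctgt D s)"
    "Dom (D1 S) (tmcell F Ms s) = (onOb F (Dom (D1 D) s), mvals Ms (Dom (D1 D) s))"
    "Cod (D1 S) (tmcell F Ms s) = (onOb F (Cod (D1 D) s), mvals Ms (Cod (D1 D) s))"
  using tmods_simps[OF assms(1), of "ctgt D s"] mpath_uobj[OF assms(1)] assms(2) by (simp_all add: tmcell_def)

lemma tmcell_idc:
  assumes "mpath F Ms G" "f \<in> Arrs D" shows "tmcell F Ms (idc D f) = tmods F Ms f"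
  using tmods_simps[OF assms] mpath_uobj[OF assms(1)] assms(2) by (simp add: tmcell_def fcell_idc)

definition cmod where
  "cmod F Ms G = mk_mod F G (\<lambda>x. odots E (onOb F x) (mvals Ms x)) (\<lambda>s. ucell (tmcell F Ms s))"

text \<open>Functoriality is interchange between the 2-cell and the identity part. Compatibility
  with the left action is associativity of the strict composite, and compatibility with the right
  action is \<open>tmods_slide\<close>.\<close>

lemma cmod_umod:
  assumes m: "mpath F Ms G"
  shows "umod (cmod F Ms G)"
  unfolding cmod_def
proof (rule mk_mod_umod)
  note u = mpath_uobj[OF m]
  show F: "uobj F" and G: "uobj G" using u by simp_all
  show "odots E (onOb F x) (mvals Ms x) \<in> Pros E \<and> psrc E (odots E (onOb F x) (mvals Ms x)) = onOb F x \<and>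
      ptgt E (odots E (onOb F x) (mvals Ms x)) = onOb G x" if "x \<in> Objs D" for x
    using E.odots_closed[OF mpath_ppath[OF m that]] .
  show "ucell (tmcell F Ms s) \<in> Cells E \<and> Dom (D1 E) (ucell (tmcell F Ms s)) = odots E (onOb F (Dom (D1 D) s)) (mvals Ms (Dom (D1 D) s)) \<and>
      Cod (D1 E) (ucell (tmcell F Ms s)) = odots E (onOb F (Cod (D1 D) s)) (mvals Ms (Cod (D1 D) s)) \<and>
      csrc E (ucell (tmcell F Ms s)) = onArr F (csrc D s) \<and> ctgt E (ucell (tmcell F Ms s)) = onArr G (ctgt D s)"
    if "s \<in> Cells D" for s
    using ucell_closed[OF tmcell_simps(1)[OF m that]] tmcell_simps[OF m that] by simp
  show "ucell (tmcell F Ms (s \<bullet>\<^bsub>D\<^esub> t)) = ucell (tmcell F Ms s) \<bullet>\<^bsub>E\<^esub> ucell (tmcell F Ms t)"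
    if st: "s \<in> Cells D" "t \<in> Cells D" "Cod (D1 D) s = Dom (D1 D) t" for s t
  proof -
    have fg: "ctgt D s \<in> Arrs D" "ctgt D t \<in> Arrs D" "Cod (D0 D) (ctgt D s) = Dom (D0 D) (ctgt D t)" using st by simp_all
    have "tmcell F Ms (s \<bullet>\<^bsub>D\<^esub> t) = (fcell F s \<^bold>\<cdot> fcell F t) \<^bold>\<star> (tmods F Ms (ctgt D s) \<^bold>\<cdot> tmods F Ms (ctgt D t))"
      unfolding tmcell_def using st F fcell_cmp[OF F st] tmods_cmp[OF m fg] D.ctgt_comp[OF st] by simp
    also have "\<dots> = tmcell F Ms s \<^bold>\<cdot> tmcell F Ms t"
      unfolding tmcell_def by (rule S.interchange) (use st F tmods_simps[OF m fg(1)] tmods_simps[OF m fg(2)] in simp_all)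
    finally show ?thesis by (simp add: ucell_S)
  qed
  show "ucell (tmcell F Ms (idcell D x)) = idcell E (odots E (onOb F x) (mvals Ms x))" if x: "x \<in> Objs D" for x
  proof -
    have "tmcell F Ms (idc D (ide (D0 D) x)) = idcell S (onOb F x, mvals Ms x)"
      using tmcell_idc[OF m, of "ide (D0 D) x"] tmods_ide[OF m x] x by simp
    then show ?thesis using x by (simp add: ucell_S)
  qed
  fix s t assume st: "s \<in> Cells D" "t \<in> Cells D" "ctgt D s = csrc D t"
  note fr = D_star_frames[OF st]
  have g: "ctgt D s \<in> Arrs D" "ctgt D t \<in> Arrs D" using st by simp_all
  have 0: "s \<star>\<^bsub>D\<^esub> t \<in> Cells D" "ctgt D (s \<star>\<^bsub>D\<^esub> t) = ctgt D t" using D.star_closed[OF st] by simp_all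
  note tm = tmods_simps[OF m g(1)] tmods_simps[OF m g(2)]
  note tc = tmcell_simps[OF m st(1)] tmcell_simps[OF m st(2)] tmcell_simps[OF m 0(1)]
  have 1: "tmcell F Ms (s \<star>\<^bsub>D\<^esub> t) = fcell F s \<^bold>\<star> tmcell F Ms t"
    unfolding tmcell_def using st F 0 tm fcell_star[OF F st] by simp
  have 2: "tmcell F Ms (s \<star>\<^bsub>D\<^esub> t) = tmcell F Ms s \<^bold>\<star> fcell G t"
  proof -
    have "tmcell F Ms s \<^bold>\<star> fcell G t = fcell F s \<^bold>\<star> (tmods F Ms (csrc D t) \<^bold>\<star> fcell G t)"
      unfolding tmcell_def using st F G tm by simp
    also have "\<dots> = fcell F s \<^bold>\<star> tmcell F Ms t"
      unfolding tmods_slide[OF m st(2)] tmcell_def ..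
    also have "\<dots> = tmcell F Ms (s \<star>\<^bsub>D\<^esub> t)" by (simp only: 1)
    finally show ?thesis by simp
  qed
  note uc = ucell_closed[OF tc(1)] ucell_closed[OF tc(6)]
  have P: "odots E (onOb F x) (mvals Ms x) \<in> Pros E" "psrc E (odots E (onOb F x) (mvals Ms x)) = onOb F x"
    "ptgt E (odots E (onOb F x) (mvals Ms x)) = onOb G x" if "x \<in> Objs D" for x
    using E.odots_closed[OF mpath_ppath[OF m that]] by simp_all
  have "ucell (fcell F s \<^bold>\<star> tmcell F Ms t) = lun_inv E (odots E (onOb F (Dom (D1 D) t)) (mvals Ms (Dom (D1 D) t))) \<bullet>\<^bsub>E\<^esub>
      (onCell F s \<star>\<^bsub>E\<^esub> ucell (tmcell F Ms t)) \<bullet>\<^bsub>E\<^esub> lun E (odots E (onOb F (Cod (D1 D) t)) (mvals Ms (Cod (D1 D) t)))"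
    by (subst ucell_star_Nil') (use F st tc in simp_all)
  then show "(onCell F s \<star>\<^bsub>E\<^esub> ucell (tmcell F Ms t)) \<bullet>\<^bsub>E\<^esub> lun E (odots E (onOb F (Cod (D1 D) s)) (mvals Ms (Cod (D1 D) s))) =
      lun E (odots E (onOb F (Dom (D1 D) s)) (mvals Ms (Dom (D1 D) s))) \<bullet>\<^bsub>E\<^esub> ucell (tmcell F Ms (s \<star>\<^bsub>D\<^esub> t))"
    unfolding 1 using F st tc uc P fr by (simp add: E.D1.cmp_inverse_cancel)
  have "ucell (tmcell F Ms s \<^bold>\<star> fcell G t) = run_inv E (odots E (onOb F (Dom (D1 D) s)) (mvals Ms (Dom (D1 D) s))) \<bullet>\<^bsub>E\<^esub>
      (ucell (tmcell F Ms s) \<star>\<^bsub>E\<^esub> onCell G t) \<bullet>\<^bsub>E\<^esub> run E (odots E (onOb F (Cod (D1 D) s)) (mvals Ms (Cod (D1 D) s)))"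
    by (subst ucell_star_Nil_right') (use G st tc in simp_all)
  then show "(ucell (tmcell F Ms s) \<star>\<^bsub>E\<^esub> onCell G t) \<bullet>\<^bsub>E\<^esub> run E (odots E (onOb F (Cod (D1 D) s)) (mvals Ms (Cod (D1 D) s))) =
      run E (odots E (onOb F (Dom (D1 D) s)) (mvals Ms (Dom (D1 D) s))) \<bullet>\<^bsub>E\<^esub> ucell (tmcell F Ms (s \<star>\<^bsub>D\<^esub> t))"
    unfolding 2 using G st tc uc P fr by (simp add: E.D1.cmp_inverse_cancel)
qed

lemma cmod_simps [simp]:
  assumes "mpath F Ms G"
  shows "msrc D (cmod F Ms G) = F" "mtgt D (cmod F Ms G) = G" "umod (cmod F Ms G)"
    "x \<in> Objs D \<Longrightarrow> mpro (cmod F Ms G) x = odots E (onOb F x) (mvals Ms x)"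
    "f \<in> Arrs D \<Longrightarrow> mcell (cmod F Ms G) (idc D f) = ucell (tmods F Ms f)"
  using mod_at_mk_mod[of F G] mpath_uobj[OF assms] cmod_umod[OF assms] tmcell_idc[OF assms]
  by (simp_all add: cmod_def)

section \<open>The comparison of a path with its composite, and the universal multicell built from
  it\<close>

definition jcell :: "'x \<Rightarrow> 'p list \<Rightarrow> ('x \<times> 'p list) \<times> ('x \<times> 'p list) \<times> 'c" where
  "jcell x ps = ((x, ps), (x, [odots E x ps]), idcell E (odots E x ps))"

definition jinv :: "'x \<Rightarrow> 'p list \<Rightarrow> ('x \<times> 'p list) \<times> ('x \<times> 'p list) \<times> 'c" where
  "jinv x ps = ((x, [odots E x ps]), (x, ps), idcell E (odots E x ps))"

lemma jcell_simps:
  assumes "ppath E x ps y"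
  shows "jcell x ps \<in> Cells S" "csrc S (jcell x ps) = ide (D0 E) x" "ctgt S (jcell x ps) = ide (D0 E) y"
    "Dom (D1 S) (jcell x ps) = (x, ps)" "Cod (D1 S) (jcell x ps) = (x, [odots E x ps])"
    "jinv x ps \<in> Cells S" "csrc S (jinv x ps) = ide (D0 E) x" "ctgt S (jinv x ps) = ide (D0 E) y"
    "Cod (D1 S) (jinv x ps) = (x, ps)" "Dom (D1 S) (jinv x ps) = (x, [odots E x ps])"
    "jcell x ps \<^bold>\<cdot> jinv x ps = idcell S (x, ps)" "jinv x ps \<^bold>\<cdot> jcell x ps = idcell S (x, [odots E x ps])"
proof -
  note o = E.odots_closed[OF assms] and p = E.paths_ppath[OF assms]
  show 1: "jcell x ps \<in> Cells S" "csrc S (jcell x ps) = ide (D0 E) x" "ctgt S (jcell x ps) = ide (D0 E) y"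
    "Dom (D1 S) (jcell x ps) = (x, ps)" "Cod (D1 S) (jcell x ps) = (x, [odots E x ps])"
    "jinv x ps \<in> Cells S" "csrc S (jinv x ps) = ide (D0 E) x" "ctgt S (jinv x ps) = ide (D0 E) y"
    "Cod (D1 S) (jinv x ps) = (x, ps)" "Dom (D1 S) (jinv x ps) = (x, [odots E x ps])"
    using o p by (simp_all add: jcell_def jinv_def)
  have u: "ucell (jcell x ps) = idcell E (odots E x ps)" "ucell (jinv x ps) = idcell E (odots E x ps)"
    by (simp_all add: jcell_def jinv_def)
  show "jcell x ps \<^bold>\<cdot> jinv x ps = idcell S (x, ps)" "jinv x ps \<^bold>\<cdot> jcell x ps = idcell S (x, [odots E x ps])"
    by (rule S_eqI; use o p 1 u in \<open>simp add: ucell_S\<close>)+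
qed

text \<open>The composite module was given the underlying cell of \<open>tmods\<close> as its value,
  and the comparison cells have identities underneath. Both equations thus compare a cell with
  itself, read between different paths.\<close>

lemma jcell_tmods:
  assumes m: "mpath F Ms G" and f: "f \<in> Arrs D"
  defines "j \<equiv> \<lambda>x. jcell (onOb F x) (mvals Ms x)" and "j' \<equiv> \<lambda>x. jinv (onOb F x) (mvals Ms x)"
  shows "tmods F Ms f \<^bold>\<cdot> j (Cod (D0 D) f) = j (Dom (D0 D) f) \<^bold>\<cdot> mdcell (cmod F Ms G) (idc D f)"
    "mdcell (cmod F Ms G) (idc D f) \<^bold>\<cdot> j' (Cod (D0 D) f) = j' (Dom (D0 D) f) \<^bold>\<cdot> tmods F Ms f"
proof -
  let ?x = "Dom (D0 D) f" and ?y = "Cod (D0 D) f"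
  have xy: "?x \<in> Objs D" "?y \<in> Objs D" using f by simp_all
  note jx = jcell_simps[OF mpath_ppath[OF m xy(1)]] and jy = jcell_simps[OF mpath_ppath[OF m xy(2)]]
  note t = tmods_simps[OF m f] and uc = ucell_closed[OF tmods_simps(1)[OF m f]]
  have u: "ucell (jcell x ps) = idcell E (odots E x ps)" "ucell (jinv x ps) = idcell E (odots E x ps)" for x ps
    by (simp_all add: jcell_def jinv_def)
  show "tmods F Ms f \<^bold>\<cdot> j ?y = j ?x \<^bold>\<cdot> mdcell (cmod F Ms G) (idc D f)"
    unfolding j_def by (rule S_eqI) (use m f xy jx jy t uc in \<open>simp_all add: ucell_S u\<close>)
  show "mdcell (cmod F Ms G) (idc D f) \<^bold>\<cdot> j' ?y = j' ?x \<^bold>\<cdot> tmods F Ms f"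
    unfolding j'_def by (rule S_eqI) (use m f xy jx jy t uc in \<open>simp_all add: ucell_S u\<close>)
qed

definition cmult where
  "cmult F Ms G = \<lparr> mmin = Ms, mmout = cmod F Ms G, mml = id_trans D E F, mmr = id_trans D E G,
     mmc = (\<lambda>(x, ms)\<in>paths_of_length D (length Ms). idcell E (odots E (onOb F x) (mvals Ms x))) \<rparr>"

lemma cmult_sel [simp]: "mmin (cmult F Ms G) = Ms" "mmout (cmult F Ms G) = cmod F Ms G"
  "mml (cmult F Ms G) = id_trans D E F" "mmr (cmult F Ms G) = id_trans D E G"
  by (simp_all add: cmult_def)

lemma mucell_cmult:
  assumes "mpath F Ms G" "x \<in> Objs D"
  shows "mucell (cmult F Ms G) x = jcell (onOb F x) (mvals Ms x)"
proof -
  have "mmc (cmult F Ms G) (x, replicate (length Ms) x) = idcell E (odots E (onOb F x) (mvals Ms x))"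
    using assms by (simp add: cmult_def paths_of_length_D)
  then show ?thesis using assms by (simp add: mucell_def jcell_def)
qed

lemma cmult_ummod:
  assumes m: "mpath F Ms G"
  shows "ummod (cmult F Ms G)"
  unfolding ummod_def
proof (intro conjI ballI)
  note u = mpath_uobj[OF m]
  show "utrans (mml (cmult F Ms G))" "utrans (mmr (cmult F Ms G))" "umod (mmout (cmult F Ms G))"
    "tcod (mml (cmult F Ms G)) = msrc D (mmout (cmult F Ms G))" "tcod (mmr (cmult F Ms G)) = mtgt D (mmout (cmult F Ms G))"
    "mpath (tdom (mml (cmult F Ms G))) (mmin (cmult F Ms G)) (tdom (mmr (cmult F Ms G)))"
    using m u by (simp_all add: utrans_id)
  show "mmc (cmult F Ms G) \<in> extensional (paths_of_length D (length (mmin (cmult F Ms G))))"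
    by (simp add: cmult_def)
  fix x assume x: "x \<in> Objs D"
  show "mucell (cmult F Ms G) x \<in> Cells S" "csrc S (mucell (cmult F Ms G) x) = atOb (mml (cmult F Ms G)) x"
    "ctgt S (mucell (cmult F Ms G) x) = atOb (mmr (cmult F Ms G)) x"
    unfolding mucell_cmult[OF m x] using jcell_simps[OF mpath_ppath[OF m x]] x by simp_all
next
  fix f assume f: "f \<in> Arrs D"
  note u = mpath_uobj[OF m]
  have xy: "Dom (D0 D) f \<in> Objs D" "Cod (D0 D) f \<in> Objs D" using f by simp_all
  note t = tmods_simps[OF m f] jcell_simps[OF mpath_ppath[OF m xy(1)]] jcell_simps[OF mpath_ppath[OF m xy(2)]]
  show "tcell (mml (cmult F Ms G)) f \<^bold>\<star> (stars S (onArr (tdom (mml (cmult F Ms G))) f) (mdids (mmin (cmult F Ms G)) f) \<^bold>\<cdot>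
        mucell (cmult F Ms G) (Cod (D0 D) f)) =
      (mucell (cmult F Ms G) (Dom (D0 D) f) \<^bold>\<cdot> mdcell (mmout (cmult F Ms G)) (idc D f)) \<^bold>\<star> tcell (mmr (cmult F Ms G)) f"
    unfolding mucell_cmult[OF m xy(1)] mucell_cmult[OF m xy(2)] cmult_sel tdom_tcod_simps tmods_def[symmetric]
      jcell_tmods(1)[OF m f, symmetric]
    using t u f by (simp add: tcell_id)
qed

text \<open>The inverse of the whiskered isomorphism yields the factorization.\<close>

lemma cmult_factor:
  assumes q: "mpath Z qs F" and p: "mpath F ps G" and r: "mpath G rs H"
    and \<mu>: "ummod \<mu>" "mmin \<mu> = qs @ ps @ rs" "tdom (mml \<mu>) = Z"
  shows "\<exists>!\<nu>. ummod \<nu> \<and> mmin \<nu> = qs @ [cmod F ps G] @ rs \<and> mmout \<nu> = mmout \<mu> \<and> mml \<nu> = mml \<mu> \<and> mmr \<nu> = mmr \<mu> \<and>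
    comp_multimod D E (id_trans D E Z) (map (id_multimod D E) qs @ [cmult F ps G] @ map (id_multimod D E) rs) \<nu> = \<mu>"
proof -
  let ?C = "cmod F ps G" and ?c = "cmult F ps G"
  let ?\<mu>s = "map (id_multimod D E) qs @ [?c] @ map (id_multimod D E) rs"
  let ?Q = "\<lambda>x. idcell S (onOb Z x, mvals qs x)" and ?R = "\<lambda>x. idcell S (onOb G x, mvals rs x)"
  let ?j = "\<lambda>x. jcell (onOb F x) (mvals ps x)" and ?j' = "\<lambda>x. jinv (onOb F x) (mvals ps x)"
  \<comment> \<open>\<open>K\<close> is the comparison for \<open>ps\<close>, whiskered by the
    identities of the surrounding paths; \<open>K'\<close> is its inverse. Composing a multicell
    with the composite multicell and identities amounts to prefixing \<open>K\<close>.\<close>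
  define K where "K x = ?Q x \<^bold>\<star> (?j x \<^bold>\<star> ?R x)" for x
  define K' where "K' x = ?Q x \<^bold>\<star> (?j' x \<^bold>\<star> ?R x)" for x
  have u: "uobj Z" "uobj F" "uobj G" "uobj H" using mpath_uobj[OF q] mpath_uobj[OF r] by simp_all
  note d = ummodD[OF \<mu>(1)]
  have mp: "mpath Z (qs @ ps @ rs) H" using q p r by (auto simp: mpath_append)
  have H: "tdom (mmr \<mu>) = H" using mpath_unique[OF _ mp] d(6) \<mu>(2,3) by simp
  have mpC: "mpath Z (qs @ [?C] @ rs) H" using q p r u by (auto simp: mpath_append)
  have ob: "onOb Z x \<in> Objs E" "onOb F x \<in> Objs E" "onOb G x \<in> Objs E" "onOb H x \<in> Objs E" if "x \<in> Objs D" for x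
    using u that by simp_all
  have Kt: "K x \<in> Cells S" "csrc S (K x) = ide (D0 E) (onOb Z x)" "ctgt S (K x) = ide (D0 E) (onOb H x)"
    "Dom (D1 S) (K x) = (onOb Z x, mvals (qs @ ps @ rs) x)" "Cod (D1 S) (K x) = (onOb Z x, mvals (qs @ [?C] @ rs) x)"
    "K' x \<in> Cells S" "csrc S (K' x) = ide (D0 E) (onOb Z x)" "ctgt S (K' x) = ide (D0 E) (onOb H x)"
    "Cod (D1 S) (K' x) = (onOb Z x, mvals (qs @ ps @ rs) x)" "Dom (D1 S) (K' x) = (onOb Z x, mvals (qs @ [?C] @ rs) x)"
    "K x \<^bold>\<cdot> K' x = idcell S (onOb Z x, mvals (qs @ ps @ rs) x)" "K' x \<^bold>\<cdot> K x = idcell S (onOb Z x, mvals (qs @ [?C] @ rs) x)"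
    if x: "x \<in> Objs D" for x
  proof -
    note j = jcell_simps[OF mpath_ppath[OF p x]]
    note t = j mpath_paths[OF q x] mpath_paths[OF p x] mpath_paths[OF r x] ob[OF x]
    have pC: "mpro ?C x = odots E (onOb F x) (mvals ps x)" using p x by simp
    show "K x \<in> Cells S" "csrc S (K x) = ide (D0 E) (onOb Z x)" "ctgt S (K x) = ide (D0 E) (onOb H x)"
      "Dom (D1 S) (K x) = (onOb Z x, mvals (qs @ ps @ rs) x)" "Cod (D1 S) (K x) = (onOb Z x, mvals (qs @ [?C] @ rs) x)"
      "K' x \<in> Cells S" "csrc S (K' x) = ide (D0 E) (onOb Z x)" "ctgt S (K' x) = ide (D0 E) (onOb H x)"
      "Cod (D1 S) (K' x) = (onOb Z x, mvals (qs @ ps @ rs) x)" "Dom (D1 S) (K' x) = (onOb Z x, mvals (qs @ [?C] @ rs) x)"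
      unfolding K_def K'_def by (simp_all add: t pC)
    have pp: "(onOb F x, mvals ps x @ mvals rs x) \<in> paths E" "(onOb F x, odots E (onOb F x) (mvals ps x) # mvals rs x) \<in> paths E"
      using E.paths_append(1)[OF mpath_paths(1)[OF p x] mpath_paths(1)[OF r x]] mpath_paths(2)[OF p x]
        E.paths_append(1)[of "(onOb F x, [odots E (onOb F x) (mvals ps x)])" "(onOb G x, mvals rs x)"] mpath_paths(1)[OF r x]
        E.odots_closed[OF mpath_ppath[OF p x]] by simp_all
    have "K x \<^bold>\<cdot> K' x = (?Q x \<^bold>\<cdot> ?Q x) \<^bold>\<star> ((?j x \<^bold>\<star> ?R x) \<^bold>\<cdot> (?j' x \<^bold>\<star> ?R x))"
      unfolding K_def K'_def by (rule S.interchange[symmetric]) (simp_all add: t)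
    also have "(?j x \<^bold>\<star> ?R x) \<^bold>\<cdot> (?j' x \<^bold>\<star> ?R x) = (?j x \<^bold>\<cdot> ?j' x) \<^bold>\<star> (?R x \<^bold>\<cdot> ?R x)"
      by (rule S.interchange[symmetric]) (simp_all add: t)
    also have "\<dots> = idcell S (onOb F x, mvals ps x @ mvals rs x)"
      using S.star_id[of "(onOb F x, mvals ps x)" "(onOb G x, mvals rs x)"] S.D1.ide_cmp'[of "?R x" "(onOb G x, mvals rs x)"] by (simp add: t)
    also have "(?Q x \<^bold>\<cdot> ?Q x) \<^bold>\<star> \<dots> = idcell S (onOb Z x, mvals (qs @ ps @ rs) x)"
      using S.star_id[of "(onOb Z x, mvals qs x)" "(onOb F x, mvals ps x @ mvals rs x)"] S.D1.ide_cmp'[of "?Q x" "(onOb Z x, mvals qs x)"]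
      by (simp add: t pp)
    finally show "K x \<^bold>\<cdot> K' x = idcell S (onOb Z x, mvals (qs @ ps @ rs) x)" .
    have "K' x \<^bold>\<cdot> K x = (?Q x \<^bold>\<cdot> ?Q x) \<^bold>\<star> ((?j' x \<^bold>\<star> ?R x) \<^bold>\<cdot> (?j x \<^bold>\<star> ?R x))"
      unfolding K_def K'_def by (rule S.interchange[symmetric]) (simp_all add: t)
    also have "(?j' x \<^bold>\<star> ?R x) \<^bold>\<cdot> (?j x \<^bold>\<star> ?R x) = (?j' x \<^bold>\<cdot> ?j x) \<^bold>\<star> (?R x \<^bold>\<cdot> ?R x)"
      by (rule S.interchange[symmetric]) (simp_all add: t)
    also have "\<dots> = idcell S (onOb F x, odots E (onOb F x) (mvals ps x) # mvals rs x)"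
      using S.star_id[of "(onOb F x, [odots E (onOb F x) (mvals ps x)])" "(onOb G x, mvals rs x)"] S.D1.ide_cmp'[of "?R x" "(onOb G x, mvals rs x)"]
        E.odots_closed[OF mpath_ppath[OF p x]] by (simp add: t)
    also have "(?Q x \<^bold>\<cdot> ?Q x) \<^bold>\<star> \<dots> = idcell S (onOb Z x, mvals (qs @ [?C] @ rs) x)"
      using S.star_id[of "(onOb Z x, mvals qs x)" "(onOb F x, odots E (onOb F x) (mvals ps x) # mvals rs x)"] S.D1.ide_cmp'[of "?Q x" "(onOb Z x, mvals qs x)"]
      by (simp add: t pp pC)
    finally show "K' x \<^bold>\<cdot> K x = idcell S (onOb Z x, mvals (qs @ [?C] @ rs) x)" .
  qed
  note iq = ids_mchain[OF q] and ir = ids_mchain[OF r]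
  have ch: "mchain (id_trans D E Z) ?\<mu>s (id_trans D E H)"
    using iq(1) ir(1) cmult_ummod[OF p] by (auto simp: mchain_append)
  have min: "concat (map mmin ?\<mu>s) = qs @ ps @ rs" and mout: "map mmout ?\<mu>s = qs @ [?C] @ rs"
    using iq ir by simp_all
  have st: "stars S (ide (D0 E) (onOb Z x)) (mus ?\<mu>s x) = K x" if x: "x \<in> Objs D" for x
  proof -
    have c1: "cpath S (ide (D0 E) (onOb Z x)) (mus (map (id_multimod D E) qs) x) (ide (D0 E) (onOb F x))"
      using mus_cpath[OF iq(1) x] x by simp
    have c2: "cpath S (ide (D0 E) (onOb G x)) (mus (map (id_multimod D E) rs) x) (ide (D0 E) (onOb H x))"
      using mus_cpath[OF ir(1) x] x by simp
    note j = jcell_simps[OF mpath_ppath[OF p x]]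
    have c3: "cpath S (ide (D0 E) (onOb F x)) (mucell ?c x # mus (map (id_multimod D E) rs) x) (ide (D0 E) (onOb H x))"
      using c2 j mucell_cmult[OF p x] by simp
    show ?thesis
      using S.stars_append[OF c1 c3] S.stars_Cons[OF c3] stars_mus_ids[OF q x] stars_mus_ids[OF r x] mucell_cmult[OF p x] j
      by (simp add: K_def)
  qed
  have cnd: "tcod (id_trans D E Z) = tdom (mml \<nu>)" if "mml \<nu> = mml \<mu>" for \<nu> :: "('o, 'f, 'o, 't, 'x, 'a, 'p, 'c) multimod"
    using that \<mu>(3) by simp
  have cc: "mucell (comp_multimod D E (id_trans D E Z) ?\<mu>s \<nu>) x = K x \<^bold>\<cdot> mucell \<nu> x"
    if "ummod \<nu>" "mmin \<nu> = qs @ [?C] @ rs" "mml \<nu> = mml \<mu>" "x \<in> Objs D" for \<nu> x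
    using mucell_comp[OF ch that(1) _ cnd[OF that(3)] that(4)] mout that(2) st[OF that(4)] that(4) by simp
  \<comment> \<open>Because composing with the universal multicell prefixes \<open>K\<close>, the
    components of a factorization can only be those of \<mu> preceded by the inverse
    \<open>K'\<close>.\<close>
  define \<nu> where "\<nu> = \<lparr> mmin = qs @ [?C] @ rs, mmout = mmout \<mu>, mml = mml \<mu>, mmr = mmr \<mu>,
     mmc = (\<lambda>(x, ms)\<in>paths_of_length D (length (qs @ [?C] @ rs)). ucell (K' x \<^bold>\<cdot> mucell \<mu> x)) \<rparr>"
  have \<nu>s: "mmin \<nu> = qs @ [?C] @ rs" "mmout \<nu> = mmout \<mu>" "mml \<nu> = mml \<mu>" "mmr \<nu> = mmr \<mu>" by (simp_all add: \<nu>_def)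
  have m\<mu>: "Dom (D1 S) (mucell \<mu> x) = (onOb Z x, mvals (qs @ ps @ rs) x)" for x by (simp add: \<mu>(2,3))
  have \<nu>c: "mucell \<nu> x = K' x \<^bold>\<cdot> mucell \<mu> x" if x: "x \<in> Objs D" for x
  proof (rule S_eqI)
    have "mmc \<nu> (x, replicate (length (qs @ [?C] @ rs)) x) = ucell (K' x \<^bold>\<cdot> mucell \<mu> x)"
      unfolding \<nu>_def using x by (simp add: paths_of_length_D del: length_append)
    then show "ucell (mucell \<nu> x) = ucell (K' x \<^bold>\<cdot> mucell \<mu> x)" unfolding mucell_sel \<nu>s(1) .
  qed (use Kt[OF x] d(7)[OF x] m\<mu> in \<open>simp_all add: \<nu>s \<mu>(3)\<close>)
  have \<nu>: "ummod \<nu>"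
    unfolding ummod_def \<nu>s
  proof (intro conjI ballI)
    show "utrans (mml \<mu>)" "utrans (mmr \<mu>)" "umod (mmout \<mu>)" "tcod (mml \<mu>) = msrc D (mmout \<mu>)" "tcod (mmr \<mu>) = mtgt D (mmout \<mu>)"
      by (fact d)+
    show "mpath (tdom (mml \<mu>)) (qs @ [?C] @ rs) (tdom (mmr \<mu>))" using mpC H \<mu>(3) by simp
    show "mmc \<nu> \<in> extensional (paths_of_length D (length (qs @ [?C] @ rs)))" by (simp add: \<nu>_def)
  next
    fix x assume x: "x \<in> Objs D"
    show "mucell \<nu> x \<in> Cells S" "csrc S (mucell \<nu> x) = atOb (mml \<mu>) x" "ctgt S (mucell \<nu> x) = atOb (mmr \<mu>) x"
      unfolding \<nu>c[OF x] using Kt[OF x] d(7-9)[OF x] m\<mu> utrans_ob[OF d(1) x] utrans_ob[OF d(2) x] \<mu>(3) H by simp_all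
  next
    fix f assume f: "f \<in> Arrs D"
    let ?x = "Dom (D0 D) f" and ?y = "Cod (D0 D) f"
    have xy: "?x \<in> Objs D" "?y \<in> Objs D" using f by simp_all
    define T where "T = tmods Z (qs @ ps @ rs) f"
    define TC where "TC = tmods Z (qs @ [?C] @ rs) f"
    define N where "N = mdcell (mmout \<mu>) (idc D f)"
    note Tt = tmods_simps[OF mp f, folded T_def] tmods_simps[OF mpC f, folded TC_def]
    have prC: "mpath F [?C] G" using p u by simp
    \<comment> \<open>Naturality of \<open>K'\<close> in the arrow \<open>f\<close>: the whiskering
      identities commute with the surrounding module cells, and in the middle
      \<open>jcell_tmods\<close> applies.\<close>
    have TK: "TC \<^bold>\<cdot> K' ?y = K' ?x \<^bold>\<cdot> T"
    proof -
      let ?q = "tmods Z qs f" and ?r = "tmods G rs f" and ?p = "tmods F ps f" and ?c = "mdcell ?C (idc D f)"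
      note a = tmods_simps[OF q f] tmods_simps[OF r f] tmods_simps[OF p f]
      note j = jcell_simps[OF mpath_ppath[OF p xy(1)]] jcell_simps[OF mpath_ppath[OF p xy(2)]]
      note pth = mpath_paths[OF q xy(1)] mpath_paths[OF p xy(1)] mpath_paths[OF r xy(1)]
         mpath_paths[OF q xy(2)] mpath_paths[OF p xy(2)] mpath_paths[OF r xy(2)] ob[OF xy(1)] ob[OF xy(2)]
      have Cc: "?c \<in> Cells S" "csrc S ?c = onArr F f" "ctgt S ?c = onArr G f" "Dom (D1 S) ?c = (onOb F ?x, [odots E (onOb F ?x) (mvals ps ?x)])"
        "Cod (D1 S) ?c = (onOb F ?y, [odots E (onOb F ?y) (mvals ps ?y)])"
        using p f by simp_all
      have rC: "mpath F ([?C] @ rs) H" "mpath F (ps @ rs) H" using p r u by (auto simp: mpath_append)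
      have TC: "TC = ?q \<^bold>\<star> (?c \<^bold>\<star> ?r)"
        unfolding TC_def tmods_append[OF q rC(1) f] using tmods_Cons[of F ?C rs H f] rC(1) f p by simp
      have T: "T = ?q \<^bold>\<star> (?p \<^bold>\<star> ?r)"
        unfolding T_def tmods_append[OF q rC(2) f] tmods_append[OF p r f] ..
      have i1: "?q \<^bold>\<cdot> ?Q ?y = ?q" "?Q ?x \<^bold>\<cdot> ?q = ?q" "?r \<^bold>\<cdot> ?R ?y = ?r" "?R ?x \<^bold>\<cdot> ?r = ?r"
        by (rule S.D1.cmp_ide' S.D1.ide_cmp'; simp add: a)+
      have "TC \<^bold>\<cdot> K' ?y = (?q \<^bold>\<cdot> ?Q ?y) \<^bold>\<star> ((?c \<^bold>\<star> ?r) \<^bold>\<cdot> (?j' ?y \<^bold>\<star> ?R ?y))"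
        unfolding TC K'_def by (rule S.interchange[symmetric]) (simp_all add: a j Cc pth u f)
      also have "(?c \<^bold>\<star> ?r) \<^bold>\<cdot> (?j' ?y \<^bold>\<star> ?R ?y) = (?c \<^bold>\<cdot> ?j' ?y) \<^bold>\<star> (?r \<^bold>\<cdot> ?R ?y)"
        by (rule S.interchange[symmetric]) (simp_all add: a j Cc pth u f)
      also have "\<dots> = (?j' ?x \<^bold>\<cdot> ?p) \<^bold>\<star> (?R ?x \<^bold>\<cdot> ?r)"
        unfolding i1 jcell_tmods(2)[OF p f] ..
      also have "\<dots> = (?j' ?x \<^bold>\<star> ?R ?x) \<^bold>\<cdot> (?p \<^bold>\<star> ?r)"
        by (rule S.interchange) (simp_all add: a j Cc pth u f)
      also have "(?q \<^bold>\<cdot> ?Q ?y) \<^bold>\<star> \<dots> = (?Q ?x \<^bold>\<cdot> ?q) \<^bold>\<star> \<dots>" unfolding i1 ..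
      also have "\<dots> = K' ?x \<^bold>\<cdot> T"
        unfolding T K'_def by (rule S.interchange) (simp_all add: a j Cc pth u f)
      finally show ?thesis .
    qed
    have nat: "tcell (mml \<mu>) f \<^bold>\<star> (T \<^bold>\<cdot> mucell \<mu> ?y) = (mucell \<mu> ?x \<^bold>\<cdot> N) \<^bold>\<star> tcell (mmr \<mu>) f"
      using d(10)[OF f] by (simp add: T_def N_def tmods_def \<mu>(2,3))
    \<comment> \<open>Identities on empty paths stand beside \<open>K'\<close> and before the
      transformation components. With them, interchange can carry \<open>K'\<close> past the
      components at either boundary.\<close>
    let ?Z = "idcell S (onOb Z ?x, [])" and ?H = "idcell S (onOb H ?x, [])"
    have pth: "(onOb Z ?x, []) \<in> paths E" "(onOb H ?x, []) \<in> paths E" using ob[OF xy(1)] by simp_all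
    have tl: "tcell (mml \<mu>) f \<in> Cells S" "csrc S (tcell (mml \<mu>) f) = atOb (mml \<mu>) ?x \<cdot>\<^bsub>D0 E\<^esub> onArr (tcod (mml \<mu>)) f"
      "ctgt S (tcell (mml \<mu>) f) = onArr Z f \<cdot>\<^bsub>D0 E\<^esub> atOb (mml \<mu>) ?y"
      "Dom (D1 S) (tcell (mml \<mu>) f) = (onOb Z ?x, [])"
      using tcell_closed[OF d(1) f] \<mu>(3) by simp_all
    have tr: "tcell (mmr \<mu>) f \<in> Cells S" "csrc S (tcell (mmr \<mu>) f) = atOb (mmr \<mu>) ?x \<cdot>\<^bsub>D0 E\<^esub> onArr (tcod (mmr \<mu>)) f"
      "ctgt S (tcell (mmr \<mu>) f) = onArr H f \<cdot>\<^bsub>D0 E\<^esub> atOb (mmr \<mu>) ?y"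
      "Dom (D1 S) (tcell (mmr \<mu>) f) = (onOb H ?x, [])"
      using tcell_closed[OF d(2) f] H by simp_all
    have Nt: "N \<in> Cells S" "csrc S N = onArr (msrc D (mmout \<mu>)) f" "ctgt S N = onArr (mtgt D (mmout \<mu>)) f"
      "Dom (D1 S) N = (onOb (msrc D (mmout \<mu>)) ?x, [mpro (mmout \<mu>) ?x])"
      using d(3) f by (simp_all add: N_def)
    note mt = d(7-9)[OF xy(1)] d(7-9)[OF xy(2)] utrans_ob[OF d(1) xy(1)] utrans_ob[OF d(1) xy(2)] utrans_ob[OF d(2) xy(1)] utrans_ob[OF d(2) xy(2)]
    have KK: "Cod (D1 S) (K' ?x) = Dom (D1 S) T" "Cod (D1 S) T = Dom (D1 S) (mucell \<mu> ?y)" "Cod (D1 S) (K' ?x) = Dom (D1 S) (mucell \<mu> ?x)"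
      "Cod (D1 S) (mucell \<mu> ?x) = Dom (D1 S) N" "Cod (D1 S) (K' ?y) = Dom (D1 S) (mucell \<mu> ?y)" "Cod (D1 S) TC = Dom (D1 S) (K' ?y)"
      using Kt[OF xy(1)] Kt[OF xy(2)] Tt m\<mu> Nt d(4) by simp_all
    note KT = Kt(1-3,6-8)[OF xy(1)] Kt(1-3,6-8)[OF xy(2)] Tt(1-3,6-8)
    have i: "?Z \<^bold>\<cdot> tcell (mml \<mu>) f = tcell (mml \<mu>) f" "?H \<^bold>\<cdot> tcell (mmr \<mu>) f = tcell (mmr \<mu>) f"
      by (rule S.D1.ide_cmp'; simp add: tl tr)+
    have iz: "?Z \<^bold>\<star> K' ?x = K' ?x" "K' ?x \<^bold>\<star> ?H = K' ?x"
      using S.idc_star'[of "K' ?x" "ide (D0 E) (onOb Z ?x)"] S.star_idc'[of "K' ?x" "ide (D0 E) (onOb H ?x)"] KT S_idc_ide ob[OF xy(1)] by simp_all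
    have "tcell (mml \<mu>) f \<^bold>\<star> (TC \<^bold>\<cdot> (K' ?y \<^bold>\<cdot> mucell \<mu> ?y)) = tcell (mml \<mu>) f \<^bold>\<star> ((TC \<^bold>\<cdot> K' ?y) \<^bold>\<cdot> mucell \<mu> ?y)"
      using KT KK mt by simp
    also have "\<dots> = (?Z \<^bold>\<cdot> tcell (mml \<mu>) f) \<^bold>\<star> (K' ?x \<^bold>\<cdot> (T \<^bold>\<cdot> mucell \<mu> ?y))"
      unfolding TK i using KT KK mt by simp
    also have "\<dots> = (?Z \<^bold>\<star> K' ?x) \<^bold>\<cdot> (tcell (mml \<mu>) f \<^bold>\<star> (T \<^bold>\<cdot> mucell \<mu> ?y))"
    proof (rule S.interchange)
      show "Cod (D1 S) (K' ?x) = Dom (D1 S) (T \<^bold>\<cdot> mucell \<mu> ?y)" using KT KK mt by simp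
      show "ctgt S (tcell (mml \<mu>) f) = csrc S (T \<^bold>\<cdot> mucell \<mu> ?y)" using KT KK mt tl by simp
    qed (use KT KK mt tl pth ob[OF xy(1)] in simp_all)
    also have "\<dots> = (K' ?x \<^bold>\<star> ?H) \<^bold>\<cdot> ((mucell \<mu> ?x \<^bold>\<cdot> N) \<^bold>\<star> tcell (mmr \<mu>) f)"
      unfolding iz nat ..
    also have "\<dots> = (K' ?x \<^bold>\<cdot> (mucell \<mu> ?x \<^bold>\<cdot> N)) \<^bold>\<star> (?H \<^bold>\<cdot> tcell (mmr \<mu>) f)"
    proof (rule S.interchange[symmetric])
      show "Cod (D1 S) (K' ?x) = Dom (D1 S) (mucell \<mu> ?x \<^bold>\<cdot> N)" using KT KK mt Nt by simp
      show "ctgt S (mucell \<mu> ?x \<^bold>\<cdot> N) = csrc S (tcell (mmr \<mu>) f)" using KT KK mt Nt tr d(5) by simp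
    qed (use KT KK mt tr Nt pth ob[OF xy(1)] in simp_all)
    also have "\<dots> = (K' ?x \<^bold>\<cdot> mucell \<mu> ?x \<^bold>\<cdot> N) \<^bold>\<star> tcell (mmr \<mu>) f"
      unfolding i using KT KK mt Nt by simp
    finally show "tcell (mml \<mu>) f \<^bold>\<star> (stars S (onArr (tdom (mml \<mu>)) f) (mdids (qs @ [?C] @ rs) f) \<^bold>\<cdot> mucell \<nu> ?y) =
        (mucell \<nu> ?x \<^bold>\<cdot> mdcell (mmout \<mu>) (idc D f)) \<^bold>\<star> tcell (mmr \<mu>) f"
      unfolding \<nu>c[OF xy(1)] \<nu>c[OF xy(2)] TC_def tmods_def N_def \<mu>(3) .
  qed
  \<comment> \<open>The frames on both sides agree already, so the factorization equation reduces to
    one equation of cells for each object. Existence and uniqueness then both follow from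
    invertibility of \<open>K\<close>.\<close>
  have cn: "comp_multimod D E (id_trans D E Z) ?\<mu>s \<nu>' = \<mu> \<longleftrightarrow> (\<forall>x\<in>Objs D. K x \<^bold>\<cdot> mucell \<nu>' x = mucell \<mu> x)"
    if n: "ummod \<nu>'" "mmin \<nu>' = qs @ [?C] @ rs" "mmout \<nu>' = mmout \<mu>" "mml \<nu>' = mml \<mu>" "mmr \<nu>' = mmr \<mu>" for \<nu>'
  proof
    assume "comp_multimod D E (id_trans D E Z) ?\<mu>s \<nu>' = \<mu>"
    then show "\<forall>x\<in>Objs D. K x \<^bold>\<cdot> mucell \<nu>' x = mucell \<mu> x" using cc[OF n(1,2,4)] by simp
  next
    assume e: "\<forall>x\<in>Objs D. K x \<^bold>\<cdot> mucell \<nu>' x = mucell \<mu> x"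
    show "comp_multimod D E (id_trans D E Z) ?\<mu>s \<nu>' = \<mu>"
    proof (rule ummod_eqI)
      show "ummod (comp_multimod D E (id_trans D E Z) ?\<mu>s \<nu>')"
        by (rule ummod_comp(1)[OF ch n(1) _ cnd[OF n(4)]]) (simp only: mout n(2))
      show "mmin (comp_multimod D E (id_trans D E Z) ?\<mu>s \<nu>') = mmin \<mu>" unfolding comp_multimod_sel min \<mu>(2) ..
      show "mml (comp_multimod D E (id_trans D E Z) ?\<mu>s \<nu>') = mml \<mu>"
        using comp_trans_id_left[OF d(1) \<mu>(3)] n(4) by simp
      show "mmr (comp_multimod D E (id_trans D E Z) ?\<mu>s \<nu>') = mmr \<mu>"
        unfolding comp_multimod_sel mchain_end[OF ch] n(5) by (rule comp_trans_id_left[OF d(2) H])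
      show "mucell (comp_multimod D E (id_trans D E Z) ?\<mu>s \<nu>') x = mucell \<mu> x" if "x \<in> Objs D" for x
        using cc[OF n(1,2,4) that] e that by simp
    qed (use \<mu> n in simp_all)
  qed
  show ?thesis
  proof (rule ex1I[of _ \<nu>])
    have "K x \<^bold>\<cdot> mucell \<nu> x = mucell \<mu> x" if x: "x \<in> Objs D" for x
    proof -
      have "K x \<^bold>\<cdot> mucell \<nu> x = (K x \<^bold>\<cdot> K' x) \<^bold>\<cdot> mucell \<mu> x"
        unfolding \<nu>c[OF x] by (rule S.D1.cmp_assoc[symmetric]) (use Kt[OF x] d(7)[OF x] m\<mu> in simp_all)
      also have "\<dots> = mucell \<mu> x"
        unfolding Kt(11)[OF x] by (rule S.D1.ide_cmp') (use d(7)[OF x] m\<mu> in simp_all)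
      finally show ?thesis .
    qed
    then show "ummod \<nu> \<and> mmin \<nu> = qs @ [?C] @ rs \<and> mmout \<nu> = mmout \<mu> \<and> mml \<nu> = mml \<mu> \<and> mmr \<nu> = mmr \<mu> \<and>
        comp_multimod D E (id_trans D E Z) ?\<mu>s \<nu> = \<mu>"
      using cn[OF \<nu> \<nu>s] \<nu> \<nu>s by simp
  next
    fix \<nu>'
    assume a: "ummod \<nu>' \<and> mmin \<nu>' = qs @ [?C] @ rs \<and> mmout \<nu>' = mmout \<mu> \<and> mml \<nu>' = mml \<mu> \<and> mmr \<nu>' = mmr \<mu> \<and>
        comp_multimod D E (id_trans D E Z) ?\<mu>s \<nu>' = \<mu>"
    then have n: "ummod \<nu>'" "mmin \<nu>' = qs @ [?C] @ rs" "mmout \<nu>' = mmout \<mu>" "mml \<nu>' = mml \<mu>" "mmr \<nu>' = mmr \<mu>" by simp_all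
    have e: "\<forall>x\<in>Objs D. K x \<^bold>\<cdot> mucell \<nu>' x = mucell \<mu> x" using cn[OF n] a by simp
    show "\<nu>' = \<nu>"
    proof (rule ummod_eqI)
      fix x assume x: "x \<in> Objs D"
      have c': "mucell \<nu>' x \<in> Cells S" "Dom (D1 S) (mucell \<nu>' x) = (onOb Z x, mvals (qs @ [?C] @ rs) x)"
        using n x \<mu>(3) by simp_all
      have "mucell \<nu> x = K' x \<^bold>\<cdot> (K x \<^bold>\<cdot> mucell \<nu>' x)" unfolding \<nu>c[OF x] using e x by simp
      also have "\<dots> = (K' x \<^bold>\<cdot> K x) \<^bold>\<cdot> mucell \<nu>' x"
        by (rule S.D1.cmp_assoc[symmetric]) (use Kt[OF x] c' in simp_all)
      also have "\<dots> = mucell \<nu>' x"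
        unfolding Kt(12)[OF x] by (rule S.D1.ide_cmp'[OF c'])
      finally show "mucell \<nu>' x = mucell \<nu> x" by simp
    qed (use n \<nu> \<nu>s in simp_all)
  qed
qed

section \<open>Products in the base and cartesianness of the composite\<close>

lemma VerDbl_P1:
  "proj1 (P1 D) x y = idc D (proj1 (P0 D) x y)" "proj2 (P1 D) x y = idc D (proj2 (P0 D) x y)"
  "term_ob (P1 D) = term_ob (P0 D)"
  by (simp_all add: VerDbl_def)

text \<open>In the category of cells of \<open>VerDbl A\<close> the morphisms are 2-cells under
  horizontal composition, so the universal property required is the two-dimensional one of a strict
  2-product.\<close>

lemma VerDbl_product:
  assumes xy: "x \<in> Objs D" "y \<in> Objs D"
  shows "is_product (D1 D) (idc D (proj1 (P0 D) x y)) (idc D (proj2 (P0 D) x y))"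
proof -
  have ob: "x \<in> Ob (A0 A)" "y \<in> Ob (A0 A)" using xy by (simp_all add: VerDbl_def)
  have fp: "Dom (D0 D) (proj1 (P0 D) x y) = prod_ob (P0 D) x y" "Cod (D0 D) (proj1 (P0 D) x y) = x"
    "Dom (D0 D) (proj2 (P0 D) x y) = prod_ob (P0 D) x y" "Cod (D0 D) (proj2 (P0 D) x y) = y"
    using A.A0_products ob by (auto simp: VerDbl_def finite_products_def Hom_def)
  note p = proj_arr[OF xy]
  show ?thesis
    unfolding is_product_def
  proof (intro conjI ballI impI)
    show "idc D (proj1 (P0 D) x y) \<in> Cells D" "idc D (proj2 (P0 D) x y) \<in> Cells D"
      "Dom (D1 D) (idc D (proj1 (P0 D) x y)) = Dom (D1 D) (idc D (proj2 (P0 D) x y))"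
      using p fp by simp_all
    fix s t assume st: "s \<in> Cells D" "t \<in> Cells D" and e: "Dom (D1 D) s = Dom (D1 D) t \<and>
      Cod (D1 D) s = Cod (D1 D) (idc D (proj1 (P0 D) x y)) \<and> Cod (D1 D) t = Cod (D1 D) (idc D (proj2 (P0 D) x y))"
    have e': "Dom (D1 D) s = Dom (D1 D) t" "Cod (D1 D) s = x" "Cod (D1 D) t = y" using e p fp by simp_all
    have "\<exists>!u. u \<in> Arr (A1 A) \<and> dom0 A u = dom0 A s \<and> cod0 A u = prod_ob (P2 A) x y \<and>
        hcmp A u (ide (A1 A) (proj1 (P2 A) x y)) = s \<and> hcmp A u (ide (A1 A) (proj2 (P2 A) x y)) = t"
      by (rule A.product_2cells[OF ob]) (use st e' in \<open>simp_all add: VerDbl_def\<close>)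
    then show "\<exists>!h. h \<in> Hom (D1 D) (Dom (D1 D) s) (Dom (D1 D) (idc D (proj1 (P0 D) x y))) \<and>
      h \<bullet>\<^bsub>D\<^esub> idc D (proj1 (P0 D) x y) = s \<and> h \<bullet>\<^bsub>D\<^esub> idc D (proj2 (P0 D) x y) = t"
      unfolding idc_D(2)[OF p(1)] fp by (simp add: VerDbl_def Hom_def conj_ac)
  qed
qed

lemma VerDbl_terminal: "is_terminal (D1 D) (term_ob (P0 D))"
  unfolding is_terminal_def
proof (intro conjI ballI)
  have "term_ob (P2 A) \<in> Ob (A0 A)" using A.A0_products by (simp add: finite_products_def is_terminal_def)
  then show "term_ob (P0 D) \<in> Pros D" by (simp add: VerDbl_def)
  fix z assume "z \<in> Pros D"
  then have "z \<in> Ob (A0 A)" by (simp add: VerDbl_def)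
  from A.terminal_2cells[OF this] show "\<exists>!h. h \<in> Hom (D1 D) z (term_ob (P0 D))"
    by (simp add: VerDbl_def Hom_def)
qed

text \<open>A single proarrow in front of a non-empty path carries no coherence, so here the strict
  composite and the composite in \<open>E\<close> agree. The comparison maps for products can thus
  be treated factor by factor.\<close>

lemma ucell_star_singleton:
  assumes "c \<in> Cells S" "d \<in> Cells S" "ctgt S c = csrc S d" "Dom (D1 S) c = (x, [m])" "Cod (D1 S) c = (y, [n])"
    "snd (Dom (D1 S) d) \<noteq> []" "snd (Cod (D1 S) d) \<noteq> []"
  shows "ucell (c \<^bold>\<star> d) = ucell c \<star>\<^bsub>E\<^esub> ucell d"
proof -
  have e: "fst (Dom (D1 S) d) = ptgt E m" "fst (Cod (D1 S) d) = ptgt E n"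
    using S.composable_frames[OF assms(1-3)] assms(4,5) by simp_all
  have pd: "Dom (D1 S) d \<in> paths E" "Cod (D1 S) d \<in> paths E"
    using S.D1.Dom_in[OF assms(2)] S.D1.Cod_in[OF assms(2)] by simp_all
  have "path_coh E (x, [m]) (Dom (D1 S) d) = idcell E (m \<odot>\<^bsub>E\<^esub> path_odot E (Dom (D1 S) d))"
    "path_coh E (y, [n]) (Cod (D1 S) d) = idcell E (n \<odot>\<^bsub>E\<^esub> path_odot E (Cod (D1 S) d))"
    using E.coh_singleton[OF assms(6), of x m] E.coh_singleton[OF assms(7), of y n] e assms(6,7)
    by (simp_all add: E.odots_Cons)
  then show ?thesis
    using assms e ucell_closed[OF assms(1)] ucell_closed[OF assms(2)] S.D1.Dom_in[OF assms(1)] S.D1.Cod_in[OF assms(1)]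
      E.path_odot_closed[OF pd(1)] E.path_odot_closed[OF pd(2)]
    by (simp add: ucell_S)
qed

lemma cart_objects_preserve:
  assumes "F \<in> cart_objects D E"
  shows "is_product (D1 D) p q \<Longrightarrow> is_product (D1 E) (onCell F p) (onCell F q)"
    "is_terminal (D1 D) t \<Longrightarrow> is_terminal (D1 E) (onPro F t)"
  using assms unfolding cart_objects_def cartesian_functor_def preserves_finite_products_def by blast+

text \<open>For the empty path the cells are the values of \<open>F\<close> on the projections, and
  \<open>F\<close> preserves products. A longer path splits off its first module, and
  \<open>iso_pairing_star\<close> joins the two comparisons. A single module is handled apart,
  because composing with an empty remainder would introduce a right unit.\<close>

lemma tmods_iso_pairing:
  assumes "mpath F Ms G" "set Ms \<subseteq> cart_proarrows D E" "F \<in> cart_objects D E" and x: "x \<in> Objs D" "y \<in> Objs D"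
  shows "is_iso (D1 E) (pairing (D1 E) (P1 E) (ucell (tmods F Ms (proj1 (P0 D) x y))) (ucell (tmods F Ms (proj2 (P0 D) x y))))"
  using assms(1-3)
proof (induction Ms arbitrary: F)
  note p = proj_arr[OF x]
  {
    case Nil
    have "is_product (D1 E) (onCell F (idc D (proj1 (P0 D) x y))) (onCell F (idc D (proj2 (P0 D) x y)))"
      by (rule cart_objects_preserve(1)[OF Nil(3) VerDbl_product[OF x]])
    then show ?case
      using E.D1.product_iso_pairing[OF E.D1_products] Nil p by (simp add: tmods_Nil ucell_S)
  next
    case (Cons M Ms)
    let ?K = "mtgt D M"
    have M: "umod M" "mpath ?K Ms G" "M \<in> cart_proarrows D E" "set Ms \<subseteq> cart_proarrows D E" "msrc D M = F"
      using Cons(2,3) by auto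
    have K: "?K \<in> cart_objects D E" using M(3) by (simp add: cart_proarrows_def)
    have isoM: "is_iso (D1 E) (pairing (D1 E) (P1 E) (mcell M (idc D (proj1 (P0 D) x y))) (mcell M (idc D (proj2 (P0 D) x y))))"
      using M(3) x by (simp add: cart_proarrows_def cartesian_module_def VerDbl_P1)
    note IH = Cons.IH[OF M(2,4) K]
    note t1 = tmods_simps[OF M(2) p(1)] and t2 = tmods_simps[OF M(2) p(2)]
    have d: "Dom (D0 D) (proj1 (P0 D) x y) = Dom (D0 D) (proj2 (P0 D) x y)"
      using VerDbl_product[OF x] p by (simp add: is_product_def)
    show ?case
    proof (cases "Ms = []")
      case True
      have "tmods F (M # Ms) f = mdcell M (idc D f)" if f: "f \<in> Arrs D" for f
        unfolding tmods_Cons[OF Cons(2) f] using True M f by (simp add: tmods_Nil)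
      then show ?thesis using isoM p by simp
    next
      case False
      then have ne: "mvals Ms z \<noteq> []" for z by (simp add: mvals_def)
      have u: "ucell (tmods F (M # Ms) f) = mcell M (idc D f) \<star>\<^bsub>E\<^esub> ucell (tmods ?K Ms f)" if f: "f \<in> Arrs D" for f
        unfolding tmods_Cons[OF Cons(2) f]
        using ucell_star_singleton[of "mdcell M (idc D f)" "tmods ?K Ms f"] M f tmods_simps[OF M(2) f] ne by simp
      show ?thesis unfolding u[OF p(1)] u[OF p(2)]
        by (rule E.iso_pairing_star)
          (use M p t1 t2 ucell_closed[OF t1(1)] ucell_closed[OF t2(1)] d isoM IH in simp_all)
    qed
  }
qed

text \<open>The same induction for the nullary product: preservation of the terminal proarrow by
  \<open>F\<close> at the empty path, and \<open>iso_to_term_odot\<close> at each further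
  module.\<close>

lemma odots_iso_to_term:
  assumes "mpath F Ms G" "set Ms \<subseteq> cart_proarrows D E" "F \<in> cart_objects D E"
  defines "t \<equiv> term_ob (P0 D)"
  shows "is_iso (D1 E) (to_term (D1 E) (P1 E) (odots E (onOb F t) (mvals Ms t)))"
  using assms(1-3)
proof (induction Ms arbitrary: F)
  have t: "t \<in> Objs D" using VerDbl_terminal by (simp add: is_terminal_def t_def)
  {
    case Nil
    have "is_terminal (D1 E) (onPro F t)"
      unfolding t_def by (rule cart_objects_preserve(2)[OF Nil(3) VerDbl_terminal])
    then show ?case
      using E.D1.terminal_iso_to_term[OF E.D1_products] Nil t by simp
  next
    case (Cons M Ms)
    let ?K = "mtgt D M"
    have M: "umod M" "mpath ?K Ms G" "M \<in> cart_proarrows D E" "set Ms \<subseteq> cart_proarrows D E" "msrc D M = F"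
      using Cons(2,3) by auto
    have K: "?K \<in> cart_objects D E" using M(3) by (simp add: cart_proarrows_def)
    have isoM: "is_iso (D1 E) (to_term (D1 E) (P1 E) (mpro M t))"
      using M(3) by (simp add: cart_proarrows_def cartesian_module_def VerDbl_P1 t_def)
    note IH = Cons.IH[OF M(2,4) K] and o = E.odots_closed[OF mpath_ppath[OF M(2) t]]
    show ?case
    proof (cases "Ms = []")
      case True
      then show ?thesis using isoM by simp
    next
      case False
      then have ne: "mvals Ms t \<noteq> []" by (simp add: mvals_def)
      have od: "odots E (onOb F t) (mvals (M # Ms) t) = mpro M t \<odot>\<^bsub>E\<^esub> odots E (onOb ?K t) (mvals Ms t)"
        using E.odots_Cons[OF ne] M(1) t by simp
      show ?thesis unfolding od
        by (rule E.iso_to_term_odot) (use M t isoM IH o in simp_all)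
    qed
  }
qed

lemma cmod_cart:
  assumes "mpath F Ms G" "set Ms \<subseteq> cart_proarrows D E" "F \<in> cart_objects D E" "G \<in> cart_objects D E"
  shows "cmod F Ms G \<in> cart_proarrows D E"
proof -
  have t: "term_ob (P0 D) \<in> Objs D" using VerDbl_terminal by (simp add: is_terminal_def)
  have FG: "cartesian_functor D E F" "cartesian_functor D E G"
    using assms(3,4) by (simp_all add: cart_objects_def)
  have "cartesian_module D E (cmod F Ms G)"
    unfolding cartesian_module_def
    using assms(1) FG t tmods_iso_pairing[OF assms(1-3)] odots_iso_to_term[OF assms(1-3)] by (simp add: VerDbl_P1)
  then show ?thesis
    using assms cmod_umod[OF assms(1)] by (simp add: cart_proarrows_def umod_is_module)
qed

lemma cmult_cart:
  assumes "mpath F Ms G" "set Ms \<subseteq> cart_proarrows D E" "F \<in> cart_objects D E" "G \<in> cart_objects D E"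
  shows "cmult F Ms G \<in> cart_multicells D E"
  using cmult_ummod[OF assms(1)] cmod_cart[OF assms] assms id_trans_cart by (simp add: cart_multicells_iff)

text \<open>Requiring the factorization to be cartesian adds no condition: its boundary
  transformations and output are those of \<mu>, its outer input modules occur among those of \<mu>,
  and the composite module is cartesian by \<open>cmod_cart\<close>.\<close>

lemma cmult_opcartesian:
  assumes m: "mpath F ps G" "set ps \<subseteq> cart_proarrows D E" "F \<in> cart_objects D E" "G \<in> cart_objects D E"
  shows "opcartesian V (cmult F ps G)"
  unfolding opcartesian_def
proof (intro conjI allI impI)
  show "cmult F ps G \<in> vcell V" using cmult_cart[OF m] by simp
  fix z qs rs \<mu>
  assume a: "vpath V z qs (Dom (V0 V) (vleft V (cmult F ps G))) \<and> \<mu> \<in> vcell V \<and>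
    vin V \<mu> = qs @ vin V (cmult F ps G) @ rs \<and> Dom (V0 V) (vleft V \<mu>) = z"
  then have q: "vpath V z qs F" and \<mu>: "\<mu> \<in> cart_multicells D E" "mmin \<mu> = qs @ ps @ rs" "tdom (mml \<mu>) = z"
    by simp_all
  note c = \<mu>(1)[unfolded cart_multicells_iff]
  note mq = vpath_mpath[OF q]
  \<comment> \<open>The input path of \<mu> splits at two intermediate functors. Since a path of
    modules determines its end, these are \<open>F\<close> and \<open>G\<close>, so the remaining
    segment starts at \<open>G\<close>.\<close>
  obtain H where r: "mpath G rs H"
  proof -
    have "mpath z (qs @ ps @ rs) (tdom (mmr \<mu>))" using ummodD(6)[of \<mu>] c \<mu>(2,3) by simp
    then obtain F' G' where "mpath z qs F'" "mpath F' ps G'" "mpath G' rs (tdom (mmr \<mu>))" by (auto simp: mpath_append)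
    with mpath_unique[OF mq(1)] mpath_unique[OF m(1)] that show ?thesis by metis
  qed
  have sub: "set (qs @ [cmod F ps G] @ rs) \<subseteq> cart_proarrows D E" using c \<mu>(2) cmod_cart[OF m] by simp
  have iff: "(\<nu> \<in> vhom V (qs @ [vout V (cmult F ps G)] @ rs) (vout V \<mu>) (vleft V \<mu>) (vright V \<mu>) \<and>
      vcmp V (ide (V0 V) z) (map (vid V) qs @ [cmult F ps G] @ map (vid V) rs) \<nu> = \<mu>) \<longleftrightarrow>
    (ummod \<nu> \<and> mmin \<nu> = qs @ [cmod F ps G] @ rs \<and> mmout \<nu> = mmout \<mu> \<and> mml \<nu> = mml \<mu> \<and> mmr \<nu> = mmr \<mu> \<and>
      comp_multimod D E (id_trans D E z) (map (id_multimod D E) qs @ [cmult F ps G] @ map (id_multimod D E) rs) \<nu> = \<mu>)" for \<nu>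
    unfolding vhom_def V_sel cmult_sel mem_Collect_eq cart_multicells_iff[of \<nu>] using c sub by metis
  show "\<exists>!\<nu>. \<nu> \<in> vhom V (qs @ [vout V (cmult F ps G)] @ rs) (vout V \<mu>) (vleft V \<mu>) (vright V \<mu>) \<and>
      vcmp V (ide (V0 V) z) (map (vid V) qs @ [cmult F ps G] @ map (vid V) rs) \<nu> = \<mu>"
    unfolding iff by (rule cmult_factor[OF mq(1) m(1) r _ \<mu>(2,3)]) (use c in simp)
qed

lemma V_representable: "representable V"
  unfolding representable_def
proof (intro conjI allI impI)
  show "virtual_double_category V" by (rule V_vdc)
  fix F ps G assume v: "vpath V F ps G"
  show "\<exists>c. is_composite V F ps G c"
    by (rule exI[of _ "cmult F ps G"]) (use cmult_opcartesian[OF vpath_mpath[OF v]] in \<open>simp add: is_composite_def\<close>)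
qed

end

theorem corollary10p7:
  fixes A :: "('o, 'f, 't) ctwo_cat"
    and E :: "('x, 'a, 'p, 'c) cdbl"
  assumes "cartesian_two_category A"
    and "cartesian_double_category E"
  shows "representable (vCartLax (VerDbl A) E)"
proof -
  interpret vertical_cart_lax A E using assms by (rule vertical_cart_lax.intro)
  show ?thesis by (rule V_representable)
qed

end
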